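(* Let $d\geq 1$ and $2_\star<\alpha<2^\star$. Let $(v_n)_{n\geq 1}$ be a bounded sequence in $\dot H^{\gamma_c}\cap\dot H^2$. Then there exist a subsequence of $(v_n)_{n\ge1}$ (still denoted $(v_n)_{n\geq 1}$), a family $(x_n^j)_{j\geq 1}$ of sequences in $\mathbb R^d$ (for each $j$, $(x_n^j)_{n\ge 1}$ is a sequence in $\mathbb R^d$) and a sequence $(V^j)_{j\geq 1}$ of functions in $\dot H^{\gamma_c}\cap\dot H^2$ such that: (i) for every $k\neq j$, $|x_n^k-x_n^j|\to\infty$ as $n\to\infty$; (ii) for every $l\geq 1$ and every $x\in\mathbb R^d$, $$v_n(x)=\sum_{j=1}^l V^j(x-x_n^j)+v_n^l(x),$$ where the remainders $v_n^l$ satisfy $$\limsup_{n\to\infty}\|v_n^l\|_{L^q}\to 0\quad\text{as } l\to\infty,$$ for every $q\in(\alpha_c,2+2^\star)$. Moreover, for every $l\ge 1$, $$\|v_n\|_{\dot H^{\gamma_c}}^2=\sum_{j=1}^l\|V^j\|_{\dot H^{\gamma_c}}^2+\|v_n^l\|_{\dot H^{\gamma_c}}^2+o_n(1),$$ $$\|v_n\|_{\dot H^{2}}^2=\sum_{j=1}^l\|V^j\|_{\dot H^{2}}^2+\|v_n^l\|_{\dot H^{2}}^2+o_n(1),$$ as $n\to\infty$.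
   Context: Functions are complex valued on $\mathbb R^d$. $2_\star:=\frac8d$; $2^\star:=\infty$ if $d\in\{1,2,3,4\}$ and $2^\star:=\frac{8}{d-4}$ if $d\geq5$. $\gamma_c:=\frac d2-\frac4\alpha$ and $\alpha_c:=\frac{2d}{d-2\gamma_c}=\frac{d\alpha}{4}$. $\dot H^\gamma$ is the homogeneous Sobolev space with norm $\|f\|_{\dot H^\gamma}=\||\nabla|^\gamma f\|_{L^2}$, where $|\nabla|^\gamma$ is the Fourier multiplier $|\xi|^\gamma$. By the Sobolev embedding $\dot H^{\gamma_c}\hookrightarrow L^{\alpha_c}$, elements of $\dot H^{\gamma_c}\cap\dot H^2$ are functions in $L^{\alpha_c}$. Boundedness in $\dot H^{\gamma_c}\cap\dot H^2$ means that both norms are bounded. $o_n(1)$ denotes a quantity tending to $0$ as $n\to\infty$ (with $l$ fixed). *)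

theory Defs
  imports "HOL-Analysis.Analysis"
begin

section \<open>Lebesgue norms\<close>

definition Lp_norm :: "real \<Rightarrow> ('a::euclidean_space \<Rightarrow> complex) \<Rightarrow> ennreal" where
  "Lp_norm p f =
     (let I = (\<integral>\<^sup>+ x. ennreal (norm (f x) powr p) \<partial>lebesgue)
      in if I = \<infinity> then \<infinity> else ennreal (enn2real I powr (1 / p)))"

definition Lp_space :: "real \<Rightarrow> ('a::euclidean_space \<Rightarrow> complex) set" where
  "Lp_space p = {f \<in> borel_measurable lebesgue. Lp_norm p f < \<infinity>}"


section \<open>Fourier transform of tempered functions\<close>

primrec iter_deriv ::
  "'a::real_normed_vector list \<Rightarrow> ('a \<Rightarrow> complex) \<Rightarrow> 'a \<Rightarrow> complex" where
  "iter_deriv [] \<phi> = \<phi>"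
| "iter_deriv (u # us) \<phi> = (\<lambda>x. frechet_derivative (iter_deriv us \<phi>) (at x) u)"

definition schwartz :: "('a::euclidean_space \<Rightarrow> complex) set" where
  "schwartz = {\<phi>. \<forall>us.
       (\<forall>x. iter_deriv us \<phi> differentiable (at x)) \<and>
       (\<forall>k::nat. bounded (range (\<lambda>x. (1 + norm x) ^ k *\<^sub>R iter_deriv us \<phi> x)))}"

text \<open>The unitary normalisation is used. It is immaterial below: the norm of \<open>Hdot\<close> is an
  \<open>L\<^sup>2\<close> norm on the physical side, and rescaling the transform by a constant does not change
  the multiplier \<open>nabla_pow\<close>.\<close>

definition fourier :: "('a::euclidean_space \<Rightarrow> complex) \<Rightarrow> 'a \<Rightarrow> complex" where
  "fourier \<phi> \<xi> =
     complex_of_real ((2 * pi) powr (- (real DIM('a) / 2))) *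
     (\<integral>x. exp (- \<i> * complex_of_real (x \<bullet> \<xi>)) * \<phi> x \<partial>lebesgue)"

text \<open>Measurable functions that define tempered distributions by integration. Every \<open>L\<^sup>p\<close>
  function with \<open>1 \<le> p\<close> is of this kind.\<close>

definition tempered :: "('a::euclidean_space \<Rightarrow> complex) set" where
  "tempered =
     {f. \<exists>N::nat. integrable lebesgue (\<lambda>x. f x / complex_of_real ((1 + norm x) ^ N))}"

text \<open>\<open>has_fourier f g\<close>: the Fourier transform of \<open>f\<close>, in the sense of tempered distributions,
  is the function \<open>g\<close>. This determines \<open>g\<close> almost everywhere.\<close>

definition has_fourier ::
  "('a::euclidean_space \<Rightarrow> complex) \<Rightarrow> ('a \<Rightarrow> complex) \<Rightarrow> bool" where
  "has_fourier f g \<longleftrightarrow> f \<in> tempered \<and> g \<in> tempered \<and>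
     (\<forall>\<phi>\<in>schwartz. (\<integral>x. f x * fourier \<phi> x \<partial>lebesgue) = (\<integral>\<xi>. g \<xi> * \<phi> \<xi> \<partial>lebesgue))"


section \<open>Homogeneous Sobolev spaces\<close>

text \<open>\<open>has_nabla_pow \<gamma> f h\<close> says \<open>|\<nabla>|\<^sup>\<gamma> f = h\<close>. The Fourier transform of \<open>f\<close> has to be a
  function, since \<open>|\<xi>|\<^sup>\<gamma>\<close> is not smooth at the origin; in particular nonzero polynomials are
  not in \<open>Hdot \<gamma>\<close>.\<close>

definition has_nabla_pow ::
  "real \<Rightarrow> ('a::euclidean_space \<Rightarrow> complex) \<Rightarrow> ('a \<Rightarrow> complex) \<Rightarrow> bool" where
  "has_nabla_pow \<gamma> f h \<longleftrightarrow>
     (\<exists>g. has_fourier f g \<and> has_fourier h (\<lambda>\<xi>. complex_of_real (norm \<xi> powr \<gamma>) * g \<xi>))"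

definition nabla_pow ::
  "real \<Rightarrow> ('a::euclidean_space \<Rightarrow> complex) \<Rightarrow> 'a \<Rightarrow> complex" where
  "nabla_pow \<gamma> f = (SOME h. has_nabla_pow \<gamma> f h)"

text \<open>Elements are functions rather than general tempered distributions. For \<open>0 \<le> \<gamma> < d/2\<close>
  nothing is lost, by the Sobolev embedding into \<open>L\<^sup>p\<close> with \<open>p = 2d/(d - 2\<gamma>)\<close>; hence nothing
  is lost either in \<open>Hdot \<gamma> \<inter> Hdot 2\<close> for such \<open>\<gamma>\<close>.\<close>

definition Hdot :: "real \<Rightarrow> ('a::euclidean_space \<Rightarrow> complex) set" where
  "Hdot \<gamma> = {f. \<exists>h \<in> Lp_space 2. has_nabla_pow \<gamma> f h}"

text \<open>Meaningful for \<open>f \<in> Hdot \<gamma>\<close> only.\<close>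

definition Hdot_norm :: "real \<Rightarrow> ('a::euclidean_space \<Rightarrow> complex) \<Rightarrow> real" where
  "Hdot_norm \<gamma> f = enn2real (Lp_norm 2 (nabla_pow \<gamma> f))"


section \<open>Exponents\<close>

definition two_lower_star :: "nat \<Rightarrow> real" where
  "two_lower_star d = 8 / real d"

definition two_upper_star :: "nat \<Rightarrow> ereal" where
  "two_upper_star d = (if d \<le> 4 then \<infinity> else ereal (8 / (real d - 4)))"

definition gamma_c :: "nat \<Rightarrow> real \<Rightarrow> real" where
  "gamma_c d \<alpha> = real d / 2 - 4 / \<alpha>"

definition alpha_c :: "nat \<Rightarrow> real \<Rightarrow> real" where
  "alpha_c d \<alpha> = 2 * real d / (real d - 2 * gamma_c d \<alpha>)"

lemma alpha_c_eq: "\<alpha> \<noteq> 0 \<Longrightarrow> alpha_c d \<alpha> = real d * \<alpha> / 4"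
  by (simp add: alpha_c_def gamma_c_def field_simps)

end

theory Submission
  imports Defs "HOL-Complex_Analysis.Great_Picard" "HOL-Probability.Characteristic_Functions"
    "HOL-Probability.Sinc_Integral"
begin

text \<open>By the Fourier transform the statement becomes one about a bounded sequence in a Hilbert
  space. An element \<open>f\<close> of both Sobolev spaces is encoded by the square integrable function \<open>G\<close>,
  the Fourier transform of \<open>f\<close> multiplied by \<open>|\<xi>|\<^sup>\<gamma> + |\<xi>|\<^sup>2\<close> (\<open>Hdot_frequency_side\<close>). Both
  Sobolev norms of \<open>f\<close> are norms of images of \<open>G\<close> under bounded real multipliers
  (\<open>frequency_side_Hdot_norm\<close>), and the translations act on \<open>G\<close> by characters: they form a
  strongly continuous unitary action that commutes with these multipliers and in which
  translates to infinity tend weakly to zero (the locale \<open>translation_action\<close>).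

  For any such action a bounded sequence has a profile decomposition (\<open>profile_decomposition\<close>).
  One repeatedly extracts a weak limit of translates of the current remainder whose norm is at
  least half of the largest possible one, and subtracts the translated limit. Weak convergence
  gives Pythagorean expansions for every symmetric operator that commutes with the action
  (\<open>Pythagorean_expansion\<close>), in particular for both Sobolev norms at once. Hence the norms of
  the profiles are square summable and tend to zero, and by the greedy choice so does the
  largest weak limit of translates of the \<open>l\<close>-th remainder as \<open>l\<close> grows. The centres separate
  because a remainder tends weakly to zero in the frame of every earlier centre
  (\<open>centres_separate\<close>).

  It remains to convert the smallness of these weak limits into smallness in \<open>L\<^sup>q\<close>. A function
  is split into waves with frequencies in dyadic shells. By Bernstein's inequality the shells of
  very high and very low frequency contribute little to the \<open>L\<^sup>q\<close> norm, uniformly on bounded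
  sets of both Sobolev spaces; this is where \<open>q\<close> strictly between the two critical exponents
  enters (\<open>admissible_exponents\<close>). For the finitely many other shells,
  \<open>|u|\<^sup>q \<le> sup |u| powr (q - 2) * |u|\<^sup>2\<close> and Plancherel reduce the matter to the suprema of the
  waves (\<open>Lq_small_of_waves_small\<close>). The value of a wave at a point is a fixed weakly continuous
  functional of a translate, so that the suprema are controlled by the weak limits
  (\<open>waves_eventually_small\<close>).

  The Fourier analysis rests on Gaussians. Their integrals determine a tempered function
  (\<open>tempered_zero_of_gaussian_integrals\<close>), which gives uniqueness of Fourier transforms and of
  inverse transforms. A Gaussian weight shows that the transform contracts the \<open>L\<^sup>2\<close> norm
  (\<open>fourier_contraction\<close>); the square of its extension to \<open>L\<^sup>2\<close> is the reflection, as can be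
  tested on Gaussians (\<open>FT_FT\<close>), and therefore the contraction is an isometry.\<close>

section \<open>Weak convergence in Hilbert spaces\<close>

lemma parallelogram_identity:
  fixes x y :: "'a::real_inner"
  shows "(norm (x + y))\<^sup>2 + (norm (x - y))\<^sup>2 = 2 * (norm x)\<^sup>2 + 2 * (norm y)\<^sup>2"
  by (simp add: power2_norm_eq_inner inner_add inner_diff inner_commute)

text \<open>The representing vector is the minimiser of \<open>(norm x)\<^sup>2 - 2 * L x\<close> on \<open>S\<close>; by the
  parallelogram identity every minimising sequence is Cauchy, and the first variation at the
  minimiser is the representation formula. The version on a closed subspace also yields
  orthogonal projections, by applying it to \<open>inner z\<close>.\<close>

lemma Riesz_representation_subspace:
  fixes S :: "'a::{real_inner,complete_space} set" and L :: "'a \<Rightarrow> real"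
  assumes S: "closed S" "subspace S"
    and add: "\<And>x y. x \<in> S \<Longrightarrow> y \<in> S \<Longrightarrow> L (x + y) = L x + L y"
    and scale: "\<And>c x. x \<in> S \<Longrightarrow> L (c *\<^sub>R x) = c * L x"
    and bound: "\<And>x. x \<in> S \<Longrightarrow> \<bar>L x\<bar> \<le> K * norm x"
  obtains l where "l \<in> S" "\<And>x. x \<in> S \<Longrightarrow> L x = inner l x"
proof -
  define J where "J x = (norm x)\<^sup>2 - 2 * L x" for x
  define m where "m = (INF x\<in>S. J x)"
  have diff: "L (x - y) = L x - L y" if "x \<in> S" "y \<in> S" for x y
    using add[of x "(-1) *\<^sub>R y"] scale[of y "-1"] that subspace_scale[OF S(2), of y "-1"] by simp
  have J_lower: "J x \<ge> - K\<^sup>2" if "x \<in> S" for x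
  proof -
    have "0 \<le> (norm x - K)\<^sup>2" by simp
    then show ?thesis
      using bound[OF that] unfolding J_def power2_diff by (simp add: algebra_simps abs_le_iff)
  qed
  have bdd: "bdd_below (J ` S)" using J_lower by (auto intro!: bdd_belowI2)
  have m_le: "m \<le> J x" if "x \<in> S" for x
    unfolding m_def by (rule cINF_lower[OF bdd that])
  have ne: "S \<noteq> {}" using S(2) subspace_0 by auto
  have "\<exists>x\<in>S. J x < m + 1 / Suc n" for n
    using cINF_less_iff[OF ne bdd, of "m + 1 / Suc n"] unfolding m_def[symmetric] by simp
  then obtain X where XS: "\<And>n. X n \<in> S" and XJ: "\<And>n. J (X n) < m + 1 / Suc n" by metis
  have key: "(norm (x - y))\<^sup>2 \<le> 2 * (J x + J y - 2 * m)" if "x \<in> S" "y \<in> S" for x y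
  proof -
    have mid: "(1/2) *\<^sub>R (x + y) \<in> S" using that S(2) by (intro subspace_scale subspace_add)
    have "J ((1/2) *\<^sub>R (x + y)) = (norm (x + y))\<^sup>2 / 4 - (L x + L y)"
      unfolding J_def using that scale[of "x + y" "1/2"] add[of x y] subspace_add[OF S(2)]
      by (simp add: power_mult_distrib power2_eq_square)
    then show ?thesis
      using m_le[OF mid] parallelogram_identity[of x y] unfolding J_def by simp
  qed
  have "Cauchy X"
  proof (rule metric_CauchyI)
    fix e :: real assume e: "e > 0"
    obtain N where N: "1 / Suc N < e\<^sup>2 / 4"
      using reals_Archimedean[of "e\<^sup>2 / 4"] e by (auto simp: inverse_eq_divide)
    show "\<exists>M. \<forall>i\<ge>M. \<forall>j\<ge>M. dist (X i) (X j) < e"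
    proof (intro exI allI impI)
      fix i j assume ij: "i \<ge> N" "j \<ge> N"
      have "1 / real (Suc i) \<le> 1 / Suc N" "1 / real (Suc j) \<le> 1 / Suc N"
        using ij by (auto intro!: divide_left_mono)
      moreover define \<delta> where "\<delta> k = 1 / real (Suc k)" for k
      ultimately have "(norm (X i - X j))\<^sup>2 < e\<^sup>2"
        using key[OF XS[of i] XS[of j]] XJ[of i] XJ[of j] N unfolding \<delta>_def[symmetric] by argo
      then show "dist (X i) (X j) < e"
        unfolding dist_norm using e by (simp add: power_less_imp_less_base)
    qed
  qed
  then obtain l where l: "X \<longlonglongrightarrow> l" using Cauchy_convergent_iff convergent_def by blast
  have lS: "l \<in> S" using closed_sequentially[OF S(1)] XS l by blast
  have "(\<lambda>n. L (X n)) \<longlonglongrightarrow> L l"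
  proof (rule Lim_transform2[OF tendsto_const])
    have "(\<lambda>n. K * norm (X n - l)) \<longlonglongrightarrow> K * 0"
      using l by (intro tendsto_mult tendsto_const tendsto_norm_zero) (simp add: LIM_zero_iff)
    moreover have "norm (L l - L (X n)) \<le> K * norm (X n - l)" for n
      using bound[OF subspace_diff[OF S(2) lS XS[of n]]] diff[OF lS XS[of n]]
      by (simp add: norm_minus_commute)
    ultimately show "(\<lambda>n. L l - L (X n)) \<longlonglongrightarrow> 0"
      using Lim_null_comparison[of "\<lambda>n. L l - L (X n)" "\<lambda>n. K * norm (X n - l)" sequentially] by simp
  qed
  then have "(\<lambda>n. J (X n)) \<longlonglongrightarrow> J l"
    unfolding J_def using l by (intro tendsto_intros)
  moreover have "(\<lambda>n. m + 1 / Suc n) \<longlonglongrightarrow> m + 0"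
    by (intro tendsto_intros LIMSEQ_Suc[OF lim_1_over_n])
  ultimately have Jl: "J l \<le> m"
    using XJ by (intro LIMSEQ_le[of "\<lambda>n. J (X n)" _ "\<lambda>n. m + 1 / Suc n"]) (auto intro!: less_imp_le exI[of _ 0])
  have "L y = inner l y" if y: "y \<in> S" for y
  proof -
    define b where "b = inner l y - L y"
    have quad: "0 \<le> 2 * t * b + t\<^sup>2 * (norm y)\<^sup>2" for t
    proof -
      have "J (l + t *\<^sub>R y) = J l + 2 * t * b + t\<^sup>2 * (norm y)\<^sup>2"
        unfolding J_def b_def power2_norm_eq_inner using add[of l "t *\<^sub>R y"] scale[OF y, of t] lS y S(2)
        by (simp add: subspace_scale inner_add inner_commute algebra_simps power2_eq_square)
      then show ?thesis using m_le[of "l + t *\<^sub>R y"] Jl lS y S(2)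
        by (simp add: subspace_add subspace_scale)
    qed
    have "b = 0"
    proof (rule ccontr)
      assume b: "b \<noteq> 0"
      define N where "N = (norm y)\<^sup>2 + 1"
      define t where "t = - b / N"
      have p: "N > 0" unfolding N_def by (simp add: add_nonneg_pos)
      have "2 * t * b + t\<^sup>2 * (norm y)\<^sup>2 \<le> 2 * t * b + t\<^sup>2 * N"
        unfolding N_def by (simp add: algebra_simps)
      also have "\<dots> = - (b\<^sup>2 / N)"
        unfolding t_def using p by (simp add: power2_eq_square field_simps)
      also have "\<dots> < 0" using b p by simp
      finally show False using quad[of t] by simp
    qed
    then show ?thesis unfolding b_def by simp
  qed
  then show thesis using that lS by blast
qed

lemma subspace_closure:
  fixes S :: "'a::real_normed_vector set"
  assumes S: "subspace S"
  shows "subspace (closure S)"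
proof (rule subspaceI)
  show "0 \<in> closure S" using subspace_0[OF S] closure_subset by blast
next
  fix x y assume "x \<in> closure S" "y \<in> closure S"
  then obtain f g where "\<forall>n. f n \<in> S" "f \<longlonglongrightarrow> x" "\<forall>n. g n \<in> S" "g \<longlonglongrightarrow> y"
    unfolding closure_sequential by blast
  then show "x + y \<in> closure S" unfolding closure_sequential
    by (intro exI[of _ "\<lambda>n. f n + g n"]) (auto intro: tendsto_add subspace_add[OF S])
next
  fix c x assume "x \<in> closure S"
  then obtain f where "\<forall>n. f n \<in> S" "f \<longlonglongrightarrow> x"
    unfolding closure_sequential by blast
  then show "c *\<^sub>R x \<in> closure S" unfolding closure_sequential
    by (intro exI[of _ "\<lambda>n. c *\<^sub>R f n"]) (auto intro: tendsto_intros subspace_scale[OF S])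
qed

definition weakly_to :: "(nat \<Rightarrow> 'a::real_inner) \<Rightarrow> 'a \<Rightarrow> bool" where
  "weakly_to f l \<longleftrightarrow> (\<forall>y. (\<lambda>n. inner (f n) y) \<longlonglongrightarrow> inner l y)"

lemma weakly_toD: "weakly_to f l \<Longrightarrow> (\<lambda>n. inner (f n) y) \<longlonglongrightarrow> inner l y"
  by (simp add: weakly_to_def)

lemma weakly_to_subseq: "weakly_to f l \<Longrightarrow> strict_mono r \<Longrightarrow> weakly_to (\<lambda>n. f (r n)) l"
  unfolding weakly_to_def using LIMSEQ_subseq_LIMSEQ[unfolded o_def] by blast

lemma weakly_to_diff: "weakly_to f l \<Longrightarrow> weakly_to g k \<Longrightarrow> weakly_to (\<lambda>n. f n - g n) (l - k)"
  unfolding weakly_to_def by (auto simp: inner_diff intro!: tendsto_diff)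

lemma weakly_to_unique:
  assumes "weakly_to f l" "weakly_to f k" shows "l = k"
proof -
  have "inner l (l - k) = inner k (l - k)"
    using assms weakly_toD LIMSEQ_unique by blast
  then have "inner (l - k) (l - k) = 0" by (simp add: inner_diff_left)
  then show ?thesis by simp
qed

lemma weakly_to_const: "weakly_to (\<lambda>n. l) l"
  unfolding weakly_to_def by simp

lemma weakly_to_norm_le:
  assumes "weakly_to f l" "\<And>n. norm (f n) \<le> B"
  shows "norm l \<le> B"
proof -
  have "inner l l \<le> B * norm l"
  proof (rule LIMSEQ_le_const2[OF weakly_toD[OF assms(1)]])
    show "\<exists>N. \<forall>n\<ge>N. inner (f n) l \<le> B * norm l"
      using assms(2) by (auto intro!: order_trans[OF norm_cauchy_schwarz] mult_right_mono)
  qed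
  then have "norm l * norm l \<le> B * norm l" by (simp add: dot_square_norm power2_eq_square)
  moreover have "0 \<le> B" using assms(2)[of 0] norm_ge_zero order_trans by blast
  ultimately show ?thesis by (cases "norm l = 0") (auto simp: mult_le_cancel_right)
qed

text \<open>Bounded sequences have weakly convergent subsequences. A diagonal subsequence makes the inner
  products with each \<open>f m\<close> converge, hence those with every vector of the closed span of the
  sequence; the limit functional is represented inside that span, and a general test vector can
  be replaced by its projection to the span, because all \<open>f n\<close> lie there.\<close>

theorem weak_sequential_compactness:
  fixes f :: "nat \<Rightarrow> 'a::{real_inner,complete_space}"
  assumes B: "\<And>n. norm (f n) \<le> B"
  obtains r l where "strict_mono r" "weakly_to (\<lambda>n. f (r n)) l"
proof -
  have B0: "0 \<le> B" using B[of 0] norm_ge_zero order_trans by blast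
  have "norm (inner (f n) x) \<le> B * B" if "x \<in> range f" for n x
    using that B by (auto intro!: order_trans[OF Cauchy_Schwarz_ineq2] mult_mono simp: B0)
  then obtain r where r: "strict_mono r"
    and conv0: "\<And>x. x \<in> range f \<Longrightarrow> \<exists>l. (\<lambda>n. inner (f (r n)) x) \<longlonglongrightarrow> l"
    by (rule function_convergent_subsequence[of "range f" "\<lambda>n x. inner (f n) x" "B * B", rotated]) auto
  define S where "S = closure (span (range f))"
  have S: "closed S" "subspace S" unfolding S_def by (auto simp: subspace_closure)
  have convspan: "convergent (\<lambda>n. inner (f (r n)) x)" if "x \<in> span (range f)" for x
    using that
  proof (induction rule: span_induct_alt)
    case base then show ?case by (simp add: convergent_const)
  next
    case (step c x y)
    obtain l where "(\<lambda>n. inner (f (r n)) x) \<longlonglongrightarrow> l" using conv0[OF step(1)] by blast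
    moreover obtain k where "(\<lambda>n. inner (f (r n)) y) \<longlonglongrightarrow> k"
      using step(2) unfolding convergent_def by blast
    ultimately have "(\<lambda>n. c * inner (f (r n)) x + inner (f (r n)) y) \<longlonglongrightarrow> c * l + k"
      by (intro tendsto_intros)
    then show ?case unfolding convergent_def by (auto simp: inner_add)
  qed
  have conv: "convergent (\<lambda>n. inner (f (r n)) x)" if x: "x \<in> S" for x
  proof -
    have "Cauchy (\<lambda>n. inner (f (r n)) x)"
    proof (rule metric_CauchyI)
      fix e :: real assume e: "e > 0"
      have e': "e / (3 * (B + 1)) > 0" using e B0 by simp
      obtain y where y: "y \<in> span (range f)" "dist y x < e / (3 * (B + 1))"
        using x e' unfolding S_def closure_approachable by blast
      have close: "\<bar>inner (f n) x - inner (f n) y\<bar> < e / 3" for n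
      proof -
        have "\<bar>inner (f n) x - inner (f n) y\<bar> \<le> norm (f n) * norm (x - y)"
          by (metis Cauchy_Schwarz_ineq2 inner_diff_right)
        also have "\<dots> \<le> (B + 1) * norm (x - y)" using B[of n] by (intro mult_right_mono) auto
        also have "\<dots> < e / 3" using y(2) B0 by (simp add: dist_norm norm_minus_commute field_simps)
        finally show ?thesis .
      qed
      have "Cauchy (\<lambda>n. inner (f (r n)) y)" using convspan[OF y(1)] Cauchy_convergent_iff by blast
      then obtain N where N: "\<And>i j. i \<ge> N \<Longrightarrow> j \<ge> N \<Longrightarrow> \<bar>inner (f (r i)) y - inner (f (r j)) y\<bar> < e / 3"
        using e unfolding Cauchy_def dist_real_def by (meson divide_pos_pos zero_less_numeral)
      show "\<exists>M. \<forall>i\<ge>M. \<forall>j\<ge>M. dist (inner (f (r i)) x) (inner (f (r j)) x) < e"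
      proof (intro exI allI impI)
        fix i j assume "i \<ge> N" "j \<ge> N"
        then show "dist (inner (f (r i)) x) (inner (f (r j)) x) < e"
          using N[of i j] close[of "r i"] close[of "r j"] unfolding dist_real_def by linarith
      qed
    qed
    then show ?thesis using Cauchy_convergent_iff by blast
  qed
  define L where "L x = lim (\<lambda>n. inner (f (r n)) x)" for x
  have L: "(\<lambda>n. inner (f (r n)) x) \<longlonglongrightarrow> L x" if "x \<in> S" for x
    unfolding L_def using conv[OF that] convergent_LIMSEQ_iff by blast
  obtain l where lS: "l \<in> S" and l: "\<And>x. x \<in> S \<Longrightarrow> L x = inner l x"
  proof (rule Riesz_representation_subspace[OF S, of L B])
    fix x y assume "x \<in> S" "y \<in> S"
    then have "(\<lambda>n. inner (f (r n)) (x + y)) \<longlonglongrightarrow> L x + L y" "x + y \<in> S"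
      using tendsto_add[OF L[of x] L[of y]] S(2) by (auto simp: inner_add subspace_add)
    then show "L (x + y) = L x + L y" using L[of "x + y"] LIMSEQ_unique by blast
  next
    fix c x assume "x \<in> S"
    then have "(\<lambda>n. inner (f (r n)) (c *\<^sub>R x)) \<longlonglongrightarrow> c * L x" "c *\<^sub>R x \<in> S"
      using tendsto_mult_left[OF L[of x], of c] S(2) by (auto simp: subspace_scale)
    then show "L (c *\<^sub>R x) = c * L x" using L[of "c *\<^sub>R x"] LIMSEQ_unique by blast
  next
    fix x assume x: "x \<in> S"
    have "\<bar>inner (f (r n)) x\<bar> \<le> B * norm x" for n
      using B by (intro order_trans[OF Cauchy_Schwarz_ineq2] mult_right_mono) auto
    then show "\<bar>L x\<bar> \<le> B * norm x"
      by (intro LIMSEQ_le_const2[OF tendsto_rabs[OF L[OF x]]]) blast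
  qed blast
  have "(\<lambda>n. inner (f (r n)) z) \<longlonglongrightarrow> inner l z" for z
  proof -
    (* p is the orthogonal projection of z to S *)
    obtain p where p: "p \<in> S" "\<And>x. x \<in> S \<Longrightarrow> inner z x = inner p x"
      by (rule Riesz_representation_subspace[OF S, of "inner z" "norm z"])
         (auto simp: inner_add Cauchy_Schwarz_ineq2)
    have fS: "f n \<in> S" for n
      unfolding S_def using span_base[of "f n" "range f"] closure_subset[of "span (range f)"] by auto
    have "inner (f (r n)) z = inner (f (r n)) p" for n
      using p(2)[OF fS] by (metis inner_commute)
    moreover have "inner l z = inner l p" using p(2)[OF lS] by (metis inner_commute)
    ultimately show ?thesis using L[OF p(1)] l[OF p(1)] by simp
  qed
  then show thesis using that r unfolding weakly_to_def by blast
qed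

text \<open>If the norms do not tend to infinity, there is a bounded subsequence, to which
  Bolzano--Weierstrass applies.\<close>

lemma not_norm_at_top_convergent_subseq:
  fixes x :: "nat \<Rightarrow> 'a::euclidean_space"
  assumes "\<not> filterlim (\<lambda>n. norm (x n)) at_top sequentially"
  obtains t z where "strict_mono t" "(\<lambda>n. x (t n)) \<longlonglongrightarrow> z"
proof -
  obtain C where "\<not> (\<forall>\<^sub>F n in sequentially. C \<le> norm (x n))"
    using assms unfolding filterlim_at_top by blast
  then have "\<exists>\<^sub>F n in sequentially. norm (x n) < C"
    unfolding frequently_def by (simp add: not_less)
  then have "infinite {n. norm (x n) < C}" by (simp add: frequently_cofinite flip: cofinite_eq_sequentially)
  then obtain s :: "nat \<Rightarrow> nat" where s: "strict_mono s" "\<And>n. s n \<in> {n. norm (x n) < C}"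
    using infinite_enumerate by blast
  have "bounded (range (\<lambda>n. x (s n)))" using s(2) by (auto simp: bounded_iff intro!: exI[of _ C] less_imp_le)
  then obtain z u where "strict_mono u" "(\<lambda>n. x (s (u n))) \<longlonglongrightarrow> z"
    using bounded_imp_convergent_subsequence[of "\<lambda>n. x (s n)"] by (auto simp: o_def)
  then show thesis using that[of "\<lambda>n. s (u n)" z] s(1) by (simp add: strict_mono_def)
qed

section \<open>Profile decomposition under a translation action\<close>

text \<open>The only properties of translations in a function space that concentration compactness uses: a
  strongly continuous action by linear isometries such that translates to infinity are
  asymptotically orthogonal to every fixed vector.\<close>

locale translation_action =
  fixes U :: "'x::euclidean_space \<Rightarrow> 'h::{real_inner,complete_space} \<Rightarrow> 'h"
  assumes add_right: "U x (a + b) = U x a + U x b"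
    and zero_left: "U 0 a = a"
    and add_left: "U (x + y) a = U x (U y a)"
    and isometry: "inner (U x a) (U x b) = inner a b"
    and continuous: "X \<longlonglongrightarrow> x \<Longrightarrow> (\<lambda>n. U (X n) a) \<longlonglongrightarrow> U x a"
    and vanishing: "filterlim (\<lambda>n. norm (X n)) at_top sequentially \<Longrightarrow> (\<lambda>n. inner (U (X n) a) b) \<longlonglongrightarrow> 0"
begin

lemma diff_right: "U x (a - b) = U x a - U x b"
  using add_right[of x "a - b" b] by simp

lemma zero_right [simp]: "U x 0 = 0"
  using add_right[of x 0 0] by simp

lemma cancel [simp]: "U (- x) (U x a) = a" "U x (U (- x) a) = a"
  by (simp_all add: zero_left flip: add_left)

lemma adjoint: "inner (U x a) b = inner a (U (- x) b)"
  using isometry[of x a "U (- x) b"] by simp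

lemma norm_eq [simp]: "norm (U x a) = norm a"
  by (simp add: norm_eq_sqrt_inner isometry)

lemma weakly_to_vanishing:
  assumes "filterlim (\<lambda>n. norm (X n)) at_top sequentially"
  shows "weakly_to (\<lambda>n. U (X n) a) 0"
  unfolding weakly_to_def using vanishing[OF assms] by simp

text \<open>Weak limits and convergent translations commute: moving the translation to the test vector
  turns it into a norm convergent perturbation.\<close>

lemma weakly_to_translated:
  assumes f: "weakly_to f l" and B: "\<And>n. norm (f n) \<le> B" and X: "X \<longlonglongrightarrow> x"
  shows "weakly_to (\<lambda>n. U (X n) (f n)) (U x l)"
  unfolding weakly_to_def
proof
  fix y
  have *: "(\<lambda>n. U (- X n) y) \<longlonglongrightarrow> U (- x) y" using X by (intro continuous tendsto_minus)
  have "(\<lambda>n. inner (f n) (U (- X n) y) - inner (f n) (U (- x) y)) \<longlonglongrightarrow> 0"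
  proof (rule Lim_null_comparison)
    show "\<forall>\<^sub>F n in sequentially. norm (inner (f n) (U (- X n) y) - inner (f n) (U (- x) y))
        \<le> B * norm (U (- X n) y - U (- x) y)"
      using B by (auto intro!: always_eventually order_trans[OF Cauchy_Schwarz_ineq2] mult_right_mono
          simp flip: inner_diff_right)
    have "(\<lambda>n. B * norm (U (- X n) y - U (- x) y)) \<longlonglongrightarrow> B * 0"
      using * by (intro tendsto_mult tendsto_const tendsto_norm_zero) (simp add: LIM_zero_iff)
    then show "(\<lambda>n. B * norm (U (- X n) y - U (- x) y)) \<longlonglongrightarrow> 0" by simp
  qed
  from tendsto_add[OF this weakly_toD[OF f, of "U (- x) y"]]
  show "(\<lambda>n. inner (U (X n) (f n)) y) \<longlonglongrightarrow> inner (U x l) y"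
    by (simp add: adjoint)
qed

text \<open>If along two families of centres one weak limit vanishes and the other does not, then the
  centres separate: otherwise a subsequence of their differences would converge, and the second
  limit would be a translate of the first.\<close>

lemma centres_separate:
  assumes x: "weakly_to (\<lambda>n. U (- X n) (R n)) 0" and y: "weakly_to (\<lambda>n. U (- Y n) (R n)) l"
    and l: "l \<noteq> 0" and B: "\<And>n. norm (R n) \<le> B"
  shows "filterlim (\<lambda>n. norm (Y n - X n)) at_top sequentially"
proof (rule ccontr)
  assume "\<not> filterlim (\<lambda>n. norm (Y n - X n)) at_top sequentially"
  then obtain t z where t: "strict_mono t" and z: "(\<lambda>n. Y (t n) - X (t n)) \<longlonglongrightarrow> z"
    by (rule not_norm_at_top_convergent_subseq)
  have "weakly_to (\<lambda>n. U (- (Y (t n) - X (t n))) (U (- X (t n)) (R (t n)))) (U (- z) 0)"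
    using B by (intro weakly_to_translated[of _ _ B] weakly_to_subseq[OF x t] tendsto_minus z) simp
  then have "weakly_to (\<lambda>n. U (- Y (t n)) (R (t n))) 0"
    by (simp flip: add_left)
  then show False using weakly_to_subseq[OF y t] weakly_to_unique l by blast
qed

text \<open>The largest norm of these vectors measures how much of the sequence can still be seen after
  translating it suitably.\<close>

definition weak_limits :: "(nat \<Rightarrow> 'h) \<Rightarrow> 'h set" where
  "weak_limits R = {l. \<exists>t Y. strict_mono t \<and> weakly_to (\<lambda>n. U (- Y n) (R (t n))) l}"

text \<open>The greedy step: take a limit \<open>l\<close> that is within a factor two of the supremum of the norms in
  \<open>weak_limits R\<close>. Its centres separate from the earlier ones by \<open>centres_separate\<close>. If the only
  limit is zero, then \<open>l = 0\<close> is taken with centres that run away from all the earlier ones; in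
  this way the construction never has to stop.\<close>

lemma extract_profile:
  fixes \<X> :: "(nat \<Rightarrow> 'x) set"
  assumes B: "\<And>n. norm (R n) \<le> B" and fin: "finite \<X>"
    and X0: "\<And>X. X \<in> \<X> \<Longrightarrow> weakly_to (\<lambda>n. U (- X n) (R n)) 0"
  obtains t Y l where "strict_mono t" "weakly_to (\<lambda>n. U (- Y n) (R (t n))) l"
    "\<And>X. X \<in> \<X> \<Longrightarrow> filterlim (\<lambda>n. norm (Y n - X (t n))) at_top sequentially"
    "\<And>k. k \<in> weak_limits R \<Longrightarrow> norm k \<le> 2 * norm l"
proof (cases "\<exists>k \<in> weak_limits R. k \<noteq> 0")
  case True
  then obtain k0 where k0: "k0 \<in> weak_limits R" "k0 \<noteq> 0" by blast
  have bdd: "bdd_above (norm ` weak_limits R)"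
  proof (rule bdd_aboveI2)
    fix k assume "k \<in> weak_limits R"
    then obtain t Y where "weakly_to (\<lambda>n. U (- Y n) (R (t n))) k" unfolding weak_limits_def by blast
    then show "norm k \<le> B" by (rule weakly_to_norm_le) (simp add: B)
  qed
  define \<eta> where "\<eta> = (SUP k\<in>weak_limits R. norm k)"
  have \<eta>_upper: "norm k \<le> \<eta>" if "k \<in> weak_limits R" for k
    unfolding \<eta>_def by (rule cSUP_upper[OF that bdd])
  have "0 < \<eta>" using \<eta>_upper[OF k0(1)] k0(2) by (meson less_le_trans zero_less_norm_iff)
  then have "\<eta> / 2 < (SUP k\<in>weak_limits R. norm k)" unfolding \<eta>_def[symmetric] by simp
  then obtain l where l: "l \<in> weak_limits R" "\<eta> / 2 < norm l"
    using less_cSUP_iff[of "weak_limits R" norm "\<eta> / 2"] bdd k0(1) by blast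
  then obtain t Y where t: "strict_mono t" and Y: "weakly_to (\<lambda>n. U (- Y n) (R (t n))) l"
    unfolding weak_limits_def by blast
  have l0: "l \<noteq> 0" using l(2) \<open>0 < \<eta>\<close> by auto
  show thesis
  proof (rule that[OF t Y])
    fix X assume "X \<in> \<X>"
    from weakly_to_subseq[OF X0[OF this] t] Y l0 B
    show "filterlim (\<lambda>n. norm (Y n - X (t n))) at_top sequentially" by (rule centres_separate)
  next
    fix k assume "k \<in> weak_limits R"
    then show "norm k \<le> 2 * norm l" using \<eta>_upper[of k] l(2) by linarith
  qed
next
  case False
  have "\<exists>y. \<forall>X\<in>\<X>. real n \<le> norm (y - X n)" for n
  proof -
    obtain y :: 'x where y: "norm y = (\<Sum>X\<in>\<X>. norm (X n)) + real n"
      using vector_choose_size[of "(\<Sum>X\<in>\<X>. norm (X n)) + real n"] by (auto simp: sum_nonneg)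
    have "real n \<le> norm (y - X n)" if "X \<in> \<X>" for X
      using member_le_sum[OF that, of "\<lambda>X. norm (X n)"] fin y norm_triangle_ineq2[of y "X n"] by auto
    then show ?thesis by blast
  qed
  then obtain Y where Y: "\<And>n X. X \<in> \<X> \<Longrightarrow> real n \<le> norm (Y n - X n)" by metis
  obtain t l where t: "strict_mono t" and l: "weakly_to (\<lambda>n. U (- Y (t n)) (R (t n))) l"
    using weak_sequential_compactness[of "\<lambda>n. U (- Y n) (R n)" B] B by auto
  have "l \<in> weak_limits R" unfolding weak_limits_def using t l by (auto intro!: exI[of _ t] exI[of _ "\<lambda>n. Y (t n)"])
  then have l0: "l = 0" using False by blast
  show thesis
  proof (rule that[OF t l])
    fix X assume X: "X \<in> \<X>"
    have "filterlim (\<lambda>n. norm (Y n - X n)) at_top sequentially"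
      by (rule filterlim_at_top_mono[OF filterlim_real_sequentially]) (use Y X in auto)
    then show "filterlim (\<lambda>n. norm (Y (t n) - X (t n))) at_top sequentially"
      by (rule filterlim_compose[OF _ filterlim_subseq[OF t]])
  next
    fix k assume "k \<in> weak_limits R" then show "norm k \<le> 2 * norm l" using False by auto
  qed
qed

text \<open>The greedy step is iterated, each time on a further subsequence, and the diagonal subsequence
  \<open>r\<close> serves all steps at once. After step \<open>l\<close> the remainder is seen to tend weakly to zero in
  the frame of each centre chosen so far: in the new frame because its weak limit was
  subtracted, in the old frames because the subtracted translate vanishes weakly there. This is
  what the next step needs for the separation of centres.\<close>

theorem profile_decomposition:
  fixes a :: "nat \<Rightarrow> 'h"
  assumes B: "\<And>n. norm (a n) \<le> B"
  obtains r X \<Phi> R where "strict_mono r" "R 0 = (\<lambda>n. a (r n))"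
    "\<And>l. R (Suc l) = (\<lambda>n. R l n - U (X l n) (\<Phi> l))"
    "\<And>l. weakly_to (\<lambda>n. U (- X l n) (R l n)) (\<Phi> l)"
    "\<And>j k. j \<noteq> k \<Longrightarrow> filterlim (\<lambda>n. norm (X k n - X j n)) at_top sequentially"
    "\<And>l \<psi>. \<psi> \<in> weak_limits (R l) \<Longrightarrow> norm \<psi> \<le> 2 * norm (\<Phi> l)"
proof -
  (* A state consists of the current subsequence s, the set \<X> of the centres so far, the
     remainder R, and the last centre and profile. Centres and remainders are indexed by the
     original sequence, so that they can be restricted to any later subsequence. *)
  define P :: "(nat \<Rightarrow> nat) \<times> (nat \<Rightarrow> 'x) set \<times> (nat \<Rightarrow> 'h) \<times> (nat \<Rightarrow> 'x) \<times> 'h \<Rightarrow> bool"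
    where "P = (\<lambda>(s, \<X>, R, X, \<Phi>). strict_mono s \<and> finite \<X> \<and> (\<exists>C. \<forall>n. norm (R n) \<le> C) \<and>
      (\<forall>x\<in>\<X>. weakly_to (\<lambda>n. U (- x (s n)) (R (s n))) 0))"
  define Q :: "(nat \<Rightarrow> nat) \<times> (nat \<Rightarrow> 'x) set \<times> (nat \<Rightarrow> 'h) \<times> (nat \<Rightarrow> 'x) \<times> 'h \<Rightarrow>
      (nat \<Rightarrow> nat) \<times> (nat \<Rightarrow> 'x) set \<times> (nat \<Rightarrow> 'h) \<times> (nat \<Rightarrow> 'x) \<times> 'h \<Rightarrow> bool"
    where "Q = (\<lambda>(s, \<X>, R, _, _) (s', \<X>', R', X', \<Phi>'). (\<exists>t. strict_mono t \<and> s' = s \<circ> t) \<and>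
      \<X>' = insert X' \<X> \<and> R' = (\<lambda>n. R n - U (X' n) \<Phi>') \<and>
      weakly_to (\<lambda>n. U (- X' (s' n)) (R (s' n))) \<Phi>' \<and>
      (\<forall>x\<in>\<X>. filterlim (\<lambda>n. norm (X' (s' n) - x (s' n))) at_top sequentially) \<and>
      (\<forall>\<psi>\<in>weak_limits (\<lambda>n. R (s n)). norm \<psi> \<le> 2 * norm \<Phi>'))"
  have start: "P (id, {}, a, undefined, undefined)"
    unfolding P_def using B by (auto simp: strict_mono_def)
  have step: "\<exists>st'. P st' \<and> Q st st'" if "P st" for st
  proof -
    obtain s \<X> R X0 \<Phi>0 where st: "st = (s, \<X>, R, X0, \<Phi>0)" by (metis prod_cases5)
    have s: "strict_mono s" and fin: "finite \<X>"
      and w0: "\<And>x. x \<in> \<X> \<Longrightarrow> weakly_to (\<lambda>n. U (- x (s n)) (R (s n))) 0"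
      using that unfolding P_def st by auto
    have "\<exists>C. \<forall>n. norm (R n) \<le> C" using that unfolding P_def st by simp
    then obtain C where C: "\<And>n. norm (R n) \<le> C" by blast
    obtain t Y l where t: "strict_mono t" and Y: "weakly_to (\<lambda>n. U (- Y n) (R (s (t n)))) l"
      and sep: "\<And>x. x \<in> (\<lambda>x n. x (s n)) ` \<X> \<Longrightarrow> filterlim (\<lambda>n. norm (Y n - x (t n))) at_top sequentially"
      and max: "\<And>k. k \<in> weak_limits (\<lambda>n. R (s n)) \<Longrightarrow> norm k \<le> 2 * norm l"
    proof (rule extract_profile[of "\<lambda>n. R (s n)" C "(\<lambda>x n. x (s n)) ` \<X>"])
      show "norm (R (s n)) \<le> C" for n by (rule C)
      show "finite ((\<lambda>x n. x (s n)) ` \<X>)" using fin by simp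
      show "weakly_to (\<lambda>n. U (- X n) (R (s n))) 0" if "X \<in> (\<lambda>x n. x (s n)) ` \<X>" for X
        using that w0 by auto
    qed blast
    define s' where "s' = s \<circ> t"
    have s': "strict_mono s'" unfolding s'_def using s t by (rule strict_mono_o)
    (* Only the values on the range of the new subsequence matter. *)
    define X' where "X' m = Y (inv s' m)" for m
    have X'[simp]: "X' (s' n) = Y n" for n
      unfolding X'_def using s' by (simp add: inv_f_f strict_mono_on_imp_inj_on)
    define R' where "R' n = R n - U (X' n) l" for n
    have Y': "weakly_to (\<lambda>n. U (- Y n) (R (s' n))) l" using Y by (simp add: s'_def)
    have sep': "filterlim (\<lambda>n. norm (Y n - x (s' n))) at_top sequentially" if "x \<in> \<X>" for x
      using sep[of "\<lambda>n. x (s n)"] that by (auto simp: s'_def)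
    have new: "weakly_to (\<lambda>n. U (- x (s' n)) (R' (s' n))) 0" if x: "x \<in> insert X' \<X>" for x
    proof (cases "x = X'")
      case True
      then show ?thesis using weakly_to_diff[OF Y' weakly_to_const[of l]]
        by (simp add: R'_def diff_right)
    next
      case False
      then have x: "x \<in> \<X>" using x by simp
      have "weakly_to (\<lambda>n. U (- x (s' n)) (R (s' n))) 0"
        using weakly_to_subseq[OF w0[OF x] t] by (simp add: s'_def)
      from weakly_to_diff[OF this weakly_to_vanishing[OF sep'[OF x], of l]]
      show ?thesis by (simp add: R'_def diff_right flip: add_left)
    qed
    have "norm (R' n) \<le> C + norm l" for n
      unfolding R'_def using norm_triangle_ineq4[of "R n" "U (X' n) l"] C[of n] by simp
    then have "P (s', insert X' \<X>, R', X', l)"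
      unfolding P_def using s' fin new by blast
    moreover have "weakly_to (\<lambda>n. U (- X' (s' n)) (R (s' n))) l" using Y' by simp
    moreover have "\<forall>x\<in>\<X>. filterlim (\<lambda>n. norm (X' (s' n) - x (s' n))) at_top sequentially"
      using sep' by simp
    moreover have "R' = (\<lambda>n. R n - U (X' n) l)" by (simp add: R'_def fun_eq_iff)
    ultimately have "Q st (s', insert X' \<X>, R', X', l)"
      unfolding Q_def st prod.case using t s'_def max by blast
    moreover have "P (s', insert X' \<X>, R', X', l)" by fact
    ultimately show ?thesis by blast
  qed
  obtain f where f: "\<And>n. P (f n)" "\<And>n. Q (f n) (f (Suc n))" and f0: "f 0 = (id, {}, a, undefined, undefined)"
  proof -
    let ?P = "\<lambda>n st. P st \<and> (n = (0::nat) \<longrightarrow> st = (id, {}, a, undefined, undefined))"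
    have "\<exists>f. \<forall>n. ?P n (f n) \<and> Q (f n) (f (Suc n))"
    proof (rule dependent_nat_choice[of ?P "\<lambda>_. Q"])
      show "\<exists>st. ?P 0 st" using start by blast
      show "\<exists>st'. ?P (Suc n) st' \<and> Q st st'" if "?P n st" for st n using step that by auto
    qed
    then show thesis using that by metis
  qed
  define S where "S n = fst (f n)" for n
  define \<X> where "\<X> n = fst (snd (f n))" for n
  define R where "R n = fst (snd (snd (f n)))" for n
  define X where "X n = fst (snd (snd (snd (f (Suc n)))))" for n
  define \<Phi> where "\<Phi> n = snd (snd (snd (snd (f (Suc n)))))" for n
  have S: "strict_mono (S n)" for n using f(1)[of n] unfolding P_def S_def by (auto split: prod.splits)
  have Q: "(\<exists>t. strict_mono t \<and> S (Suc n) = S n \<circ> t) \<and>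
      \<X> (Suc n) = insert (X n) (\<X> n) \<and> R (Suc n) = (\<lambda>i. R n i - U (X n i) (\<Phi> n)) \<and>
      weakly_to (\<lambda>i. U (- X n (S (Suc n) i)) (R n (S (Suc n) i))) (\<Phi> n) \<and>
      (\<forall>x\<in>\<X> n. filterlim (\<lambda>i. norm (X n (S (Suc n) i) - x (S (Suc n) i))) at_top sequentially) \<and>
      (\<forall>\<psi>\<in>weak_limits (\<lambda>i. R n (S n i)). norm \<psi> \<le> 2 * norm (\<Phi> n))" for n
    using f(2)[of n] unfolding Q_def S_def \<X>_def R_def X_def \<Phi>_def
    by (auto split: prod.splits)
  have "\<forall>n. \<exists>t. strict_mono t \<and> S (Suc n) = S n \<circ> t" using Q by blast
  then obtain t where t: "\<And>n. strict_mono (t n)" "\<And>n. S (Suc n) = S n \<circ> t n" by metis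
  (* the diagonal is, from index l on, a subsequence of S l *)
  define r where "r n = S n n" for n
  have nested: "\<exists>T. strict_mono T \<and> S (l + i) = S l \<circ> T" for l i
  proof (induction i)
    case 0 then show ?case by (auto intro!: exI[of _ id] simp: strict_mono_def)
  next
    case (Suc i)
    then obtain T where T: "strict_mono T" "S (l + i) = S l \<circ> T" by blast
    then show ?case using t[of "l + i"] strict_mono_o[OF T(1) t(1)]
      by (auto intro!: exI[of _ "T \<circ> t (l + i)"] simp: o_assoc)
  qed
  have tail: "\<exists>j\<ge>n. r n = S l j" if "n \<ge> l" for n l
    using nested[of l "n - l"] that seq_suble unfolding r_def by fastforce
  have r: "strict_mono r"
  proof (rule strict_monoI_Suc)
    fix n
    have "r (Suc n) = S n (t n (Suc n))" unfolding r_def t(2) by simp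
    moreover have "n < t n (Suc n)" using seq_suble[OF t(1)[of n], of "Suc n"] by simp
    ultimately show "r n < r (Suc n)" unfolding r_def using S[of n] by (simp add: strict_mono_less)
  qed
  have lim: "filterlim (\<lambda>n. g (r n)) F sequentially"
    if "filterlim (\<lambda>n. g (S l n)) F sequentially" for g :: "nat \<Rightarrow> real" and F l
    unfolding filterlim_iff
  proof (intro allI impI)
    fix Pr assume "eventually Pr F"
    then have "\<exists>N. \<forall>n\<ge>N. Pr (g (S l n))"
      using that unfolding filterlim_iff eventually_sequentially by blast
    then obtain N where N: "\<And>n. n \<ge> N \<Longrightarrow> Pr (g (S l n))" by blast
    have "Pr (g (r n))" if "n \<ge> max N l" for n
      using tail[of l n] that N by (metis max.bounded_iff order_trans)
    then show "\<forall>\<^sub>F n in sequentially. Pr (g (r n))" unfolding eventually_sequentially by blast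
  qed
  have limits: "weak_limits (\<lambda>n. R l (r n)) \<subseteq> weak_limits (\<lambda>n. R l (S l n))" for l
  proof
    fix \<psi> assume "\<psi> \<in> weak_limits (\<lambda>n. R l (r n))"
    then obtain u Y where u: "strict_mono u" and Y: "weakly_to (\<lambda>n. U (- Y n) (R l (r (u n)))) \<psi>"
      unfolding weak_limits_def by blast
    have shift: "strict_mono (\<lambda>n::nat. n + l)" by (simp add: strict_mono_def)
    have "\<exists>j. r (u (n + l)) = S l j" for n
      using tail[of l "u (n + l)"] seq_suble[OF u, of "n + l"] by fastforce
    then obtain j where j: "\<And>n. r (u (n + l)) = S l (j n)" by metis
    have "strict_mono j"
      unfolding strict_mono_def
    proof (intro allI impI)
      fix m n :: nat assume "m < n"
      then have "S l (j m) < S l (j n)"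
        using strict_mono_less[OF r] strict_mono_less[OF u] by (simp flip: j)
      then show "j m < j n" using strict_mono_less[OF S] by blast
    qed
    then show "\<psi> \<in> weak_limits (\<lambda>n. R l (S l n))"
      unfolding weak_limits_def using weakly_to_subseq[OF Y shift] by (auto simp: j)
  qed
  have mem: "X j \<in> \<X> k" if "j < k" for j k
    using that
  proof (induction k)
    case (Suc k) then show ?case using Q[of k] by (cases "j = k") auto
  qed simp
  have sep: "filterlim (\<lambda>n. norm (X k (r n) - X j (r n))) at_top sequentially" if "j < k" for j k
    using Q[of k] mem[OF that] lim[of "\<lambda>m. norm (X k m - X j m)" "Suc k"] by blast
  show thesis
  proof (rule that[OF r, of "\<lambda>l n. R l (r n)" "\<lambda>l n. X l (r n)" \<Phi>])
    show "(\<lambda>n. R 0 (r n)) = (\<lambda>n. a (r n))" unfolding R_def f0 by simp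
    show "(\<lambda>n. R (Suc l) (r n)) = (\<lambda>n. R l (r n) - U (X l (r n)) (\<Phi> l))" for l
      using Q[of l] by simp
    show "weakly_to (\<lambda>n. U (- X l (r n)) (R l (r n))) (\<Phi> l)" for l
      unfolding weakly_to_def
      using Q[of l] lim[of "\<lambda>m. inner (U (- X l m) (R l m)) y" "Suc l" for y]
      by (auto simp: weakly_to_def)
    show "filterlim (\<lambda>n. norm (X k (r n) - X j (r n))) at_top sequentially" if "j \<noteq> k" for j k
      using sep[of j k] sep[of k j] that by (cases j k rule: linorder_cases) (auto simp: norm_minus_commute)
    show "norm \<psi> \<le> 2 * norm (\<Phi> l)" if "\<psi> \<in> weak_limits (\<lambda>n. R l (r n))" for l \<psi>
      using Q[of l] limits[of l] that by blast
  qed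
qed

text \<open>Expanding the square leaves the cross term \<open>inner (U (- X n) (R n)) (M (M \<Phi>))\<close>, in which \<open>M\<close>
  has been moved to the fixed vector; it converges by weak convergence. Hence the expansion
  holds for every symmetric operator that commutes with the translations, which gives both
  Sobolev norms from one decomposition.\<close>

lemma Pythagorean_step:
  assumes R': "\<And>n. R' n = R n - U (X n) \<Phi>" and w: "weakly_to (\<lambda>n. U (- X n) (R n)) \<Phi>"
    and lin: "\<And>a b. M (a - b) = M a - M b" and sym: "\<And>a b. inner (M a) b = inner a (M b)"
    and com: "\<And>x a. M (U x a) = U x (M a)"
  shows "(\<lambda>n. (norm (M (R n)))\<^sup>2 - (norm (M (R' n)))\<^sup>2) \<longlonglongrightarrow> (norm (M \<Phi>))\<^sup>2"
proof -
  have "(norm (M (R n)))\<^sup>2 - (norm (M (R' n)))\<^sup>2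
      = 2 * inner (U (- X n) (R n)) (M (M \<Phi>)) - (norm (M \<Phi>))\<^sup>2" for n
  proof -
    have "inner (M (R n)) (U (X n) (M \<Phi>)) = inner (U (- X n) (R n)) (M (M \<Phi>))"
      by (simp add: adjoint sym com)
    then show ?thesis
      unfolding R' lin com by (simp add: power2_norm_eq_inner inner_diff inner_commute isometry)
  qed
  moreover have "(\<lambda>n. 2 * inner (U (- X n) (R n)) (M (M \<Phi>)) - (norm (M \<Phi>))\<^sup>2)
      \<longlonglongrightarrow> 2 * inner \<Phi> (M (M \<Phi>)) - (norm (M \<Phi>))\<^sup>2"
    by (intro tendsto_intros weakly_toD[OF w])
  ultimately show ?thesis by (simp add: sym[of \<Phi>, symmetric] power2_norm_eq_inner)
qed

lemma Pythagorean_expansion: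
  assumes R': "\<And>l. R (Suc l) = (\<lambda>n. R l n - U (X l n) (\<Phi> l))"
    and w: "\<And>l. weakly_to (\<lambda>n. U (- X l n) (R l n)) (\<Phi> l)"
    and lin: "\<And>a b. M (a - b) = M a - M b" and sym: "\<And>a b. inner (M a) b = inner a (M b)"
    and com: "\<And>x a. M (U x a) = U x (M a)"
  shows "(\<lambda>n. (norm (M (R 0 n)))\<^sup>2 - (norm (M (R l n)))\<^sup>2) \<longlonglongrightarrow> (\<Sum>j<l. (norm (M (\<Phi> j)))\<^sup>2)"
proof (induction l)
  case (Suc l)
  have "(\<lambda>n. (norm (M (R l n)))\<^sup>2 - (norm (M (R (Suc l) n)))\<^sup>2) \<longlonglongrightarrow> (norm (M (\<Phi> l)))\<^sup>2"
    by (rule Pythagorean_step[OF _ w lin sym com]) (simp add: R')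
  from tendsto_add[OF Suc.IH this] show ?case by simp
qed simp

text \<open>The case in which \<open>M\<close> is the identity: the squared norms of the profiles are summable, being
  bounded by \<open>B\<^sup>2\<close> in the limit.\<close>

lemma profiles_tend_to_zero:
  assumes R': "\<And>l. R (Suc l) = (\<lambda>n. R l n - U (X l n) (\<Phi> l))"
    and w: "\<And>l. weakly_to (\<lambda>n. U (- X l n) (R l n)) (\<Phi> l)"
    and B: "\<And>n. norm (R 0 n) \<le> B"
  shows "\<Phi> \<longlonglongrightarrow> 0" and "\<forall>\<^sub>F n in sequentially. norm (R l n) \<le> B + 1"
proof -
  have conv: "(\<lambda>n. (norm (R 0 n))\<^sup>2 - (norm (R l n))\<^sup>2) \<longlonglongrightarrow> (\<Sum>j<l. (norm (\<Phi> j))\<^sup>2)" for l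
    using Pythagorean_expansion[of R X \<Phi> "\<lambda>a. a" l] R' w by simp
  have B2: "(norm (R 0 n))\<^sup>2 \<le> B\<^sup>2" for n using B by (simp add: power_mono)
  have B2': "(norm (R 0 n))\<^sup>2 - (norm (R l n))\<^sup>2 \<le> B\<^sup>2" for n l
    using B2[of n] zero_le_power2[of "norm (R l n)"] by linarith
  have "(\<Sum>j<l. (norm (\<Phi> j))\<^sup>2) \<le> B\<^sup>2" for l
    using LIMSEQ_le_const2[OF conv] B2' by blast
  then have "summable (\<lambda>j. (norm (\<Phi> j))\<^sup>2)"
    by (intro summableI_nonneg_bounded[of _ "B\<^sup>2"]) auto
  then have "(\<lambda>j. (norm (\<Phi> j))\<^sup>2) \<longlonglongrightarrow> 0" by (rule summable_LIMSEQ_zero)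
  then have "(\<lambda>j. sqrt ((norm (\<Phi> j))\<^sup>2)) \<longlonglongrightarrow> sqrt 0" by (rule tendsto_real_sqrt)
  then show "\<Phi> \<longlonglongrightarrow> 0" by (simp add: tendsto_norm_zero_iff)
  have B0: "0 \<le> B" using B[of 0] norm_ge_zero order_trans by blast
  have "(\<Sum>j<l. (norm (\<Phi> j))\<^sup>2) > - 1" by (rule less_le_trans[of _ 0]) (auto intro: sum_nonneg)
  then have "\<forall>\<^sub>F n in sequentially. (norm (R 0 n))\<^sup>2 - (norm (R l n))\<^sup>2 > - 1"
    using conv[of l] order_tendstoD(1) by blast
  then show "\<forall>\<^sub>F n in sequentially. norm (R l n) \<le> B + 1"
  proof eventually_elim
    case (elim n)
    then have "(norm (R l n))\<^sup>2 \<le> B\<^sup>2 + 1" using B2[of n] by linarith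
    then have "(norm (R l n))\<^sup>2 \<le> (B + 1)\<^sup>2" using B0 by (simp add: power2_sum)
    then show ?case using B0 by (intro power2_le_imp_le[of "norm (R l n)"]) auto
  qed
qed

end

section \<open>Square integrable functions\<close>

lemma measurable_ident_lebesgue_borel [measurable (raw)]:
  "(\<lambda>x. x) \<in> borel_measurable (lebesgue :: 'a::euclidean_space measure)"
  by (rule measurable_completion) simp

definition square_integrable :: "('a::euclidean_space \<Rightarrow> complex) \<Rightarrow> bool" where
  "square_integrable f \<longleftrightarrow>
     f \<in> borel_measurable lebesgue \<and> integrable lebesgue (\<lambda>x. (cmod (f x))\<^sup>2)"

lemma square_integrableD:
  "square_integrable f \<Longrightarrow> f \<in> borel_measurable lebesgue"
  by (simp add: square_integrable_def)

lemma square_integrable_integrable: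
  "square_integrable f \<Longrightarrow> integrable lebesgue (\<lambda>x. (cmod (f x))\<^sup>2)"
  by (simp add: square_integrable_def)

lemma square_integrable_bound:
  assumes [measurable]: "f \<in> borel_measurable lebesgue" and g: "square_integrable g"
    and le: "AE x in lebesgue. cmod (f x) \<le> C * cmod (g x)"
  shows "square_integrable f"
proof -
  have "integrable lebesgue (\<lambda>x. C\<^sup>2 * (cmod (g x))\<^sup>2)"
    using square_integrable_integrable[OF g] by (rule integrable_mult_right)
  moreover have "AE x in lebesgue. norm ((cmod (f x))\<^sup>2) \<le> norm (C\<^sup>2 * (cmod (g x))\<^sup>2)"
    using le by eventually_elim (simp add: power_mono flip: power_mult_distrib)
  moreover have "(\<lambda>x. (cmod (f x))\<^sup>2) \<in> borel_measurable lebesgue" by measurable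
  ultimately have "integrable lebesgue (\<lambda>x. (cmod (f x))\<^sup>2)"
    by (intro Bochner_Integration.integrable_bound[where g = "\<lambda>x. (cmod (f x))\<^sup>2"])
  then show ?thesis by (simp add: square_integrable_def)
qed

lemma square_integrable_zero: "square_integrable (\<lambda>x. 0)"
  by (simp add: square_integrable_def)

lemma square_integrable_add:
  assumes f: "square_integrable f" and g: "square_integrable g"
  shows "square_integrable (\<lambda>x. f x + g x)"
proof -
  note [measurable] = square_integrableD[OF f] square_integrableD[OF g]
  have "integrable lebesgue (\<lambda>x. (cmod (f x + g x))\<^sup>2)"
  proof (rule Bochner_Integration.integrable_bound)
    show "integrable lebesgue (\<lambda>x. 2 * (cmod (f x))\<^sup>2 + 2 * (cmod (g x))\<^sup>2)"
      using f g by (simp add: square_integrable_integrable)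
    have "(cmod (f x + g x))\<^sup>2 \<le> 2 * (cmod (f x))\<^sup>2 + 2 * (cmod (g x))\<^sup>2" for x
    proof -
      have "(cmod (f x + g x))\<^sup>2 \<le> (cmod (f x) + cmod (g x))\<^sup>2"
        by (intro power_mono norm_triangle_ineq) simp
      also have "\<dots> \<le> 2 * (cmod (f x))\<^sup>2 + 2 * (cmod (g x))\<^sup>2"
        using zero_le_power2[of "cmod (f x) - cmod (g x)"] by (simp add: power2_sum power2_diff)
      finally show ?thesis .
    qed
    then show "AE x in lebesgue. norm ((cmod (f x + g x))\<^sup>2) \<le> norm (2 * (cmod (f x))\<^sup>2 + 2 * (cmod (g x))\<^sup>2)"
      by simp
  qed measurable
  then show ?thesis by (simp add: square_integrable_def)
qed

lemma square_integrable_bounded_mult: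
  assumes [measurable]: "m \<in> borel_measurable lebesgue" and f: "square_integrable f"
    and b: "\<And>x. cmod (m x) \<le> C"
  shows "square_integrable (\<lambda>x. m x * f x)"
proof (rule square_integrable_bound[OF _ f, of _ C])
  note [measurable] = square_integrableD[OF f]
  show "(\<lambda>x. m x * f x) \<in> borel_measurable lebesgue" by measurable
  show "AE x in lebesgue. cmod (m x * f x) \<le> C * cmod (f x)"
    by (auto intro!: mult_right_mono b simp: norm_mult)
qed

lemma square_integrable_mult_integrable:
  assumes f: "square_integrable f" and g: "square_integrable g"
  shows "integrable lebesgue (\<lambda>x. f x * g x)"
proof (rule Bochner_Integration.integrable_bound)
  note [measurable] = square_integrableD[OF f] square_integrableD[OF g]
  show "integrable lebesgue (\<lambda>x. (cmod (f x))\<^sup>2 + (cmod (g x))\<^sup>2)"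
    using f g by (simp add: square_integrable_integrable)
  show "(\<lambda>x. f x * g x) \<in> borel_measurable lebesgue" by measurable
  have "cmod (f x * g x) \<le> (cmod (f x))\<^sup>2 + (cmod (g x))\<^sup>2" for x
    using zero_le_power2[of "cmod (f x) - cmod (g x)"] zero_le_power2[of "cmod (f x)"]
     zero_le_power2[of "cmod (g x)"]
    unfolding power2_diff norm_mult by linarith
  then show "AE x in lebesgue. norm (f x * g x) \<le> norm ((cmod (f x))\<^sup>2 + (cmod (g x))\<^sup>2)" by simp
qed

lemma borel_measurable_cnj [measurable]: "cnj \<in> borel_measurable borel"
  by (intro borel_measurable_continuous_onI continuous_intros)

lemma square_integrable_cnj: "square_integrable f \<Longrightarrow> square_integrable (\<lambda>x. cnj (f x))"
  using measurable_compose[OF square_integrableD borel_measurable_cnj]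
  by (rule_tac square_integrable_bound[of _ f 1]) (auto simp: o_def)

section \<open>The Hilbert space of square integrable functions\<close>

definition L2_eq :: "('a::euclidean_space \<Rightarrow> complex) \<Rightarrow> ('a \<Rightarrow> complex) \<Rightarrow> bool" where
  "L2_eq f g \<longleftrightarrow> square_integrable f \<and> square_integrable g \<and> (AE x in lebesgue. f x = g x)"

quotient_type (overloaded) 'a L2 = "'a::euclidean_space \<Rightarrow> complex" / partial: L2_eq
  morphisms rep_L2 abs_L2
proof (rule part_equivpI)
  show "\<exists>x. L2_eq x x" by (auto simp: L2_eq_def intro!: exI[of _ "\<lambda>x. 0"] square_integrable_zero)
  show "symp L2_eq" by (auto simp: L2_eq_def symp_def elim: eventually_mono)
  show "transp L2_eq" unfolding L2_eq_def transp_def by (auto elim: eventually_elim2)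
qed

definition toL2 :: "('a::euclidean_space \<Rightarrow> complex) \<Rightarrow> 'a L2" where "toL2 f = abs_L2 f"

text \<open>A chosen representative. Pointwise identities between representatives hold almost everywhere
  only, and \<open>toL2\<close> is meaningful for square integrable functions only.\<close>

definition fn :: "'a::euclidean_space L2 \<Rightarrow> 'a \<Rightarrow> complex" where
  "fn a = (SOME f. square_integrable f \<and> toL2 f = a)"

lemma toL2_eq_iff:
  assumes "square_integrable f" "square_integrable g"
  shows "toL2 f = toL2 g \<longleftrightarrow> (AE x in lebesgue. f x = g x)"
  unfolding toL2_def using assms Quotient3_rel[OF Quotient3_L2, of f g] by (auto simp: L2_eq_def)

lemma fn: "square_integrable (fn a) \<and> toL2 (fn a) = a"
proof -
  have "\<exists>f. square_integrable f \<and> toL2 f = a"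
    using Quotient3_abs_rep[OF Quotient3_L2, of a] Quotient3_rep_reflp[OF Quotient3_L2, of a]
    unfolding toL2_def L2_eq_def by blast
  from someI_ex[OF this] show ?thesis unfolding fn_def .
qed

lemma fn_square_integrable [simp, intro]: "square_integrable (fn a)" using fn by blast

lemma toL2_fn [simp]: "toL2 (fn a) = a" using fn by blast

lemma fn_measurable [measurable]: "fn a \<in> borel_measurable lebesgue"
  by (simp add: square_integrableD)

lemma fn_toL2: "square_integrable f \<Longrightarrow> AE x in lebesgue. fn (toL2 f) x = f x"
  using toL2_eq_iff[of "fn (toL2 f)" f] by simp

lemma L2_eqI: "(AE x in lebesgue. fn a x = fn b x) \<Longrightarrow> a = b"
  using toL2_eq_iff[of "fn a" "fn b"] by simp

instantiation L2 :: (euclidean_space) real_inner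
begin
definition "0 = toL2 (\<lambda>x. 0)"
definition "a + b = toL2 (\<lambda>x. fn a x + fn b x)"
definition "- a = toL2 (\<lambda>x. - fn a x)"
definition "a - b = a + - (b :: 'a L2)"
definition "c *\<^sub>R a = toL2 (\<lambda>x. of_real c * fn a x)"
definition "inner a b = (\<integral>x. Re (fn a x * cnj (fn b x)) \<partial>lebesgue)"
definition "norm a = sqrt (inner a (a::'a L2))"
definition "sgn a = inverse (norm a) *\<^sub>R (a::'a L2)"
definition "dist a b = norm (a - b::'a L2)"
definition "uniformity = (INF e\<in>{0<..}. principal {(x, y::'a L2). dist x y < e})"
definition "open S = (\<forall>x\<in>S. \<forall>\<^sub>F (x', y) in uniformity. x' = x \<longrightarrow> y \<in> (S::'a L2 set))"

lemma fn_0: "AE x in lebesgue. fn 0 x = 0"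
  unfolding zero_L2_def by (intro fn_toL2 square_integrable_zero)

lemma fn_add: "AE x in lebesgue. fn (a + b) x = fn a x + fn b x"
  unfolding plus_L2_def by (intro fn_toL2 square_integrable_add fn_square_integrable)

lemma square_integrable_cmult: "square_integrable f \<Longrightarrow> square_integrable (\<lambda>x. c * f x)"
  by (rule square_integrable_bounded_mult[of _ _ "cmod c"]) auto

lemma fn_uminus: "AE x in lebesgue. fn (- a) x = - fn a x"
  unfolding uminus_L2_def using fn_toL2[OF square_integrable_cmult[OF fn_square_integrable, of "-1" a]] by simp

lemma fn_diff: "AE x in lebesgue. fn (a - b) x = fn a x - fn b x"
  unfolding minus_L2_def using fn_add[of a "-b"] fn_uminus[of b] by eventually_elim simp

lemma fn_scaleR: "AE x in lebesgue. fn (c *\<^sub>R a) x = of_real c * fn a x"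
  unfolding scaleR_L2_def by (intro fn_toL2 square_integrable_cmult fn_square_integrable)

lemma integrable_inner: "integrable lebesgue (\<lambda>x. Re (fn a x * cnj (fn b x)))"
  by (intro integrable_Re square_integrable_mult_integrable square_integrable_cnj fn_square_integrable)

instance
proof
  fix a b c :: "'a L2" and r s :: real
  show "a + b + c = a + (b + c)"
    by (rule L2_eqI) (use fn_add[of a b] fn_add[of "a + b" c] fn_add[of b c] fn_add[of a "b + c"] in \<open>eventually_elim, simp\<close>)
  show "a + b = b + a"
    by (rule L2_eqI) (use fn_add[of a b] fn_add[of b a] in \<open>eventually_elim, simp\<close>)
  show "0 + a = a"
    by (rule L2_eqI) (use fn_add[of 0 a] fn_0 in \<open>eventually_elim, simp\<close>)
  show "- a + a = 0"
    by (rule L2_eqI) (use fn_add[of "-a" a] fn_0 fn_uminus[of a] in \<open>eventually_elim, simp\<close>)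
  show "a - b = a + - b" by (simp add: minus_L2_def)
  show "r *\<^sub>R (a + b) = r *\<^sub>R a + r *\<^sub>R b"
    by (rule L2_eqI) (use fn_add[of a b] fn_scaleR[of r "a + b"] fn_add[of "r *\<^sub>R a" "r *\<^sub>R b"]
      fn_scaleR[of r a] fn_scaleR[of r b] in \<open>eventually_elim, simp add: algebra_simps\<close>)
  show "(r + s) *\<^sub>R a = r *\<^sub>R a + s *\<^sub>R a"
    by (rule L2_eqI) (use fn_scaleR[of "r + s" "a"] fn_add[of "r *\<^sub>R a" "s *\<^sub>R a"]
      fn_scaleR[of r a] fn_scaleR[of s a] in \<open>eventually_elim, simp add: algebra_simps\<close>)
  show "r *\<^sub>R s *\<^sub>R a = (r * s) *\<^sub>R a"
    by (rule L2_eqI) (use fn_scaleR[of r "s *\<^sub>R a"] fn_scaleR[of "r * s" a] fn_scaleR[of s a]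
      in \<open>eventually_elim, simp\<close>)
  show "1 *\<^sub>R a = a"
    by (rule L2_eqI) (use fn_scaleR[of 1 a] in \<open>eventually_elim, simp\<close>)
  show "inner a b = inner b a"
    unfolding inner_L2_def by (simp add: mult.commute)
  have "inner (a + b) c = (\<integral>x. Re (fn a x * cnj (fn c x)) + Re (fn b x * cnj (fn c x)) \<partial>lebesgue)"
    unfolding inner_L2_def
    by (rule integral_cong_AE, measurable, measurable) (use fn_add[of a b] in \<open>eventually_elim, simp add: algebra_simps\<close>)
  then show "inner (a + b) c = inner a c + inner b c"
    unfolding inner_L2_def using integrable_inner[of a c] integrable_inner[of b c] by simp
  have "inner (r *\<^sub>R a) b = (\<integral>x. r * Re (fn a x * cnj (fn b x)) \<partial>lebesgue)"
    unfolding inner_L2_def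
    by (rule integral_cong_AE, measurable, measurable) (use fn_scaleR[of r a] in \<open>eventually_elim, simp add: algebra_simps\<close>)
  then show "inner (r *\<^sub>R a) b = r * inner a b" unfolding inner_L2_def by simp
  have sq: "Re (fn a x * cnj (fn a x)) = (cmod (fn a x))\<^sup>2" for x
    by (simp add: complex_mult_cnj cmod_power2)
  show "0 \<le> inner a a" unfolding inner_L2_def sq by simp
  have "inner a a = 0 \<longleftrightarrow> (AE x in lebesgue. (cmod (fn a x))\<^sup>2 = 0)"
    unfolding inner_L2_def sq
    by (rule integral_nonneg_eq_0_iff_AE) (auto simp: square_integrable_integrable)
  also have "\<dots> \<longleftrightarrow> a = 0"
  proof
    assume z: "AE x in lebesgue. (cmod (fn a x))\<^sup>2 = 0"
    show "a = 0" by (rule L2_eqI) (use z fn_0 in \<open>eventually_elim, simp\<close>)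
  next
    assume "a = 0" then show "AE x in lebesgue. (cmod (fn a x))\<^sup>2 = 0" using fn_0 by auto
  qed
  finally show "inner a a = 0 \<longleftrightarrow> a = 0" .
qed (simp_all add: norm_L2_def sgn_L2_def dist_L2_def uniformity_L2_def open_L2_def)
end

lemma norm_L2_power2: "(norm a)\<^sup>2 = (\<integral>x. (cmod (fn a x))\<^sup>2 \<partial>lebesgue)"
proof -
  have "Re (fn a x * cnj (fn a x)) = (cmod (fn a x))\<^sup>2" for x
    by (simp add: complex_mult_cnj cmod_power2)
  then show ?thesis unfolding power2_norm_eq_inner inner_L2_def by simp
qed

lemma norm_toL2_power2:
  assumes f: "square_integrable f"
  shows "(norm (toL2 f))\<^sup>2 = (\<integral>x. (cmod (f x))\<^sup>2 \<partial>lebesgue)"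
proof -
  note [measurable] = square_integrableD[OF f]
  show ?thesis unfolding norm_L2_power2
    by (rule integral_cong_AE, measurable, measurable) (use fn_toL2[OF f] in \<open>eventually_elim, simp\<close>)
qed

lemma nn_integral_norm_L2:
  "(\<integral>\<^sup>+x. ennreal ((cmod (fn a x))\<^sup>2) \<partial>lebesgue) = ennreal ((norm a)\<^sup>2)"
  unfolding norm_L2_power2
  by (rule nn_integral_eq_integral) (auto simp: square_integrable_integrable)

lemma square_integrable_iff_nn_integral:
  assumes [measurable]: "f \<in> borel_measurable lebesgue"
  shows "square_integrable f \<longleftrightarrow> (\<integral>\<^sup>+x. ennreal ((cmod (f x))\<^sup>2) \<partial>lebesgue) < \<infinity>"
  unfolding square_integrable_def integrable_iff_bounded using assms by simp

lemma nn_integral_norm_toL2: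
  assumes "square_integrable f"
  shows "(\<integral>\<^sup>+x. ennreal ((cmod (f x))\<^sup>2) \<partial>lebesgue) = ennreal ((norm (toL2 f))\<^sup>2)"
  unfolding norm_toL2_power2[OF assms]
  by (rule nn_integral_eq_integral) (auto simp: square_integrable_integrable assms)

lemma norm_toL2_le:
  assumes f: "square_integrable f" and le: "(\<integral>\<^sup>+x. ennreal ((cmod (f x))\<^sup>2) \<partial>lebesgue) \<le> ennreal (e\<^sup>2)"
    and e: "0 \<le> e"
  shows "norm (toL2 f) \<le> e"
proof -
  have "(norm (toL2 f))\<^sup>2 \<le> e\<^sup>2" using le unfolding nn_integral_norm_toL2[OF f] by simp
  then show ?thesis using e by (rule power2_le_imp_le)
qed

text \<open>For numbers \<open>D k\<close> with summable \<open>2 ^ k * (D k)\<^sup>2\<close> one has \<open>D k = O(2 powr (- k / 2))\<close>.\<close>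

lemma summable_of_weighted_squares:
  fixes D :: "nat \<Rightarrow> real"
  assumes D: "\<And>k. 0 \<le> D k" and s: "summable (\<lambda>k. 2 ^ k * (D k)\<^sup>2)"
  shows "summable D"
proof -
  obtain C where C: "\<And>k. norm (2 ^ k * (D k)\<^sup>2) \<le> C"
    using summable_imp_Bseq[OF s] unfolding Bseq_def by blast
  have "norm (D k) \<le> sqrt C * sqrt (1/2) ^ k" for k
  proof -
    have "(D k)\<^sup>2 \<le> C * (1/2) ^ k" using C[of k] by (simp add: field_simps)
    then have "sqrt ((D k)\<^sup>2) \<le> sqrt (C * (1/2) ^ k)" by (rule real_sqrt_le_mono)
    then show ?thesis using D[of k] by (simp add: real_sqrt_mult real_sqrt_power)
  qed
  moreover have "summable (\<lambda>k. sqrt C * sqrt (1/2) ^ k)"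
    by (intro summable_mult summable_geometric) simp
  ultimately show ?thesis using summable_comparison_test' by blast
qed

text \<open>Riesz--Fischer. The weights \<open>2 ^ k\<close> let one control the sum of the increments by the sum of
  their squares, so that the almost everywhere convergence comes from monotone convergence alone.\<close>

lemma L2_subsequence_converges_AE:
  fixes f :: "nat \<Rightarrow> 'a::euclidean_space L2"
  assumes f: "\<And>k. norm (f (Suc k) - f k) \<le> (1/2) ^ k"
  shows "AE x in lebesgue. convergent (\<lambda>k. fn (f k) x)"
proof -
  define D where "D k x = cmod (fn (f (Suc k) - f k) x)" for k x
  have [measurable]: "D k \<in> borel_measurable lebesgue" for k unfolding D_def by measurable
  have "(\<integral>\<^sup>+x. (\<Sum>k. ennreal (2 ^ k * (D k x)\<^sup>2)) \<partial>lebesgue)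
      = (\<Sum>k. (\<integral>\<^sup>+x. ennreal (2 ^ k * (D k x)\<^sup>2) \<partial>lebesgue))"
    by (rule nn_integral_suminf) measurable
  also have "\<dots> = (\<Sum>k. ennreal (2 ^ k * (norm (f (Suc k) - f k))\<^sup>2))"
    by (simp add: ennreal_mult' nn_integral_cmult D_def nn_integral_norm_L2)
  also have "\<dots> \<le> (\<Sum>k. ennreal ((1/2) ^ k))"
  proof (rule suminf_le)
    fix k
    have "2 ^ k * (norm (f (Suc k) - f k))\<^sup>2 \<le> 2 ^ k * ((1/2) ^ k)\<^sup>2"
      by (intro mult_left_mono power_mono f) auto
    also have "\<dots> = (1/2 :: real) ^ k" by (simp add: power2_eq_square flip: power_mult_distrib mult.assoc)
    finally show "ennreal (2 ^ k * (norm (f (Suc k) - f k))\<^sup>2) \<le> ennreal ((1/2) ^ k)"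
      by (rule ennreal_leI)
  qed auto
  also have "\<dots> < \<infinity>"
    by (subst suminf_ennreal2) (auto intro!: summable_geometric)
  finally have "AE x in lebesgue. (\<Sum>k. ennreal (2 ^ k * (D k x)\<^sup>2)) \<noteq> \<infinity>"
    by (intro nn_integral_PInf_AE) auto
  moreover have "AE x in lebesgue. \<forall>k. fn (f (Suc k) - f k) x = fn (f (Suc k)) x - fn (f k) x"
    by (subst AE_all_countable) (simp add: fn_diff)
  ultimately show ?thesis
  proof eventually_elim
    case (elim x)
    have "summable (\<lambda>k. 2 ^ k * (D k x)\<^sup>2)"
      using elim(1) by (intro summable_suminf_not_top) auto
    then have "summable (\<lambda>k. D k x)"
      by (rule summable_of_weighted_squares[rotated]) (simp add: D_def)
    then have "summable (\<lambda>k. fn (f (Suc k)) x - fn (f k) x)"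
      using elim(2) by (auto simp: D_def intro: summable_norm_cancel)
    then have "convergent (\<lambda>n. fn (f 0) x + (\<Sum>k<n. fn (f (Suc k)) x - fn (f k) x))"
      by (intro convergent_add convergent_const) (simp add: summable_iff_convergent)
    moreover have "fn (f 0) x + (\<Sum>k<n. fn (f (Suc k)) x - fn (f k) x) = fn (f n) x" for n
      using sum_lessThan_telescope[of "\<lambda>k. fn (f k) x" n] by simp
    ultimately show ?case by (simp only:)
  qed
qed

instance L2 :: (euclidean_space) complete_space
proof
  fix X :: "nat \<Rightarrow> 'a L2" assume X: "Cauchy X"
  have "\<exists>N. \<forall>m\<ge>N. \<forall>n\<ge>N. norm (X m - X n) < (1/2) ^ k" for k
    using X unfolding Cauchy_def dist_norm by (metis zero_less_divide_1_iff zero_less_numeral zero_less_power)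
  then obtain N where N: "\<And>k m n. m \<ge> N k \<Longrightarrow> n \<ge> N k \<Longrightarrow> norm (X m - X n) < (1/2) ^ k" by metis
  define r where "r k = (\<Sum>i\<le>k. N i) + k" for k
  have r: "strict_mono r" by (rule strict_monoI_Suc) (simp add: r_def)
  have rN: "r k \<ge> N k" for k unfolding r_def by (simp add: trans_le_add1 member_le_sum)
  have rN': "r m \<ge> N k" if "k \<le> m" for k m
    using rN[of k] strict_mono_mono[OF r] that by (meson monoD order_trans)
  define f where "f k = X (r k)" for k
  have conv: "AE x in lebesgue. convergent (\<lambda>k. fn (f k) x)"
    by (rule L2_subsequence_converges_AE) (unfold f_def, intro less_imp_le N rN' le_SucI order_refl)
  define g where "g x = lim (\<lambda>k. fn (f k) x)" for x
  have [measurable]: "g \<in> borel_measurable lebesgue" unfolding g_def by measurable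
  have lim: "AE x in lebesgue. (\<lambda>k. fn (f k) x) \<longlonglongrightarrow> g x"
    using conv by eventually_elim (simp add: g_def convergent_LIMSEQ_iff)
  have Fatou: "(\<integral>\<^sup>+x. ennreal ((cmod (g x - fn (f k) x))\<^sup>2) \<partial>lebesgue) \<le> ennreal (((1/2) ^ k)\<^sup>2)" for k
  proof -
    have "AE x in lebesgue. \<forall>m. fn (f m - f k) x = fn (f m) x - fn (f k) x"
      by (subst AE_all_countable) (simp add: fn_diff)
    with lim have eq: "AE x in lebesgue. ennreal ((cmod (g x - fn (f k) x))\<^sup>2)
        = liminf (\<lambda>m. ennreal ((cmod (fn (f m - f k) x))\<^sup>2))"
    proof eventually_elim
      case (elim x)
      have "(\<lambda>m. ennreal ((cmod (fn (f m) x - fn (f k) x))\<^sup>2)) \<longlonglongrightarrow> ennreal ((cmod (g x - fn (f k) x))\<^sup>2)"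
        by (intro tendsto_intros elim)
      then show ?case
        unfolding elim(2)[rule_format] by (intro lim_imp_Liminf[symmetric] trivial_limit_sequentially)
    qed
    have "(\<integral>\<^sup>+x. ennreal ((cmod (g x - fn (f k) x))\<^sup>2) \<partial>lebesgue)
        = (\<integral>\<^sup>+x. liminf (\<lambda>m. ennreal ((cmod (fn (f m - f k) x))\<^sup>2)) \<partial>lebesgue)"
      using eq by (rule nn_integral_cong_AE)
    also have "\<dots> \<le> liminf (\<lambda>m. \<integral>\<^sup>+x. ennreal ((cmod (fn (f m - f k) x))\<^sup>2) \<partial>lebesgue)"
      by (rule nn_integral_liminf) measurable
    also have "\<dots> \<le> ennreal (((1/2) ^ k)\<^sup>2)"
    proof (rule Liminf_le)
      show "\<forall>\<^sub>F m in sequentially. (\<integral>\<^sup>+x. ennreal ((cmod (fn (f m - f k) x))\<^sup>2) \<partial>lebesgue) \<le> ennreal (((1/2) ^ k)\<^sup>2)"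
        using eventually_ge_at_top[of k]
      proof eventually_elim
        case (elim m)
        have "norm (f m - f k) \<le> (1/2) ^ k"
          unfolding f_def using N[OF rN'[OF elim] rN[of k]] by simp
        then show ?case unfolding nn_integral_norm_L2 by (intro ennreal_leI power_mono) auto
      qed
    qed simp
    finally show ?thesis .
  qed
  have diff: "square_integrable (\<lambda>x. g x - fn (f k) x)" for k
    using Fatou[of k] by (subst square_integrable_iff_nn_integral) (auto simp: less_top[symmetric] top_unique)
  have g: "square_integrable g"
    using square_integrable_add[OF diff[of 0] fn_square_integrable[of "f 0"]] by simp
  have eq: "toL2 g - f k = toL2 (\<lambda>x. g x - fn (f k) x)" for k
    by (rule L2_eqI) (use fn_diff[of "toL2 g" "f k"] fn_toL2[OF g] fn_toL2[OF diff[of k]] in \<open>eventually_elim, simp\<close>)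
  have "norm (toL2 g - f k) \<le> (1/2) ^ k" for k
    unfolding eq by (rule norm_toL2_le[OF diff Fatou]) simp
  then have "(\<lambda>k. toL2 g - f k) \<longlonglongrightarrow> 0"
    using Lim_null_comparison[of "\<lambda>k. toL2 g - f k" "\<lambda>k. (1/2) ^ k" sequentially]
    by (simp add: LIMSEQ_realpow_zero)
  then have "f \<longlonglongrightarrow> toL2 g"
    using Lim_transform2[OF tendsto_const] by blast
  then have "X \<longlonglongrightarrow> toL2 g"
    using Cauchy_converges_subseq[OF X r, of "toL2 g"] by (simp add: f_def[abs_def] o_def)
  then show "convergent X" unfolding convergent_def by blast
qed

section \<open>Bounded multipliers and the bilinear pairing\<close>

definition bounded_multiplier :: "('a::euclidean_space \<Rightarrow> complex) \<Rightarrow> bool" where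
  "bounded_multiplier m \<longleftrightarrow> m \<in> borel_measurable lebesgue \<and> (\<exists>C. \<forall>x. cmod (m x) \<le> C)"

definition mult_op :: "('a::euclidean_space \<Rightarrow> complex) \<Rightarrow> 'a L2 \<Rightarrow> 'a L2" where
  "mult_op m a = toL2 (\<lambda>x. m x * fn a x)"

lemma bounded_multiplierI:
  "m \<in> borel_measurable lebesgue \<Longrightarrow> (\<And>x. cmod (m x) \<le> C) \<Longrightarrow> bounded_multiplier m"
  unfolding bounded_multiplier_def by blast

lemma square_integrable_mult_op: "bounded_multiplier m \<Longrightarrow> square_integrable (\<lambda>x. m x * fn a x)"
  unfolding bounded_multiplier_def using square_integrable_bounded_mult by blast

lemma fn_mult_op: "bounded_multiplier m \<Longrightarrow> AE x in lebesgue. fn (mult_op m a) x = m x * fn a x"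
  unfolding mult_op_def by (intro fn_toL2 square_integrable_mult_op)

lemma mult_op_add:
  assumes "bounded_multiplier m"
  shows "mult_op m (a + b) = mult_op m a + mult_op m b"
  by (rule L2_eqI)
     (use fn_mult_op[OF assms, of "a + b"] fn_mult_op[OF assms, of a] fn_mult_op[OF assms, of b] fn_add[of a b]
        fn_add[of "mult_op m a" "mult_op m b"] in \<open>eventually_elim, simp add: algebra_simps\<close>)

lemma norm_mult_op_le:
  assumes m: "bounded_multiplier m" and C: "\<And>x. cmod (m x) \<le> C"
  shows "norm (mult_op m a) \<le> C * norm a"
  unfolding mult_op_def
proof (rule norm_toL2_le[OF square_integrable_mult_op[OF m]])
  have C0: "0 \<le> C" using C[of undefined] norm_ge_zero order_trans by blast
  then show "0 \<le> C * norm a" by simp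
  have "(\<integral>\<^sup>+x. ennreal ((cmod (m x * fn a x))\<^sup>2) \<partial>lebesgue) \<le> (\<integral>\<^sup>+x. ennreal (C\<^sup>2 * (cmod (fn a x))\<^sup>2) \<partial>lebesgue)"
    by (intro nn_integral_mono ennreal_leI) (auto simp: norm_mult power_mult_distrib intro!: mult_right_mono power_mono C)
  also have "\<dots> = ennreal ((C * norm a)\<^sup>2)"
    by (simp add: ennreal_mult' nn_integral_cmult nn_integral_norm_L2 power_mult_distrib)
  finally show "(\<integral>\<^sup>+x. ennreal ((cmod (m x * fn a x))\<^sup>2) \<partial>lebesgue) \<le> ennreal ((C * norm a)\<^sup>2)" .
qed

lemma mult_op_tendsto:
  assumes m: "\<And>n. bounded_multiplier (m n)" and k: "bounded_multiplier k"
    and C: "\<And>n x. cmod (m n x) \<le> C" and lim: "AE x in lebesgue. (\<lambda>n. m n x) \<longlonglongrightarrow> k x"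
  shows "(\<lambda>n. mult_op (m n) a) \<longlonglongrightarrow> mult_op k a"
proof -
  obtain K where K: "\<And>x. cmod (k x) \<le> K" using k unfolding bounded_multiplier_def by blast
  have [measurable]: "m n \<in> borel_measurable lebesgue" "k \<in> borel_measurable lebesgue" for n
    using m k unfolding bounded_multiplier_def by blast+
  have "(\<lambda>n. (norm (mult_op (m n) a - mult_op k a))\<^sup>2) \<longlonglongrightarrow> 0"
  proof -
    have "(norm (mult_op (m n) a - mult_op k a))\<^sup>2 = (\<integral>x. (cmod ((m n x - k x) * fn a x))\<^sup>2 \<partial>lebesgue)" for n
      unfolding norm_L2_power2
      by (rule integral_cong_AE, measurable, measurable)
         (use fn_diff[of "mult_op (m n) a" "mult_op k a"] fn_mult_op[OF m[of n], of a] fn_mult_op[OF k, of a] in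
          \<open>eventually_elim, simp add: left_diff_distrib\<close>)
    moreover have "(\<lambda>n. \<integral>x. (cmod ((m n x - k x) * fn a x))\<^sup>2 \<partial>lebesgue) \<longlonglongrightarrow> (\<integral>x. 0 \<partial>(lebesgue :: 'a measure))"
    proof (rule integral_dominated_convergence[where w = "\<lambda>x. (C + K)\<^sup>2 * (cmod (fn a x))\<^sup>2"])
      show "integrable lebesgue (\<lambda>x. (C + K)\<^sup>2 * (cmod (fn a x))\<^sup>2)"
        by (simp add: square_integrable_integrable)
      show "AE x in lebesgue. (\<lambda>n. (cmod ((m n x - k x) * fn a x))\<^sup>2) \<longlonglongrightarrow> 0"
        using lim
      proof eventually_elim
        case (elim x)
        have "(\<lambda>n. (cmod ((m n x - k x) * fn a x))\<^sup>2) \<longlonglongrightarrow> (cmod ((k x - k x) * fn a x))\<^sup>2"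
          by (intro tendsto_intros elim)
        then show ?case by simp
      qed
      fix n
      have "cmod (m n x - k x) \<le> C + K" for x
        using norm_triangle_ineq4[of "m n x" "k x"] C[of n x] K[of x] by linarith
      then show "AE x in lebesgue. norm ((cmod ((m n x - k x) * fn a x))\<^sup>2) \<le> (C + K)\<^sup>2 * (cmod (fn a x))\<^sup>2"
        by (auto simp: norm_mult power_mult_distrib intro!: mult_right_mono power_mono)
    qed measurable
    ultimately show ?thesis by simp
  qed
  then have "(\<lambda>n. sqrt ((norm (mult_op (m n) a - mult_op k a))\<^sup>2)) \<longlonglongrightarrow> sqrt 0" by (rule tendsto_real_sqrt)
  then show ?thesis by (simp add: LIM_zero_iff tendsto_norm_zero_iff)
qed

definition pairing :: "'a::euclidean_space L2 \<Rightarrow> 'a L2 \<Rightarrow> complex" where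
  "pairing a b = (\<integral>x. fn a x * fn b x \<partial>lebesgue)"

lemma pairing_integrable: "integrable lebesgue (\<lambda>x. fn a x * fn b x)"
  by (intro square_integrable_mult_integrable fn_square_integrable)

lemma pairing_toL2:
  assumes f: "square_integrable f" and g: "square_integrable g"
  shows "pairing (toL2 f) (toL2 g) = (\<integral>x. f x * g x \<partial>lebesgue)"
proof -
  note [measurable] = square_integrableD[OF f] square_integrableD[OF g]
  show ?thesis unfolding pairing_def
    by (rule integral_cong_AE, measurable, measurable)
       (use fn_toL2[OF f] fn_toL2[OF g] in \<open>eventually_elim, simp\<close>)
qed

lemma pairing_commute: "pairing a b = pairing b a"
  unfolding pairing_def by (simp add: mult.commute)

lemma pairing_add_left: "pairing (a + b) c = pairing a c + pairing b c"
proof -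
  have "pairing (a + b) c = (\<integral>x. fn a x * fn c x + fn b x * fn c x \<partial>lebesgue)"
    unfolding pairing_def
    by (rule integral_cong_AE, measurable, measurable)
       (use fn_add[of a b] in \<open>eventually_elim, simp add: algebra_simps\<close>)
  then show ?thesis unfolding pairing_def by (simp add: pairing_integrable)
qed

lemma pairing_scaleR_left: "pairing (r *\<^sub>R a) c = r *\<^sub>R pairing a c"
proof -
  have "pairing (r *\<^sub>R a) c = (\<integral>x. of_real r * (fn a x * fn c x) \<partial>lebesgue)"
    unfolding pairing_def
    by (rule integral_cong_AE, measurable, measurable)
       (use fn_scaleR[of r a] in \<open>eventually_elim, simp add: algebra_simps\<close>)
  then show ?thesis unfolding pairing_def by (simp add: scaleR_conv_of_real)
qed

text \<open>Rotating \<open>a\<close> by a unimodular constant makes the pairing real and nonnegative; it then is a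
  real inner product with the conjugate of \<open>b\<close>, and the Cauchy--Schwarz inequality applies.\<close>

lemma norm_pairing_le: "cmod (pairing a b) \<le> norm a * norm b"
proof -
  define c where "c = cnj (sgn (pairing a b))"
  have c: "cmod c \<le> 1" unfolding c_def by (simp add: norm_sgn)
  have m: "bounded_multiplier (\<lambda>x::'a. c)" by (rule bounded_multiplierI[of _ "cmod c"]) auto
  have cb: "square_integrable (\<lambda>x. cnj (fn b x))" by (intro square_integrable_cnj) auto
  have "c * pairing a b = cmod (pairing a b)"
    unfolding c_def sgn_eq using complex_norm_square[of "pairing a b"]
    by (cases "pairing a b = 0") (simp_all add: field_simps power2_eq_square)
  then have "cmod (pairing a b) = Re (c * pairing a b)" by simp
  also have "c * pairing a b = (\<integral>x. c * (fn a x * fn b x) \<partial>lebesgue)" unfolding pairing_def by simp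
  also have "Re \<dots> = (\<integral>x. Re (c * (fn a x * fn b x)) \<partial>lebesgue)"
    by (intro integral_Re[symmetric] integrable_mult_right pairing_integrable)
  also have "\<dots> = inner (mult_op (\<lambda>x. c) a) (toL2 (\<lambda>x. cnj (fn b x)))"
    unfolding inner_L2_def
    by (rule integral_cong_AE, measurable, measurable)
       (use fn_mult_op[OF m, of a] fn_toL2[OF cb] in \<open>eventually_elim, simp add: algebra_simps\<close>)
  also have "\<dots> \<le> norm (mult_op (\<lambda>x. c) a) * norm (toL2 (\<lambda>x. cnj (fn b x)))"
    by (rule norm_cauchy_schwarz)
  also have "\<dots> \<le> norm a * norm b"
  proof (intro mult_mono)
    show "norm (mult_op (\<lambda>x. c) a) \<le> norm a"
      using norm_mult_op_le[OF m, of "1" a] c by simp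
    show "norm (toL2 (\<lambda>x. cnj (fn b x))) \<le> norm b"
      by (rule norm_toL2_le[OF cb]) (simp_all add: nn_integral_norm_L2)
  qed auto
  finally show ?thesis .
qed

text \<open>The pairing is complex bilinear, without a conjugate: this is the form in which the
  multiplication formula of the Fourier transform extends to square integrable functions.\<close>

lemma bounded_bilinear_pairing: "bounded_bilinear pairing"
proof
  show "pairing (a + a') b = pairing a b + pairing a' b" for a a' b :: "'a L2" by (rule pairing_add_left)
  show "pairing a (b + b') = pairing a b + pairing a b'" for a b b' :: "'a L2"
    using pairing_add_left[of b b' a] by (simp add: pairing_commute)
  show "pairing (r *\<^sub>R a) b = r *\<^sub>R pairing a b" for r and a b :: "'a L2" by (rule pairing_scaleR_left)
  show "pairing a (r *\<^sub>R b) = r *\<^sub>R pairing a b" for r and a b :: "'a L2"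
    using pairing_scaleR_left[of r b a] by (simp add: pairing_commute)
  show "\<exists>K. \<forall>a b :: 'a L2. cmod (pairing a b) \<le> norm a * norm b * K"
    by (rule exI[of _ 1]) (simp add: norm_pairing_le)
qed

lemmas tendsto_pairing = bounded_bilinear.tendsto[OF bounded_bilinear_pairing]

section \<open>Integrals over a Euclidean space\<close>

lemma sigma_finite_lebesgue: "sigma_finite_measure (lebesgue :: 'a::euclidean_space measure)"
proof
  obtain A :: "'a set set" where A: "countable A" "A \<subseteq> sets lborel" "\<Union>A = space lborel"
    "\<forall>a\<in>A. emeasure lborel a \<noteq> \<infinity>"
    using lborel.sigma_finite_countable by blast
  then show "\<exists>A. countable A \<and> A \<subseteq> sets lebesgue \<and> \<Union>A = space (lebesgue :: 'a measure) \<and> (\<forall>a\<in>A. emeasure lebesgue a \<noteq> \<infinity>)"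
    by (intro exI[of _ A]) auto
qed

interpretation lebesgue: sigma_finite_measure lebesgue by (rule sigma_finite_lebesgue)
interpretation lebesgue_pair: pair_sigma_finite lebesgue lebesgue ..

lemma lebesgue_distr_affine:
  fixes t :: "'a::euclidean_space"
  assumes "\<bar>c\<bar> = 1"
  shows "distr lebesgue lebesgue (\<lambda>x. t + c *\<^sub>R x) = lebesgue" "(\<lambda>x. t + c *\<^sub>R x) \<in> lebesgue \<rightarrow>\<^sub>M lebesgue"
proof -
  have eq: "(\<lambda>x. t + (\<Sum>j\<in>Basis. (c * (x \<bullet> j)) *\<^sub>R j)) = (\<lambda>x. t + c *\<^sub>R x)"
    unfolding scaleR_scaleR[symmetric] scaleR_sum_right[symmetric] euclidean_representation ..
  have c: "c \<noteq> 0" using assms by auto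
  show "distr lebesgue lebesgue (\<lambda>x. t + c *\<^sub>R x) = lebesgue"
    using lebesgue_affine_euclidean[of "\<lambda>_. c" t] c assms by (simp add: eq density_1)
  show "(\<lambda>x. t + c *\<^sub>R x) \<in> lebesgue \<rightarrow>\<^sub>M lebesgue"
    using lebesgue_affine_measurable[of "\<lambda>_. c" t] c by (simp add: eq)
qed

lemma
  fixes t :: "'a::euclidean_space" and f :: "'a \<Rightarrow> 'b::{banach, second_countable_topology}"
  assumes c: "\<bar>c\<bar> = 1"
  shows lebesgue_integral_affine: "f \<in> borel_measurable lebesgue \<Longrightarrow>
      (\<integral>x. f (t + c *\<^sub>R x) \<partial>lebesgue) = (\<integral>x. f x \<partial>lebesgue)"
    and lebesgue_integrable_affine: "integrable lebesgue f \<Longrightarrow> integrable lebesgue (\<lambda>x. f (t + c *\<^sub>R x))"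
    and lebesgue_measurable_affine: "f \<in> borel_measurable lebesgue \<Longrightarrow> (\<lambda>x. f (t + c *\<^sub>R x)) \<in> borel_measurable lebesgue"
    and lebesgue_AE_affine: "(AE x in lebesgue. P x) \<Longrightarrow> AE x in lebesgue. P (t + c *\<^sub>R x)"
    and lebesgue_nn_integral_affine: "g \<in> borel_measurable lebesgue \<Longrightarrow>
      (\<integral>\<^sup>+x. g (t + c *\<^sub>R x) \<partial>lebesgue) = (\<integral>\<^sup>+x. g x \<partial>lebesgue)"
proof -
  note d = lebesgue_distr_affine[OF c, of t]
  show "f \<in> borel_measurable lebesgue \<Longrightarrow> (\<integral>x. f (t + c *\<^sub>R x) \<partial>lebesgue) = (\<integral>x. f x \<partial>lebesgue)"
    using integral_distr[OF d(2), of f] by (simp add: d(1))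
  show "integrable lebesgue f \<Longrightarrow> integrable lebesgue (\<lambda>x. f (t + c *\<^sub>R x))"
    using integrable_distr[OF d(2), of f] by (simp add: d(1))
  show "f \<in> borel_measurable lebesgue \<Longrightarrow> (\<lambda>x. f (t + c *\<^sub>R x)) \<in> borel_measurable lebesgue"
    using measurable_compose[OF d(2)] by blast
  show "(AE x in lebesgue. P x) \<Longrightarrow> AE x in lebesgue. P (t + c *\<^sub>R x)"
    using AE_distrD[OF d(2), of P] unfolding d(1) .
  show "g \<in> borel_measurable lebesgue \<Longrightarrow> (\<integral>\<^sup>+x. g (t + c *\<^sub>R x) \<partial>lebesgue) = (\<integral>\<^sup>+x. g x \<partial>lebesgue)"
    using nn_integral_distr[OF d(2), of g] by (simp add: d(1))
qed

lemma
  fixes f :: "'a::euclidean_space \<Rightarrow> real \<Rightarrow> 'b::{real_normed_field, banach, second_countable_topology}"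
  assumes f: "\<And>b. b \<in> Basis \<Longrightarrow> integrable lborel (f b)"
  shows lebesgue_integrable_prod_Basis: "integrable lebesgue (\<lambda>x. \<Prod>b\<in>Basis. f b (x \<bullet> b))"
    and lebesgue_integral_prod_Basis:
      "(\<integral>x. (\<Prod>b\<in>Basis. f b (x \<bullet> b)) \<partial>lebesgue) = (\<Prod>b\<in>Basis. \<integral>t. f b t \<partial>lborel)"
proof -
  interpret product_sigma_finite "\<lambda>_ :: 'a. lborel :: real measure" by standard
  have [measurable]: "f b \<in> borel_measurable borel" if "b \<in> Basis" for b
    using borel_measurable_integrable[OF f[OF that]] by simp
  have m [measurable]: "(\<lambda>x. \<Prod>b\<in>Basis. f b (x \<bullet> b)) \<in> borel_measurable borel" by measurable
  have T [measurable]: "(\<lambda>f. \<Sum>b\<in>Basis. f b *\<^sub>R b) \<in> (\<Pi>\<^sub>M b\<in>Basis. lborel) \<rightarrow>\<^sub>M (borel :: 'a measure)"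
    by measurable
  have coord: "(\<Prod>b\<in>Basis. f b ((\<Sum>c\<in>Basis. g c *\<^sub>R c) \<bullet> b)) = (\<Prod>b\<in>Basis. f b (g b))" for g
    by (intro prod.cong) (auto simp: inner_sum_left inner_Basis if_distrib cong: if_cong)
  have "integrable lborel (\<lambda>x. \<Prod>b\<in>Basis. f b (x \<bullet> b))"
    unfolding lborel_eq[where 'a='a]
    by (subst integrable_distr_eq[OF T m]) (unfold coord, intro product_integrable_prod f finite_Basis)
  then show "integrable lebesgue (\<lambda>x. \<Prod>b\<in>Basis. f b (x \<bullet> b))"
    by (subst integrable_completion) auto
  have "(\<integral>x. (\<Prod>b\<in>Basis. f b (x \<bullet> b)) \<partial>lborel) = (\<Prod>b\<in>Basis. \<integral>t. f b t \<partial>lborel)"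
    unfolding lborel_eq[where 'a='a]
    by (subst integral_distr[OF T m]) (unfold coord, intro product_integral_prod f finite_Basis)
  then show "(\<integral>x. (\<Prod>b\<in>Basis. f b (x \<bullet> b)) \<partial>lebesgue) = (\<Prod>b\<in>Basis. \<integral>t. f b t \<partial>lborel)"
    by (subst integral_completion) auto
qed

text \<open>\<open>(1 + norm x) ^ (2 * DIM('a))\<close> dominates the product of the \<open>1 + (x \<bullet> b)\<^sup>2\<close> over the
  coordinates, and \<open>1 / (1 + t\<^sup>2)\<close> is integrable on the line.\<close>

lemma integrable_inverse_one_plus_norm:
  "integrable lebesgue (\<lambda>x::'a::euclidean_space. 1 / (1 + norm x) ^ (2 * DIM('a)))"
proof (rule Bochner_Integration.integrable_bound)
  have "integrable lborel (\<lambda>t::real. inverse (1 + t\<^sup>2))"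
    using integrable_inverse_1_plus_square by (simp add: set_integrable_def)
  then show "integrable lebesgue (\<lambda>x::'a. \<Prod>b\<in>Basis. inverse (1 + (x \<bullet> b)\<^sup>2))"
    by (intro lebesgue_integrable_prod_Basis)
  show "(\<lambda>x::'a. 1 / (1 + norm x) ^ (2 * DIM('a))) \<in> borel_measurable lebesgue"
    by measurable
  have "1 / (1 + norm x) ^ (2 * DIM('a)) \<le> (\<Prod>b\<in>Basis. inverse (1 + (x \<bullet> b)\<^sup>2))" for x :: 'a
  proof -
    have "(\<Prod>b\<in>Basis. 1 + (x \<bullet> b)\<^sup>2) \<le> (\<Prod>b\<in>(Basis :: 'a set). (1 + norm x)\<^sup>2)"
    proof (rule prod_mono)
      fix b :: 'a assume "b \<in> Basis"
      then have "(x \<bullet> b)\<^sup>2 \<le> (norm x)\<^sup>2" using Basis_le_norm[of b x] by (simp add: abs_le_square_iff[symmetric])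
      then show "0 \<le> 1 + (x \<bullet> b)\<^sup>2 \<and> 1 + (x \<bullet> b)\<^sup>2 \<le> (1 + norm x)\<^sup>2"
        using norm_ge_zero[of x] unfolding power2_sum by (simp add: add_increasing2)
    qed
    also have "\<dots> = (1 + norm x) ^ (2 * DIM('a))" by (simp add: power_mult)
    finally have le: "(\<Prod>b\<in>Basis. 1 + (x \<bullet> b)\<^sup>2) \<le> (1 + norm x) ^ (2 * DIM('a))" .
    have "0 < (\<Prod>b\<in>Basis. 1 + (x \<bullet> b)\<^sup>2)" by (intro prod_pos) (simp add: add_pos_nonneg)
    then have "inverse ((1 + norm x) ^ (2 * DIM('a))) \<le> inverse (\<Prod>b\<in>Basis. 1 + (x \<bullet> b)\<^sup>2)"
      by (rule le_imp_inverse_le[OF le])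
    also have "\<dots> = (\<Prod>b\<in>Basis. inverse (1 + (x \<bullet> b)\<^sup>2))"
      by (rule prod_inversef[symmetric, unfolded o_def])
    finally show ?thesis by (simp only: inverse_eq_divide)
  qed
  then show "AE x in lebesgue. norm (1 / (1 + norm (x::'a)) ^ (2 * DIM('a))) \<le> norm (\<Prod>b\<in>Basis. inverse (1 + (x \<bullet> b)\<^sup>2))"
    by (auto simp: abs_prod intro!: order_trans[OF _ abs_ge_self])
qed

section \<open>Gaussians\<close>

text \<open>The Fourier integral of a Gaussian is the characteristic function of the normal distribution,
  rescaled.\<close>

lemma
  fixes t \<xi> :: real assumes t: "t > 0"
  shows integrable_gaussian_real: "integrable lborel (\<lambda>x. complex_of_real (exp (- (t / 2) * x\<^sup>2)))"
    and fourier_gaussian_real: "(\<integral>x. exp (- \<i> * complex_of_real (x * \<xi>)) * complex_of_real (exp (- (t / 2) * x\<^sup>2)) \<partial>lborel)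
      = complex_of_real (sqrt (2 * pi / t) * exp (- (\<xi>\<^sup>2 / (2 * t))))"
proof -
  have st: "sqrt t > 0" "sqrt t \<noteq> 0" using t by auto
  have dens: "std_normal_density (0 + sqrt t * x) = exp (- (t / 2) * x\<^sup>2) / sqrt (2 * pi)" for x
    using t by (simp add: std_normal_density_def power_mult_distrib field_simps)
  have "integrable lborel std_normal_density" by (rule integrable_normal_density) simp
  then have "integrable lborel (\<lambda>x. std_normal_density (0 + sqrt t * x))"
    by (rule lborel_integrable_real_affine) (use st in simp)
  then have "integrable lborel (\<lambda>x. sqrt (2 * pi) * (exp (- (t / 2) * x\<^sup>2) / sqrt (2 * pi)))"
    unfolding dens by (rule integrable_mult_right)
  then have "integrable lborel (\<lambda>x. exp (- (t / 2) * x\<^sup>2))" by simp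
  then show "integrable lborel (\<lambda>x. complex_of_real (exp (- (t / 2) * x\<^sup>2)))" by (rule integrable_of_real)
  define s where "s = - \<xi> / sqrt t"
  have "complex_of_real (exp (- (s\<^sup>2) / 2)) = (CLINT x|std_normal_distribution. iexp (s * x))"
    using fun_cong[OF char_std_normal_distribution, of s] by (simp add: char_def)
  also have "\<dots> = (\<integral>x. std_normal_density x *\<^sub>R iexp (s * x) \<partial>lborel)"
    by (subst integral_density) auto
  also have "\<dots> = \<bar>sqrt t\<bar> *\<^sub>R (\<integral>x. std_normal_density (0 + sqrt t * x) *\<^sub>R iexp (s * (0 + sqrt t * x)) \<partial>lborel)"
    by (rule lborel_integral_real_affine) (use st in simp)
  also have "(\<integral>x. std_normal_density (0 + sqrt t * x) *\<^sub>R iexp (s * (0 + sqrt t * x)) \<partial>lborel)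
     = (\<integral>x. (exp (- \<i> * complex_of_real (x * \<xi>)) * complex_of_real (exp (- (t / 2) * x\<^sup>2))) / complex_of_real (sqrt (2 * pi)) \<partial>lborel)"
    unfolding dens using st by (intro Bochner_Integration.integral_cong) (simp_all add: s_def scaleR_conv_of_real mult.commute)
  also have "\<dots> = (\<integral>x. exp (- \<i> * complex_of_real (x * \<xi>)) * complex_of_real (exp (- (t / 2) * x\<^sup>2)) \<partial>lborel) / complex_of_real (sqrt (2 * pi))"
    by simp
  finally have "(\<integral>x. exp (- \<i> * complex_of_real (x * \<xi>)) * complex_of_real (exp (- (t / 2) * x\<^sup>2)) \<partial>lborel)
     = complex_of_real (exp (- (s\<^sup>2) / 2)) * complex_of_real (sqrt (2 * pi)) / complex_of_real (sqrt t)"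
    using st t by (simp add: scaleR_conv_of_real field_simps)
  also have "\<dots> = complex_of_real (sqrt (2 * pi / t) * exp (- (\<xi>\<^sup>2 / (2 * t))))"
    using t by (simp add: s_def power_divide real_sqrt_divide mult.commute)
  finally show "(\<integral>x. exp (- \<i> * complex_of_real (x * \<xi>)) * complex_of_real (exp (- (t / 2) * x\<^sup>2)) \<partial>lborel)
      = complex_of_real (sqrt (2 * pi / t) * exp (- (\<xi>\<^sup>2 / (2 * t))))" .
qed

text \<open>The parameter is the inverse of the variance, so that the Fourier transform exchanges \<open>t\<close> and
  \<open>1 / t\<close>.\<close>

definition gaussian :: "real \<Rightarrow> 'a::euclidean_space \<Rightarrow> complex" where
  "gaussian t x = complex_of_real (exp (- (t / 2) * (norm x)\<^sup>2))"

lemma norm_power2_Basis: "(norm (x::'a::euclidean_space))\<^sup>2 = (\<Sum>b\<in>Basis. (x \<bullet> b)\<^sup>2)"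
  unfolding power2_norm_eq_inner by (subst euclidean_inner) (simp add: power2_eq_square)

lemma gaussian_prod: "gaussian t x = (\<Prod>b\<in>Basis. complex_of_real (exp (- (t / 2) * (x \<bullet> b)\<^sup>2)))"
  unfolding gaussian_def norm_power2_Basis by (simp add: sum_distrib_left exp_sum)

lemma gaussian_measurable [measurable]: "gaussian t \<in> borel_measurable borel"
  unfolding gaussian_def by measurable

lemma norm_gaussian_le_1: "0 < t \<Longrightarrow> cmod (gaussian t x) \<le> 1"
  unfolding gaussian_def by simp

lemma integrable_gaussian: "t > 0 \<Longrightarrow> integrable lebesgue (gaussian t :: 'a::euclidean_space \<Rightarrow> complex)"
  unfolding gaussian_prod
  using lebesgue_integrable_prod_Basis[of "\<lambda>_ x. complex_of_real (exp (- (t / 2) * x\<^sup>2))"] integrable_gaussian_real[of t]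
  by simp

text \<open>The integral factors over the coordinates.\<close>

lemma fourier_gaussian:
  fixes \<xi> :: "'a::euclidean_space"
  assumes t: "t > 0"
  shows "fourier (gaussian t) \<xi> = complex_of_real (t powr (- (real DIM('a) / 2))) * gaussian (1 / t) \<xi>"
proof -
  let ?f = "\<lambda>b x. exp (- \<i> * complex_of_real (x * (\<xi> \<bullet> b))) * complex_of_real (exp (- (t / 2) * x\<^sup>2))"
  have eq: "exp (- \<i> * complex_of_real (x \<bullet> \<xi>)) * gaussian t x = (\<Prod>b\<in>Basis. ?f b (x \<bullet> b))" for x :: 'a
    unfolding gaussian_prod prod.distrib euclidean_inner[of x \<xi>]
    by (simp add: sum_distrib_left flip: exp_sum sum_negf)
  have "integrable lborel (?f b)" for b :: 'a
    using integrable_gaussian_real[OF t]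
    by (rule Bochner_Integration.integrable_bound) (auto simp: norm_mult norm_exp_i_times)
  then have "(\<integral>x. exp (- \<i> * complex_of_real (x \<bullet> \<xi>)) * gaussian t x \<partial>lebesgue)
      = (\<Prod>b\<in>(Basis::'a set). \<integral>x. ?f b x \<partial>lborel)"
    unfolding eq by (intro lebesgue_integral_prod_Basis)
  also have "\<dots> = (\<Prod>b\<in>(Basis::'a set). complex_of_real (sqrt (2 * pi / t) * exp (- ((\<xi> \<bullet> b)\<^sup>2 / (2 * t)))))"
    using fourier_gaussian_real[OF t] by simp
  also have "\<dots> = complex_of_real (sqrt (2 * pi / t)) ^ DIM('a) * gaussian (1 / t) \<xi>"
    by (simp add: prod.distrib gaussian_prod mult.commute)
  finally have *: "(\<integral>x. exp (- \<i> * complex_of_real (x \<bullet> \<xi>)) * gaussian t x \<partial>lebesgue)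
      = complex_of_real (sqrt (2 * pi / t)) ^ DIM('a) * gaussian (1 / t) \<xi>" .
  have "sqrt (2 * pi / t) ^ DIM('a) = ((2 * pi) * (1 / t)) powr (real DIM('a) / 2)"
    using t by (simp add: powr_half_sqrt[symmetric] powr_powr flip: powr_realpow)
  also have "\<dots> = (2 * pi) powr (real DIM('a) / 2) * (1 / t) powr (real DIM('a) / 2)"
    using t by (intro powr_mult)
  also have "(1 / t) powr (real DIM('a) / 2) = t powr (- (real DIM('a) / 2))"
    using t by (simp add: powr_minus powr_divide inverse_eq_divide)
  finally have "(2 * pi) powr (- (real DIM('a) / 2)) * sqrt (2 * pi / t) ^ DIM('a) = t powr (- (real DIM('a) / 2))"
    by (simp add: powr_minus field_simps)
  then show ?thesis unfolding fourier_def * mult.assoc[symmetric] of_real_power[symmetric] of_real_mult[symmetric] by simp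
qed

text \<open>The value at \<open>\<xi> = 0\<close> of the Fourier transform.\<close>

lemma integral_gaussian:
  assumes t: "t > 0"
  shows "(\<integral>x. gaussian t (x::'a::euclidean_space) \<partial>lebesgue) = complex_of_real ((2 * pi / t) powr (real DIM('a) / 2))"
proof -
  have "complex_of_real ((2 * pi) powr (- (real DIM('a) / 2))) * (\<integral>x. gaussian t (x::'a) \<partial>lebesgue)
      = complex_of_real (t powr (- (real DIM('a) / 2)))"
    using fourier_gaussian[OF t, of "0::'a"] unfolding fourier_def by (simp add: gaussian_def)
  then have "complex_of_real ((2 * pi) powr (real DIM('a) / 2)) * (complex_of_real ((2 * pi) powr (- (real DIM('a) / 2))) * (\<integral>x. gaussian t (x::'a) \<partial>lebesgue))
      = complex_of_real ((2 * pi) powr (real DIM('a) / 2) * t powr (- (real DIM('a) / 2)))" by simp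
  moreover have "complex_of_real ((2 * pi) powr (real DIM('a) / 2)) * complex_of_real ((2 * pi) powr (- (real DIM('a) / 2))) = 1"
    by (simp add: powr_minus field_simps)
  moreover have "(2 * pi) powr (real DIM('a) / 2) * t powr (- (real DIM('a) / 2)) = (2 * pi / t) powr (real DIM('a) / 2)"
    using t by (simp add: powr_divide powr_minus field_simps)
  ultimately show ?thesis by (simp flip: mult.assoc)
qed

section \<open>Elementary rules for the Fourier integral\<close>

lemma norm_exp_inner [simp]: "cmod (exp (- (\<i> * complex_of_real r))) = 1" "cmod (exp (\<i> * complex_of_real r)) = 1"
  using norm_exp_i_times[of "-r"] by (auto simp: norm_exp_i_times)

lemma integrable_fourier:
  assumes f: "integrable lebesgue f"
  shows "integrable lebesgue (\<lambda>x. exp (- \<i> * complex_of_real (x \<bullet> \<xi>)) * f x)"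
proof (rule Bochner_Integration.integrable_bound[OF f])
  note [measurable] = borel_measurable_integrable[OF f]
  show "(\<lambda>x. exp (- \<i> * complex_of_real (x \<bullet> \<xi>)) * f x) \<in> borel_measurable lebesgue" by measurable
qed (simp add: norm_mult)

lemma exp_inner_add:
  "exp (- \<i> * complex_of_real ((x + y) \<bullet> \<xi>))
    = exp (- \<i> * complex_of_real (x \<bullet> \<xi>)) * exp (- \<i> * complex_of_real (y \<bullet> \<xi>))"
  by (simp add: inner_add_left distrib_left flip: exp_add)

lemma fourier_translate:
  assumes [measurable]: "f \<in> borel_measurable lebesgue"
  shows "fourier (\<lambda>x. f (x - y)) \<xi> = exp (- \<i> * complex_of_real (y \<bullet> \<xi>)) * fourier f \<xi>"
proof -
  have "(\<integral>x. exp (- \<i> * complex_of_real (x \<bullet> \<xi>)) * f (x - y) \<partial>lebesgue)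
      = (\<integral>x. exp (- \<i> * complex_of_real ((y + 1 *\<^sub>R x) \<bullet> \<xi>)) * f ((y + 1 *\<^sub>R x) - y) \<partial>lebesgue)"
  proof (rule lebesgue_integral_affine[symmetric])
    have [measurable]: "(\<lambda>x. f (x - y)) \<in> borel_measurable lebesgue"
      using lebesgue_measurable_affine[of 1 f "-y"] assms by simp
    show "(\<lambda>x. exp (- \<i> * complex_of_real (x \<bullet> \<xi>)) * f (x - y)) \<in> borel_measurable lebesgue" by measurable
  qed simp
  also have "\<dots> = (\<integral>x. exp (- \<i> * complex_of_real (y \<bullet> \<xi>)) * (exp (- \<i> * complex_of_real (x \<bullet> \<xi>)) * f x) \<partial>lebesgue)"
    by (simp only: scaleR_one exp_inner_add mult.assoc add_diff_cancel_left')
  finally show ?thesis unfolding fourier_def by simp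
qed

lemma fourier_modulate:
  "fourier (\<lambda>x. exp (\<i> * complex_of_real (x \<bullet> a)) * f x) \<xi> = fourier f (\<xi> - a)"
proof -
  have "exp (- \<i> * complex_of_real (x \<bullet> \<xi>)) * (exp (\<i> * complex_of_real (x \<bullet> a)) * f x)
     = exp (- \<i> * complex_of_real (x \<bullet> (\<xi> - a))) * f x" for x
    by (simp add: inner_diff_right right_diff_distrib exp_add[symmetric] mult.assoc[symmetric])
  then show ?thesis unfolding fourier_def by (simp only:)
qed

section \<open>Tempered and rapidly decreasing functions\<close>

definition polynomial_weight :: "nat \<Rightarrow> 'a::euclidean_space \<Rightarrow> complex" where
  "polynomial_weight N x = complex_of_real ((1 + norm x) ^ N)"

lemma polynomial_weight:
  fixes x :: "'a::euclidean_space"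
  shows "cmod (polynomial_weight N x) = (1 + norm x) ^ N" "0 < (1 + norm x) ^ N"
    "polynomial_weight N x \<noteq> 0" "polynomial_weight N \<in> borel_measurable (lebesgue :: 'a measure)"
proof -
  show p: "0 < (1 + norm x) ^ N" by (simp add: add_pos_nonneg)
  then show c: "cmod (polynomial_weight N x) = (1 + norm x) ^ N"
    unfolding polynomial_weight_def norm_of_real by simp
  show "polynomial_weight N x \<noteq> 0" using p c by (metis less_irrefl norm_zero)
  show "polynomial_weight N \<in> borel_measurable (lebesgue :: 'a measure)"
    unfolding polynomial_weight_def by measurable
qed

declare polynomial_weight(4) [measurable]

lemma tempered_iff: "f \<in> tempered \<longleftrightarrow> (\<exists>N. integrable lebesgue (\<lambda>x. f x / polynomial_weight N x))"
  unfolding tempered_def polynomial_weight_def by simp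

text \<open>The part of the Schwartz condition that makes products with tempered functions integrable. It
  is also the part of the condition that is established for Fourier transforms of Schwartz
  functions.\<close>

definition rapidly_decreasing :: "('a::euclidean_space \<Rightarrow> complex) \<Rightarrow> bool" where
  "rapidly_decreasing f \<longleftrightarrow> f \<in> borel_measurable lebesgue \<and>
     (\<forall>k. \<exists>C. \<forall>x. (1 + norm x) ^ k * cmod (f x) \<le> C)"

lemma rapidly_decreasingD: "rapidly_decreasing f \<Longrightarrow> f \<in> borel_measurable lebesgue"
  by (simp add: rapidly_decreasing_def)

lemma rapidly_decreasing_bound:
  fixes f :: "'a::euclidean_space \<Rightarrow> complex"
  assumes "rapidly_decreasing f"
  obtains C where "0 \<le> C" "\<And>x. cmod (f x) \<le> C / (1 + norm x) ^ k"
proof -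
  obtain C where C: "\<And>x. (1 + norm x) ^ k * cmod (f x) \<le> C"
    using assms unfolding rapidly_decreasing_def by blast
  have pos: "(1 + norm x) ^ k > 0" for x :: 'a by (simp add: add_pos_nonneg)
  have "0 \<le> (1 + norm (0::'a)) ^ k * cmod (f 0)" by simp
  then have "0 \<le> C" using C[of 0] by (rule order_trans)
  moreover have "cmod (f x) \<le> C / (1 + norm x) ^ k" for x
    using C[of x] pos[of x] by (simp add: pos_le_divide_eq mult.commute)
  ultimately show thesis using that by blast
qed

lemma tempered_measurable:
  fixes f :: "'a::euclidean_space \<Rightarrow> complex"
  assumes "f \<in> tempered" shows "f \<in> borel_measurable lebesgue"
proof -
  obtain N where N: "integrable lebesgue (\<lambda>x. f x / polynomial_weight N x)"
    using assms unfolding tempered_iff by blast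
  have "(\<lambda>x. (f x / polynomial_weight N x) * polynomial_weight N x) \<in> borel_measurable lebesgue"
    by (intro borel_measurable_times borel_measurable_integrable[OF N]) measurable
  then show ?thesis by (simp add: polynomial_weight(3))
qed

lemma tempered_times_rapidly_decreasing:
  fixes f :: "'a::euclidean_space \<Rightarrow> complex"
  assumes f: "f \<in> tempered" and \<phi>: "rapidly_decreasing \<phi>"
  shows "integrable lebesgue (\<lambda>x. f x * \<phi> x)"
proof -
  obtain N where N: "integrable lebesgue (\<lambda>x. f x / polynomial_weight N x)"
    using f unfolding tempered_iff by blast
  obtain C where C: "\<And>x. (1 + norm x) ^ N * cmod (\<phi> x) \<le> C"
    using \<phi> unfolding rapidly_decreasing_def by blast
  note [measurable] = tempered_measurable[OF f] rapidly_decreasingD[OF \<phi>]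
  show ?thesis
  proof (rule Bochner_Integration.integrable_bound)
    show "integrable lebesgue (\<lambda>x. complex_of_real C * (f x / polynomial_weight N x))"
      by (intro integrable_mult_right N)
    have "norm (f x * \<phi> x) \<le> norm (complex_of_real C * (f x / polynomial_weight N x))" for x
    proof -
      have p: "(1 + norm x) ^ N > 0" by (rule polynomial_weight(2))
      have "cmod (\<phi> x) \<le> \<bar>C\<bar> / (1 + norm x) ^ N"
        using C[of x] p by (simp add: pos_le_divide_eq mult.commute)
      then have "cmod (f x) * cmod (\<phi> x) \<le> cmod (f x) * (\<bar>C\<bar> / (1 + norm x) ^ N)"
        by (intro mult_left_mono) auto
      then show ?thesis using p by (simp add: norm_mult norm_divide polynomial_weight(1) mult.commute)
    qed
    then show "AE x in lebesgue. norm (f x * \<phi> x) \<le> norm (complex_of_real C * (f x / polynomial_weight N x))"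
      by simp
  qed measurable
qed

lemma tempered_mono:
  fixes f :: "'a::euclidean_space \<Rightarrow> complex"
  assumes "integrable lebesgue (\<lambda>x. f x / polynomial_weight N x)" "N \<le> M"
  shows "integrable lebesgue (\<lambda>x. f x / polynomial_weight M x)"
proof -
  have [measurable]: "f \<in> borel_measurable lebesgue"
    using assms(1) by (intro tempered_measurable) (auto simp: tempered_iff)
  show ?thesis
  proof (rule Bochner_Integration.integrable_bound[OF assms(1)])
    have "norm (f x / polynomial_weight M x) \<le> norm (f x / polynomial_weight N x)" for x
    proof -
      have "(1 + norm x) ^ N \<le> (1 + norm x) ^ M" using assms(2) by (intro power_increasing) auto
      then have "cmod (f x) / (1 + norm x) ^ M \<le> cmod (f x) / (1 + norm x) ^ N"
        by (intro divide_left_mono mult_pos_pos polynomial_weight(2)) auto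
      then show ?thesis by (simp add: norm_divide polynomial_weight(1))
    qed
    then show "AE x in lebesgue. norm (f x / polynomial_weight M x) \<le> norm (f x / polynomial_weight N x)"
      by simp
  qed measurable
qed

lemma tempered_add:
  fixes f g :: "'a::euclidean_space \<Rightarrow> complex"
  assumes "f \<in> tempered" "g \<in> tempered" shows "(\<lambda>x. f x + g x) \<in> tempered"
proof -
  obtain N M where "integrable lebesgue (\<lambda>x. f x / polynomial_weight N x)"
     "integrable lebesgue (\<lambda>x. g x / polynomial_weight M x)"
    using assms unfolding tempered_iff by blast
  then have "integrable lebesgue (\<lambda>x. f x / polynomial_weight (max N M) x)"
     "integrable lebesgue (\<lambda>x. g x / polynomial_weight (max N M) x)"
    using tempered_mono[of f N "max N M"] tempered_mono[of g M "max N M"] by simp_all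
  then have "integrable lebesgue (\<lambda>x. f x / polynomial_weight (max N M) x + g x / polynomial_weight (max N M) x)"
    by (rule Bochner_Integration.integrable_add)
  then show ?thesis unfolding tempered_iff add_divide_distrib by blast
qed

lemma tempered_bounded_mult:
  assumes f: "f \<in> tempered" and [measurable]: "m \<in> borel_measurable lebesgue" and C: "\<And>x. cmod (m x) \<le> C"
  shows "(\<lambda>x. m x * f x) \<in> tempered"
proof -
  obtain N where N: "integrable lebesgue (\<lambda>x. f x / polynomial_weight N x)"
    using f unfolding tempered_iff by blast
  note [measurable] = tempered_measurable[OF f]
  have "integrable lebesgue (\<lambda>x. m x * (f x / polynomial_weight N x))"
  proof (rule Bochner_Integration.integrable_bound)
    show "integrable lebesgue (\<lambda>x. complex_of_real C * (f x / polynomial_weight N x))"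
      by (intro integrable_mult_right N)
    have "cmod (m x) \<le> \<bar>C\<bar>" for x using C[of x] by linarith
    then show "AE x in lebesgue. norm (m x * (f x / polynomial_weight N x))
      \<le> norm (complex_of_real C * (f x / polynomial_weight N x))"
      by (simp only: norm_mult norm_of_real) (simp add: mult_right_mono)
  qed measurable
  then show ?thesis unfolding tempered_iff by auto
qed

lemma integrable_tempered: "integrable lebesgue f \<Longrightarrow> f \<in> tempered"
  unfolding tempered_iff by (auto intro!: exI[of _ 0] simp: polynomial_weight_def)

lemma rapidly_decreasing_square_integrable:
  fixes f :: "'a::euclidean_space \<Rightarrow> complex"
  assumes "rapidly_decreasing f"
  shows "square_integrable f" "integrable lebesgue f"
proof -
  note [measurable] = rapidly_decreasingD[OF assms]
  obtain C where C0: "0 \<le> C" and C: "\<And>x. cmod (f x) \<le> C / (1 + norm x) ^ (2 * DIM('a))"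
    using assms by (rule rapidly_decreasing_bound) blast
  show "integrable lebesgue f"
  proof (rule Bochner_Integration.integrable_bound)
    show "integrable lebesgue (\<lambda>x::'a. C * (1 / (1 + norm x) ^ (2 * DIM('a))))"
      by (intro integrable_mult_right integrable_inverse_one_plus_norm)
    show "AE x in lebesgue. norm (f x) \<le> norm (C * (1 / (1 + norm x) ^ (2 * DIM('a))))"
      using C C0 by simp
  qed measurable
  obtain K where K: "\<And>x. cmod (f x) \<le> K / (1 + norm x) ^ 0"
    using assms by (rule rapidly_decreasing_bound) blast
  have "integrable lebesgue (\<lambda>x. (cmod (f x))\<^sup>2)"
  proof (rule Bochner_Integration.integrable_bound)
    show "integrable lebesgue (\<lambda>x. K * cmod (f x))"
      using \<open>integrable lebesgue f\<close> by (intro integrable_mult_right integrable_norm)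
    have "(cmod (f x))\<^sup>2 \<le> K * cmod (f x)" for x
      using K[of x] by (simp add: power2_eq_square mult_right_mono)
    then show "AE x in lebesgue. norm ((cmod (f x))\<^sup>2) \<le> norm (K * cmod (f x))"
      by (auto intro!: order_trans[OF _ abs_ge_self])
  qed measurable
  then show "square_integrable f" by (simp add: square_integrable_def rapidly_decreasingD[OF assms])
qed

lemma square_integrable_tempered:
  fixes f :: "'a::euclidean_space \<Rightarrow> complex"
  assumes f: "square_integrable f" shows "f \<in> tempered"
proof -
  note [measurable] = square_integrableD[OF f]
  define w where "w x = complex_of_real (1 / (1 + norm x) ^ DIM('a))" for x :: 'a
  have [measurable]: "w \<in> borel_measurable lebesgue" unfolding w_def by measurable
  have "(cmod (w x))\<^sup>2 = 1 / (1 + norm x) ^ (2 * DIM('a))" for x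
    unfolding w_def norm_of_real by (simp add: power_divide power_mult[symmetric] mult.commute)
  then have "square_integrable w"
    unfolding square_integrable_def using integrable_inverse_one_plus_norm[where 'a='a] by simp
  from square_integrable_mult_integrable[OF f this]
  have "integrable lebesgue (\<lambda>x. f x / polynomial_weight DIM('a) x)"
    by (simp add: w_def polynomial_weight_def)
  then show ?thesis unfolding tempered_iff by blast
qed

section \<open>Schwartz functions\<close>

lemma schwartz_differentiable: "\<phi> \<in> schwartz \<Longrightarrow> iter_deriv us \<phi> differentiable (at x)"
  unfolding schwartz_def by blast

lemma schwartz_rapidly_decreasing_iter:
  assumes \<phi>: "\<phi> \<in> schwartz" shows "rapidly_decreasing (iter_deriv us \<phi>)"
  unfolding rapidly_decreasing_def
proof (intro conjI allI)
  have "continuous_on UNIV (iter_deriv us \<phi>)"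
    using schwartz_differentiable[OF \<phi>, of us] by (intro continuous_at_imp_continuous_on ballI differentiable_imp_continuous_within)
  then have "iter_deriv us \<phi> \<in> borel_measurable borel" by (rule borel_measurable_continuous_onI)
  then show "iter_deriv us \<phi> \<in> borel_measurable lebesgue" by (intro measurable_completion) simp
  fix k
  have "bounded (range (\<lambda>x. (1 + norm x) ^ k *\<^sub>R iter_deriv us \<phi> x))"
    using \<phi> unfolding schwartz_def by blast
  then obtain C where "\<And>x. norm ((1 + norm x) ^ k *\<^sub>R iter_deriv us \<phi> x) \<le> C"
    unfolding bounded_iff by blast
  moreover have "norm ((1 + norm x) ^ k *\<^sub>R iter_deriv us \<phi> x) = (1 + norm x) ^ k * cmod (iter_deriv us \<phi> x)" for x
    by (simp add: add_nonneg_nonneg)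
  ultimately show "\<exists>C. \<forall>x. (1 + norm x) ^ k * cmod (iter_deriv us \<phi> x) \<le> C" by auto
qed

lemma schwartz_rapidly_decreasing: "\<phi> \<in> schwartz \<Longrightarrow> rapidly_decreasing \<phi>"
  using schwartz_rapidly_decreasing_iter[of \<phi> "[]"] by simp

lemma schwartzI:
  assumes "\<And>us x. iter_deriv us \<phi> differentiable (at x)" "\<And>us k. \<exists>C. \<forall>x. (1 + norm x) ^ k * cmod (iter_deriv us \<phi> x) \<le> C"
  shows "\<phi> \<in> schwartz"
  unfolding schwartz_def
proof (intro CollectI allI conjI)
  fix us k
  obtain C where "\<And>x. (1 + norm x) ^ k * cmod (iter_deriv us \<phi> x) \<le> C" using assms(2) by blast
  then show "bounded (range (\<lambda>x. (1 + norm x) ^ k *\<^sub>R iter_deriv us \<phi> x))"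
    unfolding bounded_iff by (auto intro!: exI[of _ C] simp: abs_mult power_abs)
qed (rule assms(1))

lemma schwartz_translate:
  assumes \<phi>: "\<phi> \<in> schwartz" shows "(\<lambda>x. \<phi> (x - y)) \<in> schwartz"
proof -
  have shift: "((\<lambda>x. f (x - y)) has_derivative f') (at x)" if "(f has_derivative f') (at (x - y))" for f :: "'a \<Rightarrow> complex" and f' x
  proof -
    have "((\<lambda>x. x - y) has_derivative (\<lambda>h. h)) (at x)" by (auto intro!: derivative_eq_intros)
    from has_derivative_compose[OF this that] show ?thesis .
  qed
  have eq: "iter_deriv us (\<lambda>x. \<phi> (x - y)) = (\<lambda>x. iter_deriv us \<phi> (x - y))" for us
  proof (induction us)
    case (Cons u us)
    have "frechet_derivative (\<lambda>x. iter_deriv us \<phi> (x - y)) (at x) = frechet_derivative (iter_deriv us \<phi>) (at (x - y))" for x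
      by (rule frechet_derivative_at[symmetric], rule shift)
         (use schwartz_differentiable[OF \<phi>] in \<open>simp add: frechet_derivative_works[symmetric]\<close>)
    then show ?case using Cons by simp
  qed simp
  show ?thesis
  proof (rule schwartzI)
    fix us x
    show "iter_deriv us (\<lambda>x. \<phi> (x - y)) differentiable (at x)"
      unfolding eq using shift schwartz_differentiable[OF \<phi>, of us "x - y"] unfolding differentiable_def by blast
  next
    fix us k
    obtain C where C0: "0 \<le> C" and C: "\<And>x. cmod (iter_deriv us \<phi> x) \<le> C / (1 + norm x) ^ k"
      using schwartz_rapidly_decreasing_iter[OF \<phi>] by (rule rapidly_decreasing_bound) blast
    have "(1 + norm x) ^ k * cmod (iter_deriv us \<phi> (x - y)) \<le> C * (1 + norm y) ^ k" for x
    proof -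
      have p: "0 < 1 + norm (x - y)" by (simp add: add_pos_nonneg)
      have "1 + norm x \<le> (1 + norm (x - y)) * (1 + norm y)"
        using norm_triangle_sub[of x y] mult_nonneg_nonneg[OF norm_ge_zero[of "x - y"] norm_ge_zero[of y]]
        unfolding distrib_left distrib_right mult_1 mult_1_right by linarith
      then have "(1 + norm x) ^ k \<le> ((1 + norm (x - y)) * (1 + norm y)) ^ k" by (intro power_mono) auto
      then have "(1 + norm x) ^ k * cmod (iter_deriv us \<phi> (x - y))
          \<le> ((1 + norm (x - y)) * (1 + norm y)) ^ k * (C / (1 + norm (x - y)) ^ k)"
        using C[of "x - y"] by (intro mult_mono) auto
      then show ?thesis using p by (simp add: power_mult_distrib mult.commute)
    qed
    then show "\<exists>C. \<forall>x. (1 + norm x) ^ k * cmod (iter_deriv us (\<lambda>x. \<phi> (x - y)) x) \<le> C" unfolding eq by blast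
  qed
qed

lemma has_derivative_character:
  "((\<lambda>x. exp (\<i> * complex_of_real (x \<bullet> a))) has_derivative
    (\<lambda>h. \<i> * complex_of_real (h \<bullet> a) * exp (\<i> * complex_of_real (x \<bullet> a)))) (at x)"
proof -
  have "((\<lambda>x. \<i> * complex_of_real (x \<bullet> a)) has_derivative (\<lambda>h. \<i> * complex_of_real (h \<bullet> a))) (at x)"
    by (auto intro!: derivative_eq_intros)
  from has_derivative_compose[OF this DERIV_exp[unfolded has_field_derivative_def]]
  show ?thesis by (simp only: mult.commute)
qed

text \<open>By the product rule all derivatives of a modulated Schwartz function are the character times a
  linear combination of derivatives of the function.\<close>

lemma schwartz_modulate:
  assumes \<phi>: "\<phi> \<in> schwartz" shows "(\<lambda>x. exp (\<i> * complex_of_real (x \<bullet> a)) * \<phi> x) \<in> schwartz"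
proof -
  define e where "e x = exp (\<i> * complex_of_real (x \<bullet> a))" for x
  have e: "(e has_derivative (\<lambda>h. \<i> * complex_of_real (h \<bullet> a) * e x)) (at x)" for x
    unfolding e_def by (rule has_derivative_character)
  (* A list of coefficients and directions stands for a linear combination of derivatives. *)
  define S where "S L x = (\<Sum>(c, vs)\<leftarrow>L. c * iter_deriv vs \<phi> x)" for L :: "(complex \<times> 'a list) list" and x
  have S_simps: "S [] x = 0" "S ((c, vs) # L) x = c * iter_deriv vs \<phi> x + S L x" for c vs L x
    by (simp_all add: S_def)
  have d: "(iter_deriv vs \<phi> has_derivative (\<lambda>h. iter_deriv (h # vs) \<phi> x)) (at x)" for vs x
    using schwartz_differentiable[OF \<phi>, of vs x] by (simp add: frechet_derivative_works[symmetric])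
  define S' where "S' h L x = S (map (\<lambda>(c, vs). (c, h # vs)) L) x" for h L x
  have dS: "(S L has_derivative (\<lambda>h. S' h L x)) (at x)" for L x
  proof (induction L)
    case Nil
    have "S [] = (\<lambda>x. 0)" by (simp add: fun_eq_iff S_simps)
    then show ?case by (simp add: S'_def)
  next
    case (Cons p L)
    obtain c vs where p: "p = (c, vs)" by force
    have "((\<lambda>x. c * iter_deriv vs \<phi> x + S L x) has_derivative (\<lambda>h. c * iter_deriv (h # vs) \<phi> x + S' h L x)) (at x)"
      by (intro has_derivative_add has_derivative_mult_right d Cons)
    moreover have "S (p # L) = (\<lambda>x. c * iter_deriv vs \<phi> x + S L x)" by (simp add: fun_eq_iff p S_simps)
    moreover have "S' h (p # L) x = c * iter_deriv (h # vs) \<phi> x + S' h L x" for h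
      by (simp add: p S'_def S_simps del: iter_deriv.simps)
    ultimately show ?case by (simp only:)
  qed
  have deS: "((\<lambda>x. e x * S L x) has_derivative (\<lambda>h. e x * (S' h L x + \<i> * complex_of_real (h \<bullet> a) * S L x))) (at x)" for L x
    by (rule has_derivative_eq_rhs[OF has_derivative_mult[OF e dS]]) (simp add: fun_eq_iff algebra_simps)
  have scale: "c * S L x = S (map (\<lambda>(b, vs). (c * b, vs)) L) x" for c L x
    by (induction L) (auto simp: S_simps algebra_simps)
  have append: "S L x + S K x = S (L @ K) x" for L K x
    by (induction L) (auto simp: S_simps algebra_simps)
  have rep: "\<exists>L. iter_deriv us (\<lambda>x. e x * \<phi> x) = (\<lambda>x. e x * S L x)" for us
  proof (induction us)
    case Nil
    show ?case by (intro exI[of _ "[(1, [])]"]) (simp add: S_simps)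
  next
    case (Cons u us)
    then obtain L where L: "iter_deriv us (\<lambda>x. e x * \<phi> x) = (\<lambda>x. e x * S L x)" by blast
    have "iter_deriv (u # us) (\<lambda>x. e x * \<phi> x) x = e x * (S' u L x + \<i> * complex_of_real (u \<bullet> a) * S L x)" for x
      unfolding iter_deriv.simps L
      using fun_cong[OF frechet_derivative_at[OF deS[where L = L]]] by (rule sym)
    then have "iter_deriv (u # us) (\<lambda>x. e x * \<phi> x)
        = (\<lambda>x. e x * (S' u L x + \<i> * complex_of_real (u \<bullet> a) * S L x))" by (rule ext)
    then show ?case unfolding S'_def scale append by blast
  qed
  have growth: "\<exists>C. \<forall>x. (1 + norm x) ^ k * cmod (S L x) \<le> C" for L k
  proof (induction L)
    case Nil then show ?case by (auto simp: S_simps)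
  next
    case (Cons p L)
    obtain c vs where p: "p = (c, vs)" by force
    obtain C where C: "\<And>x. (1 + norm x) ^ k * cmod (S L x) \<le> C" using Cons by blast
    obtain D where D: "\<And>x. (1 + norm x) ^ k * cmod (iter_deriv vs \<phi> x) \<le> D"
      using schwartz_rapidly_decreasing_iter[OF \<phi>, of vs] unfolding rapidly_decreasing_def by blast
    have "(1 + norm x) ^ k * cmod (S (p # L) x) \<le> cmod c * D + C" for x
    proof -
      have "(1 + norm x) ^ k * cmod (S (p # L) x)
          \<le> (1 + norm x) ^ k * (cmod c * cmod (iter_deriv vs \<phi> x) + cmod (S L x))"
        unfolding p S_simps by (intro mult_left_mono order_trans[OF norm_triangle_ineq]) (auto simp: norm_mult)
      also have "\<dots> = cmod c * ((1 + norm x) ^ k * cmod (iter_deriv vs \<phi> x)) + (1 + norm x) ^ k * cmod (S L x)"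
        by (simp add: algebra_simps)
      also have "\<dots> \<le> cmod c * D + C" by (intro add_mono mult_left_mono C D) auto
      finally show ?thesis .
    qed
    then show ?case by blast
  qed
  have "(\<lambda>x. e x * \<phi> x) \<in> schwartz"
  proof (rule schwartzI)
    fix us x
    obtain L where "iter_deriv us (\<lambda>x. e x * \<phi> x) = (\<lambda>x. e x * S L x)" using rep by blast
    then show "iter_deriv us (\<lambda>x. e x * \<phi> x) differentiable (at x)"
      using deS[of L x] unfolding differentiable_def by auto
  next
    fix us k
    obtain L where L: "iter_deriv us (\<lambda>x. e x * \<phi> x) = (\<lambda>x. e x * S L x)" using rep by blast
    show "\<exists>C. \<forall>x. (1 + norm x) ^ k * cmod (iter_deriv us (\<lambda>x. e x * \<phi> x) x) \<le> C"
      unfolding L using growth[of k L] by (simp add: e_def norm_mult)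
  qed
  then show ?thesis by (simp add: e_def)
qed

text \<open>Polynomial functions on a Euclidean space; derivatives of a Gaussian are such functions times
  the Gaussian.\<close>

inductive polyfun :: "('a::euclidean_space \<Rightarrow> complex) \<Rightarrow> bool" where
  const: "polyfun (\<lambda>x. c)"
| inner: "polyfun (\<lambda>x. complex_of_real (x \<bullet> u))"
| add: "polyfun p \<Longrightarrow> polyfun q \<Longrightarrow> polyfun (\<lambda>x. p x + q x)"
| mult: "polyfun p \<Longrightarrow> polyfun q \<Longrightarrow> polyfun (\<lambda>x. p x * q x)"

lemma polyfun_derivative:
  "polyfun p \<Longrightarrow> \<exists>p'. (\<forall>x. (p has_derivative (\<lambda>h. p' h x)) (at x)) \<and> (\<forall>h. polyfun (p' h))"
proof (induction rule: polyfun.induct)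
  case (const c) show ?case by (intro exI[of _ "\<lambda>h x. 0"]) (auto intro: polyfun.const)
next
  case (inner u)
  have "((\<lambda>x. complex_of_real (x \<bullet> u)) has_derivative (\<lambda>h. complex_of_real (h \<bullet> u))) (at x)" for x :: 'a
    by (auto intro!: derivative_eq_intros)
  then show ?case by (intro exI[of _ "\<lambda>h x. complex_of_real (h \<bullet> u)"]) (auto intro: polyfun.const)
next
  case (add p q)
  then obtain p' q' where "\<forall>x. (p has_derivative (\<lambda>h. p' h x)) (at x)" "\<forall>h. polyfun (p' h)"
    "\<forall>x. (q has_derivative (\<lambda>h. q' h x)) (at x)" "\<forall>h. polyfun (q' h)" by blast
  then show ?case by (intro exI[of _ "\<lambda>h x. p' h x + q' h x"]) (auto intro: polyfun.add has_derivative_add)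
next
  case (mult p q)
  then obtain p' q' where "\<forall>x. (p has_derivative (\<lambda>h. p' h x)) (at x)" "\<forall>h. polyfun (p' h)"
    "\<forall>x. (q has_derivative (\<lambda>h. q' h x)) (at x)" "\<forall>h. polyfun (q' h)" by blast
  then show ?case using mult.hyps
    by (intro exI[of _ "\<lambda>h x. p x * q' h x + p' h x * q x"]) (auto intro!: polyfun.add polyfun.mult has_derivative_mult)
qed

lemma polyfun_growth: "polyfun p \<Longrightarrow> \<exists>C k. 0 \<le> C \<and> (\<forall>x. cmod (p x) \<le> C * (1 + norm x) ^ k)"
proof (induction rule: polyfun.induct)
  case (const c) show ?case by (intro exI[of _ "cmod c"] exI[of _ 0]) auto
next
  case (inner u)
  have "\<bar>x \<bullet> u\<bar> \<le> norm u * (1 + norm x) ^ 1" for x :: 'a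
    using Cauchy_Schwarz_ineq2[of x u] by (simp add: distrib_left mult.commute add_increasing)
  then show ?case by (intro exI[of _ "norm u"] exI[of _ 1]) auto
next
  case (add p q)
  then obtain C k D l where C: "0 \<le> C" "\<And>x. cmod (p x) \<le> C * (1 + norm x) ^ k"
    and D: "0 \<le> D" "\<And>x. cmod (q x) \<le> D * (1 + norm x) ^ l" by blast
  have "cmod (p x + q x) \<le> (C + D) * (1 + norm x) ^ (k + l)" for x
  proof -
    have "C * (1 + norm x) ^ k \<le> C * (1 + norm x) ^ (k + l)" "D * (1 + norm x) ^ l \<le> D * (1 + norm x) ^ (k + l)"
      using C(1) D(1) by (auto intro!: mult_left_mono power_increasing)
    then show ?thesis using norm_triangle_ineq[of "p x" "q x"] C(2)[of x] D(2)[of x] by (simp add: algebra_simps)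
  qed
  then show ?case using C(1) D(1) by (intro exI[of _ "C + D"] exI[of _ "k + l"]) auto
next
  case (mult p q)
  then obtain C k D l where C: "0 \<le> C" "\<And>x. cmod (p x) \<le> C * (1 + norm x) ^ k"
    and D: "0 \<le> D" "\<And>x. cmod (q x) \<le> D * (1 + norm x) ^ l" by blast
  have "cmod (p x * q x) \<le> (C * D) * (1 + norm x) ^ (k + l)" for x
  proof -
    have "cmod (p x * q x) \<le> (C * (1 + norm x) ^ k) * (D * (1 + norm x) ^ l)"
      unfolding norm_mult using C D by (intro mult_mono) auto
    then show ?thesis by (simp add: power_add mult_ac)
  qed
  then show ?case using C(1) D(1) by (intro exI[of _ "C * D"] exI[of _ "k + l"]) auto
qed

lemma has_derivative_gaussian:
  "(gaussian t has_derivative (\<lambda>h. complex_of_real (- t) * complex_of_real (x \<bullet> h) * gaussian t x)) (at x)"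
proof -
  have "((\<lambda>x. exp (- (t / 2) * (x \<bullet> x))) has_derivative (\<lambda>h. - t * (x \<bullet> h) * exp (- (t / 2) * (x \<bullet> x)))) (at x)"
    by (auto intro!: derivative_eq_intros simp: fun_eq_iff inner_commute algebra_simps)
  from has_derivative_of_real[OF this]
  show ?thesis unfolding gaussian_def[abs_def] power2_norm_eq_inner by simp
qed

text \<open>The derivatives are polynomials times the Gaussian, and \<open>1 + norm x \<le> exp (norm x)\<close> bounds the
  polynomial growth by an exponential, which loses against the Gaussian after completing the
  square.\<close>

lemma gaussian_schwartz:
  assumes t: "t > 0" shows "gaussian t \<in> schwartz"
proof -
  have rep: "\<exists>p. polyfun p \<and> iter_deriv us (gaussian t) = (\<lambda>x. p x * gaussian t x)" for us :: "'a list"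
  proof (induction us)
    case Nil show ?case by (intro exI[of _ "\<lambda>x. 1"]) (auto intro: polyfun.const)
  next
    case (Cons u us)
    then obtain p where p: "polyfun p" "iter_deriv us (gaussian t) = (\<lambda>x. p x * gaussian t x)" by blast
    obtain p' where p': "\<And>x. (p has_derivative (\<lambda>h. p' h x)) (at x)" "\<And>h. polyfun (p' h)"
      using polyfun_derivative[OF p(1)] by blast
    have "iter_deriv (u # us) (gaussian t) x = (p' u x + p x * (complex_of_real (- t) * complex_of_real (x \<bullet> u))) * gaussian t x" for x
      unfolding iter_deriv.simps p(2)
        fun_cong[OF frechet_derivative_at[OF has_derivative_mult[OF p'(1) has_derivative_gaussian[of t x]]], symmetric]
      by (simp add: algebra_simps)
    moreover have "polyfun (\<lambda>x. p' u x + p x * (complex_of_real (- t) * complex_of_real (x \<bullet> u)))"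
      by (intro polyfun.intros p p')
    ultimately show ?case by blast
  qed
  show ?thesis
  proof (rule schwartzI)
    fix us :: "'a list" and x :: 'a
    obtain p where p: "polyfun p" "iter_deriv us (gaussian t) = (\<lambda>x. p x * gaussian t x)" using rep by blast
    obtain p' where p': "\<And>x. (p has_derivative (\<lambda>h. p' h x)) (at x)"
      using polyfun_derivative[OF p(1)] by blast
    show "iter_deriv us (gaussian t) differentiable (at x)"
      unfolding p(2) using has_derivative_mult[OF p' has_derivative_gaussian] unfolding differentiable_def by blast
  next
    fix us :: "'a list" and k
    obtain p where p: "polyfun p" "iter_deriv us (gaussian t) = (\<lambda>x. p x * gaussian t x)" using rep by blast
    obtain C l where C: "0 \<le> C" "\<And>x. cmod (p x) \<le> C * (1 + norm x) ^ l" using polyfun_growth[OF p(1)] by blast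
    define m where "m = k + l"
    have "(1 + norm x) ^ k * cmod (p x * gaussian t x) \<le> C * exp ((real m)\<^sup>2 / (2 * t))" for x
    proof -
      have "(1 + norm x) ^ k * cmod (p x * gaussian t x) \<le> (1 + norm x) ^ k * (C * (1 + norm x) ^ l * exp (- (t / 2) * (norm x)\<^sup>2))"
        unfolding norm_mult gaussian_def norm_of_real using C by (intro mult_left_mono mult_mono) auto
      also have "\<dots> = C * ((1 + norm x) ^ m * exp (- (t / 2) * (norm x)\<^sup>2))" by (simp add: m_def power_add)
      also have "(1 + norm x) ^ m \<le> exp (norm x) ^ m" by (intro power_mono exp_ge_add_one_self) auto
      also have "exp (norm x) ^ m = exp (real m * norm x)" by (simp add: exp_of_nat_mult)
      also have "exp (real m * norm x) * exp (- (t / 2) * (norm x)\<^sup>2) = exp (real m * norm x - (t / 2) * (norm x)\<^sup>2)"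
        by (simp flip: exp_add)
      also have "real m * norm x - (t / 2) * (norm x)\<^sup>2 \<le> (real m)\<^sup>2 / (2 * t)"
      proof -
        have "0 \<le> (real m - t * norm x)\<^sup>2 / (2 * t)" using t by simp
        also have "\<dots> = (real m)\<^sup>2 / (2 * t) - (real m * norm x - (t / 2) * (norm x)\<^sup>2)"
          using t by (simp add: power2_eq_square field_simps)
        finally show ?thesis by simp
      qed
      finally show ?thesis using C(1) by (simp add: mult_left_mono)
    qed
    then show "\<exists>C. \<forall>x. (1 + norm x) ^ k * cmod (iter_deriv us (gaussian t) x) \<le> C" unfolding p(2) by blast
  qed
qed

section \<open>Gaussian integrals determine a tempered function\<close>

text \<open>The positive and the negative part of \<open>g\<close> are the densities of two finite measures that agree
  on boxes, hence on all Borel sets, in particular on \<open>{x. 0 < g x}\<close>.\<close>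

lemma AE_nonpos_of_box_integrals:
  fixes g :: "'a::euclidean_space \<Rightarrow> real"
  assumes g: "integrable lborel g"
    and box: "\<And>a b. (\<integral>x. g x * indicator (box a b) x \<partial>lborel) = 0"
  shows "AE x in lborel. g x \<le> 0"
proof -
  have [measurable]: "g \<in> borel_measurable borel" using borel_measurable_integrable[OF g] by simp
  define M where "M = density lborel (\<lambda>x. ennreal (g x))"
  define N where "N = density lborel (\<lambda>x. ennreal (- g x))"
  have fin: "(\<integral>\<^sup>+x. ennreal (g x) * indicator A x \<partial>lborel) < \<infinity>" "(\<integral>\<^sup>+x. ennreal (- g x) * indicator A x \<partial>lborel) < \<infinity>"
    if "A \<in> sets borel" for A
  proof -
    have "(\<integral>\<^sup>+x. ennreal (norm (g x)) \<partial>lborel) < \<infinity>" using g unfolding integrable_iff_bounded by blast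
    moreover have "(\<integral>\<^sup>+x. ennreal (g x) * indicator A x \<partial>lborel) \<le> (\<integral>\<^sup>+x. ennreal (norm (g x)) \<partial>lborel)"
      by (intro nn_integral_mono) (auto simp: indicator_def intro!: ennreal_leI)
    moreover have "(\<integral>\<^sup>+x. ennreal (- g x) * indicator A x \<partial>lborel) \<le> (\<integral>\<^sup>+x. ennreal (norm (g x)) \<partial>lborel)"
      by (intro nn_integral_mono) (auto simp: indicator_def intro!: ennreal_leI)
    ultimately show "(\<integral>\<^sup>+x. ennreal (g x) * indicator A x \<partial>lborel) < \<infinity>" "(\<integral>\<^sup>+x. ennreal (- g x) * indicator A x \<partial>lborel) < \<infinity>"
      by (auto intro: le_less_trans)
  qed
  let ?E = "range (\<lambda>(a, b). box a b :: 'a set)"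
  let ?A = "\<lambda>n::nat. box (- (real n *\<^sub>R One)) (real n *\<^sub>R One) :: 'a set"
  have "M = N"
  proof (rule measure_eqI_generator_eq[of ?E UNIV M N ?A])
    show "Int_stable ?E" by (auto simp: Int_stable_def box_Int_box)
    show "?E \<subseteq> Pow UNIV" by auto
    show "sets M = sigma_sets UNIV ?E" "sets N = sigma_sets UNIV ?E"
      unfolding M_def N_def by (simp_all add: borel_eq_box)
    show "range ?A \<subseteq> ?E" by auto
    show "(\<Union>i. ?A i) = UNIV" unfolding UN_box_eq_UNIV by auto
    fix i show "emeasure M (?A i) \<noteq> \<infinity>"
      using fin(1)[of "?A i"] unfolding M_def by (simp add: emeasure_density less_top)
  next
    fix X assume "X \<in> ?E"
    then obtain a b where X: "X = box a b" by auto
    have i: "integrable lborel (\<lambda>x. g x * indicator X x)"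
      unfolding X by (rule integrable_mult_indicator[OF _ g, unfolded real_scaleR_def, of "box a b", simplified mult.commute]) simp
    have eqs: "(\<integral>\<^sup>+x. ennreal (g x * indicator X x) \<partial>lborel) = emeasure M X"
       "(\<integral>\<^sup>+x. ennreal (- (g x * indicator X x)) \<partial>lborel) = emeasure N X"
      unfolding M_def N_def X
      by (auto simp: emeasure_density indicator_def intro!: nn_integral_cong)
    have "enn2real (emeasure M X) = enn2real (emeasure N X)"
      using real_lebesgue_integral_def[OF i] box[of a b, folded X] unfolding eqs by simp
    moreover have "emeasure M X < \<infinity>" "emeasure N X < \<infinity>"
      using fin[of X] unfolding M_def N_def X by (simp_all add: emeasure_density)
    ultimately show "emeasure M X = emeasure N X"
      by (metis ennreal_enn2real infinity_ennreal_def)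
  qed
  then have "emeasure M {x. 0 < g x} = emeasure N {x. 0 < g x}" by simp
  also have "\<dots> = (\<integral>\<^sup>+x. ennreal (- g x) * indicator {x. 0 < g x} x \<partial>lborel)"
    unfolding N_def by (subst emeasure_density) auto
  also have "\<dots> = (\<integral>\<^sup>+x. 0 \<partial>(lborel :: 'a measure))"
    by (intro nn_integral_cong) (auto simp: indicator_def ennreal_neg)
  finally have "(\<integral>\<^sup>+x. ennreal (g x) * indicator {x. 0 < g x} x \<partial>lborel) = 0"
    unfolding M_def by (subst (asm) emeasure_density) auto
  then have "AE x in lborel. ennreal (g x) * indicator {x. 0 < g x} x = 0"
    by (subst (asm) nn_integral_0_iff_AE) auto
  then show ?thesis
    by eventually_elim (auto simp: indicator_def ennreal_eq_0_iff split: if_splits)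
qed

lemma AE_zero_of_box_integrals:
  fixes f :: "'a::euclidean_space \<Rightarrow> real"
  assumes f: "integrable lebesgue f"
    and box: "\<And>a b. (\<integral>x. f x * indicator (box a b) x \<partial>lebesgue) = 0"
  shows "AE x in lebesgue. f x = 0"
proof -
  have [measurable]: "f \<in> borel_measurable lebesgue" using borel_measurable_integrable[OF f] .
  obtain g where g [measurable]: "g \<in> borel_measurable lborel" and fg: "AE x in lborel. f x = g x"
    using completion_ex_borel_measurable_real[OF borel_measurable_integrable[OF f]] by auto
  have g' [measurable]: "g \<in> borel_measurable lebesgue" by (rule measurable_completion[OF g])
  have fg': "AE x in lebesgue. f x = g x" using fg by (rule AE_completion)
  have "integrable lebesgue g"
    using f fg' by (subst integrable_cong_AE[of g _ f]) auto
  then have gi: "integrable lborel g" using g by (subst (asm) integrable_completion)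
  have box': "(\<integral>x. g x * indicator (box a b) x \<partial>lborel) = 0" for a b
  proof -
    have "(\<integral>x. g x * indicator (box a b) x \<partial>lborel) = (\<integral>x. g x * indicator (box a b) x \<partial>lebesgue)"
      by (rule integral_completion[symmetric]) measurable
    also have "\<dots> = (\<integral>x. f x * indicator (box a b) x \<partial>lebesgue)"
      using fg' by (intro integral_cong_AE) auto
    finally show ?thesis using box by simp
  qed
  have "AE x in lborel. g x \<le> 0" using gi box' by (rule AE_nonpos_of_box_integrals)
  moreover have "AE x in lborel. - g x \<le> 0"
    using gi box' by (intro AE_nonpos_of_box_integrals) auto
  ultimately have "AE x in lborel. f x = 0" using fg by eventually_elim auto
  then show ?thesis by (rule AE_completion)
qed

lemma measurable_fst_lebesgue [measurable (raw)]: "fst \<in> (lebesgue \<Otimes>\<^sub>M N) \<rightarrow>\<^sub>M borel"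
  by (rule measurable_compose[OF measurable_fst measurable_ident_lebesgue_borel])

lemma measurable_snd_lebesgue [measurable (raw)]: "snd \<in> (N \<Otimes>\<^sub>M lebesgue) \<rightarrow>\<^sub>M borel"
  by (rule measurable_compose[OF measurable_snd measurable_ident_lebesgue_borel])

lemma integrable_pair_mult:
  fixes f :: "'a::euclidean_space \<Rightarrow> complex" and g :: "'b::euclidean_space \<Rightarrow> complex"
  assumes f: "integrable lebesgue f" and g: "integrable lebesgue g"
  shows "integrable (lebesgue \<Otimes>\<^sub>M lebesgue) (\<lambda>p. f (fst p) * g (snd p))"
proof (rule lebesgue_pair.Fubini_integrable)
  note [measurable] = borel_measurable_integrable[OF f] borel_measurable_integrable[OF g]
  show "(\<lambda>p. f (fst p) * g (snd p)) \<in> borel_measurable (lebesgue \<Otimes>\<^sub>M lebesgue)" by measurable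
  show "integrable lebesgue (\<lambda>x. \<integral>y. norm (f (fst (x, y)) * g (snd (x, y))) \<partial>lebesgue)"
    using f by (simp add: norm_mult)
  show "AE x in lebesgue. integrable lebesgue (\<lambda>y. f (fst (x, y)) * g (snd (x, y)))"
    using g by simp
qed

text \<open>The density of the centred normal distribution of variance \<open>1 / t\<close> in each coordinate. As \<open>t\<close>
  grows it concentrates at the origin, so that averages against it recover a function.\<close>

definition heat_kernel :: "real \<Rightarrow> 'a::euclidean_space \<Rightarrow> complex" where
  "heat_kernel t x = complex_of_real ((t / (2 * pi)) powr (real DIM('a) / 2)) * gaussian t x"

lemma heat_kernel:
  assumes t: "t > 0"
  shows "integrable lebesgue (heat_kernel t :: 'a::euclidean_space \<Rightarrow> complex)"
    "(\<integral>x. heat_kernel t (x::'a) \<partial>lebesgue) = 1"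
    "integrable lebesgue (\<lambda>y. heat_kernel t (x - y :: 'a))"
    "(\<integral>y. heat_kernel t (x - y :: 'a) \<partial>lebesgue) = 1"
    "integrable lebesgue (\<lambda>y. cmod (heat_kernel t (x - y :: 'a)))"
    "(\<integral>y. cmod (heat_kernel t (x - y :: 'a)) \<partial>lebesgue) = 1"
    "heat_kernel t x = complex_of_real (cmod (heat_kernel t (x::'a)))"
proof -
  show i: "integrable lebesgue (heat_kernel t :: 'a \<Rightarrow> complex)"
    unfolding heat_kernel_def[abs_def] by (intro integrable_mult_right integrable_gaussian t)
  have "(t / (2 * pi)) powr (real DIM('a) / 2) * (2 * pi / t) powr (real DIM('a) / 2) = 1"
    using t by (simp flip: powr_mult)
  then show one: "(\<integral>x. heat_kernel t (x::'a) \<partial>lebesgue) = 1"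
    unfolding heat_kernel_def using integral_gaussian[OF t, where 'a='a] by (simp flip: of_real_mult)
  note m = borel_measurable_integrable[OF i]
  show i': "integrable lebesgue (\<lambda>y. heat_kernel t (x - y :: 'a))"
    using lebesgue_integrable_affine[OF _ i, of "-1" x] by simp
  then show "integrable lebesgue (\<lambda>y. cmod (heat_kernel t (x - y :: 'a)))" by (rule integrable_norm)
  show one': "(\<integral>y. heat_kernel t (x - y :: 'a) \<partial>lebesgue) = 1"
    using lebesgue_integral_affine[OF _ m, of "-1" x] one by simp
  have pos: "heat_kernel t x = complex_of_real (cmod (heat_kernel t x))" for x :: 'a
    unfolding heat_kernel_def gaussian_def norm_mult norm_of_real by simp
  then show "heat_kernel t x = complex_of_real (cmod (heat_kernel t (x::'a)))" .
  have "complex_of_real (\<integral>y. cmod (heat_kernel t (x - y)) \<partial>lebesgue) = (\<integral>y. complex_of_real (cmod (heat_kernel t (x - y))) \<partial>lebesgue)"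
    by simp
  also have "\<dots> = 1" using one' by (simp only: pos[symmetric])
  finally show "(\<integral>y. cmod (heat_kernel t (x - y :: 'a)) \<partial>lebesgue) = 1" using of_real_eq_1_iff by blast
qed

lemma heat_kernel_measurable [measurable]: "heat_kernel t \<in> borel_measurable borel"
  unfolding heat_kernel_def by measurable

text \<open>Half of the exponent pays for the smallness away from the origin; the other half is again a
  heat kernel and keeps the total mass bounded.\<close>

lemma heat_kernel_tail:
  assumes t: "t > 0" and r: "0 \<le> r" "r \<le> norm (z :: 'a::euclidean_space)"
  shows "cmod (heat_kernel t z) \<le> exp (- (t * r\<^sup>2 / 4)) * 2 powr (real DIM('a) / 2) * cmod (heat_kernel (t / 2) z)"
proof -
  have "r\<^sup>2 \<le> (norm z)\<^sup>2" using r by (intro power_mono)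
  then have "t * r\<^sup>2 \<le> t * (norm z)\<^sup>2" using t by simp
  then have "exp (- (t / 2) * (norm z)\<^sup>2) \<le> exp (- (t * r\<^sup>2 / 4) + - (t / 2 / 2) * (norm z)\<^sup>2)"
    by simp
  also have "\<dots> = exp (- (t * r\<^sup>2 / 4)) * exp (- (t / 2 / 2) * (norm z)\<^sup>2)" by (rule exp_add)
  finally have *: "exp (- (t / 2) * (norm z)\<^sup>2) \<le> exp (- (t * r\<^sup>2 / 4)) * exp (- (t / 2 / 2) * (norm z)\<^sup>2)" .
  have "t / (2 * pi) = 2 * (t / 2 / (2 * pi))" by simp
  then have "(t / (2 * pi)) powr (real DIM('a) / 2) = 2 powr (real DIM('a) / 2) * (t / 2 / (2 * pi)) powr (real DIM('a) / 2)"
    using t by (metis powr_mult)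
  then show ?thesis
    unfolding heat_kernel_def gaussian_def norm_mult norm_of_real
    using mult_left_mono[OF *, of "(t / (2 * pi)) powr (real DIM('a) / 2)"] by (simp add: mult_ac)
qed

text \<open>Off the frontier the indicator is constant near \<open>x\<close>, so only the tail of the kernel
  contributes to the difference.\<close>

lemma heat_kernel_box_tendsto:
  fixes x :: "'a::euclidean_space"
  assumes x: "x \<notin> frontier B" and [measurable]: "B \<in> sets borel"
  shows "(\<lambda>n. \<integral>y. indicator B y * heat_kernel (real (Suc n)) (x - y) \<partial>lebesgue) \<longlonglongrightarrow> indicator B x"
proof -
  have [measurable]: "B \<in> sets lebesgue" by simp
  obtain r where r: "r > 0" "\<And>y. norm (x - y) < r \<Longrightarrow> indicator B y = (indicator B x :: complex)"
  proof (cases "x \<in> B")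
    case True
    then have "x \<in> interior B" using x by (simp add: frontier_def) (use closure_subset in blast)
    then obtain r where "r > 0" "ball x r \<subseteq> B" using mem_interior by blast
    then show thesis using that[of r] True by (auto simp: subset_eq dist_norm indicator_def)
  next
    case False
    then have "x \<in> interior (- B)" using x interior_subset by (auto simp: frontier_def interior_closure)
    then obtain r where "r > 0" "ball x r \<subseteq> - B" using mem_interior by blast
    then show thesis using that[of r] False by (auto simp: subset_eq dist_norm indicator_def)
  qed
  define E where "E t = exp (- (t * r\<^sup>2 / 4)) * 2 powr (real DIM('a) / 2)" for t
  have bound: "norm ((\<integral>y. indicator B y * heat_kernel t (x - y) \<partial>lebesgue) - indicator B x) \<le> E t" if t: "t > 0" for t
  proof -
    have iB: "integrable lebesgue (\<lambda>y. indicator B y * heat_kernel t (x - y))"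
      by (rule Bochner_Integration.integrable_bound[OF heat_kernel(3)[OF t]])
         (measurable, auto simp: norm_mult indicator_def)
    have "(\<integral>y. indicator B y * heat_kernel t (x - y) \<partial>lebesgue) - indicator B x
        = (\<integral>y. indicator B y * heat_kernel t (x - y) - indicator B x * heat_kernel t (x - y) \<partial>lebesgue)"
      using iB heat_kernel(3)[OF t, of x] heat_kernel(4)[OF t, of x] by simp
    also have "norm \<dots> \<le> (\<integral>y. E t * cmod (heat_kernel (t / 2) (x - y)) \<partial>lebesgue)"
    proof (rule Bochner_Integration.integral_norm_bound_integral)
      show "integrable lebesgue (\<lambda>y. indicator B y * heat_kernel t (x - y) - indicator B x * heat_kernel t (x - y))"
        using iB heat_kernel(3)[OF t] by (intro Bochner_Integration.integrable_diff integrable_mult_right)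
      show "integrable lebesgue (\<lambda>y. E t * cmod (heat_kernel (t / 2) (x - y)))"
        using t by (intro integrable_mult_right heat_kernel(5)) simp
      fix y
      show "norm (indicator B y * heat_kernel t (x - y) - indicator B x * heat_kernel t (x - y))
        \<le> E t * cmod (heat_kernel (t / 2) (x - y))"
      proof (cases "norm (x - y) < r")
        case True then show ?thesis using r(2)[of y] by (simp add: E_def)
      next
        case False
        have "norm (indicator B y * heat_kernel t (x - y) - indicator B x * heat_kernel t (x - y)) \<le> cmod (heat_kernel t (x - y))"
          by (auto simp: indicator_def)
        also have "\<dots> \<le> E t * cmod (heat_kernel (t / 2) (x - y))"
          unfolding E_def using False r(1) by (intro heat_kernel_tail[OF t]) auto
        finally show ?thesis .
      qed
    qed
    also have "\<dots> = E t" using t heat_kernel(6)[of "t / 2" x] by simp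
    finally show ?thesis .
  qed
  have "(\<lambda>n. E (real (Suc n))) \<longlonglongrightarrow> 0 * 2 powr (real DIM('a) / 2)"
    unfolding E_def
  proof (intro tendsto_mult tendsto_const)
    have "filterlim (\<lambda>n. real (Suc n) * (r\<^sup>2 / 4)) at_top sequentially"
      using r(1) by (intro filterlim_at_top_mult_tendsto_pos[OF tendsto_const] filterlim_compose[OF filterlim_real_sequentially filterlim_Suc]) auto
    then show "(\<lambda>n. exp (- (real (Suc n) * r\<^sup>2 / 4))) \<longlonglongrightarrow> 0"
      by (intro filterlim_compose[OF exp_at_bot]) (simp add: filterlim_uminus_at_bot)
  qed
  then have E0: "(\<lambda>n. E (real (Suc n))) \<longlonglongrightarrow> 0" by simp
  have "(\<lambda>n. (\<integral>y. indicator B y * heat_kernel (real (Suc n)) (x - y) \<partial>lebesgue) - indicator B x) \<longlonglongrightarrow> 0"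
    using bound by (intro Lim_null_comparison[OF always_eventually[OF allI] E0]) simp
  then show ?thesis by (simp add: LIM_zero_iff)
qed

text \<open>Integrating the hypothesis in \<open>y\<close> over a box and exchanging the integrals gives the integral
  of \<open>D\<close> against a smoothed indicator of the box. As the smoothing disappears, all box integrals
  of \<open>D\<close> vanish.\<close>

lemma integrable_zero_of_gaussian_integrals:
  fixes D :: "'a::euclidean_space \<Rightarrow> complex"
  assumes D: "integrable lebesgue D"
    and zero: "\<And>t y. t > 0 \<Longrightarrow> (\<integral>x. D x * gaussian t (x - y) \<partial>lebesgue) = 0"
  shows "AE x in lebesgue. D x = 0"
proof -
  note [measurable] = borel_measurable_integrable[OF D]
  have box: "(\<integral>x. D x * indicator (box a b) x \<partial>lebesgue) = 0" for a b
  proof -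
    define B where "B = box a b"
    have B [measurable]: "B \<in> sets borel" "B \<in> sets lebesgue" unfolding B_def by auto
    have Bi: "integrable lebesgue (indicator B :: 'a \<Rightarrow> complex)"
      unfolding B_def by (intro integrable_real_indicator[THEN integrable_of_real, where 'a=complex, unfolded of_real_indicator]) (auto simp: emeasure_lborel_box_finite[unfolded infinity_ennreal_def])
    define F where "F n x = (\<integral>y. indicator B y * heat_kernel (real (Suc n)) (x - y) \<partial>lebesgue)" for n x
    have [measurable]: "F n \<in> borel_measurable lebesgue" for n
      unfolding F_def by (rule lebesgue.borel_measurable_lebesgue_integral) (simp add: case_prod_unfold; measurable)
    have F1: "cmod (F n x) \<le> 1" for n x
    proof -
      have "cmod (F n x) \<le> (\<integral>y. cmod (heat_kernel (real (Suc n)) (x - y)) \<partial>lebesgue)"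
        unfolding F_def
      proof (rule Bochner_Integration.integral_norm_bound_integral)
        show "integrable lebesgue (\<lambda>y. indicator B y * heat_kernel (real (Suc n)) (x - y))"
          by (rule Bochner_Integration.integrable_bound[OF heat_kernel(3)[of "real (Suc n)" x]])
            (simp, measurable, auto simp: norm_mult indicator_def)
      qed (auto intro!: heat_kernel(5) simp: indicator_def)
      then show ?thesis using heat_kernel(6)[of "real (Suc n)" x] by simp
    qed
    have "(\<integral>x. D x * F n x \<partial>lebesgue) = 0" for n
    proof -
      let ?c = "complex_of_real ((real (Suc n) / (2 * pi)) powr (real DIM('a) / 2))"
      let ?f = "\<lambda>x y. D x * (indicator B y * heat_kernel (real (Suc n)) (x - y))"
      have i: "integrable (lebesgue \<Otimes>\<^sub>M lebesgue) (case_prod ?f)"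
      proof (rule Bochner_Integration.integrable_bound)
        show "integrable (lebesgue \<Otimes>\<^sub>M lebesgue) (\<lambda>p. ?c * (D (fst p) * indicator B (snd p)))"
          by (intro integrable_mult_right integrable_pair_mult D Bi)
        show "case_prod ?f \<in> borel_measurable (lebesgue \<Otimes>\<^sub>M lebesgue)"
          unfolding case_prod_unfold by measurable
        have "cmod (?f x y) \<le> cmod (?c * (D x * indicator B y))" for x y
        proof -
          have "?f x y = (?c * (D x * indicator B y)) * gaussian (real (Suc n)) (x - y)"
            unfolding heat_kernel_def by (simp only: mult_ac)
          then have "cmod (?f x y) = cmod (?c * (D x * indicator B y)) * cmod (gaussian (real (Suc n)) (x - y))"
            by (simp only: norm_mult)
          also have "\<dots> \<le> cmod (?c * (D x * indicator B y))"
            by (rule mult_left_le[OF norm_gaussian_le_1]) simp_all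
          finally show ?thesis .
        qed
        then show "AE p in lebesgue \<Otimes>\<^sub>M lebesgue. norm (case_prod ?f p) \<le> norm (?c * (D (fst p) * indicator B (snd p)))"
          by (intro AE_I2) (simp add: case_prod_unfold)
      qed
      have "(\<integral>x. D x * F n x \<partial>lebesgue) = (\<integral>x. (\<integral>y. ?f x y \<partial>lebesgue) \<partial>lebesgue)"
        unfolding F_def by simp
      also have "\<dots> = (\<integral>y. (\<integral>x. ?f x y \<partial>lebesgue) \<partial>lebesgue)"
        by (rule lebesgue_pair.Fubini_integral[OF i, symmetric])
      also have "\<dots> = (\<integral>y. indicator B y * ?c * (\<integral>x. D x * gaussian (real (Suc n)) (x - y) \<partial>lebesgue) \<partial>lebesgue)"
        unfolding heat_kernel_def integral_mult_right_zero[symmetric]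
        by (intro Bochner_Integration.integral_cong refl) (simp_all only: mult_ac)
      also have "\<dots> = 0" using zero[of "real (Suc n)"] by simp
      finally show ?thesis .
    qed
    moreover have "(\<lambda>n. \<integral>x. D x * F n x \<partial>lebesgue) \<longlonglongrightarrow> (\<integral>x. D x * indicator B x \<partial>lebesgue)"
    proof (rule integral_dominated_convergence[where w = "\<lambda>x. cmod (D x)"])
      show "integrable lebesgue (\<lambda>x. cmod (D x))" using D by (rule integrable_norm)
      have "frontier B \<in> null_sets lebesgue"
        unfolding B_def using negligible_convex_frontier[of "box a b"] negligible_iff_null_sets convex_box(2) by blast
      then have "AE x in lebesgue. x \<notin> frontier B" by (rule AE_not_in)
      then show "AE x in lebesgue. (\<lambda>n. D x * F n x) \<longlonglongrightarrow> D x * indicator B x"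
        unfolding F_def by eventually_elim (intro tendsto_mult tendsto_const heat_kernel_box_tendsto B)
      show "AE x in lebesgue. norm (D x * F n x) \<le> cmod (D x)" for n
        using F1 by (auto simp: norm_mult mult_left_le)
    qed measurable
    ultimately have "(\<lambda>n. 0) \<longlonglongrightarrow> (\<integral>x. D x * indicator B x \<partial>lebesgue)" by simp
    from LIMSEQ_unique[OF this tendsto_const] show ?thesis unfolding B_def .
  qed
  have i: "integrable lebesgue (\<lambda>x. D x * indicator (box a b) x)" for a b
    by (rule Bochner_Integration.integrable_bound[OF D]) (measurable, auto simp: indicator_def)
  have "AE x in lebesgue. Re (D x) = 0"
  proof (rule AE_zero_of_box_integrals)
    fix a b
    have "(\<integral>x. Re (D x) * indicator (box a b) x \<partial>lebesgue) = Re (\<integral>x. D x * indicator (box a b) x \<partial>lebesgue)"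
      using i[of a b] by (subst integral_Re[symmetric]) (auto intro!: Bochner_Integration.integral_cong simp: indicator_def)
    then show "(\<integral>x. Re (D x) * indicator (box a b) x \<partial>lebesgue) = 0" using box by simp
  qed (use D in auto)
  moreover have "AE x in lebesgue. Im (D x) = 0"
  proof (rule AE_zero_of_box_integrals)
    fix a b
    have "(\<integral>x. Im (D x) * indicator (box a b) x \<partial>lebesgue) = Im (\<integral>x. D x * indicator (box a b) x \<partial>lebesgue)"
      using i[of a b] by (subst integral_Im[symmetric]) (auto intro!: Bochner_Integration.integral_cong simp: indicator_def)
    then show "(\<integral>x. Im (D x) * indicator (box a b) x \<partial>lebesgue) = 0" using box by simp
  qed (use D in auto)
  ultimately show ?thesis by eventually_elim (simp add: complex_eq_iff)
qed

text \<open>Completing the square.\<close>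

lemma gaussian_product:
  assumes t: "t > 0"
  shows "gaussian 1 x * gaussian t (x - y)
    = gaussian (t / (1 + t)) y * gaussian (1 + t) (x - (t / (1 + t)) *\<^sub>R y)"
proof -
  define s where "s = 1 + t"
  have s: "s > 0" "t = s - 1" using t by (auto simp: s_def)
  have "(norm x)\<^sup>2 + t * (norm (x - y))\<^sup>2 = (t / s) * (norm y)\<^sup>2 + s * (norm (x - (t / s) *\<^sub>R y))\<^sup>2"
    unfolding power2_norm_eq_inner s(2) using s(1)
    by (simp add: inner_diff inner_commute field_simps)
  then have "- (1 / 2) * (norm x)\<^sup>2 + - (t / 2) * (norm (x - y))\<^sup>2
     = - (t / s / 2) * (norm y)\<^sup>2 + - (s / 2) * (norm (x - (t / s) *\<^sub>R y))\<^sup>2" by simp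
  then show ?thesis unfolding gaussian_def s_def[symmetric] of_real_mult[symmetric] exp_add[symmetric] by simp
qed

text \<open>Translates of Gaussians separate tempered functions. A Gaussian factor makes \<open>D\<close> integrable,
  and it does not leave the class of test functions, since a product of two Gaussians is a
  Gaussian. All uniqueness statements for Fourier transforms below, and the inversion formula,
  reduce to this theorem, because the Fourier transforms of Gaussians are known explicitly.\<close>

theorem tempered_zero_of_gaussian_integrals:
  fixes D :: "'a::euclidean_space \<Rightarrow> complex"
  assumes D: "D \<in> tempered"
    and zero: "\<And>t y. t > 0 \<Longrightarrow> (\<integral>x. D x * gaussian t (x - y) \<partial>lebesgue) = 0"
  shows "AE x in lebesgue. D x = 0"
proof -
  have "AE x in lebesgue. D x * gaussian 1 x = 0"
  proof (rule integrable_zero_of_gaussian_integrals)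
    show "integrable lebesgue (\<lambda>x. D x * gaussian 1 x)"
      by (intro tempered_times_rapidly_decreasing D schwartz_rapidly_decreasing gaussian_schwartz) simp
    fix t :: real and y :: 'a assume t: "t > 0"
    have "(\<integral>x. D x * gaussian 1 x * gaussian t (x - y) \<partial>lebesgue)
      = (\<integral>x. gaussian (t / (1 + t)) y * (D x * gaussian (1 + t) (x - (t / (1 + t)) *\<^sub>R y)) \<partial>lebesgue)"
      by (intro Bochner_Integration.integral_cong refl) (simp only: mult.assoc gaussian_product[OF t] mult.left_commute)
    also have "\<dots> = 0" using zero[of "1 + t"] t by simp
    finally show "(\<integral>x. D x * gaussian 1 x * gaussian t (x - y) \<partial>lebesgue) = 0" .
  qed
  then show ?thesis by eventually_elim (auto simp: gaussian_def)
qed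

section \<open>Bounds and continuity of the Fourier integral\<close>

lemma fourier_measurable:
  assumes f: "f \<in> borel_measurable lebesgue"
  shows "fourier f \<in> borel_measurable lebesgue"
proof -
  note [measurable] = f
  have "(\<lambda>\<xi>. \<integral>x. exp (- \<i> * complex_of_real (x \<bullet> \<xi>)) * f x \<partial>lebesgue) \<in> borel_measurable lebesgue"
    by (rule lebesgue.borel_measurable_lebesgue_integral) (unfold case_prod_unfold, measurable)
  then show ?thesis unfolding fourier_def by measurable
qed

definition fourier_const :: "'a::euclidean_space itself \<Rightarrow> real" where
  "fourier_const _ = (2 * pi) powr (- (real DIM('a) / 2))"

lemma fourier_const_pos: "fourier_const TYPE('a::euclidean_space) > 0"
  by (simp add: fourier_const_def)

lemma fourier_eq:
  "fourier f \<xi> = complex_of_real (fourier_const TYPE('a)) *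
     (\<integral>x. exp (- \<i> * complex_of_real (x \<bullet> \<xi>)) * f x \<partial>lebesgue)" for f :: "'a::euclidean_space \<Rightarrow> complex"
  by (simp add: fourier_def fourier_const_def)

lemma norm_fourier_le:
  fixes f :: "'a::euclidean_space \<Rightarrow> complex"
  assumes "integrable lebesgue f"
  shows "cmod (fourier f \<xi>) \<le> fourier_const TYPE('a) * (\<integral>x. cmod (f x) \<partial>lebesgue)"
proof -
  have "cmod (\<integral>x. exp (- \<i> * complex_of_real (x \<bullet> \<xi>)) * f x \<partial>lebesgue) \<le> (\<integral>x. cmod (f x) \<partial>lebesgue)"
    by (rule Bochner_Integration.integral_norm_bound_integral)
       (rule integrable_fourier[OF assms], rule integrable_norm[OF assms], simp add: norm_mult)
  then show ?thesis
    unfolding fourier_eq norm_mult using fourier_const_pos[where 'a='a] by (simp add: mult_left_mono)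
qed

lemma fourier_diff:
  assumes "integrable lebesgue f" "integrable lebesgue g"
  shows "fourier (\<lambda>x. f x - g x) \<xi> = fourier f \<xi> - fourier g \<xi>"
  unfolding fourier_eq using integrable_fourier[OF assms(1)] integrable_fourier[OF assms(2)]
  by (simp add: right_diff_distrib)

lemma fourier_cmult: "fourier (\<lambda>x. c * f x) \<xi> = c * fourier f \<xi>"
  unfolding fourier_eq by (simp add: mult.left_commute)

lemma fourier_tendsto:
  fixes f :: "nat \<Rightarrow> 'a::euclidean_space \<Rightarrow> complex"
  assumes m: "\<And>n. f n \<in> borel_measurable lebesgue" and g: "g \<in> borel_measurable lebesgue"
    and w: "integrable lebesgue w" "\<And>n x. cmod (f n x) \<le> w x"
    and lim: "\<And>x. (\<lambda>n. f n x) \<longlonglongrightarrow> g x"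
  shows "(\<lambda>n. fourier (f n) \<xi>) \<longlonglongrightarrow> fourier g \<xi>"
  unfolding fourier_eq
proof (intro tendsto_mult tendsto_const)
  note [measurable] = m g
  show "(\<lambda>n. \<integral>x. exp (- \<i> * complex_of_real (x \<bullet> \<xi>)) * f n x \<partial>lebesgue)
      \<longlonglongrightarrow> (\<integral>x. exp (- \<i> * complex_of_real (x \<bullet> \<xi>)) * g x \<partial>lebesgue)"
    by (rule integral_dominated_convergence[where w = w])
       (measurable, auto intro!: w tendsto_mult lim tendsto_const simp: norm_mult)
qed

section \<open>The Fourier transform of a Schwartz function decays rapidly\<close>

text \<open>Polynomial weights change by a bounded factor under bounded shifts; this dominates difference
  quotients.\<close>

lemma one_plus_norm_shift:
  fixes x z :: "'a::euclidean_space"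
  assumes "norm z \<le> 1" shows "(1 + norm x) ^ k \<le> 2 ^ k * (1 + norm (x + z)) ^ k"
proof -
  have "1 + norm x \<le> 2 * (1 + norm (x + z))"
    using norm_triangle_ineq4[of "x + z" z] norm_ge_zero[of "x + z"] assms
    unfolding add_diff_cancel_right' by argo
  then have "(1 + norm x) ^ k \<le> (2 * (1 + norm (x + z))) ^ k" by (intro power_mono) auto
  then show ?thesis by (simp only: power_mult_distrib)
qed

lemma difference_quotient_bound:
  fixes \<zeta> :: "'a::euclidean_space \<Rightarrow> complex"
  assumes d: "\<And>x. (\<zeta> has_derivative \<zeta>' x) (at x)" and h: "0 < h"
    and C: "\<And>s. 0 \<le> s \<Longrightarrow> s \<le> h \<Longrightarrow> cmod (\<zeta>' (x + s *\<^sub>R u) u) \<le> C"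
  shows "cmod ((\<zeta> (x + h *\<^sub>R u) - \<zeta> x) / complex_of_real h) \<le> C"
proof -
  have "norm (\<zeta> (x + h *\<^sub>R u) - \<zeta> (x + 0 *\<^sub>R u)) \<le> C * norm (h - 0)"
  proof (rule differentiable_bound[of "{0..h}" "\<lambda>s. \<zeta> (x + s *\<^sub>R u)" "\<lambda>s r. r *\<^sub>R \<zeta>' (x + s *\<^sub>R u) u" C])
    fix s assume s: "s \<in> {0..h}"
    have "((\<lambda>s. x + s *\<^sub>R u) has_derivative (\<lambda>r. r *\<^sub>R u)) (at s within {0..h})"
      by (auto intro!: derivative_eq_intros)
    from has_derivative_compose[OF this d]
    show "((\<lambda>s. \<zeta> (x + s *\<^sub>R u)) has_derivative (\<lambda>r. r *\<^sub>R \<zeta>' (x + s *\<^sub>R u) u)) (at s within {0..h})"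
      using linear_scale[OF has_derivative_linear[OF d]] by simp
    have "onorm (\<lambda>r. r *\<^sub>R \<zeta>' (x + s *\<^sub>R u) u) \<le> onorm (\<lambda>r::real. r) * norm (\<zeta>' (x + s *\<^sub>R u) u)"
      by (rule onorm_scaleR_left_lemma) (rule bounded_linear_ident)
    then show "onorm (\<lambda>r. r *\<^sub>R \<zeta>' (x + s *\<^sub>R u) u) \<le> C"
      using C[of s] s by (simp add: onorm_id)
  qed (use h in auto)
  then show ?thesis using h by (simp add: norm_divide divide_le_eq)
qed

lemma difference_quotient_tendsto:
  fixes \<zeta> :: "'a::euclidean_space \<Rightarrow> complex"
  assumes d: "\<And>x. (\<zeta> has_derivative \<zeta>' x) (at x)"
  shows "(\<lambda>n. (\<zeta> (x + (1 / real (Suc n)) *\<^sub>R u) - \<zeta> x) / complex_of_real (1 / real (Suc n))) \<longlonglongrightarrow> \<zeta>' x u"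
proof -
  define h where "h n = 1 / real (Suc n)" for n
  have "((\<lambda>s. x + s *\<^sub>R u) has_derivative (\<lambda>r. r *\<^sub>R u)) (at 0)"
    by (auto intro!: derivative_eq_intros)
  from has_derivative_compose[OF this d]
  have "((\<lambda>s. \<zeta> (x + s *\<^sub>R u)) has_derivative (\<lambda>r. r *\<^sub>R \<zeta>' x u)) (at 0)"
    using linear_scale[OF has_derivative_linear[OF d]] by simp
  then have "((\<lambda>y. norm (\<zeta> (x + y *\<^sub>R u) - \<zeta> x - y *\<^sub>R \<zeta>' x u) / norm y) \<longlongrightarrow> 0) (at 0)"
    unfolding has_derivative_iff_norm by simp
  moreover have "filterlim h (at 0) sequentially"
    unfolding filterlim_at h_def using LIMSEQ_Suc[OF lim_1_over_n] by auto
  ultimately have "(\<lambda>n. norm (\<zeta> (x + h n *\<^sub>R u) - \<zeta> x - h n *\<^sub>R \<zeta>' x u) / norm (h n)) \<longlonglongrightarrow> 0"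
    by (rule filterlim_compose)
  moreover have "norm (\<zeta> (x + h n *\<^sub>R u) - \<zeta> x - h n *\<^sub>R \<zeta>' x u) / norm (h n)
      = norm ((\<zeta> (x + h n *\<^sub>R u) - \<zeta> x) / complex_of_real (h n) - \<zeta>' x u)" for n
  proof -
    have "h n > 0" by (simp add: h_def)
    then have "(\<zeta> (x + h n *\<^sub>R u) - \<zeta> x) / complex_of_real (h n) - \<zeta>' x u
       = (\<zeta> (x + h n *\<^sub>R u) - \<zeta> x - h n *\<^sub>R \<zeta>' x u) / complex_of_real (h n)"
      by (simp add: scaleR_conv_of_real field_simps)
    then show ?thesis by (simp add: norm_divide)
  qed
  ultimately have "(\<lambda>n. norm ((\<zeta> (x + h n *\<^sub>R u) - \<zeta> x) / complex_of_real (h n) - \<zeta>' x u)) \<longlonglongrightarrow> 0" by simp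
  then show ?thesis unfolding h_def by (simp only: tendsto_norm_zero_iff LIM_zero_iff)
qed

text \<open>The difference quotients of \<open>iter_deriv us \<phi>\<close> converge with an integrable majorant, and
  translations become characters under the Fourier transform, whose difference quotients at zero
  are explicit.\<close>

lemma fourier_derivative:
  fixes \<phi> :: "'a::euclidean_space \<Rightarrow> complex"
  assumes \<phi>: "\<phi> \<in> schwartz" and u: "norm u \<le> 1"
  shows "fourier (iter_deriv (u # us) \<phi>) \<xi> = \<i> * complex_of_real (u \<bullet> \<xi>) * fourier (iter_deriv us \<phi>) \<xi>"
proof -
  define \<zeta> where "\<zeta> = iter_deriv us \<phi>"
  define D where "D = iter_deriv (u # us) \<phi>"
  have d: "(\<zeta> has_derivative (\<lambda>h. frechet_derivative \<zeta> (at x) h)) (at x)" for x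
    unfolding \<zeta>_def using schwartz_differentiable[OF \<phi>, of us x] by (simp add: frechet_derivative_works[symmetric])
  have D: "D x = frechet_derivative \<zeta> (at x) u" for x by (simp add: D_def \<zeta>_def)
  have r\<zeta>: "rapidly_decreasing \<zeta>" and rD: "rapidly_decreasing D"
    unfolding \<zeta>_def D_def by (intro schwartz_rapidly_decreasing_iter \<phi>)+
  note [measurable] = rapidly_decreasingD[OF r\<zeta>] rapidly_decreasingD[OF rD]
  note i\<zeta> = rapidly_decreasing_square_integrable(2)[OF r\<zeta>]
  obtain C where C0: "0 \<le> C" and C: "\<And>x. cmod (D x) \<le> C / (1 + norm x) ^ (2 * DIM('a))"
    using rD by (rule rapidly_decreasing_bound) blast
  define h where "h n = 1 / real (Suc n)" for n
  have h: "0 < h n" "h n \<le> 1" for n by (simp_all add: h_def)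
  have shift [measurable]: "(\<lambda>x. \<zeta> (x - - (s *\<^sub>R u))) \<in> borel_measurable lebesgue" for s
    using lebesgue_measurable_affine[of 1 \<zeta> "s *\<^sub>R u"] by (simp add: add.commute)
  define q where "q n x = (\<zeta> (x - - (h n *\<^sub>R u)) - \<zeta> x) / complex_of_real (h n)" for n x
  define K where "K = 2 ^ (2 * DIM('a)) * C"
  have lim1: "(\<lambda>n. fourier (q n) \<xi>) \<longlonglongrightarrow> fourier D \<xi>"
  proof (rule fourier_tendsto[where w = "\<lambda>x. K * (1 / (1 + norm x) ^ (2 * DIM('a)))"])
    show "q n \<in> borel_measurable lebesgue" for n unfolding q_def by measurable
    show "integrable lebesgue (\<lambda>x::'a. K * (1 / (1 + norm x) ^ (2 * DIM('a))))"
      by (intro integrable_mult_right integrable_inverse_one_plus_norm)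
    show "(\<lambda>n. q n x) \<longlonglongrightarrow> D x" for x
      using difference_quotient_tendsto[OF d, of x u] by (simp add: q_def h_def D)
    fix n x
    have "cmod ((\<zeta> (x + h n *\<^sub>R u) - \<zeta> x) / complex_of_real (h n)) \<le> K * (1 / (1 + norm x) ^ (2 * DIM('a)))"
    proof (rule difference_quotient_bound[OF d h(1)])
      fix s assume s: "0 \<le> s" "s \<le> h n"
      have "norm (s *\<^sub>R u) \<le> 1" using s h(2)[of n] u by (simp add: mult_le_one)
      from one_plus_norm_shift[OF this, of x "2 * DIM('a)"]
      have le: "(1 + norm x) ^ (2 * DIM('a)) \<le> 2 ^ (2 * DIM('a)) * (1 + norm (x + s *\<^sub>R u)) ^ (2 * DIM('a))" .
      have "cmod (frechet_derivative \<zeta> (at (x + s *\<^sub>R u)) u) \<le> C / (1 + norm (x + s *\<^sub>R u)) ^ (2 * DIM('a))"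
        using C D by metis
      also have "\<dots> \<le> K * (1 / (1 + norm x) ^ (2 * DIM('a)))"
        using mult_left_mono[OF le C0] polynomial_weight(2)[of x "2 * DIM('a)"] polynomial_weight(2)[of "x + s *\<^sub>R u" "2 * DIM('a)"]
        unfolding K_def by (simp add: field_simps)
      finally show "cmod (frechet_derivative \<zeta> (at (x + s *\<^sub>R u)) u) \<le> K * (1 / (1 + norm x) ^ (2 * DIM('a)))" .
    qed
    then show "cmod (q n x) \<le> K * (1 / (1 + norm x) ^ (2 * DIM('a)))" by (simp add: q_def)
  qed measurable
  have eq: "fourier (q n) \<xi> = (exp (\<i> * complex_of_real (h n * (u \<bullet> \<xi>))) - 1) / complex_of_real (h n) * fourier \<zeta> \<xi>" for n
  proof -
    have i: "integrable lebesgue (\<lambda>x. \<zeta> (x - - (h n *\<^sub>R u)))"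
      using lebesgue_integrable_affine[OF _ i\<zeta>, of 1 "h n *\<^sub>R u"] by (simp add: add.commute)
    have "fourier (q n) \<xi> = (1 / complex_of_real (h n)) * (fourier (\<lambda>x. \<zeta> (x - - (h n *\<^sub>R u))) \<xi> - fourier \<zeta> \<xi>)"
      unfolding fourier_diff[OF i i\<zeta>, symmetric] fourier_cmult[symmetric] q_def by simp
    also have "fourier (\<lambda>x. \<zeta> (x - - (h n *\<^sub>R u))) \<xi> = exp (\<i> * complex_of_real (h n * (u \<bullet> \<xi>))) * fourier \<zeta> \<xi>"
      by (subst fourier_translate) (rule rapidly_decreasingD[OF r\<zeta>], simp)
    finally show ?thesis by (simp add: field_simps)
  qed
  have "(\<lambda>n. (exp (\<i> * complex_of_real (h n * (u \<bullet> \<xi>))) - 1) / complex_of_real (h n)) \<longlonglongrightarrow> \<i> * complex_of_real (u \<bullet> \<xi>)"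
    using difference_quotient_tendsto[OF has_derivative_character[of \<xi>], of 0 u]
    by (simp add: h_def)
  from tendsto_mult_right[OF this, of "fourier \<zeta> \<xi>"]
  have "(\<lambda>n. fourier (q n) \<xi>) \<longlonglongrightarrow> \<i> * complex_of_real (u \<bullet> \<xi>) * fourier \<zeta> \<xi>"
    unfolding eq .
  with lim1 show ?thesis unfolding D_def \<zeta>_def by (rule LIMSEQ_unique)
qed

text \<open>Each power of \<open>norm \<xi>\<close> is bounded by the coordinates of \<open>\<xi>\<close>, and a coordinate factor is the
  transform of one more derivative.\<close>

lemma fourier_schwartz_rapidly_decreasing:
  fixes \<phi> :: "'a::euclidean_space \<Rightarrow> complex"
  assumes \<phi>: "\<phi> \<in> schwartz" shows "rapidly_decreasing (fourier \<phi>)"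
  unfolding rapidly_decreasing_def
proof (intro conjI allI)
  show "fourier \<phi> \<in> borel_measurable lebesgue"
    by (intro fourier_measurable rapidly_decreasingD schwartz_rapidly_decreasing \<phi>)
  fix k
  have "\<exists>C. \<forall>\<xi>. (1 + norm \<xi>) ^ k * cmod (fourier (iter_deriv us \<phi>) \<xi>) \<le> C" for us
  proof (induction k arbitrary: us)
    case 0
    have "integrable lebesgue (iter_deriv us \<phi>)"
      by (intro rapidly_decreasing_square_integrable(2) schwartz_rapidly_decreasing_iter \<phi>)
    from norm_fourier_le[OF this] show ?case by auto
  next
    case (Suc k)
    have "\<exists>B. \<forall>us \<xi>. (1 + norm \<xi>) ^ k * cmod (fourier (iter_deriv us \<phi>) \<xi>) \<le> B us"
      using Suc.IH by metis
    then obtain B where B: "\<And>us \<xi>. (1 + norm \<xi>) ^ k * cmod (fourier (iter_deriv us \<phi>) \<xi>) \<le> B us" by blast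
    have "(1 + norm \<xi>) ^ Suc k * cmod (fourier (iter_deriv us \<phi>) \<xi>) \<le> B us + (\<Sum>b\<in>Basis. B (b # us))" for \<xi>
    proof -
      define F where "F = cmod (fourier (iter_deriv us \<phi>) \<xi>)"
      define W where "W = (1 + norm \<xi>) ^ k"
      have W0: "0 \<le> W" by (simp add: W_def)
      have F0: "0 \<le> F" by (simp add: F_def)
      have b: "W * (\<bar>\<xi> \<bullet> b\<bar> * F) \<le> B (b # us)" if "b \<in> Basis" for b
        using B[of \<xi> "b # us"] fourier_derivative[OF \<phi>, of b us \<xi>] that
        unfolding W_def F_def by (simp add: norm_mult inner_commute del: iter_deriv.simps)
      have "(1 + norm \<xi>) ^ Suc k * F = W * F + norm \<xi> * (W * F)"
        unfolding W_def by (simp add: algebra_simps)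
      also have "norm \<xi> * (W * F) \<le> (\<Sum>b\<in>Basis. \<bar>\<xi> \<bullet> b\<bar>) * (W * F)"
        using W0 F0 by (intro mult_right_mono norm_le_l1) auto
      also have "\<dots> = (\<Sum>b\<in>Basis. W * (\<bar>\<xi> \<bullet> b\<bar> * F))" by (simp add: sum_distrib_left sum_distrib_right mult_ac)
      also have "\<dots> \<le> (\<Sum>b\<in>Basis. B (b # us))" by (intro sum_mono b)
      finally show ?thesis using B[of \<xi> us] unfolding W_def F_def by simp
    qed
    then show ?case by blast
  qed
  from this[of "[]"] show "\<exists>C. \<forall>\<xi>. (1 + norm \<xi>) ^ k * cmod (fourier \<phi> \<xi>) \<le> C" by simp
qed

section \<open>Plancherel\<close>

lemma fourier_multiplication_formula:
  fixes f g :: "'a::euclidean_space \<Rightarrow> complex"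
  assumes f: "integrable lebesgue f" and g: "integrable lebesgue g"
  shows "(\<integral>x. fourier f x * g x \<partial>lebesgue) = (\<integral>x. f x * fourier g x \<partial>lebesgue)"
proof -
  note [measurable] = borel_measurable_integrable[OF f] borel_measurable_integrable[OF g]
  let ?c = "complex_of_real (fourier_const TYPE('a))"
  let ?e = "\<lambda>x y :: 'a. exp (- \<i> * complex_of_real (x \<bullet> y))"
  have i: "integrable (lebesgue \<Otimes>\<^sub>M lebesgue) (\<lambda>(x, y). ?e x y * (f x * g y))"
    by (rule Bochner_Integration.integrable_bound[OF integrable_pair_mult[OF f g]])
       (unfold case_prod_unfold, measurable, auto simp: norm_mult)
  have "(\<integral>y. (\<integral>x. ?e x y * (f x * g y) \<partial>lebesgue) \<partial>lebesgue) = (\<integral>x. (\<integral>y. ?e x y * (f x * g y) \<partial>lebesgue) \<partial>lebesgue)"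
    by (rule lebesgue_pair.Fubini_integral[OF i])
  moreover have "(\<integral>x. ?e x y * (f x * g y) \<partial>lebesgue) = (\<integral>x. ?e x y * f x \<partial>lebesgue) * g y" for y
    by (simp flip: mult.assoc)
  moreover have "(\<integral>y. ?e x y * (f x * g y) \<partial>lebesgue) = f x * (\<integral>y. ?e y x * g y \<partial>lebesgue)" for x
    by (subst integral_mult_right_zero[symmetric]) (simp add: inner_commute mult.left_commute)
  ultimately have "(\<integral>y. (\<integral>x. ?e x y * f x \<partial>lebesgue) * g y \<partial>lebesgue) = (\<integral>x. f x * (\<integral>y. ?e y x * g y \<partial>lebesgue) \<partial>lebesgue)"
    by (simp only:)
  then show ?thesis
    by (simp only: fourier_eq mult.assoc mult.left_commute[of _ ?c] integral_mult_right_zero)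
qed

text \<open>The domain on which the Fourier integral converges and the \<open>L\<^sup>2\<close> norm is finite.\<close>

definition L1L2 :: "('a::euclidean_space \<Rightarrow> complex) \<Rightarrow> bool" where
  "L1L2 f \<longleftrightarrow> integrable lebesgue f \<and> square_integrable f"

lemma L1L2D: "L1L2 f \<Longrightarrow> integrable lebesgue f" "L1L2 f \<Longrightarrow> square_integrable f"
  by (simp_all add: L1L2_def)

lemma L1L2_rapidly_decreasing: "rapidly_decreasing f \<Longrightarrow> L1L2 f"
  unfolding L1L2_def using rapidly_decreasing_square_integrable by blast

text \<open>The multiplication formula, used twice: the conjugate of the transform of \<open>f\<close> is the transform
  of the conjugated reflection, and the transform of a modulated Gaussian is a translated heat
  kernel.\<close>

lemma Gaussian_weighted_Plancherel:
  fixes f :: "'a::euclidean_space \<Rightarrow> complex"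
  assumes f: "integrable lebesgue f" and \<epsilon>: "\<epsilon> > 0"
  shows "(\<integral>\<xi>. fourier f \<xi> * (cnj (fourier f \<xi>) * gaussian \<epsilon> \<xi>) \<partial>lebesgue)
     = (\<integral>x. f x * (\<integral>y. cnj (f y) * heat_kernel (1 / \<epsilon>) (x - y) \<partial>lebesgue) \<partial>lebesgue)"
proof -
  note [measurable] = borel_measurable_integrable[OF f] fourier_measurable[OF borel_measurable_integrable[OF f]]
  let ?c = "complex_of_real (fourier_const TYPE('a))"
  define g where "g x = cnj (f (- x))" for x
  have g: "integrable lebesgue g"
    using lebesgue_integrable_affine[OF _ f, of "-1" 0] unfolding g_def by simp
  have cnj_fourier: "cnj (fourier f \<xi>) = fourier g \<xi>" for \<xi>
  proof -
    have "cnj (fourier f \<xi>) = ?c * cnj (\<integral>x. exp (- \<i> * complex_of_real (x \<bullet> \<xi>)) * f x \<partial>lebesgue)"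
      unfolding fourier_eq by simp
    also have "cnj (\<integral>x. exp (- \<i> * complex_of_real (x \<bullet> \<xi>)) * f x \<partial>lebesgue)
        = (\<integral>x. cnj (exp (- \<i> * complex_of_real (x \<bullet> \<xi>)) * f x) \<partial>lebesgue)"
      by (rule Bochner_Integration.integral_cnj[symmetric])
    also have "(\<integral>x. cnj (exp (- \<i> * complex_of_real (x \<bullet> \<xi>)) * f x) \<partial>lebesgue)
        = (\<integral>x. cnj (exp (- \<i> * complex_of_real ((0 + -1 *\<^sub>R x) \<bullet> \<xi>)) * f (0 + -1 *\<^sub>R x)) \<partial>lebesgue)"
      by (rule lebesgue_integral_affine[symmetric]) (simp, measurable)
    also have "\<dots> = (\<integral>x. exp (- \<i> * complex_of_real (x \<bullet> \<xi>)) * g x \<partial>lebesgue)"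
      by (simp add: g_def exp_cnj)
    finally show ?thesis unfolding fourier_eq .
  qed
  define h where "h \<xi> = cnj (fourier f \<xi>) * gaussian \<epsilon> \<xi>" for \<xi>
  have h: "integrable lebesgue h"
  proof (rule Bochner_Integration.integrable_bound)
    show "integrable lebesgue (\<lambda>\<xi>. complex_of_real (fourier_const TYPE('a) * (\<integral>x. cmod (f x) \<partial>lebesgue)) * gaussian \<epsilon> \<xi>)"
      by (intro integrable_mult_right integrable_gaussian \<epsilon>)
    show "h \<in> borel_measurable lebesgue" unfolding h_def by measurable
    show "AE \<xi> in lebesgue. norm (h \<xi>) \<le> norm (complex_of_real (fourier_const TYPE('a) * (\<integral>x. cmod (f x) \<partial>lebesgue)) * gaussian \<epsilon> \<xi>)"
      unfolding h_def norm_mult norm_of_real complex_mod_cnj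
      by (intro AE_I2 mult_right_mono order_trans[OF norm_fourier_le[OF f] abs_ge_self]) simp
  qed
  have fourier_h: "fourier h x = (\<integral>y. cnj (f y) * heat_kernel (1 / \<epsilon>) (x - y) \<partial>lebesgue)" for x
  proof -
    let ?G = "\<lambda>\<xi>. exp (\<i> * complex_of_real (\<xi> \<bullet> (- x))) * gaussian \<epsilon> \<xi>"
    have G: "integrable lebesgue ?G"
      using integrable_fourier[OF integrable_gaussian[OF \<epsilon>], of x] by simp
    have "fourier h x = ?c * (\<integral>\<xi>. fourier g \<xi> * ?G \<xi> \<partial>lebesgue)"
      unfolding fourier_eq[of h] h_def cnj_fourier
      by (intro arg_cong[of _ _ "\<lambda>z. ?c * z"] Bochner_Integration.integral_cong) (simp_all add: inner_commute mult.left_commute)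
    also have "\<dots> = ?c * (\<integral>y. g y * fourier ?G y \<partial>lebesgue)"
      unfolding fourier_multiplication_formula[OF g G] ..
    also have "\<dots> = (\<integral>y. g y * heat_kernel (1 / \<epsilon>) (x + y) \<partial>lebesgue)"
    proof -
      have "?c * fourier ?G y = heat_kernel (1 / \<epsilon>) (x + y)" for y
      proof -
        have "(1 / \<epsilon> / (2 * pi)) powr (real DIM('a) / 2) = (2 * pi) powr - (real DIM('a) / 2) * \<epsilon> powr - (real DIM('a) / 2)"
          using \<epsilon> by (simp add: powr_divide powr_mult powr_minus field_simps)
        then show ?thesis
          unfolding fourier_modulate fourier_gaussian[OF \<epsilon>] heat_kernel_def fourier_const_def
          by (simp add: add.commute)
      qed
      then have "?c * (g y * fourier ?G y) = g y * heat_kernel (1 / \<epsilon>) (x + y)" for y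
        by (simp add: mult.left_commute)
      then show ?thesis unfolding integral_mult_right_zero[symmetric] by (simp only:)
    qed
    also have "\<dots> = (\<integral>y. g (0 + -1 *\<^sub>R y) * heat_kernel (1 / \<epsilon>) (x + (0 + -1 *\<^sub>R y)) \<partial>lebesgue)"
      by (rule lebesgue_integral_affine[symmetric]) (use g in \<open>simp, measurable\<close>)
    finally show ?thesis by (simp add: g_def)
  qed
  show ?thesis using fourier_multiplication_formula[OF f h] unfolding fourier_h unfolding h_def .
qed

lemma nn_integral_heat_kernel:
  fixes F :: "'a::euclidean_space \<Rightarrow> real"
  assumes t: "t > 0" and F: "F \<in> borel_measurable lebesgue" "\<And>x. 0 \<le> F x"
  shows "(\<integral>\<^sup>+x. \<integral>\<^sup>+y. ennreal (F x * cmod (heat_kernel t (x - y))) \<partial>lebesgue \<partial>lebesgue) = (\<integral>\<^sup>+x. ennreal (F x) \<partial>lebesgue)"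
    "(\<integral>\<^sup>+x. \<integral>\<^sup>+y. ennreal (F y * cmod (heat_kernel t (x - y))) \<partial>lebesgue \<partial>lebesgue) = (\<integral>\<^sup>+x. ennreal (F x) \<partial>lebesgue)"
proof -
  note [measurable] = F(1)
  have one: "(\<integral>\<^sup>+y. ennreal (cmod (heat_kernel t (x - y))) \<partial>lebesgue) = 1" for x :: 'a
    using heat_kernel(5,6)[OF t, of x] by (subst nn_integral_eq_integral) auto
  have sym: "cmod (heat_kernel t (x - y)) = cmod (heat_kernel t (y - x))" for x y :: 'a
    unfolding heat_kernel_def gaussian_def by (simp add: norm_minus_commute)
  show 1: "(\<integral>\<^sup>+x. \<integral>\<^sup>+y. ennreal (F x * cmod (heat_kernel t (x - y))) \<partial>lebesgue \<partial>lebesgue) = (\<integral>\<^sup>+x. ennreal (F x) \<partial>lebesgue)"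
    by (simp add: ennreal_mult' F nn_integral_cmult one)
  have "(\<integral>\<^sup>+x. \<integral>\<^sup>+y. ennreal (F y * cmod (heat_kernel t (x - y))) \<partial>lebesgue \<partial>lebesgue)
     = (\<integral>\<^sup>+y. \<integral>\<^sup>+x. ennreal (F y * cmod (heat_kernel t (x - y))) \<partial>lebesgue \<partial>lebesgue)"
    by (rule lebesgue_pair.Fubini'[symmetric]) (unfold case_prod_unfold, measurable)
  also have "\<dots> = (\<integral>\<^sup>+y. ennreal (F y) \<partial>lebesgue)"
    using 1 by (simp only: sym)
  finally show "(\<integral>\<^sup>+x. \<integral>\<^sup>+y. ennreal (F y * cmod (heat_kernel t (x - y))) \<partial>lebesgue \<partial>lebesgue) = (\<integral>\<^sup>+x. ennreal (F x) \<partial>lebesgue)" .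
qed

lemma norm_integral_le_nn_integral:
  fixes f :: "'a \<Rightarrow> complex"
  shows "ennreal (cmod (\<integral>x. f x \<partial>M)) \<le> (\<integral>\<^sup>+x. ennreal (cmod (f x)) \<partial>M)"
  by (cases "integrable M f") (simp_all add: integral_norm_bound_ennreal not_integrable_integral_eq)

text \<open>With a Gaussian weight the integral of \<open>|fourier f|\<^sup>2\<close> is the integral of \<open>f x * cnj (f y)\<close>
  against a heat kernel in \<open>x - y\<close>. Since \<open>2 * |f x * f y| \<le> |f x|\<^sup>2 + |f y|\<^sup>2\<close> and the kernel
  has mass one, it is at most the squared norm of \<open>f\<close>; the weight is removed by Fatou's lemma.
  Equality follows later, from \<open>FT_FT\<close>.\<close>

theorem fourier_contraction:
  fixes f :: "'a::euclidean_space \<Rightarrow> complex"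
  assumes f: "L1L2 f"
  shows "square_integrable (fourier f)" "norm (toL2 (fourier f)) \<le> norm (toL2 f)"
proof -
  note fi = L1L2D(1)[OF f] and f2 = L1L2D(2)[OF f]
  note [measurable] = borel_measurable_integrable[OF fi] fourier_measurable[OF borel_measurable_integrable[OF fi]]
  have bound: "(\<integral>\<^sup>+\<xi>. ennreal ((cmod (fourier f \<xi>))\<^sup>2 * cmod (gaussian \<epsilon> \<xi>)) \<partial>lebesgue) \<le> ennreal ((norm (toL2 f))\<^sup>2)"
    if \<epsilon>: "\<epsilon> > 0" for \<epsilon>
  proof -
    define t where "t = 1 / \<epsilon>"
    have t: "t > 0" using \<epsilon> by (simp add: t_def)
    have eq: "fourier f \<xi> * (cnj (fourier f \<xi>) * gaussian \<epsilon> \<xi>) = complex_of_real ((cmod (fourier f \<xi>))\<^sup>2 * cmod (gaussian \<epsilon> \<xi>))" for \<xi>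
      unfolding of_real_mult complex_norm_square gaussian_def by simp
    have i: "integrable lebesgue (\<lambda>\<xi>. (cmod (fourier f \<xi>))\<^sup>2 * cmod (gaussian \<epsilon> \<xi>))"
    proof (rule Bochner_Integration.integrable_bound)
      show "integrable lebesgue (\<lambda>\<xi>. (fourier_const TYPE('a) * (\<integral>x. cmod (f x) \<partial>lebesgue))\<^sup>2 * cmod (gaussian \<epsilon> (\<xi>::'a)))"
        by (intro integrable_mult_right integrable_norm integrable_gaussian \<epsilon>)
      show "AE \<xi> in lebesgue. norm ((cmod (fourier f \<xi>))\<^sup>2 * cmod (gaussian \<epsilon> \<xi>))
        \<le> norm ((fourier_const TYPE('a) * (\<integral>x. cmod (f x) \<partial>lebesgue))\<^sup>2 * cmod (gaussian \<epsilon> \<xi>))"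
        by (intro AE_I2) (simp add: abs_mult del: power_mult_distrib, intro mult_right_mono power_mono norm_fourier_le[OF fi], auto)
    qed measurable
    have "(\<integral>\<^sup>+\<xi>. ennreal ((cmod (fourier f \<xi>))\<^sup>2 * cmod (gaussian \<epsilon> \<xi>)) \<partial>lebesgue)
        = ennreal (\<integral>\<xi>. (cmod (fourier f \<xi>))\<^sup>2 * cmod (gaussian \<epsilon> \<xi>) \<partial>lebesgue)"
      by (rule nn_integral_eq_integral[OF i]) simp
    also have "(\<integral>\<xi>. (cmod (fourier f \<xi>))\<^sup>2 * cmod (gaussian \<epsilon> \<xi>) \<partial>lebesgue)
        = cmod (\<integral>\<xi>. fourier f \<xi> * (cnj (fourier f \<xi>) * gaussian \<epsilon> \<xi>) \<partial>lebesgue)"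
      unfolding eq integral_complex_of_real norm_of_real by simp
    also have "\<dots> = cmod (\<integral>x. f x * (\<integral>y. cnj (f y) * heat_kernel t (x - y) \<partial>lebesgue) \<partial>lebesgue)"
      unfolding Gaussian_weighted_Plancherel[OF fi \<epsilon>] t_def ..
    also have "ennreal \<dots> \<le> (\<integral>\<^sup>+x. ennreal (cmod (f x * (\<integral>y. cnj (f y) * heat_kernel t (x - y) \<partial>lebesgue))) \<partial>lebesgue)"
      by (rule norm_integral_le_nn_integral)
    also have "\<dots> \<le> (\<integral>\<^sup>+x. \<integral>\<^sup>+y. ennreal ((cmod (f x))\<^sup>2 / 2 * cmod (heat_kernel t (x - y))) + ennreal ((cmod (f y))\<^sup>2 / 2 * cmod (heat_kernel t (x - y))) \<partial>lebesgue \<partial>lebesgue)"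
    proof (rule nn_integral_mono)
      fix x
      have "ennreal (cmod (f x * (\<integral>y. cnj (f y) * heat_kernel t (x - y) \<partial>lebesgue)))
         = ennreal (cmod (f x)) * ennreal (cmod (\<integral>y. cnj (f y) * heat_kernel t (x - y) \<partial>lebesgue))"
        by (simp add: norm_mult ennreal_mult')
      also have "\<dots> \<le> ennreal (cmod (f x)) * (\<integral>\<^sup>+y. ennreal (cmod (cnj (f y) * heat_kernel t (x - y))) \<partial>lebesgue)"
        by (intro mult_left_mono norm_integral_le_nn_integral) simp
      also have "\<dots> = (\<integral>\<^sup>+y. ennreal (cmod (f x)) * ennreal (cmod (cnj (f y) * heat_kernel t (x - y))) \<partial>lebesgue)"
        by (rule nn_integral_cmult[symmetric]) measurable
      also have "\<dots> \<le> (\<integral>\<^sup>+y. ennreal ((cmod (f x))\<^sup>2 / 2 * cmod (heat_kernel t (x - y))) + ennreal ((cmod (f y))\<^sup>2 / 2 * cmod (heat_kernel t (x - y))) \<partial>lebesgue)"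
      proof (rule nn_integral_mono)
        fix y
        have "cmod (f x) * cmod (f y) \<le> (cmod (f x))\<^sup>2 / 2 + (cmod (f y))\<^sup>2 / 2"
          using zero_le_power2[of "cmod (f x) - cmod (f y)"] unfolding power2_diff by simp
        then have "cmod (f x) * cmod (f y) * cmod (heat_kernel t (x - y))
          \<le> ((cmod (f x))\<^sup>2 / 2 + (cmod (f y))\<^sup>2 / 2) * cmod (heat_kernel t (x - y))"
          by (rule mult_right_mono) simp
        then show "ennreal (cmod (f x)) * ennreal (cmod (cnj (f y) * heat_kernel t (x - y)))
          \<le> ennreal ((cmod (f x))\<^sup>2 / 2 * cmod (heat_kernel t (x - y))) + ennreal ((cmod (f y))\<^sup>2 / 2 * cmod (heat_kernel t (x - y)))"
          by (simp add: norm_mult distrib_right mult.assoc flip: ennreal_mult' ennreal_plus)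
      qed
      finally show "ennreal (cmod (f x * (\<integral>y. cnj (f y) * heat_kernel t (x - y) \<partial>lebesgue)))
        \<le> (\<integral>\<^sup>+y. ennreal ((cmod (f x))\<^sup>2 / 2 * cmod (heat_kernel t (x - y))) + ennreal ((cmod (f y))\<^sup>2 / 2 * cmod (heat_kernel t (x - y))) \<partial>lebesgue)" .
    qed
    also have "\<dots> = (\<integral>\<^sup>+x. \<integral>\<^sup>+y. ennreal ((cmod (f x))\<^sup>2 / 2 * cmod (heat_kernel t (x - y))) \<partial>lebesgue \<partial>lebesgue)
        + (\<integral>\<^sup>+x. \<integral>\<^sup>+y. ennreal ((cmod (f y))\<^sup>2 / 2 * cmod (heat_kernel t (x - y))) \<partial>lebesgue \<partial>lebesgue)"
    proof -
      have [measurable]: "(\<lambda>x. \<integral>\<^sup>+y. ennreal ((cmod (f x))\<^sup>2 / 2 * cmod (heat_kernel t (x - y))) \<partial>lebesgue) \<in> borel_measurable lebesgue"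
        by (rule lebesgue.borel_measurable_nn_integral) (unfold case_prod_unfold, measurable)
      have [measurable]: "(\<lambda>x. \<integral>\<^sup>+y. ennreal ((cmod (f y))\<^sup>2 / 2 * cmod (heat_kernel t (x - y))) \<partial>lebesgue) \<in> borel_measurable lebesgue"
        by (rule lebesgue.borel_measurable_nn_integral) (unfold case_prod_unfold, measurable)
      have "(\<integral>\<^sup>+y. ennreal ((cmod (f x))\<^sup>2 / 2 * cmod (heat_kernel t (x - y))) + ennreal ((cmod (f y))\<^sup>2 / 2 * cmod (heat_kernel t (x - y))) \<partial>lebesgue)
         = (\<integral>\<^sup>+y. ennreal ((cmod (f x))\<^sup>2 / 2 * cmod (heat_kernel t (x - y))) \<partial>lebesgue) + (\<integral>\<^sup>+y. ennreal ((cmod (f y))\<^sup>2 / 2 * cmod (heat_kernel t (x - y))) \<partial>lebesgue)" for x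
        by (rule nn_integral_add) measurable
      then show ?thesis by (simp only:) (rule nn_integral_add; measurable)
    qed
    also have "\<dots> = (\<integral>\<^sup>+x. ennreal ((cmod (f x))\<^sup>2 / 2) \<partial>lebesgue) + (\<integral>\<^sup>+x. ennreal ((cmod (f x))\<^sup>2 / 2) \<partial>lebesgue)"
    proof -
      have m: "(\<lambda>x. (cmod (f x))\<^sup>2 / 2) \<in> borel_measurable lebesgue" by measurable
      show ?thesis
        using nn_integral_heat_kernel[OF t m] by (simp only: divide_nonneg_pos zero_le_power2 zero_less_numeral)
    qed
    also have "\<dots> = (\<integral>\<^sup>+x. ennreal ((cmod (f x))\<^sup>2 / 2) + ennreal ((cmod (f x))\<^sup>2 / 2) \<partial>lebesgue)"
      by (rule nn_integral_add[symmetric]) measurable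
    also have "\<dots> = (\<integral>\<^sup>+x. ennreal ((cmod (f x))\<^sup>2) \<partial>lebesgue)"
      by (simp flip: ennreal_plus)
    also have "\<dots> = ennreal ((norm (toL2 f))\<^sup>2)" by (rule nn_integral_norm_toL2[OF f2])
    finally show ?thesis .
  qed
  have le: "(\<integral>\<^sup>+\<xi>. ennreal ((cmod (fourier f \<xi>))\<^sup>2) \<partial>lebesgue) \<le> ennreal ((norm (toL2 f))\<^sup>2)"
  proof -
    have "ennreal ((cmod (fourier f \<xi>))\<^sup>2) = liminf (\<lambda>n. ennreal ((cmod (fourier f \<xi>))\<^sup>2 * cmod (gaussian (1 / real (Suc n)) \<xi>)))" for \<xi>
    proof (rule lim_imp_Liminf[symmetric, OF trivial_limit_sequentially])
      have "(\<lambda>n. cmod (gaussian (1 / real (Suc n)) \<xi>)) \<longlonglongrightarrow> exp (- (0 / 2) * (norm \<xi>)\<^sup>2)"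
        unfolding gaussian_def norm_of_real abs_exp_cancel
        by (intro tendsto_intros LIMSEQ_Suc[OF lim_1_over_n]) auto
      then have "(\<lambda>n. (cmod (fourier f \<xi>))\<^sup>2 * cmod (gaussian (1 / real (Suc n)) \<xi>)) \<longlonglongrightarrow> (cmod (fourier f \<xi>))\<^sup>2 * 1"
        by (intro tendsto_mult tendsto_const) simp
      then show "(\<lambda>n. ennreal ((cmod (fourier f \<xi>))\<^sup>2 * cmod (gaussian (1 / real (Suc n)) \<xi>))) \<longlonglongrightarrow> ennreal ((cmod (fourier f \<xi>))\<^sup>2)"
        by (intro tendsto_ennrealI) simp
    qed
    then have "(\<integral>\<^sup>+\<xi>. ennreal ((cmod (fourier f \<xi>))\<^sup>2) \<partial>lebesgue)
      = (\<integral>\<^sup>+\<xi>. liminf (\<lambda>n. ennreal ((cmod (fourier f \<xi>))\<^sup>2 * cmod (gaussian (1 / real (Suc n)) \<xi>))) \<partial>lebesgue)" by (simp only:)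
    also have "\<dots> \<le> liminf (\<lambda>n. \<integral>\<^sup>+\<xi>. ennreal ((cmod (fourier f \<xi>))\<^sup>2 * cmod (gaussian (1 / real (Suc n)) \<xi>)) \<partial>lebesgue)"
      by (rule nn_integral_liminf) measurable
    also have "\<dots> \<le> ennreal ((norm (toL2 f))\<^sup>2)"
      by (rule Liminf_le) (auto intro!: always_eventually bound simp del: of_nat_Suc)
    finally show ?thesis .
  qed
  show s: "square_integrable (fourier f)"
    using le by (subst square_integrable_iff_nn_integral) (auto intro: le_less_trans)
  show "norm (toL2 (fourier f)) \<le> norm (toL2 f)" by (rule norm_toL2_le[OF s le]) simp
qed

section \<open>The Fourier transform on the Hilbert space\<close>

lemma L1L2_diff: "L1L2 f \<Longrightarrow> L1L2 g \<Longrightarrow> L1L2 (\<lambda>x. f x - g x)"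
  unfolding L1L2_def using square_integrable_add[OF _ square_integrable_cmult[of g "-1"], of f] by simp

lemma toL2_diff:
  assumes f: "square_integrable f" and g: "square_integrable g"
  shows "toL2 (\<lambda>x. f x - g x) = toL2 f - toL2 g"
proof -
  have d: "square_integrable (\<lambda>x. f x - g x)"
    using square_integrable_add[OF f square_integrable_cmult[OF g, of "-1"]] by simp
  show ?thesis
    by (rule L2_eqI) (use fn_toL2[OF f] fn_toL2[OF g] fn_toL2[OF d] fn_diff[of "toL2 f" "toL2 g"] in \<open>eventually_elim, simp\<close>)
qed

lemma fourier_contraction_diff:
  assumes f: "L1L2 f" and g: "L1L2 g"
  shows "norm (toL2 (fourier f) - toL2 (fourier g)) \<le> norm (toL2 f - toL2 g)"
proof -
  have "fourier (\<lambda>x. f x - g x) = (\<lambda>x. fourier f x - fourier g x)"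
    by (intro ext fourier_diff L1L2D f g)
  then have "toL2 (fourier f) - toL2 (fourier g) = toL2 (fourier (\<lambda>x. f x - g x))"
    using toL2_diff[OF fourier_contraction(1)[OF f] fourier_contraction(1)[OF g]] by (simp only:)
  then show ?thesis
    using fourier_contraction(2)[OF L1L2_diff[OF f g]] toL2_diff[OF L1L2D(2)[OF f] L1L2D(2)[OF g]] by simp
qed

definition truncate :: "nat \<Rightarrow> 'a::euclidean_space L2 \<Rightarrow> 'a \<Rightarrow> complex" where
  "truncate n a x = indicator (cball 0 (real n)) x * fn a x"

lemma bounded_multiplier_indicator [simp]: "S \<in> sets lebesgue \<Longrightarrow> bounded_multiplier (indicator S)"
  by (rule bounded_multiplierI[of _ 1]) (auto simp: indicator_def)

lemma square_integrable_bounded_support: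
  fixes f :: "'a::euclidean_space \<Rightarrow> complex"
  assumes f: "square_integrable f" and S: "S \<in> sets lebesgue" "emeasure lebesgue S < \<infinity>"
  shows "L1L2 (\<lambda>x. indicator S x * f x)"
proof -
  have i: "square_integrable (indicator S :: 'a \<Rightarrow> complex)"
  proof -
    have "(\<lambda>x. (cmod (indicator S x :: complex))\<^sup>2) = indicat_real S" by (auto simp: indicator_def)
    then show ?thesis
      unfolding square_integrable_def using integrable_real_indicator[OF S] S(1) by simp
  qed
  show ?thesis unfolding L1L2_def
    using square_integrable_mult_integrable[OF i f] square_integrable_bounded_mult[of "indicator S" f 1] S f
    by (auto simp: indicator_def)
qed

lemma L1L2_truncate: "L1L2 (truncate n a)"
  unfolding truncate_def[abs_def]
  by (rule square_integrable_bounded_support) (auto simp: emeasure_lborel_cball_finite[unfolded infinity_ennreal_def])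

lemma toL2_truncate: "toL2 (truncate n a) = mult_op (indicator (cball 0 (real n))) a"
  unfolding mult_op_def truncate_def[abs_def] ..

lemma truncate_tendsto: "(\<lambda>n. toL2 (truncate n a)) \<longlonglongrightarrow> a"
proof -
  have one: "mult_op (\<lambda>x. 1) a = a" by (simp add: mult_op_def)
  have "(\<lambda>n. mult_op (indicator (cball 0 (real n))) a) \<longlonglongrightarrow> mult_op (\<lambda>x. 1) a"
  proof (rule mult_op_tendsto[where C = 1])
    show "bounded_multiplier (\<lambda>x::'a. 1)" by (rule bounded_multiplierI[of _ 1]) auto
    have "(\<lambda>n. indicator (cball 0 (real n)) x :: complex) \<longlonglongrightarrow> 1" for x :: 'a
    proof (rule tendsto_eventually)
      have "\<forall>\<^sub>F n in sequentially. norm x \<le> real n" using filterlim_real_sequentially unfolding filterlim_at_top by blast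
      then show "\<forall>\<^sub>F n in sequentially. indicator (cball 0 (real n)) x = (1 :: complex)"
        by eventually_elim (simp add: indicator_def)
    qed
    then show "AE x in lebesgue. (\<lambda>n. indicator (cball 0 (real n)) (x::'a) :: complex) \<longlonglongrightarrow> 1" by simp
  qed (auto simp: indicator_def)
  then show ?thesis unfolding one toL2_truncate .
qed

text \<open>The extension by continuity from truncations to balls.\<close>

definition FT :: "'a::euclidean_space L2 \<Rightarrow> 'a L2" where
  "FT a = lim (\<lambda>n. toL2 (fourier (truncate n a)))"

lemma FT_truncate: "(\<lambda>n. toL2 (fourier (truncate n a))) \<longlonglongrightarrow> FT a"
proof -
  have "Cauchy (\<lambda>n. toL2 (fourier (truncate n a)))"
  proof (rule metric_CauchyI)
    fix e :: real assume "e > 0"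
    then obtain M where M: "\<And>m n. m \<ge> M \<Longrightarrow> n \<ge> M \<Longrightarrow> dist (toL2 (truncate m a)) (toL2 (truncate n a)) < e"
      using LIMSEQ_imp_Cauchy[OF truncate_tendsto[of a]] unfolding Cauchy_def by blast
    show "\<exists>M. \<forall>m\<ge>M. \<forall>n\<ge>M. dist (toL2 (fourier (truncate m a))) (toL2 (fourier (truncate n a))) < e"
      using M fourier_contraction_diff[OF L1L2_truncate L1L2_truncate] unfolding dist_norm
      by (meson le_less_trans)
  qed
  then show ?thesis unfolding FT_def using Cauchy_convergent_iff convergent_LIMSEQ_iff by blast
qed

lemma FT_toL2:
  assumes f: "L1L2 f" shows "FT (toL2 f) = toL2 (fourier f)"
proof -
  have "(\<lambda>n. toL2 (fourier (truncate n (toL2 f))) - toL2 (fourier f)) \<longlonglongrightarrow> 0"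
  proof (rule Lim_null_comparison)
    show "\<forall>\<^sub>F n in sequentially. norm (toL2 (fourier (truncate n (toL2 f))) - toL2 (fourier f)) \<le> norm (toL2 (truncate n (toL2 f)) - toL2 f)"
      by (intro always_eventually allI fourier_contraction_diff L1L2_truncate f)
    show "(\<lambda>n. norm (toL2 (truncate n (toL2 f)) - toL2 f)) \<longlonglongrightarrow> 0"
      using truncate_tendsto[of "toL2 f"] by (simp add: tendsto_norm_zero_iff LIM_zero_iff)
  qed
  then show ?thesis using FT_truncate[of "toL2 f"] LIMSEQ_unique unfolding LIM_zero_iff by blast
qed

lemma norm_FT_diff_le: "norm (FT a - FT b) \<le> norm (a - b)"
proof (rule tendsto_le[OF trivial_limit_sequentially])
  show "(\<lambda>n. norm (toL2 (truncate n a) - toL2 (truncate n b))) \<longlonglongrightarrow> norm (a - b)"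
    by (intro tendsto_intros truncate_tendsto)
  show "(\<lambda>n. norm (toL2 (fourier (truncate n a)) - toL2 (fourier (truncate n b)))) \<longlonglongrightarrow> norm (FT a - FT b)"
    by (intro tendsto_intros FT_truncate)
  show "\<forall>\<^sub>F n in sequentially. norm (toL2 (fourier (truncate n a)) - toL2 (fourier (truncate n b))) \<le> norm (toL2 (truncate n a) - toL2 (truncate n b))"
    by (intro always_eventually allI fourier_contraction_diff L1L2_truncate)
qed

lemma FT_0: "FT 0 = 0"
proof -
  have "L1L2 (\<lambda>x::'a. 0)" by (simp add: L1L2_def square_integrable_zero)
  moreover have "fourier (\<lambda>x::'a. 0) = (\<lambda>x. 0)" by (simp add: fourier_def fun_eq_iff)
  ultimately show ?thesis using FT_toL2[of "\<lambda>x::'a. 0"] by (simp add: zero_L2_def)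
qed

lemma norm_FT_le: "norm (FT a) \<le> norm a"
  using norm_FT_diff_le[of a 0] by (simp add: FT_0)

lemma FT_tendsto:
  assumes "(\<lambda>n. f n) \<longlonglongrightarrow> a" shows "(\<lambda>n. FT (f n)) \<longlonglongrightarrow> FT a"
proof -
  have "(\<lambda>n. FT (f n) - FT a) \<longlonglongrightarrow> 0"
  proof (rule Lim_null_comparison)
    show "\<forall>\<^sub>F n in sequentially. norm (FT (f n) - FT a) \<le> norm (f n - a)"
      by (intro always_eventually allI norm_FT_diff_le)
    show "(\<lambda>n. norm (f n - a)) \<longlonglongrightarrow> 0"
      using assms by (simp add: tendsto_norm_zero_iff LIM_zero_iff)
  qed
  then show ?thesis by (simp add: LIM_zero_iff)
qed

text \<open>The multiplication formula, extended from truncations by continuity.\<close>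

lemma pairing_FT: "pairing (FT a) b = pairing a (FT b)"
proof -
  have 1: "pairing (FT (toL2 f)) (toL2 g) = pairing (toL2 f) (FT (toL2 g))" if f: "L1L2 f" and g: "L1L2 g" for f g :: "'a \<Rightarrow> complex"
    unfolding FT_toL2[OF f] FT_toL2[OF g]
    using fourier_multiplication_formula[OF L1L2D(1)[OF f] L1L2D(1)[OF g]]
      L1L2D(2)[OF f] L1L2D(2)[OF g] fourier_contraction(1)[OF f] fourier_contraction(1)[OF g]
    by (simp add: pairing_toL2)
  have "(\<lambda>n. pairing (FT (toL2 (truncate n a))) (toL2 (truncate n b))) \<longlonglongrightarrow> pairing (FT a) b"
    by (intro tendsto_pairing FT_tendsto truncate_tendsto)
  moreover have "(\<lambda>n. pairing (toL2 (truncate n a)) (FT (toL2 (truncate n b)))) \<longlonglongrightarrow> pairing a (FT b)"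
    by (intro tendsto_pairing FT_tendsto truncate_tendsto)
  ultimately show ?thesis unfolding 1[OF L1L2_truncate L1L2_truncate] by (rule LIMSEQ_unique)
qed

definition reflect :: "'a::euclidean_space L2 \<Rightarrow> 'a L2" where
  "reflect a = toL2 (\<lambda>x. fn a (- x))"

lemma square_integrable_reflect:
  assumes f: "square_integrable f" shows "square_integrable (\<lambda>x. f (- x))"
  using lebesgue_measurable_affine[of "-1" f 0] lebesgue_integrable_affine[of "-1" "\<lambda>x. (cmod (f x))\<^sup>2" 0] f
  unfolding square_integrable_def by simp

lemma fn_reflect: "AE x in lebesgue. fn (reflect a) x = fn a (- x)"
  unfolding reflect_def by (intro fn_toL2 square_integrable_reflect fn_square_integrable)

lemma norm_reflect: "norm (reflect a) = norm a"
proof -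
  have "(norm (reflect a))\<^sup>2 = (\<integral>x. (cmod (fn a (0 + -1 *\<^sub>R x)))\<^sup>2 \<partial>lebesgue)"
    unfolding reflect_def norm_toL2_power2[OF square_integrable_reflect[OF fn_square_integrable]] by simp
  also have "\<dots> = (norm a)\<^sup>2"
    unfolding norm_L2_power2 by (rule lebesgue_integral_affine[of "-1" "\<lambda>x. (cmod (fn a x))\<^sup>2"]) auto
  finally show ?thesis by simp
qed

lemma reflect_reflect: "reflect (reflect a) = a"
proof (rule L2_eqI)
  have "AE x in lebesgue. fn (reflect a) (0 + -1 *\<^sub>R x) = fn a (- (0 + -1 *\<^sub>R x))"
    by (rule lebesgue_AE_affine[OF _ fn_reflect]) simp
  then show "AE x in lebesgue. fn (reflect (reflect a)) x = fn a x"
    using fn_reflect[of "reflect a"] by eventually_elim simp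
qed

lemma L1L2_gaussian_translate:
  fixes y :: "'a::euclidean_space"
  assumes "t > 0" shows "L1L2 (\<lambda>x. gaussian t (x - y))"
  using assms by (intro L1L2_rapidly_decreasing schwartz_rapidly_decreasing schwartz_translate gaussian_schwartz)

text \<open>The first transform turns the translation into a modulation, the second one turns it back.\<close>

lemma FT_FT_gaussian:
  fixes y :: "'a::euclidean_space"
  assumes t: "t > 0"
  shows "FT (FT (toL2 (\<lambda>x. gaussian t (x - y)))) = toL2 (\<lambda>x. gaussian t (- x - y))"
proof -
  let ?s = "complex_of_real (t powr (- (real DIM('a) / 2)))"
  have 1: "fourier (\<lambda>x. gaussian t (x - y)) = (\<lambda>\<xi>. ?s * (exp (\<i> * complex_of_real (\<xi> \<bullet> (- y))) * gaussian (1 / t) \<xi>))"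
  proof
    fix \<xi>
    have "gaussian t \<in> borel_measurable lebesgue" by (intro measurable_completion) simp
    then show "fourier (\<lambda>x. gaussian t (x - y)) \<xi> = ?s * (exp (\<i> * complex_of_real (\<xi> \<bullet> (- y))) * gaussian (1 / t) \<xi>)"
      by (simp add: fourier_translate fourier_gaussian[OF t] inner_commute)
  qed
  have "L1L2 (\<lambda>\<xi>. exp (\<i> * complex_of_real (\<xi> \<bullet> (- y))) * gaussian (1 / t) \<xi>)"
    using t by (intro L1L2_rapidly_decreasing schwartz_rapidly_decreasing schwartz_modulate gaussian_schwartz) simp
  then have 2: "L1L2 (\<lambda>\<xi>. ?s * (exp (\<i> * complex_of_real (\<xi> \<bullet> (- y))) * gaussian (1 / t) \<xi>))"
    unfolding L1L2_def by (intro conjI integrable_mult_right square_integrable_cmult) auto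
  have "fourier (\<lambda>\<xi>. ?s * (exp (\<i> * complex_of_real (\<xi> \<bullet> (- y))) * gaussian (1 / t) \<xi>)) = (\<lambda>x. gaussian t (- x - y))"
  proof
    fix x :: 'a
    have "?s * complex_of_real ((1 / t) powr (- (real DIM('a) / 2))) = 1"
      using t unfolding of_real_mult[symmetric] by (simp flip: powr_mult)
    then show "fourier (\<lambda>\<xi>. ?s * (exp (\<i> * complex_of_real (\<xi> \<bullet> (- y))) * gaussian (1 / t) \<xi>)) x = gaussian t (- x - y)"
      unfolding fourier_cmult fourier_modulate using t
      by (simp add: fourier_gaussian mult.assoc[symmetric]) (simp add: gaussian_def norm_minus_commute[of "-x" y] add.commute)
  qed
  then show ?thesis
    using FT_toL2[OF L1L2_gaussian_translate[OF t, of y]] FT_toL2[OF 2] by (simp only: 1)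
qed

text \<open>Fourier inversion. Both sides have the same pairing with all translated Gaussians, because
  \<open>FT\<close> can be moved to the Gaussian, where the formula is explicit.\<close>

theorem FT_FT: "FT (FT a) = reflect a"
proof (rule L2_eqI)
  have "AE x in lebesgue. fn (FT (FT a) - reflect a) x = 0"
  proof (rule tempered_zero_of_gaussian_integrals)
    show "fn (FT (FT a) - reflect a) \<in> tempered" by (rule square_integrable_tempered) simp
    fix t :: real and y :: 'a assume t: "t > 0"
    let ?\<psi> = "\<lambda>x. gaussian t (x - y)"
    note \<psi> = L1L2D(2)[OF L1L2_gaussian_translate[OF t, of y]]
    have "(\<integral>x. fn (FT (FT a) - reflect a) x * ?\<psi> x \<partial>lebesgue) = pairing (FT (FT a) - reflect a) (toL2 ?\<psi>)"
      using pairing_toL2[OF fn_square_integrable \<psi>, of "FT (FT a) - reflect a"] by simp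
    also have "\<dots> = pairing (FT (FT a)) (toL2 ?\<psi>) - pairing (reflect a) (toL2 ?\<psi>)"
      by (rule bounded_bilinear.diff_left[OF bounded_bilinear_pairing])
    also have "pairing (FT (FT a)) (toL2 ?\<psi>) = pairing a (FT (FT (toL2 ?\<psi>)))" by (simp only: pairing_FT)
    also have "\<dots> = (\<integral>x. fn a x * gaussian t (- x - y) \<partial>lebesgue)"
      unfolding FT_FT_gaussian[OF t]
      using pairing_toL2[OF fn_square_integrable square_integrable_reflect[OF \<psi>], of a] by simp
    also have "\<dots> = (\<integral>x. fn a (0 + -1 *\<^sub>R x) * gaussian t (- (0 + -1 *\<^sub>R x) - y) \<partial>lebesgue)"
      by (rule lebesgue_integral_affine[symmetric]) (simp, measurable)
    also have "\<dots> = pairing (reflect a) (toL2 ?\<psi>)"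
      unfolding reflect_def using pairing_toL2[OF square_integrable_reflect[OF fn_square_integrable] \<psi>, of a] by simp
    finally show "(\<integral>x. fn (FT (FT a) - reflect a) x * ?\<psi> x \<partial>lebesgue) = 0" by simp
  qed
  then show "AE x in lebesgue. fn (FT (FT a)) x = fn (reflect a) x"
    using fn_diff[of "FT (FT a)" "reflect a"] by eventually_elim simp
qed

text \<open>A contraction whose square is an isometry is an isometry.\<close>

theorem norm_FT: "norm (FT a) = norm a"
  using norm_FT_le[of a] norm_FT_le[of "FT a"] by (simp add: FT_FT norm_reflect)

text \<open>The square of \<open>FT\<close> is an involution, so its third power is its inverse.\<close>

definition inverse_FT :: "'a::euclidean_space L2 \<Rightarrow> 'a L2" where
  "inverse_FT a = FT (FT (FT a))"

lemma FT_inverse_FT: "FT (inverse_FT a) = a"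
  by (simp add: inverse_FT_def FT_FT reflect_reflect)

lemma norm_inverse_FT: "norm (inverse_FT a) = norm a"
  by (simp add: inverse_FT_def norm_FT)

section \<open>Fourier transforms of tempered functions\<close>

lemma has_fourierD:
  assumes "has_fourier f g"
  shows "f \<in> tempered" "g \<in> tempered" "\<phi> \<in> schwartz \<Longrightarrow> (\<integral>x. f x * fourier \<phi> x \<partial>lebesgue) = (\<integral>\<xi>. g \<xi> * \<phi> \<xi> \<partial>lebesgue)"
  using assms by (auto simp: has_fourier_def)

lemma has_fourierI:
  assumes "f \<in> tempered" "g \<in> tempered" "\<And>\<phi>. \<phi> \<in> schwartz \<Longrightarrow> (\<integral>x. f x * fourier \<phi> x \<partial>lebesgue) = (\<integral>\<xi>. g \<xi> * \<phi> \<xi> \<partial>lebesgue)"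
  shows "has_fourier f g"
  using assms by (auto simp: has_fourier_def)

lemma has_fourier_integrable:
  assumes "has_fourier f g" "\<phi> \<in> schwartz"
  shows "integrable lebesgue (\<lambda>x. f x * fourier \<phi> x)" "integrable lebesgue (\<lambda>x. g x * \<phi> x)"
  by (rule tempered_times_rapidly_decreasing[OF has_fourierD(1)[OF assms(1)] fourier_schwartz_rapidly_decreasing[OF assms(2)]],
      rule tempered_times_rapidly_decreasing[OF has_fourierD(2)[OF assms(1)] schwartz_rapidly_decreasing[OF assms(2)]])

lemma tempered_cong_AE:
  fixes f :: "'a::euclidean_space \<Rightarrow> complex"
  assumes f: "f \<in> tempered" and [measurable]: "f' \<in> borel_measurable lebesgue" and eq: "AE x in lebesgue. f x = f' x"
  shows "f' \<in> tempered"
proof -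
  note [measurable] = tempered_measurable[OF f]
  obtain N where "integrable lebesgue (\<lambda>x. f x / polynomial_weight N x)" using f unfolding tempered_iff by blast
  also have "integrable lebesgue (\<lambda>x. f x / polynomial_weight N x) \<longleftrightarrow> integrable lebesgue (\<lambda>x. f' x / polynomial_weight N x)"
    by (rule integrable_cong_AE) (measurable, measurable, use eq in \<open>eventually_elim, simp\<close>)
  finally show ?thesis unfolding tempered_iff by blast
qed

lemma has_fourier_cong_AE:
  fixes f :: "'a::euclidean_space \<Rightarrow> complex"
  assumes F: "has_fourier f g" and [measurable]: "f' \<in> borel_measurable lebesgue" "g' \<in> borel_measurable lebesgue"
    and f: "AE x in lebesgue. f x = f' x" and g: "AE x in lebesgue. g x = g' x"
  shows "has_fourier f' g'"
proof (rule has_fourierI)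
  note [measurable] = tempered_measurable[OF has_fourierD(1)[OF F]] tempered_measurable[OF has_fourierD(2)[OF F]]
  show "f' \<in> tempered" by (rule tempered_cong_AE[OF has_fourierD(1)[OF F] _ f]) measurable
  show "g' \<in> tempered" by (rule tempered_cong_AE[OF has_fourierD(2)[OF F] _ g]) measurable
  fix \<phi> :: "'a \<Rightarrow> complex" assume \<phi>: "\<phi> \<in> schwartz"
  note [measurable] = rapidly_decreasingD[OF schwartz_rapidly_decreasing[OF \<phi>]]
    rapidly_decreasingD[OF fourier_schwartz_rapidly_decreasing[OF \<phi>]]
  have "(\<integral>x. f' x * fourier \<phi> x \<partial>lebesgue) = (\<integral>x. f x * fourier \<phi> x \<partial>lebesgue)"
    by (rule integral_cong_AE) (measurable, measurable, use f in \<open>eventually_elim, simp\<close>)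
  also have "\<dots> = (\<integral>\<xi>. g \<xi> * \<phi> \<xi> \<partial>lebesgue)" by (rule has_fourierD(3)[OF F \<phi>])
  also have "\<dots> = (\<integral>\<xi>. g' \<xi> * \<phi> \<xi> \<partial>lebesgue)"
    by (rule integral_cong_AE) (measurable, measurable, use g in \<open>eventually_elim, simp\<close>)
  finally show "(\<integral>x. f' x * fourier \<phi> x \<partial>lebesgue) = (\<integral>\<xi>. g' \<xi> * \<phi> \<xi> \<partial>lebesgue)" .
qed

lemma has_fourier_add:
  fixes f :: "'a::euclidean_space \<Rightarrow> complex"
  assumes F: "has_fourier f g" and F': "has_fourier f' g'"
  shows "has_fourier (\<lambda>x. f x + f' x) (\<lambda>x. g x + g' x)"
proof (rule has_fourierI)
  fix \<phi> :: "'a \<Rightarrow> complex" assume \<phi>: "\<phi> \<in> schwartz"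
  show "(\<integral>x. (f x + f' x) * fourier \<phi> x \<partial>lebesgue) = (\<integral>\<xi>. (g \<xi> + g' \<xi>) * \<phi> \<xi> \<partial>lebesgue)"
    using has_fourier_integrable[OF F \<phi>] has_fourier_integrable[OF F' \<phi>] has_fourierD(3)[OF F \<phi>] has_fourierD(3)[OF F' \<phi>]
    by (simp add: distrib_right)
qed (intro tempered_add has_fourierD(1)[OF F] has_fourierD(1)[OF F'], intro tempered_add has_fourierD(2)[OF F] has_fourierD(2)[OF F'])

lemma has_fourier_uminus:
  fixes f :: "'a::euclidean_space \<Rightarrow> complex"
  assumes F: "has_fourier f g" shows "has_fourier (\<lambda>x. - f x) (\<lambda>x. - g x)"
proof (rule has_fourierI)
  show "(\<lambda>x. - f x) \<in> tempered" "(\<lambda>x. - g x) \<in> tempered"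
    using tempered_bounded_mult[OF has_fourierD(1)[OF F], of "\<lambda>x. -1" 1]
      tempered_bounded_mult[OF has_fourierD(2)[OF F], of "\<lambda>x. -1" 1] by simp_all
qed (simp add: has_fourierD(3)[OF F])

lemma has_fourier_diff:
  assumes "has_fourier f g" "has_fourier f' g'"
  shows "has_fourier (\<lambda>x. f x - f' x) (\<lambda>x. g x - g' x)"
  using has_fourier_add[OF assms(1) has_fourier_uminus[OF assms(2)]] by simp

lemma tempered_translate:
  fixes f :: "'a::euclidean_space \<Rightarrow> complex"
  assumes f: "f \<in> tempered" shows "(\<lambda>x. f (x - y)) \<in> tempered"
proof -
  obtain N where N: "integrable lebesgue (\<lambda>x. f x / polynomial_weight N x)" using f unfolding tempered_iff by blast
  have [measurable]: "(\<lambda>x. f (x - y)) \<in> borel_measurable lebesgue"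
    using lebesgue_measurable_affine[of 1 f "-y"] tempered_measurable[OF f] by simp
  have "integrable lebesgue (\<lambda>x. f (x - y) / polynomial_weight N x)"
  proof (rule Bochner_Integration.integrable_bound)
    have "integrable lebesgue (\<lambda>x. f (x - y) / polynomial_weight N (x - y))"
      using lebesgue_integrable_affine[OF _ N, of 1 "-y"] by simp
    then show "integrable lebesgue (\<lambda>x. complex_of_real ((1 + norm y) ^ N) * (f (x - y) / polynomial_weight N (x - y)))"
      by (rule integrable_mult_right)
    have "norm (f (x - y) / polynomial_weight N x) \<le> norm (complex_of_real ((1 + norm y) ^ N) * (f (x - y) / polynomial_weight N (x - y)))" for x
    proof -
      have "1 + norm (x - y) \<le> (1 + norm y) * (1 + norm x)"
        using norm_triangle_ineq4[of x y] mult_nonneg_nonneg[OF norm_ge_zero[of y] norm_ge_zero[of x]]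
        unfolding distrib_left distrib_right mult_1 mult_1_right by linarith
      then have "(1 + norm (x - y)) ^ N \<le> ((1 + norm y) * (1 + norm x)) ^ N" by (intro power_mono) auto
      then have le: "(1 + norm (x - y)) ^ N \<le> (1 + norm y) ^ N * (1 + norm x) ^ N" unfolding power_mult_distrib .
      have "cmod (f (x - y)) * (1 + norm (x - y)) ^ N \<le> cmod (f (x - y)) * ((1 + norm y) ^ N * (1 + norm x) ^ N)"
        by (rule mult_left_mono[OF le]) simp
      moreover have "\<bar>(1 + norm y) ^ N\<bar> = (1 + norm y) ^ N" using polynomial_weight(2)[of y N] by simp
      ultimately show ?thesis
        using polynomial_weight(2)[of x N] polynomial_weight(2)[of "x - y" N]
        unfolding norm_mult norm_divide polynomial_weight(1) norm_of_real by (simp add: field_simps)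
    qed
    then show "AE x in lebesgue. norm (f (x - y) / polynomial_weight N x) \<le> norm (complex_of_real ((1 + norm y) ^ N) * (f (x - y) / polynomial_weight N (x - y)))"
      by simp
  qed measurable
  then show ?thesis unfolding tempered_iff by blast
qed

lemma character_measurable: "(\<lambda>\<xi>. exp (\<i> * complex_of_real (\<xi> \<bullet> a))) \<in> borel_measurable lebesgue"
proof -
  have "(\<lambda>\<xi>. exp (\<i> * complex_of_real (\<xi> \<bullet> a))) \<in> borel_measurable borel"
    by (intro borel_measurable_continuous_onI continuous_intros)
  then show ?thesis by (intro measurable_completion) simp
qed

lemma has_fourier_translate:
  fixes f :: "'a::euclidean_space \<Rightarrow> complex"
  assumes F: "has_fourier f g"
  shows "has_fourier (\<lambda>x. f (x - y)) (\<lambda>\<xi>. exp (\<i> * complex_of_real (\<xi> \<bullet> (- y))) * g \<xi>)"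
proof (rule has_fourierI)
  show "(\<lambda>x. f (x - y)) \<in> tempered" by (rule tempered_translate[OF has_fourierD(1)[OF F]])
  show "(\<lambda>\<xi>. exp (\<i> * complex_of_real (\<xi> \<bullet> (- y))) * g \<xi>) \<in> tempered"
    by (rule tempered_bounded_mult[OF has_fourierD(2)[OF F] character_measurable, of _ 1]) simp
  fix \<phi> :: "'a \<Rightarrow> complex" assume \<phi>: "\<phi> \<in> schwartz"
  define \<psi> where "\<psi> \<xi> = exp (\<i> * complex_of_real (\<xi> \<bullet> (- y))) * \<phi> \<xi>" for \<xi>
  have \<psi>: "\<psi> \<in> schwartz" unfolding \<psi>_def by (rule schwartz_modulate[OF \<phi>])
  have [measurable]: "(\<lambda>x. f (x - y)) \<in> borel_measurable lebesgue"
    by (rule tempered_measurable[OF tempered_translate[OF has_fourierD(1)[OF F]]])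
  note [measurable] = rapidly_decreasingD[OF fourier_schwartz_rapidly_decreasing[OF \<phi>]]
  have "(\<integral>x. f (x - y) * fourier \<phi> x \<partial>lebesgue) = (\<integral>x. f (y + 1 *\<^sub>R x - y) * fourier \<phi> (y + 1 *\<^sub>R x) \<partial>lebesgue)"
    by (rule lebesgue_integral_affine[symmetric]) (simp, measurable)
  also have "\<dots> = (\<integral>x. f x * fourier \<psi> x \<partial>lebesgue)"
    unfolding \<psi>_def fourier_modulate by (simp add: add.commute)
  also have "\<dots> = (\<integral>\<xi>. g \<xi> * \<psi> \<xi> \<partial>lebesgue)" by (rule has_fourierD(3)[OF F \<psi>])
  also have "\<dots> = (\<integral>\<xi>. exp (\<i> * complex_of_real (\<xi> \<bullet> (- y))) * g \<xi> * \<phi> \<xi> \<partial>lebesgue)"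
    unfolding \<psi>_def by (simp only: mult_ac)
  finally show "(\<integral>x. f (x - y) * fourier \<phi> x \<partial>lebesgue) = (\<integral>\<xi>. exp (\<i> * complex_of_real (\<xi> \<bullet> (- y))) * g \<xi> * \<phi> \<xi> \<partial>lebesgue)" .
qed

theorem has_fourier_unique:
  fixes f :: "'a::euclidean_space \<Rightarrow> complex"
  assumes F: "has_fourier f g" and F': "has_fourier f g'"
  shows "AE \<xi> in lebesgue. g \<xi> = g' \<xi>"
proof -
  have D: "has_fourier (\<lambda>x. f x - f x) (\<lambda>x. g x - g' x)" by (rule has_fourier_diff[OF F F'])
  have "AE \<xi> in lebesgue. g \<xi> - g' \<xi> = 0"
  proof (rule tempered_zero_of_gaussian_integrals[OF has_fourierD(2)[OF D]])
    fix t :: real and y :: 'a assume "t > 0"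
    then have "(\<lambda>x. gaussian t (x - y)) \<in> schwartz" by (intro schwartz_translate gaussian_schwartz)
    from has_fourierD(3)[OF D this] show "(\<integral>x. (g x - g' x) * gaussian t (x - y) \<partial>lebesgue) = 0" by simp
  qed
  then show ?thesis by simp
qed

text \<open>The test functions are modulated Gaussians, whose transforms are multiples of translated
  Gaussians.\<close>

theorem has_fourier_unique_inverse:
  fixes f :: "'a::euclidean_space \<Rightarrow> complex"
  assumes F: "has_fourier f g" and F': "has_fourier f' g"
  shows "AE x in lebesgue. f x = f' x"
proof -
  have D: "has_fourier (\<lambda>x. f x - f' x) (\<lambda>x. g x - g x)" by (rule has_fourier_diff[OF F F'])
  have "AE x in lebesgue. f x - f' x = 0"
  proof (rule tempered_zero_of_gaussian_integrals[OF has_fourierD(1)[OF D]])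
    fix t :: real and y :: 'a assume t: "t > 0"
    then have "(\<lambda>x. exp (\<i> * complex_of_real (x \<bullet> y)) * gaussian (1 / t) x) \<in> schwartz"
      by (intro schwartz_modulate gaussian_schwartz) simp
    from has_fourierD(3)[OF D this]
    have "(\<integral>x. (f x - f' x) * (complex_of_real ((1 / t) powr (- (real DIM('a) / 2))) * gaussian t (x - y)) \<partial>lebesgue) = 0"
      unfolding fourier_modulate using t by (simp add: fourier_gaussian)
    then show "(\<integral>x. (f x - f' x) * gaussian t (x - y) \<partial>lebesgue) = 0"
      using t unfolding mult.left_commute[of _ "complex_of_real ((1 / t) powr - (real DIM('a) / 2))"] integral_mult_right_zero
      by simp
  qed
  then show ?thesis by simp
qed

lemma has_fourier_L2:
  fixes f :: "'a::euclidean_space \<Rightarrow> complex"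
  assumes f: "square_integrable f"
  shows "has_fourier f (fn (FT (toL2 f)))"
proof (rule has_fourierI)
  show "f \<in> tempered" by (rule square_integrable_tempered[OF f])
  show "fn (FT (toL2 f)) \<in> tempered" by (rule square_integrable_tempered) simp
  fix \<phi> :: "'a \<Rightarrow> complex" assume \<phi>: "\<phi> \<in> schwartz"
  have L: "L1L2 \<phi>" by (intro L1L2_rapidly_decreasing schwartz_rapidly_decreasing \<phi>)
  have "(\<integral>x. f x * fourier \<phi> x \<partial>lebesgue) = pairing (toL2 f) (FT (toL2 \<phi>))"
    unfolding FT_toL2[OF L] by (rule pairing_toL2[OF f fourier_contraction(1)[OF L], symmetric])
  also have "\<dots> = pairing (FT (toL2 f)) (toL2 \<phi>)" by (rule pairing_FT[symmetric])
  also have "\<dots> = (\<integral>\<xi>. fn (FT (toL2 f)) \<xi> * \<phi> \<xi> \<partial>lebesgue)"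
    using pairing_toL2[OF fn_square_integrable L1L2D(2)[OF L], of "FT (toL2 f)"] by simp
  finally show "(\<integral>x. f x * fourier \<phi> x \<partial>lebesgue) = (\<integral>\<xi>. fn (FT (toL2 f)) \<xi> * \<phi> \<xi> \<partial>lebesgue)" .
qed

lemma has_fourier_inverse_FT: "has_fourier (fn (inverse_FT a)) (fn a)"
  using has_fourier_L2[OF fn_square_integrable, of "inverse_FT a"] by (simp add: FT_inverse_FT)

lemma fourier_inversion_schwartz:
  assumes \<phi>: "\<phi> \<in> schwartz" shows "AE x in lebesgue. fourier (fourier \<phi>) (- x) = \<phi> x"
proof -
  note L = L1L2_rapidly_decreasing[OF schwartz_rapidly_decreasing[OF \<phi>]]
  note L' = L1L2_rapidly_decreasing[OF fourier_schwartz_rapidly_decreasing[OF \<phi>]]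
  have "toL2 (fourier (fourier \<phi>)) = reflect (toL2 \<phi>)"
    using FT_FT[of "toL2 \<phi>"] unfolding FT_toL2[OF L] FT_toL2[OF L'] .
  then have "AE x in lebesgue. fourier (fourier \<phi>) x = fn (reflect (toL2 \<phi>)) x"
    using fn_toL2[OF fourier_contraction(1)[OF L']] by (auto elim: eventually_mono)
  from lebesgue_AE_affine[OF _ this, of "-1" 0]
  have "AE x in lebesgue. fourier (fourier \<phi>) (- x) = fn (reflect (toL2 \<phi>)) (- x)" by simp
  moreover from lebesgue_AE_affine[OF _ fn_reflect[of "toL2 \<phi>"], of "-1" 0]
  have "AE x in lebesgue. fn (reflect (toL2 \<phi>)) (- x) = fn (toL2 \<phi>) x" by simp
  moreover note fn_toL2[OF L1L2D(2)[OF L]]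
  ultimately show ?thesis by eventually_elim simp
qed

lemma fourier_reflect:
  assumes f: "f \<in> borel_measurable lebesgue" shows "fourier (\<lambda>x. f (- x)) \<xi> = fourier f (- \<xi>)"
proof -
  note [measurable] = f
  have "(\<integral>x. exp (- \<i> * complex_of_real ((0 + -1 *\<^sub>R x) \<bullet> (- \<xi>))) * f (0 + -1 *\<^sub>R x) \<partial>lebesgue)
     = (\<integral>x. exp (- \<i> * complex_of_real (x \<bullet> (- \<xi>))) * f x \<partial>lebesgue)"
    by (rule lebesgue_integral_affine) (simp, measurable)
  then show ?thesis unfolding fourier_eq by simp
qed

lemma bounded_tempered:
  fixes f :: "'a::euclidean_space \<Rightarrow> complex"
  assumes [measurable]: "f \<in> borel_measurable lebesgue" and C: "\<And>x. cmod (f x) \<le> C"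
  shows "f \<in> tempered"
proof -
  have "integrable lebesgue (\<lambda>x. f x / polynomial_weight (2 * DIM('a)) x)"
  proof (rule Bochner_Integration.integrable_bound)
    show "integrable lebesgue (\<lambda>x::'a. C * (1 / (1 + norm x) ^ (2 * DIM('a))))"
      by (intro integrable_mult_right integrable_inverse_one_plus_norm)
    have "norm (f x / polynomial_weight (2 * DIM('a)) x) \<le> norm (C * (1 / (1 + norm x) ^ (2 * DIM('a))))" for x
    proof -
      have "0 \<le> C" using C[of x] norm_ge_zero order_trans by blast
      then show ?thesis using C[of x] polynomial_weight(2)[of x "2 * DIM('a)"]
        by (simp add: norm_divide polynomial_weight(1) divide_right_mono)
    qed
    then show "AE x in lebesgue. norm (f x / polynomial_weight (2 * DIM('a)) x) \<le> norm (C * (1 / (1 + norm x) ^ (2 * DIM('a))))" by simp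
  qed measurable
  then show ?thesis unfolding tempered_iff by blast
qed

text \<open>By the multiplication formula this is Fourier inversion for Schwartz functions, in the almost
  everywhere form that follows from \<open>FT_FT\<close>.\<close>

lemma has_fourier_L1:
  fixes g :: "'a::euclidean_space \<Rightarrow> complex"
  assumes g: "integrable lebesgue g"
  shows "has_fourier (\<lambda>x. fourier g (- x)) g"
proof (rule has_fourierI)
  note [measurable] = borel_measurable_integrable[OF g] fourier_measurable[OF borel_measurable_integrable[OF g]]
  have m [measurable]: "(\<lambda>x. fourier g (- x)) \<in> borel_measurable lebesgue"
    using lebesgue_measurable_affine[of "-1" "fourier g" 0] by simp
  show "(\<lambda>x. fourier g (- x)) \<in> tempered" by (rule bounded_tempered[OF m norm_fourier_le[OF g]])
  show "g \<in> tempered" by (rule integrable_tempered[OF g])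
  fix \<phi> :: "'a \<Rightarrow> complex" assume \<phi>: "\<phi> \<in> schwartz"
  note r = fourier_schwartz_rapidly_decreasing[OF \<phi>]
  note [measurable] = rapidly_decreasingD[OF r] rapidly_decreasingD[OF schwartz_rapidly_decreasing[OF \<phi>]]
  have i: "integrable lebesgue (\<lambda>x. fourier \<phi> (- x))"
    using lebesgue_integrable_affine[OF _ L1L2D(1)[OF L1L2_rapidly_decreasing[OF r]], of "-1" 0] by simp
  note [measurable] = borel_measurable_integrable[OF i] fourier_measurable[OF borel_measurable_integrable[OF i]]
  have "(\<integral>x. fourier g (- x) * fourier \<phi> x \<partial>lebesgue) = (\<integral>x. fourier g (- (0 + -1 *\<^sub>R x)) * fourier \<phi> (0 + -1 *\<^sub>R x) \<partial>lebesgue)"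
    by (rule lebesgue_integral_affine[symmetric]) (simp, measurable)
  also have "\<dots> = (\<integral>x. fourier g x * fourier \<phi> (- x) \<partial>lebesgue)" by simp
  also have "\<dots> = (\<integral>x. g x * fourier (\<lambda>x. fourier \<phi> (- x)) x \<partial>lebesgue)"
    by (rule fourier_multiplication_formula[OF g i])
  also have "\<dots> = (\<integral>x. g x * \<phi> x \<partial>lebesgue)"
  proof (rule integral_cong_AE)
    show "AE x in lebesgue. g x * fourier (\<lambda>x. fourier \<phi> (- x)) x = g x * \<phi> x"
      using fourier_inversion_schwartz[OF \<phi>]
      by eventually_elim (simp add: fourier_reflect rapidly_decreasingD[OF r])
  qed measurable
  finally show "(\<integral>x. fourier g (- x) * fourier \<phi> x \<partial>lebesgue) = (\<integral>x. g x * \<phi> x \<partial>lebesgue)" .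
qed

section \<open>Homogeneous Sobolev norms on the Fourier side\<close>

lemma nn_integral_powr_2: "(\<integral>\<^sup>+ x. ennreal (norm (f x) powr 2) \<partial>lebesgue) = (\<integral>\<^sup>+ x. ennreal ((cmod (f x))\<^sup>2) \<partial>lebesgue)"
  by (intro nn_integral_cong) (simp add: powr_numeral)

lemma Lp_space_2_iff: "h \<in> Lp_space 2 \<longleftrightarrow> square_integrable h"
proof (cases "h \<in> borel_measurable lebesgue")
  case True
  then show ?thesis
    unfolding Lp_space_def Lp_norm_def Let_def nn_integral_powr_2 square_integrable_iff_nn_integral[OF True]
    by (auto simp: less_top split: if_splits)
qed (auto simp: Lp_space_def square_integrable_def)

lemma Lp_norm_2:
  assumes h: "square_integrable h" shows "Lp_norm 2 h = ennreal (norm (toL2 h))"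
  unfolding Lp_norm_def Let_def nn_integral_powr_2 nn_integral_norm_toL2[OF h]
  by (simp add: powr_half_sqrt)

text \<open>A function with Fourier transform \<open>g\<close> belongs to both Sobolev spaces iff
  \<open>G = sobolev_weight \<gamma> * g\<close> is square integrable. The whole argument takes place in the Hilbert
  space of these \<open>G\<close>; \<open>frequency_side \<gamma> G\<close> recovers \<open>g\<close>, and the two Sobolev norms are the norms
  of \<open>G\<close> multiplied by the two functions \<open>symbol \<gamma> s\<close> with \<open>s \<in> {\<gamma>, 2}\<close>, which are bounded by
  one and add up to one. The origin, where the weight vanishes, is a null set.\<close>

definition sobolev_weight :: "real \<Rightarrow> 'a::euclidean_space \<Rightarrow> complex" where
  "sobolev_weight \<gamma> \<xi> = complex_of_real (norm \<xi> powr \<gamma> + norm \<xi> powr 2)"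

definition symbol :: "real \<Rightarrow> real \<Rightarrow> 'a::euclidean_space \<Rightarrow> complex" where
  "symbol \<gamma> s \<xi> = complex_of_real (norm \<xi> powr s) / sobolev_weight \<gamma> \<xi>"

definition frequency_side :: "real \<Rightarrow> 'a::euclidean_space L2 \<Rightarrow> 'a \<Rightarrow> complex" where
  "frequency_side \<gamma> G \<xi> = fn G \<xi> / sobolev_weight \<gamma> \<xi>"

lemma sobolev_weight_measurable [measurable]: "sobolev_weight \<gamma> \<in> borel_measurable lebesgue"
  unfolding sobolev_weight_def by measurable

lemma frequency_side_measurable [measurable]: "frequency_side \<gamma> G \<in> borel_measurable lebesgue"
  unfolding frequency_side_def[abs_def] by measurable

lemma cmod_sobolev_weight: "cmod (sobolev_weight \<gamma> \<xi>) = norm \<xi> powr \<gamma> + norm \<xi> powr 2"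
  unfolding sobolev_weight_def norm_of_real by (simp add: add_nonneg_nonneg)

lemma sobolev_weight_nonzero: "\<xi> \<noteq> 0 \<Longrightarrow> sobolev_weight \<gamma> \<xi> \<noteq> 0"
  using cmod_sobolev_weight[of \<gamma> \<xi>] by (auto simp: add_pos_nonneg add_nonneg_eq_0_iff)

lemma AE_nonzero: "AE \<xi> in lebesgue. (\<xi> :: 'a::euclidean_space) \<noteq> 0"
proof -
  have "{0::'a} \<in> null_sets lebesgue" using negligible_sing[of "0::'a"] negligible_iff_null_sets by blast
  from AE_not_in[OF this] show ?thesis by simp
qed

lemma cmod_symbol_le_1: "s \<in> {\<gamma>, 2} \<Longrightarrow> cmod (symbol \<gamma> s \<xi>) \<le> 1"
proof (cases "\<xi> = 0")
  case False
  then have "0 < norm \<xi> powr \<gamma> + norm \<xi> powr 2" by (simp add: add_pos_nonneg)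
  moreover assume "s \<in> {\<gamma>, 2}"
  ultimately show ?thesis unfolding symbol_def norm_divide cmod_sobolev_weight by (auto simp: divide_le_eq_1)
qed (simp add: symbol_def sobolev_weight_def)

lemma symbol_bounded_multiplier:
  assumes "s \<in> {\<gamma>, 2}" shows "bounded_multiplier (symbol \<gamma> s)"
proof (rule bounded_multiplierI[OF _ cmod_symbol_le_1[OF assms]])
  show "symbol \<gamma> s \<in> borel_measurable lebesgue" unfolding symbol_def[abs_def] by measurable
qed

text \<open>The two memberships come with Fourier transforms that agree almost everywhere by uniqueness,
  so that the two square integrable multiples of them can be added.\<close>

lemma Hdot_frequency_side:
  fixes f :: "'a::euclidean_space \<Rightarrow> complex"
  assumes "f \<in> Hdot \<gamma>" "f \<in> Hdot 2"
  obtains G where "has_fourier f (frequency_side \<gamma> G)"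
proof -
  obtain h g where h: "h \<in> Lp_space 2" and g: "has_fourier f g"
    and hg: "has_fourier h (\<lambda>\<xi>. complex_of_real (norm \<xi> powr \<gamma>) * g \<xi>)"
    using assms(1) unfolding Hdot_def has_nabla_pow_def by blast
  obtain h' g' where h': "h' \<in> Lp_space 2" and g': "has_fourier f g'"
    and hg': "has_fourier h' (\<lambda>\<xi>. complex_of_real (norm \<xi> powr 2) * g' \<xi>)"
    using assms(2) unfolding Hdot_def has_nabla_pow_def by blast
  note [measurable] = tempered_measurable[OF has_fourierD(2)[OF g]] tempered_measurable[OF has_fourierD(1)[OF g]]
  have 1: "AE \<xi> in lebesgue. complex_of_real (norm \<xi> powr \<gamma>) * g \<xi> = fn (FT (toL2 h)) \<xi>"
    using has_fourier_unique[OF hg has_fourier_L2] h by (simp add: Lp_space_2_iff)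
  have 2: "AE \<xi> in lebesgue. complex_of_real (norm \<xi> powr 2) * g' \<xi> = fn (FT (toL2 h')) \<xi>"
    using has_fourier_unique[OF hg' has_fourier_L2] h' by (simp add: Lp_space_2_iff)
  define G where "G = FT (toL2 h) + FT (toL2 h')"
  have "AE \<xi> in lebesgue. g \<xi> = frequency_side \<gamma> G \<xi>"
    using 1 2 has_fourier_unique[OF g g'] fn_add[of "FT (toL2 h)" "FT (toL2 h')"] AE_nonzero
  proof eventually_elim
    case (elim \<xi>)
    have "fn G \<xi> = sobolev_weight \<gamma> \<xi> * g \<xi>"
      using elim(1-4) unfolding G_def sobolev_weight_def by (simp add: distrib_right)
    then show ?case unfolding frequency_side_def using sobolev_weight_nonzero[OF elim(5), of \<gamma>] by simp
  qed
  then have "has_fourier f (frequency_side \<gamma> G)"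
    by (rule has_fourier_cong_AE[OF g tempered_measurable[OF has_fourierD(1)[OF g]] frequency_side_measurable AE_I2[OF refl]])
  then show thesis by (rule that)
qed

text \<open>The norm is defined through a choice of \<open>|\<nabla>|\<^sup>s f\<close>; uniqueness in both directions makes it
  independent of the choice, and Plancherel moves it to the frequency side.\<close>

lemma
  fixes f :: "'a::euclidean_space \<Rightarrow> complex"
  assumes f: "has_fourier f (frequency_side \<gamma> G)" and s: "s \<in> {\<gamma>, 2}"
  shows frequency_side_Hdot: "f \<in> Hdot s"
    and frequency_side_Hdot_norm: "Hdot_norm s f = norm (mult_op (symbol \<gamma> s) G)"
proof -
  define k where "k = mult_op (symbol \<gamma> s) G"
  have k: "AE \<xi> in lebesgue. fn k \<xi> = complex_of_real (norm \<xi> powr s) * frequency_side \<gamma> G \<xi>"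
    using fn_mult_op[OF symbol_bounded_multiplier[OF s], of G] unfolding k_def
    by eventually_elim (simp add: symbol_def frequency_side_def)
  define h where "h = fn (inverse_FT k)"
  have h: "square_integrable h" unfolding h_def by simp
  have "has_fourier h (\<lambda>\<xi>. complex_of_real (norm \<xi> powr s) * frequency_side \<gamma> G \<xi>)"
    unfolding h_def by (rule has_fourier_cong_AE[OF has_fourier_inverse_FT _ _ _ k]) (auto, measurable)
  with f have hn: "has_nabla_pow s f h" unfolding has_nabla_pow_def by blast
  then show "f \<in> Hdot s" unfolding Hdot_def using h Lp_space_2_iff by blast
  define h' where "h' = nabla_pow s f"
  have "has_nabla_pow s f h'" unfolding h'_def nabla_pow_def by (rule someI[of "has_nabla_pow s f", OF hn])
  then obtain g where g: "has_fourier f g" and h'g: "has_fourier h' (\<lambda>\<xi>. complex_of_real (norm \<xi> powr s) * g \<xi>)"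
    unfolding has_nabla_pow_def by blast
  have "AE \<xi> in lebesgue. complex_of_real (norm \<xi> powr s) * g \<xi> = fn k \<xi>"
    using has_fourier_unique[OF g f] k by eventually_elim simp
  then have "has_fourier h' (fn k)"
    using has_fourier_cong_AE[OF h'g tempered_measurable[OF has_fourierD(1)[OF h'g]], of "fn k"] by simp
  from has_fourier_unique_inverse[OF this has_fourier_inverse_FT]
  have ae: "AE x in lebesgue. h' x = h x" unfolding h_def .
  have "Lp_norm 2 h' = Lp_norm 2 h"
  proof -
    have "(\<integral>\<^sup>+ x. ennreal (norm (h' x) powr 2) \<partial>lebesgue) = (\<integral>\<^sup>+ x. ennreal (norm (h x) powr 2) \<partial>lebesgue)"
      by (rule nn_integral_cong_AE) (use ae in \<open>eventually_elim, simp\<close>)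
    then show ?thesis unfolding Lp_norm_def by (simp only:)
  qed
  also have "\<dots> = ennreal (norm k)"
    unfolding Lp_norm_2[OF h] unfolding h_def by (simp add: norm_inverse_FT)
  finally show "Hdot_norm s f = norm (mult_op (symbol \<gamma> s) G)"
    unfolding Hdot_norm_def h'_def k_def by simp
qed

section \<open>Dyadic shells\<close>

text \<open>Half open, so that the shells partition the nonzero frequencies. Sharp cut-offs are
  sufficient, since only \<open>L\<^sup>2\<close> and supremum bounds of the pieces are used.\<close>

definition shell :: "int \<Rightarrow> 'a::euclidean_space set" where
  "shell N = {\<xi>. 2 powr real_of_int N \<le> norm \<xi> \<and> norm \<xi> < 2 powr (real_of_int N + 1)}"

lemma shell_sets [measurable]: "shell N \<in> sets borel"
  unfolding shell_def by measurable

lemma shell_sets_lebesgue [measurable, simp]: "shell N \<in> sets lebesgue"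
  by simp

lemma mem_shell_iff: "\<xi> \<in> shell N \<longleftrightarrow> \<xi> \<noteq> 0 \<and> N = \<lfloor>log 2 (norm \<xi>)\<rfloor>"
proof (cases "\<xi> = 0")
  case True then show ?thesis by (simp add: shell_def)
next
  case False
  then have p: "norm \<xi> > 0" by simp
  have "\<xi> \<in> shell N \<longleftrightarrow> real_of_int N \<le> log 2 (norm \<xi>) \<and> log 2 (norm \<xi>) < real_of_int N + 1"
    unfolding shell_def using p by (simp add: le_log_iff log_less_iff)
  also have "\<dots> \<longleftrightarrow> N = \<lfloor>log 2 (norm \<xi>)\<rfloor>" by linarith
  finally show ?thesis using False by simp
qed

text \<open>The shells of index \<open>0, 1, 2, \<dots>\<close> exhaust the frequencies outside the unit ball, those of index
  \<open>-1, -2, \<dots>\<close> the nonzero ones inside it.\<close>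

lemma sums_indicator_shell:
  fixes \<xi> :: "'a::euclidean_space"
  shows "(\<lambda>k. indicator (shell (int k)) \<xi> :: complex) sums indicator {\<xi>. 1 \<le> norm \<xi>} \<xi>"
    and "(\<lambda>k. indicator (shell (- 1 - int k)) \<xi> :: complex) sums indicator (ball 0 1 - {0}) \<xi>"
proof -
  define L where "L = \<lfloor>log 2 (norm \<xi>)\<rfloor>"
  show "(\<lambda>k. indicator (shell (int k)) \<xi> :: complex) sums indicator {\<xi>. 1 \<le> norm \<xi>} \<xi>"
  proof (cases "1 \<le> norm \<xi>")
    case True
    then have p: "0 < norm \<xi>" by linarith
    then have "0 \<le> L" "\<xi> \<noteq> 0" unfolding L_def using True by auto
    then have "(\<lambda>k. indicator (shell (int k)) \<xi> :: complex) = (\<lambda>k. if k = nat L then 1 else 0)"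
      by (auto simp: fun_eq_iff indicator_def mem_shell_iff L_def[symmetric])
    then show ?thesis using True sums_single[of "nat L" "\<lambda>_. 1 :: complex"] by simp
  next
    case False
    have "\<xi> \<notin> shell (int k)" for k
    proof
      assume "\<xi> \<in> shell (int k)"
      then have "2 powr real k \<le> norm \<xi>" by (simp add: shell_def)
      moreover have "1 \<le> 2 powr real k" by (simp add: ge_one_powr_ge_zero)
      ultimately show False using False by linarith
    qed
    then show ?thesis using False by (simp add: sums_zero)
  qed
  show "(\<lambda>k. indicator (shell (- 1 - int k)) \<xi> :: complex) sums indicator (ball 0 1 - {0}) \<xi>"
  proof (cases "\<xi> \<noteq> 0 \<and> norm \<xi> < 1")
    case True
    then have "L \<le> - 1" unfolding L_def by (simp add: floor_le_iff log_less_iff)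
    then have "- 1 - int k = L \<longleftrightarrow> k = nat (- 1 - L)" for k by linarith
    then have "(\<lambda>k. indicator (shell (- 1 - int k)) \<xi> :: complex) = (\<lambda>k. if k = nat (- 1 - L) then 1 else 0)"
      using True by (auto simp: fun_eq_iff indicator_def mem_shell_iff L_def[symmetric])
    then show ?thesis using True sums_single[of "nat (- 1 - L)" "\<lambda>_. 1 :: complex"] by simp
  next
    case False
    have "\<xi> \<notin> shell (- 1 - int k)" for k
    proof
      assume a: "\<xi> \<in> shell (- 1 - int k)"
      then have "norm \<xi> < 2 powr (- real k)" by (simp add: shell_def)
      also have "\<dots> \<le> 1" by (simp add: powr_minus inverse_le_1_iff ge_one_powr_ge_zero)
      finally show False using False a by (simp add: mem_shell_iff)
    qed
    then show ?thesis using False by (auto simp: sums_zero indicator_def)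
  qed
qed

lemma measure_shell:
  "emeasure lebesgue (shell N :: 'a::euclidean_space set) < \<infinity>"
  "measure lebesgue (shell N :: 'a set) \<le> unit_ball_vol (real DIM('a)) * 2 ^ DIM('a) * 2 powr (real_of_int N * real DIM('a))"
proof -
  let ?r = "2 powr (real_of_int N + 1) :: real"
  have sub: "shell N \<subseteq> (cball 0 ?r :: 'a set)" by (auto simp: shell_def)
  have fin: "cball 0 ?r \<in> fmeasurable (lebesgue :: 'a measure)" by (rule lmeasurable_cball)
  then have "shell N \<in> fmeasurable (lebesgue :: 'a measure)" by (rule fmeasurableI2[OF _ sub]) simp
  then show "emeasure lebesgue (shell N :: 'a set) < \<infinity>" by (rule fmeasurableD2[THEN less_top[THEN iffD1], simplified infinity_ennreal_def[symmetric]])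
  have "measure lebesgue (shell N :: 'a set) \<le> measure lebesgue (cball 0 ?r :: 'a set)"
    by (rule measure_mono_fmeasurable[OF sub _ fin]) simp
  also have "\<dots> = unit_ball_vol (real DIM('a)) * ?r ^ DIM('a)"
    using content_cball[of ?r "0::'a"] by (simp add: measure_completion)
  also have "?r ^ DIM('a) = 2 ^ DIM('a) * 2 powr (real_of_int N * real DIM('a))"
    by (simp add: powr_add power_mult_distrib powr_power mult.commute)
  finally show "measure lebesgue (shell N :: 'a set) \<le> unit_ball_vol (real DIM('a)) * 2 ^ DIM('a) * 2 powr (real_of_int N * real DIM('a))"
    by (simp add: mult.assoc)
qed

lemma L1_norm_le_measure:
  fixes f :: "'a::euclidean_space \<Rightarrow> complex"
  assumes f: "square_integrable f" and S: "S \<in> sets lebesgue" "emeasure lebesgue S < \<infinity>"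
    and supp: "\<And>x. x \<notin> S \<Longrightarrow> f x = 0"
  shows "L1L2 f" "(\<integral>x. cmod (f x) \<partial>lebesgue) \<le> sqrt (measure lebesgue S) * norm (toL2 f)"
proof -
  have eq: "(\<lambda>x. indicator S x * f x) = f" using supp by (auto simp: fun_eq_iff indicator_def)
  show "L1L2 f" using square_integrable_bounded_support[OF f S] unfolding eq .
  have sq: "(\<lambda>x. (cmod (indicator S x :: complex))\<^sup>2) = indicat_real S" by (auto simp: indicator_def)
  have i: "square_integrable (indicator S :: 'a \<Rightarrow> complex)"
    unfolding square_integrable_def sq using integrable_real_indicator[OF S] S(1) by simp
  have "(norm (toL2 (indicator S :: 'a \<Rightarrow> complex)))\<^sup>2 = measure lebesgue S"
    unfolding norm_toL2_power2[OF i] sq using S by (simp add: measure_def)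
  then have ni: "norm (toL2 (indicator S :: 'a \<Rightarrow> complex)) = sqrt (measure lebesgue S)"
    by (metis norm_ge_zero real_sqrt_unique)
  have a: "square_integrable (\<lambda>x. complex_of_real (cmod (f x)))"
    using f square_integrableD[OF f] unfolding square_integrable_def by simp
  have "(norm (toL2 (\<lambda>x. complex_of_real (cmod (f x)))))\<^sup>2 = (norm (toL2 f))\<^sup>2"
    unfolding norm_toL2_power2[OF a] norm_toL2_power2[OF f] by simp
  then have na: "norm (toL2 (\<lambda>x. complex_of_real (cmod (f x)))) = norm (toL2 f)" by simp
  have "pairing (toL2 (indicator S)) (toL2 (\<lambda>x. complex_of_real (cmod (f x)))) = (\<integral>x. complex_of_real (cmod (f x)) \<partial>lebesgue)"
    unfolding pairing_toL2[OF i a]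
    by (intro Bochner_Integration.integral_cong refl) (use supp in \<open>auto simp: indicator_def\<close>)
  also have "cmod \<dots> = (\<integral>x. cmod (f x) \<partial>lebesgue)"
    by (simp add: integral_nonneg_AE)
  finally show "(\<integral>x. cmod (f x) \<partial>lebesgue) \<le> sqrt (measure lebesgue S) * norm (toL2 f)"
    using norm_pairing_le[of "toL2 (indicator S)" "toL2 (\<lambda>x. complex_of_real (cmod (f x)))"] unfolding ni na by simp
qed

definition piece :: "real \<Rightarrow> 'a::euclidean_space L2 \<Rightarrow> int \<Rightarrow> 'a \<Rightarrow> complex" where
  "piece \<gamma> G N \<xi> = indicator (shell N) \<xi> * frequency_side \<gamma> G \<xi>"

text \<open>The inverse Fourier integral of one piece: a bounded function with frequencies in one shell.\<close>

definition wave :: "real \<Rightarrow> 'a::euclidean_space L2 \<Rightarrow> int \<Rightarrow> 'a \<Rightarrow> complex" where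
  "wave \<gamma> G N x = fourier (piece \<gamma> G N) (- x)"

lemma piece_measurable [measurable]: "piece \<gamma> G N \<in> borel_measurable lebesgue"
  unfolding piece_def[abs_def] by measurable

text \<open>The weight is at least \<open>norm \<xi> powr s\<close> for either exponent. The exponent \<open>2\<close> is the good one
  for high frequencies, \<open>\<gamma>\<close> for low ones.\<close>

lemma cmod_piece_le:
  assumes s: "s \<in> {\<gamma>, 2}" "0 \<le> \<gamma>"
  shows "cmod (piece \<gamma> G N \<xi>) \<le> 2 powr (- real_of_int N * s) * cmod (fn G \<xi>)"
proof (cases "\<xi> \<in> shell N")
  case True
  have "2 powr (real_of_int N * s) = (2 powr real_of_int N) powr s" by (simp add: powr_powr)
  also have "\<dots> \<le> norm \<xi> powr s" using True s by (intro powr_mono2) (auto simp: shell_def)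
  also have "\<dots> \<le> cmod (sobolev_weight \<gamma> \<xi>)" unfolding cmod_sobolev_weight using s by auto
  finally have le: "2 powr (real_of_int N * s) \<le> cmod (sobolev_weight \<gamma> \<xi>)" .
  have "cmod (fn G \<xi>) / cmod (sobolev_weight \<gamma> \<xi>) \<le> cmod (fn G \<xi>) / 2 powr (real_of_int N * s)"
    by (rule divide_left_mono[OF le]) (auto intro!: mult_pos_pos less_le_trans[OF _ le])
  then show ?thesis using True
    by (simp add: piece_def frequency_side_def norm_divide norm_mult norm_inverse powr_minus divide_inverse mult.commute)
qed (simp add: piece_def)

lemma
  assumes s: "s \<in> {\<gamma>, 2}" "0 \<le> \<gamma>"
  shows square_integrable_piece: "square_integrable (piece \<gamma> G N)"
    and norm_piece_le: "norm (toL2 (piece \<gamma> G N)) \<le> 2 powr (- real_of_int N * s) * norm G"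
proof -
  show sq: "square_integrable (piece \<gamma> G N)"
    by (rule square_integrable_bound[OF piece_measurable fn_square_integrable[of G] AE_I2[OF cmod_piece_le[OF s]]])
  show "norm (toL2 (piece \<gamma> G N)) \<le> 2 powr (- real_of_int N * s) * norm G"
  proof (rule norm_toL2_le[OF sq])
    have "(\<integral>\<^sup>+\<xi>. ennreal ((cmod (piece \<gamma> G N \<xi>))\<^sup>2) \<partial>lebesgue)
      \<le> (\<integral>\<^sup>+\<xi>. ennreal ((2 powr (- real_of_int N * s))\<^sup>2 * (cmod (fn G \<xi>))\<^sup>2) \<partial>lebesgue)"
      by (intro nn_integral_mono ennreal_leI) (simp only: power_mult_distrib[symmetric], intro power_mono cmod_piece_le[OF s] norm_ge_zero)
    also have "\<dots> = ennreal ((2 powr (- real_of_int N * s) * norm G)\<^sup>2)"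
      by (simp add: ennreal_mult' nn_integral_cmult nn_integral_norm_L2 power_mult_distrib)
    finally show "(\<integral>\<^sup>+\<xi>. ennreal ((cmod (piece \<gamma> G N \<xi>))\<^sup>2) \<partial>lebesgue) \<le> ennreal ((2 powr (- real_of_int N * s) * norm G)\<^sup>2)" .
  qed simp
qed

definition shell_const :: "'a::euclidean_space itself \<Rightarrow> real" where
  "shell_const _ = sqrt (unit_ball_vol (real DIM('a)) * 2 ^ DIM('a))"

text \<open>The Cauchy--Schwarz inequality on the shell, whose measure is of order \<open>2 powr (N * DIM('a))\<close>.\<close>

lemma
  fixes G :: "'a::euclidean_space L2"
  assumes \<gamma>: "0 \<le> \<gamma>"
  shows L1L2_piece: "L1L2 (piece \<gamma> G N)"
    and L1_piece_le: "(\<integral>\<xi>. cmod (piece \<gamma> G N \<xi>) \<partial>lebesgue)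
      \<le> shell_const TYPE('a) * 2 powr (real_of_int N * real DIM('a) / 2) * norm (toL2 (piece \<gamma> G N))"
proof -
  have sq: "square_integrable (piece \<gamma> G N)" by (rule square_integrable_piece[of 2]) (use \<gamma> in auto)
  have supp: "\<xi> \<notin> shell N \<Longrightarrow> piece \<gamma> G N \<xi> = 0" for \<xi> by (simp add: piece_def)
  show "L1L2 (piece \<gamma> G N)" by (rule L1_norm_le_measure(1)[OF sq _ measure_shell(1) supp]) auto
  have "(\<integral>\<xi>. cmod (piece \<gamma> G N \<xi>) \<partial>lebesgue) \<le> sqrt (measure lebesgue (shell N :: 'a set)) * norm (toL2 (piece \<gamma> G N))"
    by (rule L1_norm_le_measure(2)[OF sq _ measure_shell(1) supp]) auto
  also have "\<dots> \<le> (shell_const TYPE('a) * 2 powr (real_of_int N * real DIM('a) / 2)) * norm (toL2 (piece \<gamma> G N))"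
  proof (rule mult_right_mono)
    have "sqrt (measure lebesgue (shell N :: 'a set)) \<le> sqrt (unit_ball_vol (real DIM('a)) * 2 ^ DIM('a) * 2 powr (real_of_int N * real DIM('a)))"
      using measure_shell(2) by (rule real_sqrt_le_mono)
    also have "\<dots> = shell_const TYPE('a) * sqrt (2 powr (real_of_int N * real DIM('a)))"
      unfolding shell_const_def by (rule real_sqrt_mult)
    also have "sqrt (2 powr (real_of_int N * real DIM('a))) = 2 powr (real_of_int N * real DIM('a) / 2)"
      by (simp add: powr_half_sqrt[symmetric] powr_powr)
    finally show "sqrt (measure lebesgue (shell N :: 'a set)) \<le> shell_const TYPE('a) * 2 powr (real_of_int N * real DIM('a) / 2)" .
  qed simp
  finally show "(\<integral>\<xi>. cmod (piece \<gamma> G N \<xi>) \<partial>lebesgue)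
      \<le> shell_const TYPE('a) * 2 powr (real_of_int N * real DIM('a) / 2) * norm (toL2 (piece \<gamma> G N))" .
qed

text \<open>Bernstein's inequality.\<close>

lemma norm_wave_le:
  fixes G :: "'a::euclidean_space L2"
  assumes \<gamma>: "0 \<le> \<gamma>"
  shows "cmod (wave \<gamma> G N x) \<le> fourier_const TYPE('a) * shell_const TYPE('a) * 2 powr (real_of_int N * real DIM('a) / 2) * norm (toL2 (piece \<gamma> G N))"
proof -
  have "cmod (wave \<gamma> G N x) \<le> fourier_const TYPE('a) * (\<integral>\<xi>. cmod (piece \<gamma> G N \<xi>) \<partial>lebesgue)"
    unfolding wave_def by (rule norm_fourier_le[OF L1L2D(1)[OF L1L2_piece[OF \<gamma>]]])
  also have "\<dots> \<le> fourier_const TYPE('a) * (shell_const TYPE('a) * 2 powr (real_of_int N * real DIM('a) / 2) * norm (toL2 (piece \<gamma> G N)))"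
    using fourier_const_pos[where 'a='a] by (intro mult_left_mono L1_piece_le[OF \<gamma>]) simp
  finally show ?thesis by (simp add: mult.assoc)
qed

section \<open>The low and the high frequencies\<close>

text \<open>The splitting at frequency one produces an actual function with a given Fourier transform: the
  low part is integrable, so that its inverse Fourier integral converges, and the high part is
  square integrable.\<close>

definition low_frequencies :: "real \<Rightarrow> 'a::euclidean_space L2 \<Rightarrow> 'a \<Rightarrow> complex" where
  "low_frequencies \<gamma> G \<xi> = indicator (ball 0 1 - {0}) \<xi> * frequency_side \<gamma> G \<xi>"

definition high_frequencies :: "real \<Rightarrow> 'a::euclidean_space L2 \<Rightarrow> 'a \<Rightarrow> complex" where
  "high_frequencies \<gamma> G \<xi> = indicator {\<xi>. 1 \<le> norm \<xi>} \<xi> * frequency_side \<gamma> G \<xi>"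

lemma low_plus_high: "low_frequencies \<gamma> G \<xi> + high_frequencies \<gamma> G \<xi> = frequency_side \<gamma> G \<xi>"
proof (cases "\<xi> = 0")
  case True then show ?thesis
    by (simp add: low_frequencies_def high_frequencies_def frequency_side_def sobolev_weight_def)
qed (auto simp: low_frequencies_def high_frequencies_def indicator_def)

lemma low_sums: "(\<lambda>k. piece \<gamma> G (- 1 - int k) \<xi>) sums low_frequencies \<gamma> G \<xi>"
  unfolding piece_def low_frequencies_def by (rule sums_mult2[OF sums_indicator_shell(2)])

lemma low_frequencies_measurable [measurable]:
  fixes G :: "'a::euclidean_space L2" shows "low_frequencies \<gamma> G \<in> borel_measurable lebesgue"
proof -
  have [measurable]: "(ball 0 1 - {0} :: 'a set) \<in> sets lebesgue" by simp
  show "low_frequencies \<gamma> G \<in> borel_measurable lebesgue"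
    unfolding low_frequencies_def[abs_def] by measurable
qed

lemma high_frequencies_measurable [measurable]:
  fixes G :: "'a::euclidean_space L2" shows "high_frequencies \<gamma> G \<in> borel_measurable lebesgue"
proof -
  have "{\<xi>::'a. 1 \<le> norm \<xi>} \<in> sets borel" by measurable
  then have [measurable]: "{\<xi>::'a. 1 \<le> norm \<xi>} \<in> sets lebesgue" by simp
  show "high_frequencies \<gamma> G \<in> borel_measurable lebesgue"
    unfolding high_frequencies_def[abs_def] by measurable
qed

text \<open>Convergence along a subsequence \<open>r\<close> of partial sums is enough, which matters where the sum of
  the waves converges in \<open>L\<^sup>2\<close> only.\<close>

lemma norm_sums_le_ennreal:
  fixes p :: "nat \<Rightarrow> complex"
  assumes r: "(\<lambda>n. \<Sum>k<r n. p k) \<longlonglongrightarrow> L"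
  shows "ennreal (cmod L) \<le> (\<Sum>k. ennreal (cmod (p k)))"
proof (rule LIMSEQ_le_const2)
  show "(\<lambda>n. ennreal (cmod (\<Sum>k<r n. p k))) \<longlonglongrightarrow> ennreal (cmod L)"
    by (intro tendsto_ennrealI tendsto_norm r)
  have "ennreal (cmod (\<Sum>k<r n. p k)) \<le> (\<Sum>k. ennreal (cmod (p k)))" for n
  proof -
    have "ennreal (cmod (\<Sum>k<r n. p k)) \<le> ennreal (\<Sum>k<r n. cmod (p k))" by (intro ennreal_leI norm_sum)
    also have "\<dots> = (\<Sum>k<r n. ennreal (cmod (p k)))" by (simp add: sum_ennreal)
    also have "\<dots> \<le> (\<Sum>k. ennreal (cmod (p k)))" by (rule sum_le_suminf) auto
    finally show ?thesis .
  qed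
  then show "\<exists>N. \<forall>n\<ge>N. ennreal (cmod (\<Sum>k<r n. p k)) \<le> (\<Sum>k. ennreal (cmod (p k)))" by blast
qed

text \<open>By Bernstein the piece of index \<open>N\<close> has \<open>L\<^sup>1\<close> norm of order \<open>2 powr (N * (DIM('a) / 2 - \<gamma>))\<close>,
  which is summable over negative \<open>N\<close> because \<open>\<gamma>\<close> is below half the dimension.\<close>

lemma integrable_low_frequencies:
  fixes G :: "'a::euclidean_space L2"
  assumes \<gamma>: "0 < \<gamma>" "2 * \<gamma> < real DIM('a)"
  shows "integrable lebesgue (low_frequencies \<gamma> G)"
  unfolding integrable_iff_bounded
proof
  define \<delta> where "\<delta> = real DIM('a) / 2 - \<gamma>"
  have \<delta>: "\<delta> > 0" using \<gamma> by (simp add: \<delta>_def)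
  define C where "C = shell_const TYPE('a) * norm G"
  have C: "0 \<le> C" by (simp add: C_def shell_const_def)
  have piece_le: "(\<integral>\<^sup>+\<xi>. ennreal (cmod (piece \<gamma> G (- 1 - int k) \<xi>)) \<partial>lebesgue) \<le> ennreal (C * (2 powr (- \<delta>)) ^ k)" for k
  proof -
    have "(\<integral>\<^sup>+\<xi>. ennreal (cmod (piece \<gamma> G (- 1 - int k) \<xi>)) \<partial>lebesgue) = ennreal (\<integral>\<xi>. cmod (piece \<gamma> G (- 1 - int k) \<xi>) \<partial>lebesgue)"
      using L1L2D(1)[OF L1L2_piece[of \<gamma> G]] \<gamma> by (intro nn_integral_eq_integral) auto
    also have "(\<integral>\<xi>. cmod (piece \<gamma> G (- 1 - int k) \<xi>) \<partial>lebesgue)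
       \<le> shell_const TYPE('a) * 2 powr (real_of_int (- 1 - int k) * real DIM('a) / 2) * norm (toL2 (piece \<gamma> G (- 1 - int k)))"
      using \<gamma> by (intro L1_piece_le) simp
    also have "\<dots> \<le> shell_const TYPE('a) * 2 powr (real_of_int (- 1 - int k) * real DIM('a) / 2) * (2 powr (- real_of_int (- 1 - int k) * \<gamma>) * norm G)"
      using \<gamma> by (intro mult_left_mono norm_piece_le) (auto simp: shell_const_def)
    also have "\<dots> = C * 2 powr (- (1 + real k) * \<delta>)"
      unfolding C_def \<delta>_def by (simp add: powr_add[symmetric] algebra_simps add_divide_distrib[symmetric] diff_divide_distrib)
    also have "\<dots> \<le> C * 2 powr (- real k * \<delta>)"
      using \<delta> C by (intro mult_left_mono powr_mono) (auto simp: algebra_simps)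
    also have "2 powr (- real k * \<delta>) = (2 powr (- \<delta>)) ^ k" by (simp add: powr_power mult.commute)
    finally show ?thesis using ennreal_leI by blast
  qed
  have "(\<integral>\<^sup>+\<xi>. ennreal (norm (low_frequencies \<gamma> G \<xi>)) \<partial>lebesgue) \<le> (\<integral>\<^sup>+\<xi>. (\<Sum>k. ennreal (cmod (piece \<gamma> G (- 1 - int k) \<xi>))) \<partial>lebesgue)"
    by (intro nn_integral_mono norm_sums_le_ennreal[where r = "\<lambda>n. n"]) (use low_sums in \<open>simp add: sums_def\<close>)
  also have "\<dots> = (\<Sum>k. \<integral>\<^sup>+\<xi>. ennreal (cmod (piece \<gamma> G (- 1 - int k) \<xi>)) \<partial>lebesgue)"
    by (rule nn_integral_suminf) measurable
  also have "\<dots> \<le> (\<Sum>k. ennreal (C * (2 powr (- \<delta>)) ^ k))"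
    by (rule suminf_le[OF piece_le]) auto
  also have "\<dots> < \<infinity>"
  proof -
    have "2 powr (- \<delta>) < (1::real)" using \<delta> using powr_less_mono[of "- \<delta>" 0 2] by simp
    then have "summable (\<lambda>k. C * (2 powr (- \<delta>)) ^ k)" by (intro summable_mult summable_geometric) simp
    then show ?thesis using C by (subst suminf_ennreal2) auto
  qed
  finally show "(\<integral>\<^sup>+\<xi>. ennreal (norm (low_frequencies \<gamma> G \<xi>)) \<partial>lebesgue) < \<infinity>" .
qed measurable

lemma square_integrable_high_frequencies:
  assumes \<gamma>: "0 \<le> \<gamma>" shows "square_integrable (high_frequencies \<gamma> G)"
proof (rule square_integrable_bound[OF high_frequencies_measurable fn_square_integrable[of G] AE_I2])
  fix \<xi>
  show "cmod (high_frequencies \<gamma> G \<xi>) \<le> 1 * cmod (fn G \<xi>)"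
  proof (cases "1 \<le> norm \<xi>")
    case True
    then have "1 \<le> norm \<xi> powr 2" by (simp add: ge_one_powr_ge_zero)
    then have "1 \<le> cmod (sobolev_weight \<gamma> \<xi>)" unfolding cmod_sobolev_weight by (simp add: add_increasing)
    then have "cmod (fn G \<xi>) / cmod (sobolev_weight \<gamma> \<xi>) \<le> cmod (fn G \<xi>) / 1"
      by (intro divide_left_mono) auto
    then show ?thesis using True by (simp add: high_frequencies_def frequency_side_def norm_divide)
  qed (simp add: high_frequencies_def)
qed

lemma has_fourier_low_plus_high:
  fixes G :: "'a::euclidean_space L2"
  assumes \<gamma>: "0 < \<gamma>" "2 * \<gamma> < real DIM('a)"
  shows "has_fourier (\<lambda>x. fourier (low_frequencies \<gamma> G) (- x) + fn (inverse_FT (toL2 (high_frequencies \<gamma> G))) x) (frequency_side \<gamma> G)"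
proof -
  have sq: "square_integrable (high_frequencies \<gamma> G)" using \<gamma> by (intro square_integrable_high_frequencies) simp
  have F: "has_fourier (\<lambda>x. fourier (low_frequencies \<gamma> G) (- x) + fn (inverse_FT (toL2 (high_frequencies \<gamma> G))) x)
    (\<lambda>\<xi>. low_frequencies \<gamma> G \<xi> + fn (toL2 (high_frequencies \<gamma> G)) \<xi>)"
    by (intro has_fourier_add has_fourier_L1 integrable_low_frequencies \<gamma> has_fourier_inverse_FT)
  have "AE \<xi> in lebesgue. low_frequencies \<gamma> G \<xi> + fn (toL2 (high_frequencies \<gamma> G)) \<xi> = frequency_side \<gamma> G \<xi>"
    using fn_toL2[OF sq] by eventually_elim (simp add: low_plus_high)
  from has_fourier_cong_AE[OF F tempered_measurable[OF has_fourierD(1)[OF F]] frequency_side_measurable AE_I2[OF refl] this]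
  show ?thesis .
qed

lemma L2_tendsto_AE_subseq:
  assumes "f \<longlonglongrightarrow> a"
  obtains r where "strict_mono r" "AE x in lebesgue. (\<lambda>n. fn (f (r n)) x) \<longlonglongrightarrow> fn a x"
proof -
  have int: "integrable lebesgue (\<lambda>x. (cmod (fn (f n - a) x))\<^sup>2)" for n by (simp add: square_integrable_integrable)
  have "(\<lambda>n. (norm (f n - a))\<^sup>2) \<longlonglongrightarrow> 0\<^sup>2"
    using assms by (intro tendsto_power) (simp add: tendsto_norm_zero_iff LIM_zero_iff)
  then have "(\<lambda>n. \<integral>x. norm ((cmod (fn (f n - a) x))\<^sup>2) \<partial>lebesgue) \<longlonglongrightarrow> 0"
    unfolding norm_L2_power2 by simp
  from tendsto_L1_AE_subseq[OF int this]
  obtain r where r: "strict_mono r" "AE x in lebesgue. (\<lambda>n. (cmod (fn (f (r n) - a) x))\<^sup>2) \<longlonglongrightarrow> 0" by blast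
  have "AE x in lebesgue. \<forall>n. fn (f (r n) - a) x = fn (f (r n)) x - fn a x"
    by (subst AE_all_countable) (simp add: fn_diff)
  with r(2) have "AE x in lebesgue. (\<lambda>n. fn (f (r n)) x) \<longlonglongrightarrow> fn a x"
  proof eventually_elim
    case (elim x)
    have "(\<lambda>n. sqrt ((cmod (fn (f (r n) - a) x))\<^sup>2)) \<longlonglongrightarrow> sqrt 0" by (intro tendsto_real_sqrt elim)
    then show ?case unfolding elim(2)[rule_format] by (simp add: tendsto_norm_zero_iff LIM_zero_iff)
  qed
  with r(1) show thesis by (rule that)
qed

lemma inverse_FT_toL2:
  assumes f: "L1L2 f" shows "inverse_FT (toL2 f) = toL2 (\<lambda>x. fourier f (- x))"
proof -
  note sq = fourier_contraction(1)[OF f]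
  have "inverse_FT (toL2 f) = reflect (toL2 (fourier f))"
    unfolding inverse_FT_def FT_FT FT_toL2[OF f, symmetric] by (simp add: FT_FT[symmetric])
  also have "\<dots> = toL2 (\<lambda>x. fourier f (- x))"
  proof (rule L2_eqI)
    show "AE x in lebesgue. fn (reflect (toL2 (fourier f))) x = fn (toL2 (\<lambda>x. fourier f (- x))) x"
      using fn_reflect[of "toL2 (fourier f)"] lebesgue_AE_affine[OF _ fn_toL2[OF sq], of "-1" 0] fn_toL2[OF square_integrable_reflect[OF sq]]
      by simp (auto elim: eventually_elim2)
  qed
  finally show ?thesis .
qed

lemma fourier_sum:
  fixes p :: "nat \<Rightarrow> 'a::euclidean_space \<Rightarrow> complex"
  assumes "\<And>k. L1L2 (p k)"
  shows "L1L2 (\<lambda>\<xi>. \<Sum>k<n. p k \<xi>)" "fourier (\<lambda>\<xi>. \<Sum>k<n. p k \<xi>) x = (\<Sum>k<n. fourier (p k) x)"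
proof -
  show "L1L2 (\<lambda>\<xi>. \<Sum>k<n. p k \<xi>)"
  proof (induction n)
    case 0 show ?case by (simp add: L1L2_def square_integrable_zero)
  next
    case (Suc n) then show ?case using assms[of n] unfolding L1L2_def by (simp add: square_integrable_add)
  qed
  show "fourier (\<lambda>\<xi>. \<Sum>k<n. p k \<xi>) x = (\<Sum>k<n. fourier (p k) x)"
    unfolding fourier_eq using integrable_fourier[OF L1L2D(1)[OF assms]]
    by (simp add: sum_distrib_left)
qed

text \<open>Pointwise everywhere, by dominated convergence in the Fourier integral.\<close>

lemma norm_low_le:
  fixes G :: "'a::euclidean_space L2"
  assumes \<gamma>: "0 < \<gamma>" "2 * \<gamma> < real DIM('a)"
  shows "ennreal (cmod (fourier (low_frequencies \<gamma> G) (- x))) \<le> (\<Sum>k. ennreal (cmod (wave \<gamma> G (- 1 - int k) x)))"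
proof (rule norm_sums_le_ennreal[where r = "\<lambda>n. n"])
  have L: "L1L2 (piece \<gamma> G (- 1 - int k))" for k using \<gamma> by (intro L1L2_piece) simp
  have "(\<lambda>n. fourier (\<lambda>\<xi>. \<Sum>k<n. piece \<gamma> G (- 1 - int k) \<xi>) (- x)) \<longlonglongrightarrow> fourier (low_frequencies \<gamma> G) (- x)"
  proof (rule fourier_tendsto[where w = "\<lambda>\<xi>. cmod (low_frequencies \<gamma> G \<xi>)"])
    show "integrable lebesgue (\<lambda>\<xi>. cmod (low_frequencies \<gamma> G \<xi>))" by (intro integrable_norm integrable_low_frequencies \<gamma>)
    show "(\<lambda>n. \<Sum>k<n. piece \<gamma> G (- 1 - int k) \<xi>) \<longlonglongrightarrow> low_frequencies \<gamma> G \<xi>" for \<xi>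
      using low_sums unfolding sums_def .
    fix n \<xi>
    (* at most one of the shells contains \<xi> *)
    show "cmod (\<Sum>k<n. piece \<gamma> G (- 1 - int k) \<xi>) \<le> cmod (low_frequencies \<gamma> G \<xi>)"
    proof (cases "\<exists>k<n. \<xi> \<in> shell (- 1 - int k)")
      case True
      then obtain k where k: "k < n" "\<xi> \<in> shell (- 1 - int k)" by blast
      have "(\<Sum>j<n. piece \<gamma> G (- 1 - int j) \<xi>) = (\<Sum>j<n. if j = k then frequency_side \<gamma> G \<xi> else 0)"
        using k(2) by (intro sum.cong) (auto simp: piece_def indicator_def mem_shell_iff)
      also have "\<dots> = frequency_side \<gamma> G \<xi>" using k(1) by simp
      also have "\<dots> = low_frequencies \<gamma> G \<xi>"
      proof -
        have "norm \<xi> < 2 powr (- real k)" "\<xi> \<noteq> 0" using k(2) by (auto simp: shell_def mem_shell_iff)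
        moreover have "2 powr (- real k) \<le> 1" by (simp add: powr_minus inverse_le_1_iff ge_one_powr_ge_zero)
        ultimately show ?thesis by (simp add: low_frequencies_def)
      qed
      finally show ?thesis by simp
    next
      case False
      then have "(\<Sum>k<n. piece \<gamma> G (- 1 - int k) \<xi>) = 0" by (intro sum.neutral) (auto simp: piece_def)
      then show ?thesis by simp
    qed
  qed measurable
  then show "(\<lambda>n. \<Sum>k<n. wave \<gamma> G (- 1 - int k) x) \<longlonglongrightarrow> fourier (low_frequencies \<gamma> G) (- x)"
    unfolding wave_def fourier_sum(2)[OF L] .
qed

text \<open>The partial sums of the waves converge in \<open>L\<^sup>2\<close>, by continuity of the inverse transform, hence
  almost everywhere along a subsequence.\<close>

lemma norm_high_le:
  fixes G :: "'a::euclidean_space L2"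
  assumes \<gamma>: "0 \<le> \<gamma>"
  shows "AE x in lebesgue. ennreal (cmod (fn (inverse_FT (toL2 (high_frequencies \<gamma> G))) x)) \<le> (\<Sum>k. ennreal (cmod (wave \<gamma> G (int k) x)))"
proof -
  note sq = square_integrable_high_frequencies[OF \<gamma>, of G]
  define H where "H = toL2 (high_frequencies \<gamma> G)"
  have L: "L1L2 (piece \<gamma> G (int k))" for k by (intro L1L2_piece \<gamma>)
  (* The partial sums of the pieces are bounded multiples of the high part. *)
  define m where "m n \<xi> = (\<Sum>k<n. indicator (shell (int k)) \<xi> :: complex)" for n and \<xi> :: 'a
  have m_le: "cmod (m n \<xi>) \<le> 1" for n \<xi>
  proof (cases "\<exists>k<n. \<xi> \<in> shell (int k)")
    case True
    then obtain k where k: "k < n" "\<xi> \<in> shell (int k)" by blast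
    have "m n \<xi> = (\<Sum>j<n. if j = k then 1 else 0)"
      unfolding m_def using k(2) by (intro sum.cong) (auto simp: indicator_def mem_shell_iff)
    then show ?thesis using k(1) by simp
  next
    case False
    then have "m n \<xi> = 0" unfolding m_def by (intro sum.neutral) auto
    then show ?thesis by simp
  qed
  have [measurable]: "m n \<in> borel_measurable lebesgue" for n unfolding m_def[abs_def] by measurable
  have bm: "bounded_multiplier (m n)" for n by (rule bounded_multiplierI[OF _ m_le]) measurable
  have one: "mult_op (\<lambda>x. 1) H = H" by (simp add: mult_op_def)
  have S1: "{\<xi>::'a. 1 \<le> norm \<xi>} \<in> sets lebesgue"
  proof -
    have "{\<xi>::'a. 1 \<le> norm \<xi>} \<in> sets borel" by measurable
    then show ?thesis by simp
  qed
  have "(\<lambda>n. mult_op (m n) H) \<longlonglongrightarrow> mult_op (indicator {\<xi>. 1 \<le> norm \<xi>}) H"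
    by (rule mult_op_tendsto[OF bm bounded_multiplier_indicator[OF S1] m_le])
       (rule AE_I2, unfold m_def, rule sums_indicator_shell(1)[unfolded sums_def])
  also have "mult_op (indicator {\<xi>. 1 \<le> norm \<xi>}) H = H"
    unfolding H_def
    by (rule L2_eqI) (use fn_mult_op[OF bounded_multiplier_indicator[OF S1], of "toL2 (high_frequencies \<gamma> G)"] fn_toL2[OF sq] in
        \<open>eventually_elim, simp add: high_frequencies_def indicator_def\<close>)
  finally have "(\<lambda>n. inverse_FT (mult_op (m n) H)) \<longlonglongrightarrow> inverse_FT H"
    unfolding inverse_FT_def by (intro FT_tendsto)
  then obtain r where r: "strict_mono r" and lim: "AE x in lebesgue. (\<lambda>n. fn (inverse_FT (mult_op (m (r n)) H)) x) \<longlonglongrightarrow> fn (inverse_FT H) x"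
    by (rule L2_tendsto_AE_subseq)
  have eq: "mult_op (m n) H = toL2 (\<lambda>\<xi>. \<Sum>k<n. piece \<gamma> G (int k) \<xi>)" for n
  proof (rule L2_eqI)
    have pt: "m n \<xi> * high_frequencies \<gamma> G \<xi> = (\<Sum>k<n. piece \<gamma> G (int k) \<xi>)" for \<xi>
      unfolding m_def sum_distrib_right
    proof (rule sum.cong)
      fix k
      have "1 \<le> norm \<xi>" if "\<xi> \<in> shell (int k)"
      proof -
        have "1 \<le> 2 powr real k" by (simp add: ge_one_powr_ge_zero)
        also have "\<dots> \<le> norm \<xi>" using that by (simp add: shell_def)
        finally show ?thesis .
      qed
      then show "indicator (shell (int k)) \<xi> * high_frequencies \<gamma> G \<xi> = piece \<gamma> G (int k) \<xi>"
        by (auto simp: piece_def high_frequencies_def indicator_def)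
    qed simp
    show "AE \<xi> in lebesgue. fn (mult_op (m n) H) \<xi> = fn (toL2 (\<lambda>\<xi>. \<Sum>k<n. piece \<gamma> G (int k) \<xi>)) \<xi>"
      using fn_mult_op[OF bm[of n], of H] fn_toL2[OF sq] fn_toL2[OF L1L2D(2)[OF fourier_sum(1)[of "\<lambda>k. piece \<gamma> G (int k)" n, OF L]]]
      unfolding H_def by eventually_elim (simp add: pt)
  qed
  have "AE x in lebesgue. \<forall>n. fn (inverse_FT (mult_op (m n) H)) x = (\<Sum>k<n. wave \<gamma> G (int k) x)"
    unfolding AE_all_countable
  proof
    fix n
    have sqn: "square_integrable (\<lambda>x. fourier (\<lambda>\<xi>. \<Sum>k<n. piece \<gamma> G (int k) \<xi>) (- x))"
      by (intro square_integrable_reflect fourier_contraction(1) fourier_sum(1) L)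
    show "AE x in lebesgue. fn (inverse_FT (mult_op (m n) H)) x = (\<Sum>k<n. wave \<gamma> G (int k) x)"
      unfolding eq inverse_FT_toL2[OF fourier_sum(1)[OF L]] using fn_toL2[OF sqn]
      by eventually_elim (simp add: fourier_sum(2)[OF L] wave_def)
  qed
  with lim show ?thesis
    unfolding H_def[symmetric]
  proof eventually_elim
    case (elim x)
    show ?case by (rule norm_sums_le_ennreal[where r = r]) (use elim in simp)
  qed
qed

text \<open>Uniqueness identifies \<open>V\<close> with the sum of the low and the high part. A bound by absolute
  values suffices for estimates of Lebesgue norms. The waves are enumerated in pairs \<open>k\<close> and
  \<open>-1 - k\<close>.\<close>

theorem dyadic_bound_AE:
  fixes G :: "'a::euclidean_space L2"
  assumes \<gamma>: "0 < \<gamma>" "2 * \<gamma> < real DIM('a)" and V: "has_fourier V (frequency_side \<gamma> G)"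
  shows "AE x in lebesgue. ennreal (cmod (V x)) \<le> (\<Sum>k. ennreal (cmod (wave \<gamma> G (int k) x) + cmod (wave \<gamma> G (- 1 - int k) x)))"
  using has_fourier_unique_inverse[OF V has_fourier_low_plus_high[OF \<gamma>]] norm_high_le[OF less_imp_le[OF \<gamma>(1)], of G]
proof eventually_elim
  case (elim x)
  have "ennreal (cmod (V x)) \<le> ennreal (cmod (fn (inverse_FT (toL2 (high_frequencies \<gamma> G))) x)) + ennreal (cmod (fourier (low_frequencies \<gamma> G) (- x)))"
    unfolding elim(1) ennreal_plus[OF norm_ge_zero norm_ge_zero, symmetric]
    by (rule ennreal_leI, rule order_trans[OF norm_triangle_ineq]) (simp add: add.commute)
  also have "\<dots> \<le> (\<Sum>k. ennreal (cmod (wave \<gamma> G (int k) x))) + (\<Sum>k. ennreal (cmod (wave \<gamma> G (- 1 - int k) x)))"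
    using \<gamma> elim(2) by (intro add_mono norm_low_le) auto
  also have "\<dots> = (\<Sum>k. ennreal (cmod (wave \<gamma> G (int k) x)) + ennreal (cmod (wave \<gamma> G (- 1 - int k) x)))"
    by (intro suminf_add summableI)
  finally show ?case by simp
qed

section \<open>Smallness of the Lebesgue norm\<close>

text \<open>A substitute for the triangle inequality in \<open>L\<^sup>q\<close>, at the price of a geometric factor: if the
  right hand side is \<open>S\<close>, then each of its terms is at most \<open>S\<close>, which bounds \<open>b k\<close> by a term of
  a geometric series with sum \<open>S powr (1 / q)\<close>.\<close>

lemma power_sum_bound:
  fixes b :: "nat \<Rightarrow> real"
  assumes b: "\<And>k. 0 \<le> b k" and v: "0 \<le> v" "ennreal v \<le> (\<Sum>k. ennreal (b k))"
    and \<theta>: "0 < \<theta>" "\<theta> < 1" and q: "0 < q"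
  shows "ennreal (v powr q) \<le> (\<Sum>k. ennreal ((1 / (1 - \<theta>)) powr q * (\<theta> powr (- q)) ^ k * b k powr q))"
proof (cases "(\<Sum>k. ennreal ((1 / (1 - \<theta>)) powr q * (\<theta> powr (- q)) ^ k * b k powr q)) = \<infinity>")
  case False
  define c where "c = 1 / (1 - \<theta>)"
  have c: "c > 0" using \<theta> by (simp add: c_def)
  define a where "a k = c powr q * (\<theta> powr (- q)) ^ k * b k powr q" for k
  have a0: "0 \<le> a k" for k by (simp add: a_def)
  have fin: "(\<Sum>k. ennreal (a k)) \<noteq> \<infinity>" using False by (simp add: a_def c_def)
  have sa: "summable a" using a0 fin by (intro summable_suminf_not_top) auto
  define S where "S = (\<Sum>k. a k)"
  have S0: "0 \<le> S" unfolding S_def by (rule suminf_nonneg[OF sa a0])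
  have aS: "a k \<le> S" for k
    unfolding S_def using sum_le_suminf[OF sa, of "{k}"] a0 by simp
  have bk: "b k \<le> S powr (1 / q) * (1 - \<theta>) * \<theta> ^ k" for k
  proof -
    have "a k powr (1 / q) \<le> S powr (1 / q)" using a0 aS q by (intro powr_mono2) auto
    moreover have "a k powr (1 / q) = c * (1 / \<theta>) ^ k * b k"
    proof -
      have "(\<theta> powr (- q)) ^ k = ((1 / \<theta>) ^ k) powr q"
        using \<theta> by (simp add: powr_minus powr_divide inverse_eq_divide powr_power power_divide powr_powr flip: powr_realpow)
          (simp add: mult.commute powr_realpow powr_powr[symmetric])
      then have "a k = (c * (1 / \<theta>) ^ k * b k) powr q"
        unfolding a_def using \<theta> c b by (simp add: powr_mult)
      then show ?thesis using q \<theta> c b[of k] by (simp add: powr_powr)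
    qed
    ultimately have "c * (1 / \<theta>) ^ k * b k \<le> S powr (1 / q)" by simp
    then show ?thesis using \<theta> unfolding c_def by (simp add: field_simps power_divide)
  qed
  have sb: "summable (\<lambda>k. S powr (1 / q) * (1 - \<theta>) * \<theta> ^ k)"
    using \<theta> by (intro summable_mult summable_geometric) simp
  have "ennreal v \<le> (\<Sum>k. ennreal (S powr (1 / q) * (1 - \<theta>) * \<theta> ^ k))"
    by (rule order_trans[OF v(2)]) (intro suminf_le ennreal_leI bk summableI)
  also have "\<dots> = ennreal (\<Sum>k. S powr (1 / q) * (1 - \<theta>) * \<theta> ^ k)"
    using \<theta> by (intro suminf_ennreal2 sb) auto
  also have "(\<Sum>k. S powr (1 / q) * (1 - \<theta>) * \<theta> ^ k) = S powr (1 / q)"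
    using \<theta> by (subst suminf_mult) (auto intro!: summable_geometric simp: suminf_geometric)
  finally have "v \<le> S powr (1 / q)" by simp
  then have "v powr q \<le> (S powr (1 / q)) powr q" using v(1) q by (intro powr_mono2) auto
  also have "\<dots> = S" using S0 q by (simp add: powr_powr)
  finally have "ennreal (v powr q) \<le> ennreal S" by (rule ennreal_leI)
  also have "\<dots> = (\<Sum>k. ennreal (a k))" unfolding S_def by (rule suminf_ennreal2[symmetric, OF a0 sa])
  finally show ?thesis by (simp add: a_def c_def)
qed simp

lemma wave_measurable [measurable]:
  fixes G :: "'a::euclidean_space L2" shows "wave \<gamma> G N \<in> borel_measurable lebesgue"
  unfolding wave_def[abs_def]
  using lebesgue_measurable_affine[of "-1" "fourier (piece \<gamma> G N)" 0] fourier_measurable[OF piece_measurable[of \<gamma> G N]]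
  by simp

text \<open>Interpolation between the supremum bound \<open>\<beta>\<close> and Plancherel.\<close>

lemma nn_integral_wave_powr:
  fixes G :: "'a::euclidean_space L2"
  assumes \<gamma>: "0 \<le> \<gamma>" and q: "2 < q" and \<beta>: "\<And>x. cmod (wave \<gamma> G N x) \<le> \<beta>"
  shows "(\<integral>\<^sup>+x. ennreal (cmod (wave \<gamma> G N x) powr q) \<partial>lebesgue) \<le> ennreal (\<beta> powr (q - 2) * (norm (toL2 (piece \<gamma> G N)))\<^sup>2)"
proof -
  note L = L1L2_piece[OF \<gamma>, of G N]
  have sq: "square_integrable (wave \<gamma> G N)"
    unfolding wave_def[abs_def] by (intro square_integrable_reflect fourier_contraction(1) L)
  have \<beta>0: "0 \<le> \<beta>" using \<beta>[of 0] norm_ge_zero order_trans by blast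
  have "cmod (wave \<gamma> G N x) powr q \<le> \<beta> powr (q - 2) * (cmod (wave \<gamma> G N x))\<^sup>2" for x
  proof (cases "wave \<gamma> G N x = 0")
    case False
    then have "cmod (wave \<gamma> G N x) powr q = cmod (wave \<gamma> G N x) powr (q - 2) * (cmod (wave \<gamma> G N x)) powr 2"
      unfolding powr_add[symmetric] by simp
    also have "\<dots> \<le> \<beta> powr (q - 2) * (cmod (wave \<gamma> G N x)) powr 2"
      using q \<beta>[of x] by (intro mult_right_mono powr_mono2) auto
    finally show ?thesis using False by (simp add: powr_numeral)
  qed simp
  then have "(\<integral>\<^sup>+x. ennreal (cmod (wave \<gamma> G N x) powr q) \<partial>lebesgue) \<le> (\<integral>\<^sup>+x. ennreal (\<beta> powr (q - 2)) * ennreal ((cmod (wave \<gamma> G N x))\<^sup>2) \<partial>lebesgue)"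
    by (intro nn_integral_mono) (simp flip: ennreal_mult')
  also have "\<dots> = ennreal (\<beta> powr (q - 2)) * ennreal ((norm (toL2 (wave \<gamma> G N)))\<^sup>2)"
    by (subst nn_integral_cmult) (measurable, simp add: nn_integral_norm_toL2[OF sq])
  also have "toL2 (wave \<gamma> G N) = inverse_FT (toL2 (piece \<gamma> G N))"
    unfolding inverse_FT_toL2[OF L] wave_def[abs_def] ..
  finally show ?thesis by (simp add: norm_inverse_FT ennreal_mult')
qed

lemma add_powr_le:
  fixes a b :: real assumes "0 \<le> a" "0 \<le> b" "0 < q"
  shows "(a + b) powr q \<le> 2 powr q * (a powr q + b powr q)"
proof -
  have "(a + b) powr q \<le> (2 * max a b) powr q" using assms by (intro powr_mono2) auto
  also have "\<dots> = 2 powr q * max a b powr q" using assms by (simp add: powr_mult)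
  also have "\<dots> \<le> 2 powr q * (a powr q + b powr q)" by (intro mult_left_mono) (auto simp: max_def)
  finally show ?thesis .
qed

text \<open>The pointwise dyadic bound, integrated: \<open>\<beta> N\<close> is any bound of the wave of index \<open>N\<close>, and \<open>\<theta>\<close>
  is free.\<close>

lemma nn_integral_powr_dyadic_bound:
  fixes G :: "'a::euclidean_space L2"
  assumes \<gamma>: "0 < \<gamma>" "2 * \<gamma> < real DIM('a)" and V: "has_fourier V (frequency_side \<gamma> G)"
    and q: "2 < q" and \<theta>: "0 < \<theta>" "\<theta> < 1" and \<beta>: "\<And>N x. cmod (wave \<gamma> G N x) \<le> \<beta> N"
  shows "(\<integral>\<^sup>+x. ennreal (cmod (V x) powr q) \<partial>lebesgue)
    \<le> (\<Sum>k. ennreal ((1 / (1 - \<theta>)) powr q * (\<theta> powr (- q)) ^ k * (2 powr q *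
          (\<beta> (int k) powr (q - 2) * (norm (toL2 (piece \<gamma> G (int k))))\<^sup>2
           + \<beta> (- 1 - int k) powr (q - 2) * (norm (toL2 (piece \<gamma> G (- 1 - int k))))\<^sup>2))))"
proof -
  define c where "c k = (1 / (1 - \<theta>)) powr q * (\<theta> powr (- q)) ^ k * 2 powr q" for k :: nat
  have c0: "0 \<le> c k" for k by (simp add: c_def)
  define w where "w N x = cmod (wave \<gamma> G N x)" for N x
  have [measurable]: "w N \<in> borel_measurable lebesgue" for N unfolding w_def[abs_def] by measurable
  have w0: "0 \<le> w N x" for N x by (simp add: w_def)
  have "(\<integral>\<^sup>+x. ennreal (cmod (V x) powr q) \<partial>lebesgue)
     \<le> (\<integral>\<^sup>+x. (\<Sum>k. ennreal (c k * w (int k) x powr q) + ennreal (c k * w (- 1 - int k) x powr q)) \<partial>lebesgue)"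
  proof (rule nn_integral_mono_AE)
    show "AE x in lebesgue. ennreal (cmod (V x) powr q) \<le> (\<Sum>k. ennreal (c k * w (int k) x powr q) + ennreal (c k * w (- 1 - int k) x powr q))"
      using dyadic_bound_AE[OF \<gamma> V]
    proof eventually_elim
      case (elim x)
      have "ennreal (cmod (V x) powr q) \<le> (\<Sum>k. ennreal ((1 / (1 - \<theta>)) powr q * (\<theta> powr (- q)) ^ k * (w (int k) x + w (- 1 - int k) x) powr q))"
        by (rule power_sum_bound) (use elim q \<theta> w0 in \<open>auto simp: w_def\<close>)
      also have "\<dots> \<le> (\<Sum>k. ennreal (c k * w (int k) x powr q) + ennreal (c k * w (- 1 - int k) x powr q))"
      proof (intro suminf_le summableI)
        fix k
        have "(1 / (1 - \<theta>)) powr q * (\<theta> powr (- q)) ^ k * (w (int k) x + w (- 1 - int k) x) powr q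
          \<le> (1 / (1 - \<theta>)) powr q * (\<theta> powr (- q)) ^ k * (2 powr q * (w (int k) x powr q + w (- 1 - int k) x powr q))"
          using q by (intro mult_left_mono add_powr_le w0) auto
        also have "\<dots> = c k * w (int k) x powr q + c k * w (- 1 - int k) x powr q"
          unfolding c_def by (simp add: distrib_left mult.assoc)
        finally show "ennreal ((1 / (1 - \<theta>)) powr q * (\<theta> powr (- q)) ^ k * (w (int k) x + w (- 1 - int k) x) powr q)
          \<le> ennreal (c k * w (int k) x powr q) + ennreal (c k * w (- 1 - int k) x powr q)"
          using c0 by (simp add: ennreal_leI flip: ennreal_plus)
      qed
      finally show ?case .
    qed
  qed
  also have "\<dots> = (\<Sum>k. \<integral>\<^sup>+x. ennreal (c k * w (int k) x powr q) + ennreal (c k * w (- 1 - int k) x powr q) \<partial>lebesgue)"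
    by (rule nn_integral_suminf) measurable
  also have "\<dots> \<le> (\<Sum>k. ennreal (c k * (\<beta> (int k) powr (q - 2) * (norm (toL2 (piece \<gamma> G (int k))))\<^sup>2
           + \<beta> (- 1 - int k) powr (q - 2) * (norm (toL2 (piece \<gamma> G (- 1 - int k))))\<^sup>2)))"
  proof (intro suminf_le summableI)
    fix k
    have one: "(\<integral>\<^sup>+x. ennreal (c k * w N x powr q) \<partial>lebesgue) \<le> ennreal (c k * (\<beta> N powr (q - 2) * (norm (toL2 (piece \<gamma> G N)))\<^sup>2))" for N
    proof -
      have "(\<integral>\<^sup>+x. ennreal (c k * w N x powr q) \<partial>lebesgue) = ennreal (c k) * (\<integral>\<^sup>+x. ennreal (w N x powr q) \<partial>lebesgue)"
        by (simp add: ennreal_mult' c0 nn_integral_cmult)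
      also have "\<dots> \<le> ennreal (c k) * ennreal (\<beta> N powr (q - 2) * (norm (toL2 (piece \<gamma> G N)))\<^sup>2)"
        unfolding w_def using \<gamma> by (intro mult_left_mono nn_integral_wave_powr q \<beta>) auto
      finally show ?thesis by (simp add: ennreal_mult' c0)
    qed
    have "(\<integral>\<^sup>+x. ennreal (c k * w (int k) x powr q) + ennreal (c k * w (- 1 - int k) x powr q) \<partial>lebesgue)
       = (\<integral>\<^sup>+x. ennreal (c k * w (int k) x powr q) \<partial>lebesgue) + (\<integral>\<^sup>+x. ennreal (c k * w (- 1 - int k) x powr q) \<partial>lebesgue)"
      by (rule nn_integral_add) measurable
    also have "\<dots> \<le> ennreal (c k * (\<beta> (int k) powr (q - 2) * (norm (toL2 (piece \<gamma> G (int k))))\<^sup>2))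
        + ennreal (c k * (\<beta> (- 1 - int k) powr (q - 2) * (norm (toL2 (piece \<gamma> G (- 1 - int k))))\<^sup>2))"
      by (intro add_mono one)
    also have "\<dots> = ennreal (c k * (\<beta> (int k) powr (q - 2) * (norm (toL2 (piece \<gamma> G (int k))))\<^sup>2
           + \<beta> (- 1 - int k) powr (q - 2) * (norm (toL2 (piece \<gamma> G (- 1 - int k))))\<^sup>2))"
      using c0 by (subst ennreal_plus[symmetric]) (auto simp: distrib_left)
    finally show "(\<integral>\<^sup>+x. ennreal (c k * w (int k) x powr q) + ennreal (c k * w (- 1 - int k) x powr q) \<partial>lebesgue)
      \<le> ennreal (c k * (\<beta> (int k) powr (q - 2) * (norm (toL2 (piece \<gamma> G (int k))))\<^sup>2
           + \<beta> (- 1 - int k) powr (q - 2) * (norm (toL2 (piece \<gamma> G (- 1 - int k))))\<^sup>2))" .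
  qed
  finally show ?thesis unfolding c_def by (simp only: mult.assoc)
qed

text \<open>The contribution of one shell when the supremum is estimated by Bernstein's inequality.\<close>

lemma Bernstein_power_bound:
  fixes B p q e d x :: real
  assumes "0 \<le> B" "0 \<le> p" "2 < q" and e: "d / 2 * (q - 2) = q * e"
  shows "(B * 2 powr (x * d / 2) * p) powr (q - 2) * p\<^sup>2 = B powr (q - 2) * (2 powr (x * e) * p) powr q"
proof (cases "p = 0")
  case False
  then have p: "p > 0" using assms by simp
  have 1: "(B * 2 powr (x * d / 2) * p) powr (q - 2) = B powr (q - 2) * 2 powr (x * d / 2 * (q - 2)) * p powr (q - 2)"
    using assms by (simp add: powr_mult powr_powr)
  have 2: "x * d / 2 * (q - 2) = x * e * q" using e by (simp add: mult.assoc mult.commute mult.left_commute)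
  have 3: "p powr (q - 2) * p\<^sup>2 = p powr q"
  proof -
    have "p powr (q - 2) * p powr 2 = p powr q" unfolding powr_add[symmetric] by simp
    then show ?thesis using p by (simp add: powr_numeral)
  qed
  show ?thesis unfolding 1 2 using p 3 by (simp add: powr_mult powr_powr mult.assoc)
qed (use assms in simp)

text \<open>Put \<open>e = d * (1 / 2 - 1 / q)\<close>, the exponent for which \<open>H\<^sup>e\<close> scales like \<open>L\<^sup>q\<close>. By Bernstein
  the shell of index \<open>N\<close> contributes a multiple of \<open>(2 powr (N * (e - s)))\<^sup>q\<close> for either choice
  \<open>s = 2\<close> or \<open>s = \<gamma>\<close>. Since \<open>\<gamma> < e < 2\<close>, this decays geometrically, with \<open>s = 2\<close> as \<open>N\<close> tends to
  \<open>\<infinity>\<close> and with \<open>s = \<gamma>\<close> as \<open>N\<close> tends to \<open>-\<infinity>\<close>, uniformly for \<open>G\<close> in a ball, so that all but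
  finitely many shells are negligible; each of the remaining shells carries a factor
  \<open>\<delta> powr (q - 2)\<close> because \<open>q > 2\<close>.\<close>

theorem Lq_small_of_waves_small:
  fixes \<gamma> q M \<epsilon> :: real
  assumes \<gamma>: "0 < \<gamma>" "2 * \<gamma> < real DIM('a::euclidean_space)" and q: "2 < q"
    and e: "\<gamma> < real DIM('a) * (1 / 2 - 1 / q)" "real DIM('a) * (1 / 2 - 1 / q) < 2"
    and M: "0 \<le> M" and \<epsilon>: "0 < \<epsilon>"
  obtains K :: nat and \<delta> where "0 < \<delta>"
    "\<And>(G :: 'a L2) V. norm G \<le> M \<Longrightarrow> has_fourier V (frequency_side \<gamma> G) \<Longrightarrow>
       (\<And>N x. \<bar>N\<bar> \<le> int K \<Longrightarrow> cmod (wave \<gamma> G N x) \<le> \<delta>) \<Longrightarrow>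
       (\<integral>\<^sup>+x. ennreal (cmod (V x) powr q) \<partial>lebesgue) \<le> ennreal \<epsilon>"
proof -
  define d where "d = real DIM('a)"
  define e where "e = d * (1 / 2 - 1 / q)"
  define \<sigma> where "\<sigma> = min (2 - e) (e - \<gamma>)"
  have \<sigma>: "0 < \<sigma>" "\<sigma> \<le> 2 - e" "\<sigma> \<le> e - \<gamma>" using assms(4,5) by (auto simp: \<sigma>_def e_def d_def)
  have de: "d / 2 * (q - 2) = q * e" using q by (simp add: e_def field_simps)
  (* The geometric loss of the dyadic bound may use up half of the decay rate \<sigma>. *)
  define \<theta> where "\<theta> = (2::real) powr (- (\<sigma> / 2))"
  have \<theta>: "0 < \<theta>" "\<theta> < 1" using \<sigma> powr_less_mono[of "- (\<sigma> / 2)" 0 2] by (auto simp: \<theta>_def)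
  define c where "c = (1 / (1 - \<theta>)) powr q * 2 powr q"
  define C where "C = fourier_const TYPE('a) * shell_const TYPE('a)"
  have c0: "0 \<le> c" and C0: "0 \<le> C"
    using fourier_const_pos[where 'a='a] by (auto simp: c_def C_def shell_const_def)
  define \<tau> where "\<tau> = (2::real) powr (- (q * \<sigma> / 2))"
  have \<tau>: "0 < \<tau>" "\<tau> < 1" using \<sigma> q powr_less_mono[of "- (q * \<sigma> / 2)" 0 2] by (auto simp: \<tau>_def)
  define A where "A = c * (2 * (C powr (q - 2) * M powr q))"
  define g where "g k = A * \<tau> ^ k" for k
  have sg: "summable g" unfolding g_def using \<tau> by (intro summable_mult summable_geometric) simp
  have A0: "0 \<le> A" using c0 by (simp add: A_def)
  have g0: "0 \<le> g k" for k using A0 \<tau> by (simp add: g_def)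
  have "(\<lambda>K. suminf g - sum g {..<K}) \<longlonglongrightarrow> suminf g - suminf g"
    by (intro tendsto_diff tendsto_const summable_LIMSEQ sg)
  then have "(\<lambda>K. suminf g - sum g {..<K}) \<longlonglongrightarrow> 0" by simp
  from order_tendstoD(2)[OF this half_gt_zero[OF \<epsilon>]]
  have "\<forall>\<^sub>F K in sequentially. suminf g - sum g {..<K} < \<epsilon> / 2" .
  then obtain K where K: "suminf g - sum g {..<K} < \<epsilon> / 2" unfolding eventually_sequentially by blast
  define B where "B = c * (\<theta> powr (- q)) ^ K * (2 * (2 powr (real K * \<gamma>) * M)\<^sup>2)"
  have B0: "0 \<le> B" using c0 by (simp add: B_def)
  (* Chosen so that K terms of size B * \<delta> powr (q - 2) add up to at most \<epsilon> / 2. *)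
  define \<delta> where "\<delta> = (\<epsilon> / (2 * (real K * B + 1))) powr (1 / (q - 2))"
  have "0 < \<epsilon> / (2 * (real K * B + 1))" using \<epsilon> B0 by (intro divide_pos_pos) (auto simp: add_nonneg_pos)
  then have \<delta>: "0 < \<delta>" unfolding \<delta>_def powr_gt_zero by linarith
  have \<delta>q: "\<delta> powr (q - 2) = \<epsilon> / (2 * (real K * B + 1))"
    using q \<epsilon> B0 by (simp add: \<delta>_def powr_powr add_nonneg_pos)
  have KB: "real K * (B * \<delta> powr (q - 2)) \<le> \<epsilon> / 2"
  proof -
    have "real K * B \<le> real K * B + 1" by simp
    then have "(real K * B) * (\<epsilon> / (2 * (real K * B + 1))) \<le> (real K * B + 1) * (\<epsilon> / (2 * (real K * B + 1)))"
      using \<epsilon> B0 by (intro mult_right_mono) auto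
    also have "\<dots> = \<epsilon> / 2"
    proof -
      have "a * (\<epsilon> / (2 * a)) = \<epsilon> / 2" if "0 < a" for a :: real using that by (simp add: field_simps)
      moreover have "0 < real K * B + 1" using B0 by (simp add: add_nonneg_pos)
      ultimately show ?thesis .
    qed
    finally show ?thesis unfolding \<delta>q by (simp add: mult.assoc)
  qed
  show thesis
  proof (rule that[OF \<delta>, of K])
    fix G :: "'a L2" and V
    assume G: "norm G \<le> M" and V: "has_fourier V (frequency_side \<gamma> G)"
      and small: "\<And>N x. \<bar>N\<bar> \<le> int K \<Longrightarrow> cmod (wave \<gamma> G N x) \<le> \<delta>"
    define p where "p N = norm (toL2 (piece \<gamma> G N))" for N
    have p0: "0 \<le> p N" for N by (simp add: p_def)
    have p_le: "p N \<le> 2 powr (- real_of_int N * s) * M" if "s \<in> {\<gamma>, 2}" for N s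
      unfolding p_def using norm_piece_le[OF that, of G N] \<gamma> G
      by (meson less_imp_le mult_left_mono order_trans powr_ge_zero)
    (* The first K pairs of shells are those with index from -K to K - 1. *)
    define \<beta> where "\<beta> N = (if - int K \<le> N \<and> N < int K then \<delta> else C * 2 powr (real_of_int N * d / 2) * p N)" for N
    have \<beta>: "cmod (wave \<gamma> G N x) \<le> \<beta> N" for N x
      using small[of N x] norm_wave_le[of \<gamma> G N x] \<gamma> by (auto simp: \<beta>_def C_def d_def p_def)
    define u where "u k = (1 / (1 - \<theta>)) powr q * (\<theta> powr (- q)) ^ k * (2 powr q *
       (\<beta> (int k) powr (q - 2) * (p (int k))\<^sup>2 + \<beta> (- 1 - int k) powr (q - 2) * (p (- 1 - int k))\<^sup>2))" for k
    have int: "(\<integral>\<^sup>+x. ennreal (cmod (V x) powr q) \<partial>lebesgue) \<le> (\<Sum>k. ennreal (u k))"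
      unfolding u_def p_def by (rule nn_integral_powr_dyadic_bound[OF \<gamma> V q \<theta> \<beta>])
    have u_eq: "u k = c * (\<theta> powr (- q)) ^ k * (\<beta> (int k) powr (q - 2) * (p (int k))\<^sup>2 + \<beta> (- 1 - int k) powr (q - 2) * (p (- 1 - int k))\<^sup>2)" for k
      by (simp add: u_def c_def mult_ac)
    have u0: "0 \<le> u k" for k unfolding u_eq using c0 by simp
    have small_k: "u k \<le> B * \<delta> powr (q - 2)" if k: "k < K" for k
    proof -
      have b: "\<beta> (int k) = \<delta>" "\<beta> (- 1 - int k) = \<delta>" using k by (auto simp: \<beta>_def)
      have "p (int k) \<le> 2 powr (- real k * 2) * M" using p_le[of 2 "int k"] by simp
      also have "\<dots> \<le> 2 powr (real K * \<gamma>) * M" using M \<gamma> by (intro mult_right_mono powr_mono) (auto intro: order_trans[of _ 0])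
      finally have 1: "(p (int k))\<^sup>2 \<le> (2 powr (real K * \<gamma>) * M)\<^sup>2" by (intro power_mono p0)
      have "p (- 1 - int k) \<le> 2 powr (- real_of_int (- 1 - int k) * \<gamma>) * M" by (rule p_le) simp
      also have "\<dots> \<le> 2 powr (real K * \<gamma>) * M" using M \<gamma> k by (intro mult_right_mono powr_mono) auto
      finally have 2: "(p (- 1 - int k))\<^sup>2 \<le> (2 powr (real K * \<gamma>) * M)\<^sup>2" by (intro power_mono p0)
      have "1 \<le> \<theta> powr (- q)"
        unfolding \<theta>_def using \<sigma> q by (simp add: powr_powr ge_one_powr_ge_zero)
      then have t: "(\<theta> powr (- q)) ^ k \<le> (\<theta> powr (- q)) ^ K" using k by (intro power_increasing) auto
      have "u k \<le> c * (\<theta> powr (- q)) ^ K * (\<delta> powr (q - 2) * (2 powr (real K * \<gamma>) * M)\<^sup>2 + \<delta> powr (q - 2) * (2 powr (real K * \<gamma>) * M)\<^sup>2)"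
        unfolding u_eq b using 1 2 t c0 by (intro mult_mono add_mono mult_left_mono) auto
      then show ?thesis by (simp add: B_def mult_ac)
    qed
    have large_k: "u k \<le> g k" if k: "\<not> k < K" for k
    proof -
      have shell_term: "\<beta> N powr (q - 2) * (p N)\<^sup>2 \<le> C powr (q - 2) * (M powr q * (2 powr (- (q * \<sigma>))) ^ k)"
        if N: "\<beta> N = C * 2 powr (real_of_int N * d / 2) * p N" and s: "s \<in> {\<gamma>, 2}"
          and le: "real_of_int N * (e - s) \<le> - (real k * \<sigma>)" for N s
      proof -
        have "\<beta> N powr (q - 2) * (p N)\<^sup>2 = C powr (q - 2) * (2 powr (real_of_int N * e) * p N) powr q"
          unfolding N by (rule Bernstein_power_bound[OF C0 p0 q de])
        also have "\<dots> \<le> C powr (q - 2) * (M * 2 powr (- (real k * \<sigma>))) powr q"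
        proof (intro mult_left_mono powr_mono2)
          have "2 powr (real_of_int N * e) * p N \<le> 2 powr (real_of_int N * e) * (2 powr (- real_of_int N * s) * M)"
            by (intro mult_left_mono p_le s) simp
          also have "\<dots> = M * 2 powr (real_of_int N * (e - s))"
            by (simp add: powr_add[symmetric] mult.assoc[symmetric] right_diff_distrib mult.commute[of _ M])
          also have "\<dots> \<le> M * 2 powr (- (real k * \<sigma>))" using le M by (intro mult_left_mono powr_mono) auto
          finally show "2 powr (real_of_int N * e) * p N \<le> M * 2 powr (- (real k * \<sigma>))" .
        qed (use q p0 in auto)
        also have "(M * 2 powr (- (real k * \<sigma>))) powr q = M powr q * (2 powr (- (q * \<sigma>))) ^ k"
          using M by (simp add: powr_mult powr_powr powr_power mult_ac)
        finally show ?thesis .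
      qed
      have le1: "real k * \<sigma> \<le> real k * (2 - e)" "real k * \<sigma> \<le> real k * (e - \<gamma>)"
        using \<sigma> by (auto intro: mult_left_mono)
      have 1: "\<beta> (int k) powr (q - 2) * (p (int k))\<^sup>2 \<le> C powr (q - 2) * (M powr q * (2 powr (- (q * \<sigma>))) ^ k)"
        by (rule shell_term[of _ 2]) (use k le1(1) in \<open>auto simp: \<beta>_def algebra_simps\<close>)
      have 2: "\<beta> (- 1 - int k) powr (q - 2) * (p (- 1 - int k))\<^sup>2 \<le> C powr (q - 2) * (M powr q * (2 powr (- (q * \<sigma>))) ^ k)"
        by (rule shell_term[of _ \<gamma>]) (use k le1(2) \<sigma> in \<open>auto simp: \<beta>_def algebra_simps\<close>)
      have "\<theta> powr (- q) * 2 powr (- (q * \<sigma>)) = \<tau>"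
        by (simp add: \<theta>_def \<tau>_def powr_powr powr_add[symmetric] mult.commute)
      then have \<tau>k: "(\<theta> powr (- q)) ^ k * (2 powr (- (q * \<sigma>))) ^ k = \<tau> ^ k"
        by (simp flip: power_mult_distrib)
      have "u k \<le> c * (\<theta> powr (- q)) ^ k * (2 * (C powr (q - 2) * (M powr q * (2 powr (- (q * \<sigma>))) ^ k)))"
        unfolding u_eq using add_mono[OF 1 2] c0 by (intro mult_left_mono) (simp_all add: mult_ac)
      also have "\<dots> = g k" unfolding g_def A_def \<tau>k[symmetric] by (simp add: mult_ac)
      finally show ?thesis .
    qed
    define D where "D = B * \<delta> powr (q - 2)"
    define h where "h k = g k + (if k \<in> {..<K} then D - g k else 0)" for k
    have h: "h sums (suminf g + (\<Sum>k<K. D - g k))"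
      unfolding h_def by (intro sums_add summable_sums sg sums_If_finite_set) simp
    have uh: "u k \<le> h k" for k using small_k[of k] large_k[of k] by (simp add: h_def D_def)
    have "(\<Sum>k. ennreal (u k)) \<le> (\<Sum>k. ennreal (h k))"
      by (intro suminf_le ennreal_leI uh summableI)
    also have "\<dots> = ennreal (suminf h)"
      using uh u0 h by (intro suminf_ennreal2) (auto intro: order_trans simp: sums_iff)
    also have "suminf h = (suminf g - sum g {..<K}) + real K * D"
      using h by (simp add: sums_iff sum_subtractf)
    also have "ennreal \<dots> \<le> ennreal \<epsilon>" using K KB by (intro ennreal_leI) (simp add: D_def)
    finally show "(\<integral>\<^sup>+x. ennreal (cmod (V x) powr q) \<partial>lebesgue) \<le> ennreal \<epsilon>"
      using int order_trans by blast
  qed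
qed

section \<open>Translations on the Fourier side\<close>

text \<open>Translation by \<open>x\<close>, on the frequency side.\<close>

definition shift_op :: "'a::euclidean_space \<Rightarrow> 'a L2 \<Rightarrow> 'a L2" where
  "shift_op x = mult_op (\<lambda>\<xi>. exp (\<i> * complex_of_real (\<xi> \<bullet> (- x))))"

lemma bounded_multiplier_character: "bounded_multiplier (\<lambda>\<xi>. exp (\<i> * complex_of_real (\<xi> \<bullet> a)))"
  by (rule bounded_multiplierI[OF character_measurable, of _ 1]) simp

lemma fn_shift_op: "AE \<xi> in lebesgue. fn (shift_op x a) \<xi> = exp (\<i> * complex_of_real (\<xi> \<bullet> (- x))) * fn a \<xi>"
  unfolding shift_op_def by (rule fn_mult_op[OF bounded_multiplier_character])

lemma FT_diff: "FT (a - b) = FT a - FT b"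
proof (rule L2_eqI)
  have F: "has_fourier (fn c) (fn (FT c))" for c :: "'a L2" using has_fourier_L2[OF fn_square_integrable, of c] by simp
  have "has_fourier (fn (a - b)) (\<lambda>x. fn (FT a) x - fn (FT b) x)"
    by (rule has_fourier_cong_AE[OF has_fourier_diff[OF F F] fn_measurable _ _ AE_I2[OF refl]])
       (measurable, use fn_diff[of a b] in \<open>auto elim: eventually_mono\<close>)
  from has_fourier_unique[OF F this] show "AE x in lebesgue. fn (FT (a - b)) x = fn (FT a - FT b) x"
    using fn_diff[of "FT a" "FT b"] by eventually_elim simp
qed

lemma inner_inverse_FT: "inner (inverse_FT a) (inverse_FT b) = inner a b"
proof -
  have polar: "inner x y = ((norm x)\<^sup>2 + (norm y)\<^sup>2 - (norm (x - y))\<^sup>2) / 2" for x y :: "'a L2"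
    by (simp add: power2_norm_eq_inner inner_diff inner_commute)
  have "inverse_FT a - inverse_FT b = inverse_FT (a - b)" by (simp add: inverse_FT_def FT_diff)
  then show ?thesis unfolding polar by (simp add: norm_inverse_FT)
qed

lemma inverse_FT_shift_op: "AE y in lebesgue. fn (inverse_FT (shift_op x a)) y = fn (inverse_FT a) (y - x)"
proof -
  have F: "has_fourier (\<lambda>y. fn (inverse_FT a) (y - x)) (\<lambda>\<xi>. exp (\<i> * complex_of_real (\<xi> \<bullet> (- x))) * fn a \<xi>)"
    by (rule has_fourier_translate[OF has_fourier_inverse_FT])
  have "AE \<xi> in lebesgue. exp (\<i> * complex_of_real (\<xi> \<bullet> (- x))) * fn a \<xi> = fn (shift_op x a) \<xi>"
    using fn_shift_op[of x a] by eventually_elim simp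
  from has_fourier_cong_AE[OF F tempered_measurable[OF has_fourierD(1)[OF F]] fn_measurable AE_I2[OF refl] this]
  show ?thesis by (rule has_fourier_unique_inverse[OF has_fourier_inverse_FT])
qed

lemma shift_op_isometry: "inner (shift_op x a) (shift_op x b) = inner a b"
  unfolding inner_L2_def
proof (rule integral_cong_AE)
  show "AE \<xi> in lebesgue. Re (fn (shift_op x a) \<xi> * cnj (fn (shift_op x b) \<xi>)) = Re (fn a \<xi> * cnj (fn b \<xi>))"
    using fn_shift_op[of x a] fn_shift_op[of x b]
  proof eventually_elim
    case (elim \<xi>)
    define e where "e = exp (\<i> * complex_of_real (\<xi> \<bullet> (- x)))"
    have "e * cnj e = 1" unfolding complex_norm_square[symmetric] e_def by simp
    then have "(e * fn a \<xi>) * cnj (e * fn b \<xi>) = fn a \<xi> * cnj (fn b \<xi>)"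
      by (metis (no_types, lifting) complex_cnj_mult mult.assoc mult.commute mult.left_neutral)
    then show ?case unfolding elim e_def by (rule arg_cong)
  qed
qed measurable

lemma norm_shift_op: "norm (shift_op x a) = norm a"
  by (simp add: norm_eq_sqrt_inner shift_op_isometry)

text \<open>On the physical side this is the inner product of two functions with disjoint supports.\<close>

lemma inner_shift_op_vanishing_truncated:
  assumes a: "a = FT (toL2 (truncate m A))" and b: "b = FT (toL2 (truncate m B))" and x: "norm x > 2 * real m"
  shows "inner (shift_op x a) b = 0"
proof -
  have inv: "inverse_FT (FT c) = c" for c :: "'a L2"
    by (simp add: inverse_FT_def FT_FT reflect_reflect)
  have "inner (shift_op x a) b = inner (inverse_FT (shift_op x a)) (inverse_FT b)" by (rule inner_inverse_FT[symmetric])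
  also have "\<dots> = (\<integral>y. 0 \<partial>(lebesgue :: 'a measure))"
    unfolding inner_L2_def
  proof (rule integral_cong_AE)
    have tr: "AE y in lebesgue. fn (toL2 (truncate m C)) y = truncate m C y" for C :: "'a L2"
      by (rule fn_toL2[OF L1L2D(2)[OF L1L2_truncate]])
    have "AE y in lebesgue. fn (toL2 (truncate m A)) (- x + 1 *\<^sub>R y) = truncate m A (- x + 1 *\<^sub>R y)"
      by (rule lebesgue_AE_affine[OF _ tr]) simp
    with inverse_FT_shift_op[of x a] tr[of B]
    show "AE y in lebesgue. Re (fn (inverse_FT (shift_op x a)) y * cnj (fn (inverse_FT b) y)) = 0"
      unfolding a b inv
    proof eventually_elim
      case (elim y)
      have "norm x \<le> norm (y - x) + norm y" using norm_triangle_ineq4[of y "y - x"] by simp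
      then have "truncate m A (y - x) = 0 \<or> truncate m B y = 0"
        using x unfolding truncate_def by (auto simp: indicator_def)
      then show ?case using elim by (auto simp: algebra_simps)
    qed
  qed measurable
  finally show ?thesis by simp
qed

text \<open>Functions of bounded support are dense, and translations are isometries.\<close>

lemma inner_shift_op_vanishing:
  fixes X :: "nat \<Rightarrow> 'a::euclidean_space"
  assumes X: "filterlim (\<lambda>n. norm (X n)) at_top sequentially"
  shows "(\<lambda>n. inner (shift_op (X n) a) b) \<longlonglongrightarrow> 0"
proof (rule LIMSEQ_I)
  fix e :: real assume e: "e > 0"
  define am where "am m = FT (toL2 (truncate m (inverse_FT a)))" for m
  define bm where "bm m = FT (toL2 (truncate m (inverse_FT b)))" for m
  have "am \<longlonglongrightarrow> a" "bm \<longlonglongrightarrow> b"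
    using FT_tendsto[OF truncate_tendsto[of "inverse_FT a"]] FT_tendsto[OF truncate_tendsto[of "inverse_FT b"]]
    by (simp_all add: am_def[abs_def] bm_def[abs_def] FT_inverse_FT)
  then have "(\<lambda>m. norm (a - am m) * norm b + norm (am m) * norm (b - bm m)) \<longlonglongrightarrow> norm (a - a) * norm b + norm a * norm (b - b)"
    by (intro tendsto_intros)
  then have "(\<lambda>m. norm (a - am m) * norm b + norm (am m) * norm (b - bm m)) \<longlonglongrightarrow> 0" by simp
  from order_tendstoD(2)[OF this e]
  obtain m where m: "norm (a - am m) * norm b + norm (am m) * norm (b - bm m) < e"
    unfolding eventually_sequentially by blast
  have diff: "shift_op x (c - d) = shift_op x c - shift_op x d" for x and c d :: "'a L2"
    using mult_op_add[OF bounded_multiplier_character, of "- x" "c - d" d] by (simp add: shift_op_def)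
  have "\<forall>\<^sub>F n in sequentially. 2 * real m < norm (X n)"
    using X unfolding filterlim_at_top_dense by blast
  then obtain n0 where n0: "\<And>n. n \<ge> n0 \<Longrightarrow> 2 * real m < norm (X n)" unfolding eventually_sequentially by blast
  have "norm (inner (shift_op (X n) a) b - 0) < e" if n: "n \<ge> n0" for n
  proof -
    have "inner (shift_op (X n) a) b = inner (shift_op (X n) (a - am m)) b + inner (shift_op (X n) (am m)) (b - bm m) + inner (shift_op (X n) (am m)) (bm m)"
      by (simp add: diff inner_diff_left inner_diff_right)
    also have "inner (shift_op (X n) (am m)) (bm m) = 0"
      by (rule inner_shift_op_vanishing_truncated[OF am_def bm_def n0[OF n]])
    finally have "\<bar>inner (shift_op (X n) a) b\<bar> \<le> \<bar>inner (shift_op (X n) (a - am m)) b\<bar> + \<bar>inner (shift_op (X n) (am m)) (b - bm m)\<bar>"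
      by simp
    also have "\<dots> \<le> norm (a - am m) * norm b + norm (am m) * norm (b - bm m)"
      using Cauchy_Schwarz_ineq2[of "shift_op (X n) (a - am m)" b] Cauchy_Schwarz_ineq2[of "shift_op (X n) (am m)" "b - bm m"]
      by (simp add: norm_shift_op)
    also have "\<dots> < e" by (rule m)
    finally show ?thesis by simp
  qed
  then show "\<exists>n0. \<forall>n\<ge>n0. norm (inner (shift_op (X n) a) b - 0) < e" by blast
qed

interpretation shift: translation_action shift_op
proof
  fix x y :: 'a and a b :: "'a L2"
  show "shift_op x (a + b) = shift_op x a + shift_op x b"
    unfolding shift_op_def by (rule mult_op_add[OF bounded_multiplier_character])
  show "shift_op 0 a = a" by (simp add: shift_op_def mult_op_def)
  show "shift_op (x + y) a = shift_op x (shift_op y a)"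
  proof (rule L2_eqI)
    show "AE \<xi> in lebesgue. fn (shift_op (x + y) a) \<xi> = fn (shift_op x (shift_op y a)) \<xi>"
      using fn_shift_op[of "x + y" a] fn_shift_op[of x "shift_op y a"] fn_shift_op[of y a]
    proof eventually_elim
      case (elim \<xi>)
      have "exp (\<i> * complex_of_real (\<xi> \<bullet> (- (x + y)))) = exp (\<i> * complex_of_real (\<xi> \<bullet> (- x))) * exp (\<i> * complex_of_real (\<xi> \<bullet> (- y)))"
        unfolding exp_add[symmetric] by (simp add: inner_diff_right right_diff_distrib inner_add_right)
      then show ?case unfolding elim by (simp only: mult.assoc)
    qed
  qed
  show "inner (shift_op x a) (shift_op x b) = inner a b" by (rule shift_op_isometry)
next
  fix X :: "nat \<Rightarrow> 'a" and x and a :: "'a L2" assume "X \<longlonglongrightarrow> x"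
  then show "(\<lambda>n. shift_op (X n) a) \<longlonglongrightarrow> shift_op x a"
    unfolding shift_op_def
    by (intro mult_op_tendsto[where C = 1] bounded_multiplier_character AE_I2) (auto intro!: tendsto_intros)
next
  fix X :: "nat \<Rightarrow> 'a" and a b :: "'a L2" assume "filterlim (\<lambda>n. norm (X n)) at_top sequentially"
  then show "(\<lambda>n. inner (shift_op (X n) a) b) \<longlonglongrightarrow> 0" by (rule inner_shift_op_vanishing)
qed

lemma mult_op_shift_op:
  assumes m: "bounded_multiplier m" shows "mult_op m (shift_op x a) = shift_op x (mult_op m a)"
  by (rule L2_eqI)
     (use fn_mult_op[OF m, of "shift_op x a"] fn_mult_op[OF m, of a] fn_shift_op[of x a] fn_shift_op[of x "mult_op m a"] in
       \<open>eventually_elim, simp add: mult_ac\<close>)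

lemma mult_op_symmetric:
  assumes m: "bounded_multiplier m" and re: "\<And>\<xi>. cnj (m \<xi>) = m \<xi>"
  shows "inner (mult_op m a) b = inner a (mult_op m b)"
  unfolding inner_L2_def
  by (rule integral_cong_AE, measurable, measurable)
     (use fn_mult_op[OF m, of a] fn_mult_op[OF m, of b] in \<open>eventually_elim, simp add: re mult_ac\<close>)

lemma mult_op_diff:
  assumes m: "bounded_multiplier m" shows "mult_op m (a - b) = mult_op m a - mult_op m b"
  using mult_op_add[OF m, of "a - b" b] by simp

section \<open>Waves as weakly continuous functionals\<close>

text \<open>The real and imaginary parts of the pairing with \<open>k\<close> are bounded functionals, hence inner
  products.\<close>

lemma weakly_to_pairing:
  assumes f: "weakly_to f l" shows "(\<lambda>n. pairing (f n) k) \<longlonglongrightarrow> pairing l k"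
proof -
  interpret P: bounded_bilinear pairing by (rule bounded_bilinear_pairing)
  have sub: "closed (UNIV :: 'a L2 set)" "subspace (UNIV :: 'a L2 set)" by auto
  have bound: "\<bar>Re (pairing x k)\<bar> \<le> norm k * norm x" "\<bar>Im (pairing x k)\<bar> \<le> norm k * norm x" for x
    using norm_pairing_le[of x k] abs_Re_le_cmod[of "pairing x k"] abs_Im_le_cmod[of "pairing x k"]
    by (auto simp: mult.commute)
  obtain u where u: "\<And>x. Re (pairing x k) = inner u x"
    by (rule Riesz_representation_subspace[OF sub, of "\<lambda>x. Re (pairing x k)" "norm k"])
       (auto simp: P.add_left P.scaleR_left bound)
  obtain w where w: "\<And>x. Im (pairing x k) = inner w x"
    by (rule Riesz_representation_subspace[OF sub, of "\<lambda>x. Im (pairing x k)" "norm k"])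
       (auto simp: P.add_left P.scaleR_left bound)
  show ?thesis
    unfolding tendsto_complex_iff u w using weakly_toD[OF f, of u] weakly_toD[OF f, of w] by (simp add: inner_commute)
qed

text \<open>Evaluation of a wave at \<open>x\<close> is the pairing of the function translated by \<open>- x\<close> with one fixed
  square integrable kernel.\<close>

definition wave_kernel :: "real \<Rightarrow> int \<Rightarrow> 'a::euclidean_space \<Rightarrow> complex" where
  "wave_kernel \<gamma> N \<xi> = complex_of_real (fourier_const TYPE('a)) * (indicator (shell N) \<xi> / sobolev_weight \<gamma> \<xi>)"

lemma square_integrable_wave_kernel: "square_integrable (wave_kernel \<gamma> N :: 'a::euclidean_space \<Rightarrow> complex)"
  unfolding wave_kernel_def[abs_def]
proof (rule square_integrable_cmult)
  have i: "square_integrable (indicator (shell N) :: 'a \<Rightarrow> complex)"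
  proof -
    have "(\<lambda>x. (cmod (indicator (shell N) (x::'a) :: complex))\<^sup>2) = indicat_real (shell N)" by (auto simp: indicator_def)
    then show ?thesis
      unfolding square_integrable_def using integrable_real_indicator[OF _ measure_shell(1)[of N, where 'a='a]] by simp
  qed
  show "square_integrable (\<lambda>\<xi>::'a. indicator (shell N) \<xi> / sobolev_weight \<gamma> \<xi>)"
  proof (rule square_integrable_bound[OF _ i AE_I2])
    show "(\<lambda>\<xi>::'a. indicator (shell N) \<xi> / sobolev_weight \<gamma> \<xi>) \<in> borel_measurable lebesgue" by measurable
    fix \<xi> :: 'a
    show "cmod (indicator (shell N) \<xi> / sobolev_weight \<gamma> \<xi>) \<le> 2 powr (- real_of_int N * 2) * cmod (indicator (shell N) \<xi> :: complex)"
    proof (cases "\<xi> \<in> shell N")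
      case True
      have "2 powr (real_of_int N * 2) = (2 powr real_of_int N) powr 2" by (simp add: powr_powr)
      also have "\<dots> \<le> norm \<xi> powr 2" using True by (intro powr_mono2) (auto simp: shell_def)
      also have "\<dots> \<le> cmod (sobolev_weight \<gamma> \<xi>)" unfolding cmod_sobolev_weight by simp
      finally have le: "2 powr (real_of_int N * 2) \<le> cmod (sobolev_weight \<gamma> \<xi>)" .
      have "inverse (cmod (sobolev_weight \<gamma> \<xi>)) \<le> inverse (2 powr (real_of_int N * 2))"
        by (rule le_imp_inverse_le[OF le]) simp
      then show ?thesis using True by (simp add: norm_divide norm_inverse divide_inverse powr_minus)
    qed simp
  qed
qed

lemma wave_eq_pairing: "wave \<gamma> G N x = pairing (shift_op (- x) G) (toL2 (wave_kernel \<gamma> N))"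
proof -
  note k = fn_toL2[OF square_integrable_wave_kernel[of \<gamma> N, where 'a='a]]
  have "wave \<gamma> G N x = (\<integral>\<xi>. complex_of_real (fourier_const TYPE('a)) * (exp (- \<i> * complex_of_real (\<xi> \<bullet> (- x))) * piece \<gamma> G N \<xi>) \<partial>lebesgue)"
    unfolding wave_def fourier_eq by simp
  also have "\<dots> = pairing (shift_op (- x) G) (toL2 (wave_kernel \<gamma> N))"
    unfolding pairing_def
  proof (rule integral_cong_AE)
    have [measurable]: "(\<lambda>\<xi>. exp (- \<i> * complex_of_real (\<xi> \<bullet> (- x)))) \<in> borel_measurable lebesgue"
      using character_measurable[of x] by simp
    show "(\<lambda>\<xi>. complex_of_real (fourier_const TYPE('a)) * (exp (- \<i> * complex_of_real (\<xi> \<bullet> (- x))) * piece \<gamma> G N \<xi>)) \<in> borel_measurable lebesgue"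
      by measurable
    show "(\<lambda>\<xi>. fn (shift_op (- x) G) \<xi> * fn (toL2 (wave_kernel \<gamma> N)) \<xi>) \<in> borel_measurable lebesgue" by measurable
    show "AE \<xi> in lebesgue. complex_of_real (fourier_const TYPE('a)) * (exp (- \<i> * complex_of_real (\<xi> \<bullet> (- x))) * piece \<gamma> G N \<xi>)
        = fn (shift_op (- x) G) \<xi> * fn (toL2 (wave_kernel \<gamma> N)) \<xi>"
      using fn_shift_op[of "- x" G] k
      by eventually_elim (simp add: piece_def wave_kernel_def frequency_side_def mult_ac)
  qed
  finally show ?thesis .
qed

text \<open>Otherwise there are points \<open>y n\<close> at which the wave stays above \<open>\<delta>\<close>. Translating them to the
  origin and passing to a weak limit \<open>\<psi>\<close> keeps the absolute value of the functional at least
  \<open>\<delta>\<close>, against the bound on \<open>norm \<psi>\<close>.\<close>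

lemma waves_eventually_small:
  fixes R :: "nat \<Rightarrow> 'a::euclidean_space L2"
  assumes B: "\<forall>\<^sub>F n in sequentially. norm (R n) \<le> B"
    and W: "\<And>\<psi>. \<psi> \<in> shift.weak_limits R \<Longrightarrow> norm \<psi> \<le> \<eta>"
    and small: "\<eta> * norm (toL2 (wave_kernel \<gamma> N :: 'a \<Rightarrow> complex)) < \<delta>"
  shows "\<forall>\<^sub>F n in sequentially. \<forall>x. cmod (wave \<gamma> (R n) N x) \<le> \<delta>"
proof (rule ccontr)
  define k where "k = toL2 (wave_kernel \<gamma> N :: 'a \<Rightarrow> complex)"
  assume "\<not> (\<forall>\<^sub>F n in sequentially. \<forall>x. cmod (wave \<gamma> (R n) N x) \<le> \<delta>)"
  then have "\<exists>\<^sub>F n in sequentially. \<exists>x. \<delta> < cmod (wave \<gamma> (R n) N x)"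
    unfolding frequently_def by (simp add: not_less)
  then have "\<exists>\<^sub>F n in sequentially. norm (R n) \<le> B \<and> (\<exists>x. \<delta> < cmod (wave \<gamma> (R n) N x))"
    using B by (rule frequently_eventually_conj)
  then have "infinite {n. norm (R n) \<le> B \<and> (\<exists>x. \<delta> < cmod (wave \<gamma> (R n) N x))}"
    by (simp add: frequently_cofinite flip: cofinite_eq_sequentially)
  then obtain t :: "nat \<Rightarrow> nat" where t: "strict_mono t"
    "\<And>n. t n \<in> {n. norm (R n) \<le> B \<and> (\<exists>x. \<delta> < cmod (wave \<gamma> (R n) N x))}"
    using infinite_enumerate by blast
  then have "\<forall>n. \<exists>x. \<delta> < cmod (wave \<gamma> (R (t n)) N x)" by blast
  then obtain y where y: "\<And>n. \<delta> < cmod (wave \<gamma> (R (t n)) N (y n))" by metis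
  have tB: "norm (shift_op (- y n) (R (t n))) \<le> B" for n using t(2)[of n] by (simp add: norm_shift_op)
  obtain u \<psi> where u: "strict_mono u" and \<psi>: "weakly_to (\<lambda>n. shift_op (- y (u n)) (R (t (u n)))) \<psi>"
    using weak_sequential_compactness[of "\<lambda>n. shift_op (- y n) (R (t n))" B, OF tB] by blast
  have "\<psi> \<in> shift.weak_limits R"
    unfolding shift.weak_limits_def using \<psi> strict_mono_o[OF t(1) u]
    by (auto intro!: exI[of _ "t \<circ> u"] exI[of _ "\<lambda>n. y (u n)"])
  then have "norm \<psi> * norm k \<le> \<eta> * norm k" by (intro mult_right_mono W) auto
  then have "cmod (pairing \<psi> k) < \<delta>"
    using norm_pairing_le[of \<psi> k] small unfolding k_def[symmetric] by linarith
  moreover have "\<delta> \<le> cmod (pairing \<psi> k)"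
  proof (rule LIMSEQ_le_const[OF tendsto_norm[OF weakly_to_pairing[OF \<psi>]]])
    show "\<exists>N. \<forall>n\<ge>N. \<delta> \<le> cmod (pairing (shift_op (- y (u n)) (R (t (u n)))) k)"
      using y unfolding wave_eq_pairing k_def by (auto intro: less_imp_le)
  qed
  ultimately show False by simp
qed

section \<open>The profile decomposition of a bounded sequence\<close>

lemma Lp_norm_le:
  assumes q: "0 < q" and \<epsilon>: "0 \<le> \<epsilon>" and le: "(\<integral>\<^sup>+x. ennreal (cmod (f x) powr q) \<partial>lebesgue) \<le> ennreal (\<epsilon> powr q)"
  shows "Lp_norm q f \<le> ennreal \<epsilon>"
proof -
  define I where "I = (\<integral>\<^sup>+x. ennreal (cmod (f x) powr q) \<partial>lebesgue)"
  have fin: "I \<noteq> \<infinity>" using le unfolding I_def[symmetric] by (auto simp: top_unique)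
  have "enn2real I \<le> \<epsilon> powr q" using le unfolding I_def[symmetric] by (intro enn2real_leI) auto
  then have "enn2real I powr (1 / q) \<le> (\<epsilon> powr q) powr (1 / q)" using q by (intro powr_mono2) auto
  also have "\<dots> = \<epsilon>" using q \<epsilon> by (simp add: powr_powr)
  finally show ?thesis using fin unfolding Lp_norm_def Let_def I_def[symmetric] by (simp add: ennreal_leI)
qed

text \<open>The two symbols add up to one.\<close>

lemma norm_le_symbols: "norm G \<le> norm (mult_op (symbol \<gamma> \<gamma>) G) + norm (mult_op (symbol \<gamma> 2) G)"
proof -
  have "G = mult_op (symbol \<gamma> \<gamma>) G + mult_op (symbol \<gamma> 2) G"
  proof (rule L2_eqI)
    have b: "bounded_multiplier (symbol \<gamma> \<gamma>)" "bounded_multiplier (symbol \<gamma> 2)"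
      by (rule symbol_bounded_multiplier; simp)+
    show "AE \<xi> in lebesgue. fn G \<xi> = fn (mult_op (symbol \<gamma> \<gamma>) G + mult_op (symbol \<gamma> 2) G) \<xi>"
      using fn_add[of "mult_op (symbol \<gamma> \<gamma>) G" "mult_op (symbol \<gamma> 2) G"]
        fn_mult_op[OF b(1), of G] fn_mult_op[OF b(2), of G] AE_nonzero
    proof eventually_elim
      case (elim \<xi>)
      have "symbol \<gamma> \<gamma> \<xi> + symbol \<gamma> 2 \<xi> = sobolev_weight \<gamma> \<xi> / sobolev_weight \<gamma> \<xi>"
        unfolding symbol_def sobolev_weight_def by (simp only: add_divide_distrib of_real_add)
      also have "\<dots> = 1" using sobolev_weight_nonzero[OF elim(4)] by simp
      finally show ?case unfolding elim(1-3) by (simp flip: distrib_right)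
    qed
  qed
  then show ?thesis by (metis norm_triangle_ineq)
qed

lemma has_fourier_remainder:
  assumes f: "has_fourier f (frequency_side \<gamma> A)" and V: "has_fourier V (frequency_side \<gamma> \<Phi>)"
  shows "has_fourier (\<lambda>x. f x - V (x - y)) (frequency_side \<gamma> (A - shift_op y \<Phi>))"
proof -
  have F: "has_fourier (\<lambda>x. f x - V (x - y)) (\<lambda>\<xi>. frequency_side \<gamma> A \<xi> - exp (\<i> * complex_of_real (\<xi> \<bullet> (- y))) * frequency_side \<gamma> \<Phi> \<xi>)"
    by (rule has_fourier_diff[OF f has_fourier_translate[OF V]])
  have "AE \<xi> in lebesgue. frequency_side \<gamma> A \<xi> - exp (\<i> * complex_of_real (\<xi> \<bullet> (- y))) * frequency_side \<gamma> \<Phi> \<xi> = frequency_side \<gamma> (A - shift_op y \<Phi>) \<xi>"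
    using fn_diff[of A "shift_op y \<Phi>"] fn_shift_op[of y \<Phi>]
    by eventually_elim (simp add: frequency_side_def diff_divide_distrib)
  from has_fourier_cong_AE[OF F tempered_measurable[OF has_fourierD(1)[OF F]] frequency_side_measurable AE_I2[OF refl] this]
  show ?thesis .
qed

lemma cnj_symbol: "cnj (symbol \<gamma> s \<xi>) = symbol \<gamma> s \<xi>"
  unfolding symbol_def sobolev_weight_def by simp

text \<open>Scaling: \<open>\<alpha>\<^sub>c\<close> is the exponent \<open>q\<close> with \<open>d * (1 / 2 - 1 / q) = \<gamma>\<close>, and in dimension above four
  \<open>2 + 8 / (d - 4) = 2 * d / (d - 4)\<close> is the one with \<open>d * (1 / 2 - 1 / q) = 2\<close>.\<close>

lemma admissible_exponents:
  fixes \<alpha> q :: real and d :: nat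
  assumes d: "0 < d" and \<alpha>: "two_lower_star d < \<alpha>"
  shows "0 < gamma_c d \<alpha>" "2 * gamma_c d \<alpha> < real d"
    and "alpha_c d \<alpha> < q \<Longrightarrow> 2 < q"
    and "alpha_c d \<alpha> < q \<Longrightarrow> gamma_c d \<alpha> < real d * (1 / 2 - 1 / q)"
    and "alpha_c d \<alpha> < q \<Longrightarrow> ereal q < 2 + two_upper_star d \<Longrightarrow> real d * (1 / 2 - 1 / q) < 2"
proof -
  have d0: "real d > 0" using d by simp
  have "8 / real d < \<alpha>" using \<alpha> by (simp add: two_lower_star_def)
  then have ad: "8 < \<alpha> * real d" using d0 by (simp add: divide_less_eq)
  have \<alpha>0: "0 < \<alpha>" using \<open>8 / real d < \<alpha>\<close> d0 by (meson divide_pos_pos less_trans zero_less_numeral)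
  show "0 < gamma_c d \<alpha>" using ad \<alpha>0 by (simp add: gamma_c_def field_simps)
  show "2 * gamma_c d \<alpha> < real d" using \<alpha>0 by (simp add: gamma_c_def)
  have ac: "alpha_c d \<alpha> = real d * \<alpha> / 4" using \<alpha>0 by (simp add: alpha_c_eq)
  show q2: "2 < q" if "alpha_c d \<alpha> < q" using that ad unfolding ac by (simp add: mult.commute)
  show "gamma_c d \<alpha> < real d * (1 / 2 - 1 / q)" if q: "alpha_c d \<alpha> < q"
  proof -
    have "real d / q < 4 / \<alpha>" using q q2[OF q] \<alpha>0 d0 unfolding ac by (simp add: field_simps)
    then show ?thesis by (simp add: gamma_c_def right_diff_distrib)
  qed
  show "real d * (1 / 2 - 1 / q) < 2" if q: "alpha_c d \<alpha> < q" "ereal q < 2 + two_upper_star d"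
  proof (cases "d \<le> 4")
    case True
    have "0 < real d / q" using q2[OF q(1)] d0 by simp
    moreover have "real d \<le> 4" using True by simp
    ultimately show ?thesis by (simp add: right_diff_distrib)
  next
    case False
    then have d4: "real d - 4 > 0" by simp
    have "ereal q < ereal (2 + 8 / (real d - 4))" using q(2) False by (simp add: two_upper_star_def)
    then have "q < 2 + 8 / (real d - 4)" by simp
    also have "\<dots> = 2 * real d / (real d - 4)" using d4 by (simp add: field_simps)
    finally have "q * (real d - 4) < 2 * real d" using d4 by (simp add: pos_less_divide_eq)
    then have "(real d - 4) / 2 < real d / q" using q2[OF q(1)] by (simp add: field_simps)
    then show ?thesis by (simp add: right_diff_distrib diff_divide_distrib)
  qed
qed

theorem theorem2p9:
  fixes \<alpha> :: real
    and v :: "nat \<Rightarrow> real ^ 'd \<Rightarrow> complex"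
  defines "d \<equiv> CARD('d)"
  defines "\<gamma> \<equiv> gamma_c d \<alpha>"
  assumes "two_lower_star d < \<alpha>"
    and "ereal \<alpha> < two_upper_star d"
    and "\<And>n. v n \<in> Hdot \<gamma> \<inter> Hdot 2"
    and "\<exists>M. \<forall>n. Hdot_norm \<gamma> (v n) \<le> M \<and> Hdot_norm 2 (v n) \<le> M"
  shows "\<exists>(r :: nat \<Rightarrow> nat) (X :: nat \<Rightarrow> nat \<Rightarrow> real ^ 'd)
           (V :: nat \<Rightarrow> real ^ 'd \<Rightarrow> complex) (w :: nat \<Rightarrow> nat \<Rightarrow> real ^ 'd \<Rightarrow> complex).
    strict_mono r \<and>
    (\<forall>j\<ge>1. V j \<in> Hdot \<gamma> \<inter> Hdot 2) \<and>
    (\<forall>k\<ge>1. \<forall>j\<ge>1. k \<noteq> j \<longrightarrow>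
       filterlim (\<lambda>n. norm (X k n - X j n)) at_top sequentially) \<and>
    (\<forall>l\<ge>1. \<forall>n x. v (r n) x = (\<Sum>j=1..l. V j (x - X j n)) + w l n x) \<and>
    (\<forall>q. alpha_c d \<alpha> < q \<and> ereal q < 2 + two_upper_star d \<longrightarrow>
       (\<lambda>l. limsup (\<lambda>n. Lp_norm q (w l n))) \<longlonglongrightarrow> 0) \<and>
    (\<forall>l\<ge>1. \<forall>s\<in>{\<gamma>, 2}.
       (\<lambda>n. (Hdot_norm s (v (r n)))\<^sup>2
          - ((\<Sum>j=1..l. (Hdot_norm s (V j))\<^sup>2) + (Hdot_norm s (w l n))\<^sup>2)) \<longlonglongrightarrow> 0)"
proof -
  have dim: "DIM(real ^ 'd) = d" by (simp add: d_def)
  have d0: "0 < d" by (simp add: d_def)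
  note expo = admissible_exponents[OF d0 assms(3), folded \<gamma>_def]
  have \<gamma>: "0 < \<gamma>" "2 * \<gamma> < real DIM(real ^ 'd)" using expo(1,2) unfolding dim by auto
  obtain M where M: "\<And>n. Hdot_norm \<gamma> (v n) \<le> M" "\<And>n. Hdot_norm 2 (v n) \<le> M" using assms(6) by blast
  have "\<forall>n. \<exists>G. has_fourier (v n) (frequency_side \<gamma> G)"
  proof
    fix n
    have "v n \<in> Hdot \<gamma>" "v n \<in> Hdot 2" using assms(5)[of n] by auto
    then show "\<exists>G. has_fourier (v n) (frequency_side \<gamma> G)" using Hdot_frequency_side by blast
  qed
  then obtain G where G: "\<And>n. has_fourier (v n) (frequency_side \<gamma> (G n))" by metis
  define B where "B = 2 * M"
  have GB: "norm (G n) \<le> B" for n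
    using norm_le_symbols[of "G n" \<gamma>] M[of n]
      frequency_side_Hdot_norm[OF G[of n], of \<gamma>] frequency_side_Hdot_norm[OF G[of n], of 2]
    unfolding B_def by simp
  obtain r X \<Phi> R where r: "strict_mono r" and R0: "R 0 = (\<lambda>n. G (r n))"
    and RS: "\<And>l. R (Suc l) = (\<lambda>n. R l n - shift_op (X l n) (\<Phi> l))"
    and weak: "\<And>l. weakly_to (\<lambda>n. shift_op (- X l n) (R l n)) (\<Phi> l)"
    and sep: "\<And>j k. j \<noteq> k \<Longrightarrow> filterlim (\<lambda>n. norm (X k n - X j n)) at_top sequentially"
    and max: "\<And>l \<psi>. \<psi> \<in> shift.weak_limits (R l) \<Longrightarrow> norm \<psi> \<le> 2 * norm (\<Phi> l)"
    by (rule shift.profile_decomposition[of G B, OF GB]) (rule that)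
  have R0B: "norm (R 0 n) \<le> B" for n by (simp add: R0 GB)
  note \<Phi>0 = shift.profiles_tend_to_zero(1)[OF RS weak R0B]
  note RB = shift.profiles_tend_to_zero(2)[OF RS weak R0B]
  have "\<forall>j. \<exists>V. has_fourier V (frequency_side \<gamma> (\<Phi> j))"
    using has_fourier_low_plus_high[OF \<gamma>] by blast
  then obtain V where V: "\<And>j. has_fourier (V j) (frequency_side \<gamma> (\<Phi> j))" by metis
  define w where "w l n x = v (r n) x - (\<Sum>j=1..l. V (j - 1) (x - X (j - 1) n))" for l n x
  have w: "has_fourier (w l n) (frequency_side \<gamma> (R l n))" for l n
  proof (induction l)
    case 0
    have "w 0 n = v (r n)" by (simp add: w_def fun_eq_iff)
    then show ?case using G by (simp add: R0)
  next
    case (Suc l)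
    have "w (Suc l) n = (\<lambda>x. w l n x - V l (x - X l n))" by (simp add: w_def fun_eq_iff)
    then show ?case unfolding RS using has_fourier_remainder[OF Suc V] by simp
  qed
  have Lq: "(\<lambda>l. limsup (\<lambda>n. Lp_norm q (w l n))) \<longlonglongrightarrow> 0"
    if q: "alpha_c d \<alpha> < q" "ereal q < 2 + two_upper_star d" for q
  proof (rule order_tendstoI)
    fix a :: ennreal assume "0 < a"
    then obtain a' where a': "0 < a'" "a' < a" using dense[of 0 a] by blast
    obtain \<epsilon> where \<epsilon>: "a' = ennreal \<epsilon>" "0 \<le> \<epsilon>" using a'(2) by (cases a') auto
    have \<epsilon>0: "0 < \<epsilon>" using a'(1) \<epsilon> by (simp add: ennreal_less_zero_iff)
    have q2: "2 < q" using expo(3)[OF q(1)] .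
    obtain K :: nat and \<delta> where \<delta>: "0 < \<delta>" and small:
      "\<And>(G :: (real ^ 'd) L2) V. norm G \<le> max 0 (B + 1) \<Longrightarrow> has_fourier V (frequency_side \<gamma> G) \<Longrightarrow>
       (\<And>N x. \<bar>N\<bar> \<le> int K \<Longrightarrow> cmod (wave \<gamma> G N x) \<le> \<delta>) \<Longrightarrow>
       (\<integral>\<^sup>+x. ennreal (cmod (V x) powr q) \<partial>lebesgue) \<le> ennreal (\<epsilon> powr q)"
    proof (rule Lq_small_of_waves_small[OF \<gamma> q2, of "max 0 (B + 1)" "\<epsilon> powr q"])
      show "\<gamma> < real DIM(real ^ 'd) * (1 / 2 - 1 / q)" unfolding dim using expo(4)[OF q(1)] .
      show "real DIM(real ^ 'd) * (1 / 2 - 1 / q) < 2" unfolding dim using expo(5)[OF q] .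
    qed (use \<epsilon>0 in auto)
    (* The weak limits of the l-th remainder are at most twice as large as the l-th profile. *)
    have ev: "\<forall>\<^sub>F l in sequentially. \<forall>N\<in>{- int K..int K}.
        2 * norm (\<Phi> l) * norm (toL2 (wave_kernel \<gamma> N :: real ^ 'd \<Rightarrow> complex)) < \<delta>"
    proof (rule eventually_ball_finite)
      show "\<forall>N\<in>{- int K..int K}. \<forall>\<^sub>F l in sequentially. 2 * norm (\<Phi> l) * norm (toL2 (wave_kernel \<gamma> N :: real ^ 'd \<Rightarrow> complex)) < \<delta>"
      proof
        fix N
        have "(\<lambda>l. 2 * norm (\<Phi> l) * norm (toL2 (wave_kernel \<gamma> N :: real ^ 'd \<Rightarrow> complex))) \<longlonglongrightarrow> 2 * norm (0 :: (real ^ 'd) L2) * norm (toL2 (wave_kernel \<gamma> N :: real ^ 'd \<Rightarrow> complex))"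
          by (intro tendsto_intros \<Phi>0)
        then show "\<forall>\<^sub>F l in sequentially. 2 * norm (\<Phi> l) * norm (toL2 (wave_kernel \<gamma> N :: real ^ 'd \<Rightarrow> complex)) < \<delta>"
          using order_tendstoD(2)[OF _ \<delta>] by simp
      qed
    qed simp
    then show "\<forall>\<^sub>F l in sequentially. limsup (\<lambda>n. Lp_norm q (w l n)) < a"
    proof eventually_elim
      case (elim l)
      have "\<forall>\<^sub>F n in sequentially. \<forall>N\<in>{- int K..int K}. \<forall>x. cmod (wave \<gamma> (R l n) N x) \<le> \<delta>"
        using elim by (intro eventually_ball_finite ballI waves_eventually_small[OF RB max]) auto
      then have "\<forall>\<^sub>F n in sequentially. Lp_norm q (w l n) \<le> ennreal \<epsilon>"
        using RB[of l]
      proof eventually_elim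
        case (elim n)
        show ?case
        proof (rule Lp_norm_le)
          show "(\<integral>\<^sup>+x. ennreal (cmod (w l n x) powr q) \<partial>lebesgue) \<le> ennreal (\<epsilon> powr q)"
          proof (rule small[OF _ w[of l n]])
            show "norm (R l n) \<le> max 0 (B + 1)" using elim(2) by simp
            show "cmod (wave \<gamma> (R l n) N x) \<le> \<delta>" if "\<bar>N\<bar> \<le> int K" for N x
              using elim(1) that by (simp add: abs_le_iff)
          qed
        qed (use q2 \<epsilon> in auto)
      qed
      then have "limsup (\<lambda>n. Lp_norm q (w l n)) \<le> ennreal \<epsilon>" by (rule Limsup_bounded)
      also have "\<dots> < a" using a'(2) \<epsilon>(1) by simp
      finally show ?case .
    qed
  qed simp
  have Pyth: "(\<lambda>n. (Hdot_norm s (v (r n)))\<^sup>2 - ((\<Sum>j=1..l. (Hdot_norm s (V (j - 1)))\<^sup>2) + (Hdot_norm s (w l n))\<^sup>2)) \<longlonglongrightarrow> 0"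
    if s: "s \<in> {\<gamma>, 2}" for s l
  proof -
    let ?m = "mult_op (symbol \<gamma> s)"
    note b = symbol_bounded_multiplier[OF s]
    have "(\<lambda>n. (norm (?m (R 0 n)))\<^sup>2 - (norm (?m (R l n)))\<^sup>2) \<longlonglongrightarrow> (\<Sum>j<l. (norm (?m (\<Phi> j)))\<^sup>2)"
      by (rule shift.Pythagorean_expansion[where M = ?m and R = R and X = X and \<Phi> = \<Phi>, OF RS weak mult_op_diff[OF b] mult_op_symmetric[OF b cnj_symbol] mult_op_shift_op[OF b]])
    from tendsto_diff[OF this tendsto_const[of "\<Sum>j<l. (norm (?m (\<Phi> j)))\<^sup>2"]]
    have lim: "(\<lambda>n. (norm (?m (R 0 n)))\<^sup>2 - (norm (?m (R l n)))\<^sup>2 - (\<Sum>j<l. (norm (?m (\<Phi> j)))\<^sup>2)) \<longlonglongrightarrow> 0" by simp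
    have "Hdot_norm s (v (r n)) = norm (?m (R 0 n))" for n
      using frequency_side_Hdot_norm[OF G s] by (simp add: R0)
    moreover have "Hdot_norm s (w l n) = norm (?m (R l n))" for n
      by (rule frequency_side_Hdot_norm[OF w s])
    moreover have "(\<Sum>j=1..l. (Hdot_norm s (V (j - 1)))\<^sup>2) = (\<Sum>j<l. (norm (?m (\<Phi> j)))\<^sup>2)"
      using sum_bounds_lt_plus1[of "\<lambda>j. (Hdot_norm s (V (j - 1)))\<^sup>2" l] by (simp add: frequency_side_Hdot_norm[OF V s])
    ultimately show ?thesis using lim by (simp add: algebra_simps)
  qed
  show ?thesis
  (* The profiles are numbered from 0 in the Hilbert space and from 1 in the statement. *)
  proof (rule exI[of _ r], rule exI[of _ "\<lambda>j. X (j - 1)"], rule exI[of _ "\<lambda>j. V (j - 1)"], rule exI[of _ w],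
      intro conjI allI impI ballI)
    show "strict_mono r" by (rule r)
    show "V (j - 1) \<in> Hdot \<gamma> \<inter> Hdot 2" for j
      using frequency_side_Hdot[OF V] by simp
    show "filterlim (\<lambda>n. norm (X (k - 1) n - X (j - 1) n)) at_top sequentially" if "1 \<le> k" "1 \<le> j" "k \<noteq> j" for k j
      using that by (intro sep) auto
    show "v (r n) x = (\<Sum>j=1..l. V (j - 1) (x - X (j - 1) n)) + w l n x" for l n x by (simp add: w_def)
    show "(\<lambda>l. limsup (\<lambda>n. Lp_norm q (w l n))) \<longlonglongrightarrow> 0" if "alpha_c d \<alpha> < q \<and> ereal q < 2 + two_upper_star d" for q
      using Lq that by blast
    show "(\<lambda>n. (Hdot_norm s (v (r n)))\<^sup>2 - ((\<Sum>j=1..l. (Hdot_norm s (V (j - 1)))\<^sup>2) + (Hdot_norm s (w l n))\<^sup>2)) \<longlonglongrightarrow> 0"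
      if "1 \<le> l" "s \<in> {\<gamma>, 2}" for l s by (rule Pyth[OF that(2)])
  qed
qed

end
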